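(* Let $\Lambda\colon V\times V\to\mathbb{K}$ be an even continuous bilinear form, $z\in\mathbb{K}$, $\frac12\le R<1$, and let $w\in V_{\mathbf 0}$ be an even vector. (i) For all $v\in V$ we have, in $\widehat{\mathcal{W}}_R(V)$, $$\exp(w)\star_{z\Lambda}v=\exp(w)\left(v+z\Lambda(w,v)\right)\quad\text{and}\quad v\star_{z\Lambda}\exp(w)=\exp(w)\left(v+z\Lambda(v,w)\right).$$ (ii) For all $t\in\mathbb{K}$ one has $$\frac{\mathrm{d}}{\mathrm{d}t}\mathrm{e}^{tw+\frac{t^2z}{2}\Lambda(w,w)1}=\mathrm{e}^{tw+\frac{t^2z}{2}\Lambda(w,w)1}\star_{z\Lambda}w=w\star_{z\Lambda}\mathrm{e}^{tw+\frac{t^2z}{2}\Lambda(w,w)1}.$$ (iii) For all $t\in\mathbb{K}$ the star-exponential series converges absolutely in $\widehat{\mathcal{W}}_R(V,\star_{z\Lambda})$ and $$\operatorname{Exp}_{\star_{z\Lambda}}(tw)=\sum_{n=0}^\infty\frac{t^n}{n!}\,w\star_{z\Lambda}\cdots\star_{z\Lambda}w=\mathrm{e}^{tw+\frac{t^2z}{2}\Lambda(w,w)1}.$$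
   Context: $\mathbb{K}=\mathbb{R}$ or $\mathbb{C}$, and $V=V_{\mathbf 0}\oplus V_{\mathbf 1}$ is a $\mathbb{Z}_2$-graded Hausdorff locally convex $\mathbb{K}$-vector space with continuous projections onto $V_{\mathbf 0}$, $V_{\mathbf 1}$. In exponents of $-1$ a homogeneous vector denotes its parity. Symmetric algebra: $S_n$ acts from the right on $V^{\otimes n}$ by $(v_1\otimes\cdots\otimes v_n)\triangleleft\sigma=\pm\, v_{\sigma(1)}\otimes\cdots\otimes v_{\sigma(n)}$ for homogeneous $v_i$, where $\pm$ is the Koszul sign ($-1$ to the number of pairs $i<j$ with $\sigma(i)>\sigma(j)$ and $v_{\sigma(i)},v_{\sigma(j)}$ both odd). $\mathcal{S}_n(v)=\frac1{n!}\sum_{\sigma} v\triangleleft\sigma$, $\mathrm{S}^n(V)=\operatorname{im}\mathcal{S}_n\subseteq V^{\otimes n}$, $\mathrm{S}^0(V)=\mathbb{K}$ (with unit $1$), $\mathrm{S}^\bullet(V)=\bigoplus_n \mathrm{S}^n(V)$, with product $\mu(v\otimes w)=vw=\mathcal{S}(v\otimes w)$, $\mathcal{S}=\bigoplus_n\mathcal{S}_n$. $\Lambda$ is even if $\Lambda(v,w)=0$ for homogeneous $v,w$ of different parity. $P_\Lambda$ is the linear extension of $$P_\Lambda(v_1\cdots v_n\otimes w_1\cdots w_m)=\sum_{k=1}^n\sum_{\ell=1}^m(-1)^{v_k(v_{k+1}+\cdots+v_n)+w_\ell(w_1+\cdots+w_{\ell-1})}\Lambda(v_k,w_\ell)\,v_1\cdots\widehat{v_k}\cdots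 v_n\otimes w_1\cdots\widehat{w_\ell}\cdots w_m$$ on $\mathrm{S}^\bullet(V)\otimes \mathrm{S}^\bullet(V)$ (homogeneous vectors; hats denote omission; $P_\Lambda$ vanishes if one factor is in $\mathrm{S}^0(V)$), and $a\star_{z\Lambda}b=\sum_{k\ge0}\frac{z^k}{k!}\mu(P_\Lambda^k(a\otimes b))$. Topology: for a continuous seminorm $p$ on $V$ let $p^n$ be the projective tensor seminorm on $V^{\otimes n}$ ($p^0=|\cdot|$) and $p_R(v)=\sum_np^n(v_n)\,n!^R$ for $v=\sum_nv_n$. $\mathcal{W}_R(V,\star_{z\Lambda})$ is $\mathrm{S}^\bullet(V)$ with product $\star_{z\Lambda}$ and the topology of all $p_R$ ($p$ a continuous seminorm on $V$). For $R\ge\frac12$ both $\mu$ and $\star_{z\Lambda}$ are continuous and extend to the completion $\widehat{\mathcal{W}}_R(V)$, which is denoted $\widehat{\mathcal{W}}_R(V,\star_{z\Lambda})$ when considered with $\star_{z\Lambda}$. $\exp(x)=\mathrm{e}^x=\sum_n\frac{x^n}{n!}$ denotes the exponential series with respect to the symmetric product $\mu$, which converges absolutely in $\widehat{\mathcal{W}}_R(V)$ for $x\in V\oplus\mathbb{K}1$ and $R<1$; juxtaposition is the symmetric product. $\operatorname{Exp}_{\star_{z\Lambda}}$ is the exponential series with respect to $\star_{z\Lambda}$. *)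

theory Defs
  imports
    "HOL-Analysis.Analysis"
    "HOL-Combinatorics.Permutations"
    "HOL-Library.Function_Algebras"
    "HOL-Library.Groups_Big_Fun"
begin

section \<open>Graded locally convex spaces\<close>

text \<open>
  The scalars \<open>'k\<close> range over the class \<^class>\<open>real_normed_field\<close>: it contains
  \<^typ>\<open>real\<close> and \<^typ>\<open>complex\<close>, and by the Gelfand-Mazur theorem every field in
  this class is isometrically isomorphic to one of them.
  The vector space \<open>V\<close> is the type \<open>'v\<close>; its topology and its addition come from the type
  classes, its scalar multiplication and its grading from the record.
\<close>

record ('k, 'v) graded_space =
  vscale :: "'k \<Rightarrow> 'v \<Rightarrow> 'v"
  even_part :: "'v set"
  odd_part :: "'v set"

definition even_proj :: "('k, 'v::ab_group_add) graded_space \<Rightarrow> 'v \<Rightarrow> 'v" where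
  "even_proj G v = (THE a. a \<in> even_part G \<and> v - a \<in> odd_part G)"

definition odd_proj :: "('k, 'v::ab_group_add) graded_space \<Rightarrow> 'v \<Rightarrow> 'v" where
  "odd_proj G v = (THE b. b \<in> odd_part G \<and> v - b \<in> even_part G)"

locale graded_lcs = vector_space "vscale G"
  for G :: "('k::real_normed_field, 'v::{topological_ab_group_add, t2_space}) graded_space" +
  assumes continuous_vscale: "continuous_on UNIV (\<lambda>(c, v). vscale G c v)"
    and locally_convex: "\<And>U. open U \<Longrightarrow> 0 \<in> U \<Longrightarrow>
      \<exists>C. open C \<and> 0 \<in> C \<and> C \<subseteq> U \<and>
        (\<forall>x\<in>C. \<forall>y\<in>C. \<forall>t\<in>{0..1::real}.
           vscale G (of_real (1 - t)) x + vscale G (of_real t) y \<in> C)"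
    and subspace_even: "subspace (even_part G)"
    and subspace_odd: "subspace (odd_part G)"
    and even_odd_disjoint: "even_part G \<inter> odd_part G = {0}"
    and even_odd_sum: "\<And>v. \<exists>a\<in>even_part G. \<exists>b\<in>odd_part G. v = a + b"
    and continuous_even_proj: "continuous_on UNIV (even_proj G)"
    and continuous_odd_proj: "continuous_on UNIV (odd_proj G)"

definition cont_seminorms ::
  "('k::real_normed_field, 'v::{ab_group_add, topological_space}) graded_space \<Rightarrow> ('v \<Rightarrow> real) set"
  where
  "cont_seminorms G = {p. (\<forall>v w. p (v + w) \<le> p v + p w) \<and>
     (\<forall>c v. p (vscale G c v) = norm c * p v) \<and> continuous_on UNIV p}"

definition bilinear_form ::
  "('k::field, 'v::ab_group_add) graded_space \<Rightarrow> ('v \<Rightarrow> 'v \<Rightarrow> 'k) \<Rightarrow> bool" where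
  "bilinear_form G \<Lambda> \<longleftrightarrow>
     (\<forall>v. Vector_Spaces.linear (vscale G) (*) (\<lambda>w. \<Lambda> v w)) \<and>
     (\<forall>w. Vector_Spaces.linear (vscale G) (*) (\<lambda>v. \<Lambda> v w))"

definition even_form ::
  "('k::zero, 'v) graded_space \<Rightarrow> ('v \<Rightarrow> 'v \<Rightarrow> 'k) \<Rightarrow> bool" where
  "even_form G \<Lambda> \<longleftrightarrow> (\<forall>v\<in>even_part G. \<forall>w\<in>odd_part G. \<Lambda> v w = 0 \<and> \<Lambda> w v = 0)"


section \<open>Tensor powers\<close>

text \<open>
  The tensor product is taken in the form of linear functionals on multilinear forms:
  \<open>v\<^sub>1 \<otimes> \<dots> \<otimes> v\<^sub>n\<close> is the evaluation of \<open>n\<close>-linear forms at \<open>(v\<^sub>1, \<dots>, v\<^sub>n)\<close>, and the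
  \<open>n\<close>-th tensor power is the linear span of these evaluations.  A form \<open>\<phi>\<close> is a function on lists
  of arbitrary length that is linear in every entry, i.e. an independent choice of an
  \<open>n\<close>-linear form for every \<open>n\<close>; therefore the tensor powers of different degrees are in direct
  sum, and the whole tensor algebra lives in the single type \<open>('a, 'k) tensor\<close>.
\<close>

type_synonym ('a, 'k) tensor = "('a list \<Rightarrow> 'k) \<Rightarrow> 'k"

definition fscale :: "'k::times \<Rightarrow> ('x \<Rightarrow> 'k) \<Rightarrow> 'x \<Rightarrow> 'k" where
  "fscale c f = (\<lambda>x. c * f x)"

definition multilinear :: "('k::field \<Rightarrow> 'a::ab_group_add \<Rightarrow> 'a) \<Rightarrow> ('a list \<Rightarrow> 'k) \<Rightarrow> bool" where
  "multilinear s \<phi> \<longleftrightarrow> (\<forall>us ws. Vector_Spaces.linear s (*) (\<lambda>v. \<phi> (us @ v # ws)))"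

definition tens :: "('k::field \<Rightarrow> 'a::ab_group_add \<Rightarrow> 'a) \<Rightarrow> 'a list \<Rightarrow> ('a, 'k) tensor" where
  "tens s vs = (\<lambda>\<phi>. if multilinear s \<phi> then \<phi> vs else 0)"

definition tensor_power ::
  "('k::field \<Rightarrow> 'a::ab_group_add \<Rightarrow> 'a) \<Rightarrow> nat \<Rightarrow> ('a, 'k) tensor set" where
  "tensor_power s n = module.span fscale {tens s vs | vs. length vs = n}"

text \<open>
  \<open>lin_ext I g f\<close> is the linear extension of \<open>g i \<mapsto> f i\<close> (\<open>i \<in> I\<close>) to the span of the \<open>g i\<close>.
  It is meaningful only when every linear relation between the \<open>g i\<close> also holds between the \<open>f i\<close>.
\<close>

definition lin_ext ::
  "'i set \<Rightarrow> ('i \<Rightarrow> 'x \<Rightarrow> 'k::field) \<Rightarrow> ('i \<Rightarrow> 'y \<Rightarrow> 'k) \<Rightarrow> ('x \<Rightarrow> 'k) \<Rightarrow> 'y \<Rightarrow> 'k" where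
  "lin_ext I g f x =
     (THE y. \<exists>F c. finite F \<and> F \<subseteq> I \<and>
        x = (\<Sum>i\<in>F. fscale (c i) (g i)) \<and> y = (\<Sum>i\<in>F. fscale (c i) (f i)))"

definition degree_part ::
  "('k::field \<Rightarrow> 'a::ab_group_add \<Rightarrow> 'a) \<Rightarrow> nat \<Rightarrow> ('a, 'k) tensor \<Rightarrow> ('a, 'k) tensor" where
  "degree_part s n = lin_ext UNIV (tens s) (\<lambda>vs. if length vs = n then tens s vs else 0)"

definition tensor_mult ::
  "('k::field \<Rightarrow> 'a::ab_group_add \<Rightarrow> 'a) \<Rightarrow> ('a, 'k) tensor \<Rightarrow> ('a, 'k) tensor \<Rightarrow> ('a, 'k) tensor"
  where
  "tensor_mult s x y =
     lin_ext UNIV (tens s) (\<lambda>vs. lin_ext UNIV (tens s) (\<lambda>ws. tens s (vs @ ws)) y) x"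

text \<open>
  The scalars \<open>c\<close> only matter for \<open>n = 0\<close>, where they cannot be absorbed into the vectors;
  they make the formula yield the absolute value there.
\<close>

definition proj_seminorm ::
  "('k::real_normed_field \<Rightarrow> 'a::ab_group_add \<Rightarrow> 'a) \<Rightarrow> ('a \<Rightarrow> real) \<Rightarrow> nat \<Rightarrow> ('a, 'k) tensor \<Rightarrow> real"
  where
  "proj_seminorm s p n x =
     Inf {(\<Sum>(c, vs)\<leftarrow>L. norm c * prod_list (map p vs)) | L.
            (\<forall>(c, vs)\<in>set L. length vs = n) \<and> x = (\<Sum>(c, vs)\<leftarrow>L. fscale c (tens s vs))}"


section \<open>The symmetric algebra\<close>

text \<open>The parity of a homogeneous vector; the zero vector counts as even.\<close>

definition parity :: "('k, 'v) graded_space \<Rightarrow> 'v \<Rightarrow> nat" where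
  "parity G v = (if v \<in> even_part G then 0 else 1)"

definition hom_lists :: "('k, 'v) graded_space \<Rightarrow> 'v list set" where
  "hom_lists G = lists (even_part G \<union> odd_part G)"

text \<open>Permutations act on positions \<open>0, \<dots>, n - 1\<close>;
  \<open>permute_list \<sigma> vs\<close> has the entry \<open>vs ! \<sigma> i\<close> at position \<open>i\<close>.\<close>

definition koszul_sign ::
  "('k::comm_ring_1, 'v) graded_space \<Rightarrow> (nat \<Rightarrow> nat) \<Rightarrow> 'v list \<Rightarrow> 'k" where
  "koszul_sign G \<sigma> vs = (-1) ^ card {(i, j). i < j \<and> j < length vs \<and> \<sigma> i > \<sigma> j \<and>
     parity G (vs ! \<sigma> i) = 1 \<and> parity G (vs ! \<sigma> j) = 1}"

definition perm_act ::
  "('k::field, 'v::ab_group_add) graded_space \<Rightarrow> nat \<Rightarrow> ('v, 'k) tensor \<Rightarrow> (nat \<Rightarrow> nat) \<Rightarrow> ('v, 'k) tensor"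
  where
  "perm_act G n x \<sigma> =
     lin_ext {vs \<in> hom_lists G. length vs = n} (tens (vscale G))
       (\<lambda>vs. fscale (koszul_sign G \<sigma> vs) (tens (vscale G) (permute_list \<sigma> vs))) x"

definition symmetrizer_n ::
  "('k::field_char_0, 'v::ab_group_add) graded_space \<Rightarrow> nat \<Rightarrow> ('v, 'k) tensor \<Rightarrow> ('v, 'k) tensor" where
  "symmetrizer_n G n x = fscale (1 / fact n) (\<Sum>\<sigma> | \<sigma> permutes {..<n}. perm_act G n x \<sigma>)"

text \<open>\<^const>\<open>Sum_any\<close> is the sum of the non-zero terms; here and below there are finitely many.\<close>

definition symmetrizer ::
  "('k::field_char_0, 'v::ab_group_add) graded_space \<Rightarrow> ('v, 'k) tensor \<Rightarrow> ('v, 'k) tensor" where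
  "symmetrizer G x = Sum_any (\<lambda>n. symmetrizer_n G n (degree_part (vscale G) n x))"

definition sym_power ::
  "('k::field_char_0, 'v::ab_group_add) graded_space \<Rightarrow> nat \<Rightarrow> ('v, 'k) tensor set" where
  "sym_power G n = symmetrizer_n G n ` tensor_power (vscale G) n"

definition sym_algebra ::
  "('k::field_char_0, 'v::ab_group_add) graded_space \<Rightarrow> ('v, 'k) tensor set" where
  "sym_algebra G = module.span fscale (\<Union>n. sym_power G n)"

definition sym_mult ::
  "('k::field_char_0, 'v::ab_group_add) graded_space \<Rightarrow> ('v, 'k) tensor \<Rightarrow> ('v, 'k) tensor \<Rightarrow> ('v, 'k) tensor"
  where
  "sym_mult G a b = symmetrizer G (tensor_mult (vscale G) a b)"

definition sym_one :: "('k::field, 'v::ab_group_add) graded_space \<Rightarrow> ('v, 'k) tensor" where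
  "sym_one G = tens (vscale G) []"

definition sym_vec :: "('k::field, 'v::ab_group_add) graded_space \<Rightarrow> 'v \<Rightarrow> ('v, 'k) tensor" where
  "sym_vec G v = tens (vscale G) [v]"

definition sym_prod ::
  "('k::field_char_0, 'v::ab_group_add) graded_space \<Rightarrow> 'v list \<Rightarrow> ('v, 'k) tensor" where
  "sym_prod G vs = foldr (\<lambda>v. sym_mult G (sym_vec G v)) vs (sym_one G)"


section \<open>The star product\<close>

text \<open>
  The tensor product of the symmetric algebra with itself consists of tensors of length two over the
  vector space \<^typ>\<open>('v, 'k) tensor\<close>.
\<close>

definition tens2 ::
  "('v, 'k::field) tensor \<Rightarrow> ('v, 'k) tensor \<Rightarrow> (('v, 'k) tensor, 'k) tensor" where
  "tens2 a b = tens fscale [a, b]"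

definition mu ::
  "('k::field_char_0, 'v::ab_group_add) graded_space \<Rightarrow> (('v, 'k) tensor, 'k) tensor \<Rightarrow> ('v, 'k) tensor"
  where
  "mu G = lin_ext (sym_algebra G \<times> sym_algebra G) (\<lambda>(a, b). tens2 a b) (\<lambda>(a, b). sym_mult G a b)"

definition omit :: "nat \<Rightarrow> 'a list \<Rightarrow> 'a list" where
  "omit k xs = take k xs @ drop (Suc k) xs"

definition P_form ::
  "('k::field_char_0, 'v::ab_group_add) graded_space \<Rightarrow> ('v \<Rightarrow> 'v \<Rightarrow> 'k) \<Rightarrow>
     (('v, 'k) tensor, 'k) tensor \<Rightarrow> (('v, 'k) tensor, 'k) tensor" where
  "P_form G \<Lambda> = lin_ext (hom_lists G \<times> hom_lists G)
     (\<lambda>(vs, ws). tens2 (sym_prod G vs) (sym_prod G ws))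
     (\<lambda>(vs, ws). \<Sum>k<length vs. \<Sum>l<length ws.
        fscale ((-1) ^ (parity G (vs ! k) * (\<Sum>j\<in>{k<..<length vs}. parity G (vs ! j))
                        + parity G (ws ! l) * (\<Sum>j<l. parity G (ws ! j)))
                * \<Lambda> (vs ! k) (ws ! l))
          (tens2 (sym_prod G (omit k vs)) (sym_prod G (omit l ws))))"

definition star ::
  "('k::field_char_0, 'v::ab_group_add) graded_space \<Rightarrow> 'k \<Rightarrow> ('v \<Rightarrow> 'v \<Rightarrow> 'k) \<Rightarrow>
     ('v, 'k) tensor \<Rightarrow> ('v, 'k) tensor \<Rightarrow> ('v, 'k) tensor" where
  "star G z \<Lambda> a b =
     Sum_any (\<lambda>k. fscale (z ^ k / fact k) (mu G ((P_form G \<Lambda> ^^ k) (tens2 a b))))"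


section \<open>Completion with respect to a family of seminorms\<close>

text \<open>
  The Hausdorff completion of a vector space \<open>W\<close> with the topology of a family \<open>Q\<close> of
  seminorms: Cauchy filters on \<open>W\<close> modulo the relation of having the same limit.
\<close>

definition cauchy_filters ::
  "'a::ab_group_add set \<Rightarrow> ('a \<Rightarrow> real) set \<Rightarrow> 'a filter set" where
  "cauchy_filters W Q = {F. F \<noteq> bot \<and> F \<le> principal W \<and>
     (\<forall>q\<in>Q. \<forall>e>0. eventually (\<lambda>(x, y). q (x - y) < e) (F \<times>\<^sub>F F))}"

definition cauchy_class ::
  "'a::ab_group_add set \<Rightarrow> ('a \<Rightarrow> real) set \<Rightarrow> 'a filter \<Rightarrow> 'a filter set" where
  "cauchy_class W Q F = {H \<in> cauchy_filters W Q.
     \<forall>q\<in>Q. \<forall>e>0. eventually (\<lambda>(x, y). q (x - y) < e) (F \<times>\<^sub>F H)}"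

definition completion_space ::
  "'a::ab_group_add set \<Rightarrow> ('a \<Rightarrow> real) set \<Rightarrow> 'a filter set set" where
  "completion_space W Q = cauchy_class W Q ` cauchy_filters W Q"

definition completion_emb ::
  "'a::ab_group_add set \<Rightarrow> ('a \<Rightarrow> real) set \<Rightarrow> 'a \<Rightarrow> 'a filter set" where
  "completion_emb W Q x = cauchy_class W Q (principal {x})"

text \<open>
  The extensions by continuity: the image of representing filters represents the value.  For
  continuous linear or bilinear maps the union is one and the same class for all representatives.
\<close>

definition completion_lift ::
  "'a::ab_group_add set \<Rightarrow> ('a \<Rightarrow> real) set \<Rightarrow> ('a \<Rightarrow> 'a) \<Rightarrow> 'a filter set \<Rightarrow> 'a filter set" where
  "completion_lift W Q f X = (\<Union>F\<in>X. cauchy_class W Q (filtermap f F))"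

definition completion_lift2 ::
  "'a::ab_group_add set \<Rightarrow> ('a \<Rightarrow> real) set \<Rightarrow> ('a \<Rightarrow> 'a \<Rightarrow> 'a) \<Rightarrow>
     'a filter set \<Rightarrow> 'a filter set \<Rightarrow> 'a filter set" where
  "completion_lift2 W Q f X Y =
     (\<Union>F\<in>X. \<Union>H\<in>Y. cauchy_class W Q (filtermap (\<lambda>(x, y). f x y) (F \<times>\<^sub>F H)))"

definition completion_seminorm :: "('a \<Rightarrow> real) \<Rightarrow> 'a filter set \<Rightarrow> real" where
  "completion_seminorm q X = (THE r. \<forall>F\<in>X. (q \<longlongrightarrow> r) F)"

definition completion_topology ::
  "'a::ab_group_add set \<Rightarrow> ('a \<Rightarrow> real) set \<Rightarrow> 'a filter set topology" where
  "completion_topology W Q = topology_generated_by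
     {{Y \<in> completion_space W Q. completion_seminorm q (completion_lift2 W Q (-) Y X) < e} | q X e.
        q \<in> Q \<and> X \<in> completion_space W Q \<and> e > 0}"


section \<open>The completed algebra\<close>

definition seminorm_R ::
  "('k::real_normed_field, 'v::ab_group_add) graded_space \<Rightarrow> real \<Rightarrow> ('v \<Rightarrow> real) \<Rightarrow> ('v, 'k) tensor \<Rightarrow> real"
  where
  "seminorm_R G R p a =
     Sum_any (\<lambda>n. proj_seminorm (vscale G) p n (degree_part (vscale G) n a) * fact n powr R)"

definition seminorms_R ::
  "('k::real_normed_field, 'v::{ab_group_add, topological_space}) graded_space \<Rightarrow> real \<Rightarrow>
     (('v, 'k) tensor \<Rightarrow> real) set" where
  "seminorms_R G R = seminorm_R G R ` cont_seminorms G"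

type_synonym ('v, 'k) ctensor = "('v, 'k) tensor filter set"

definition emb ::
  "('k::real_normed_field, 'v::{ab_group_add, topological_space}) graded_space \<Rightarrow> real \<Rightarrow>
     ('v, 'k) tensor \<Rightarrow> ('v, 'k) ctensor" where
  "emb G R = completion_emb (sym_algebra G) (seminorms_R G R)"

definition W_topology ::
  "('k::real_normed_field, 'v::{ab_group_add, topological_space}) graded_space \<Rightarrow> real \<Rightarrow>
     ('v, 'k) ctensor topology" where
  "W_topology G R = completion_topology (sym_algebra G) (seminorms_R G R)"

definition W_add ::
  "('k::real_normed_field, 'v::{ab_group_add, topological_space}) graded_space \<Rightarrow> real \<Rightarrow>
     ('v, 'k) ctensor \<Rightarrow> ('v, 'k) ctensor \<Rightarrow> ('v, 'k) ctensor" where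
  "W_add G R = completion_lift2 (sym_algebra G) (seminorms_R G R) (+)"

definition W_diff ::
  "('k::real_normed_field, 'v::{ab_group_add, topological_space}) graded_space \<Rightarrow> real \<Rightarrow>
     ('v, 'k) ctensor \<Rightarrow> ('v, 'k) ctensor \<Rightarrow> ('v, 'k) ctensor" where
  "W_diff G R = completion_lift2 (sym_algebra G) (seminorms_R G R) (-)"

definition W_scale ::
  "('k::real_normed_field, 'v::{ab_group_add, topological_space}) graded_space \<Rightarrow> real \<Rightarrow>
     'k \<Rightarrow> ('v, 'k) ctensor \<Rightarrow> ('v, 'k) ctensor" where
  "W_scale G R c = completion_lift (sym_algebra G) (seminorms_R G R) (fscale c)"

definition W_mult ::
  "('k::real_normed_field, 'v::{ab_group_add, topological_space}) graded_space \<Rightarrow> real \<Rightarrow>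
     ('v, 'k) ctensor \<Rightarrow> ('v, 'k) ctensor \<Rightarrow> ('v, 'k) ctensor" where
  "W_mult G R = completion_lift2 (sym_algebra G) (seminorms_R G R) (sym_mult G)"

definition W_star ::
  "('k::real_normed_field, 'v::{ab_group_add, topological_space}) graded_space \<Rightarrow> real \<Rightarrow>
     'k \<Rightarrow> ('v \<Rightarrow> 'v \<Rightarrow> 'k) \<Rightarrow> ('v, 'k) ctensor \<Rightarrow> ('v, 'k) ctensor \<Rightarrow> ('v, 'k) ctensor" where
  "W_star G R z \<Lambda> = completion_lift2 (sym_algebra G) (seminorms_R G R) (star G z \<Lambda>)"

primrec W_partial_sum ::
  "('k::real_normed_field, 'v::{ab_group_add, topological_space}) graded_space \<Rightarrow> real \<Rightarrow>
     (nat \<Rightarrow> ('v, 'k) ctensor) \<Rightarrow> nat \<Rightarrow> ('v, 'k) ctensor" where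
  "W_partial_sum G R f 0 = emb G R 0"
| "W_partial_sum G R f (Suc N) = W_add G R (W_partial_sum G R f N) (f N)"

definition W_sums ::
  "('k::real_normed_field, 'v::{ab_group_add, topological_space}) graded_space \<Rightarrow> real \<Rightarrow>
     (nat \<Rightarrow> ('v, 'k) ctensor) \<Rightarrow> ('v, 'k) ctensor \<Rightarrow> bool" where
  "W_sums G R f X \<longleftrightarrow> limitin (W_topology G R) (W_partial_sum G R f) X sequentially"

definition W_suminf ::
  "('k::real_normed_field, 'v::{ab_group_add, topological_space}) graded_space \<Rightarrow> real \<Rightarrow>
     (nat \<Rightarrow> ('v, 'k) ctensor) \<Rightarrow> ('v, 'k) ctensor" where
  "W_suminf G R f = (THE X. W_sums G R f X)"

text \<open>Absolute convergence only needs to be required for the seminorms that generate the topology: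
  they are directed, so every continuous seminorm is bounded by a multiple of one of them.\<close>

definition W_abs_convergent ::
  "('k::real_normed_field, 'v::{ab_group_add, topological_space}) graded_space \<Rightarrow> real \<Rightarrow>
     (nat \<Rightarrow> ('v, 'k) ctensor) \<Rightarrow> bool" where
  "W_abs_convergent G R f \<longleftrightarrow> (\<exists>X. W_sums G R f X) \<and>
     (\<forall>q\<in>seminorms_R G R. summable (\<lambda>n. completion_seminorm q (f n)))"

text \<open>Powers and the exponential series with respect to an arbitrary product \<open>m\<close> on the completion.\<close>

primrec W_power ::
  "('k::real_normed_field, 'v::{ab_group_add, topological_space}) graded_space \<Rightarrow> real \<Rightarrow>
     (('v, 'k) ctensor \<Rightarrow> ('v, 'k) ctensor \<Rightarrow> ('v, 'k) ctensor) \<Rightarrow>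
     ('v, 'k) ctensor \<Rightarrow> nat \<Rightarrow> ('v, 'k) ctensor" where
  "W_power G R m X 0 = emb G R (sym_one G)"
| "W_power G R m X (Suc n) = m (W_power G R m X n) X"

definition exp_term ::
  "('k::real_normed_field, 'v::{ab_group_add, topological_space}) graded_space \<Rightarrow> real \<Rightarrow>
     (('v, 'k) ctensor \<Rightarrow> ('v, 'k) ctensor \<Rightarrow> ('v, 'k) ctensor) \<Rightarrow>
     ('v, 'k) ctensor \<Rightarrow> nat \<Rightarrow> ('v, 'k) ctensor" where
  "exp_term G R m X n = W_scale G R (1 / fact n) (W_power G R m X n)"

definition W_exp ::
  "('k::real_normed_field, 'v::{ab_group_add, topological_space}) graded_space \<Rightarrow> real \<Rightarrow>
     ('v, 'k) ctensor \<Rightarrow> ('v, 'k) ctensor" where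
  "W_exp G R X = W_suminf G R (exp_term G R (W_mult G R) X)"

definition W_star_exp ::
  "('k::real_normed_field, 'v::{ab_group_add, topological_space}) graded_space \<Rightarrow> real \<Rightarrow>
     'k \<Rightarrow> ('v \<Rightarrow> 'v \<Rightarrow> 'k) \<Rightarrow> ('v, 'k) ctensor \<Rightarrow> ('v, 'k) ctensor" where
  "W_star_exp G R z \<Lambda> X = W_suminf G R (exp_term G R (W_star G R z \<Lambda>) X)"

definition W_has_derivative ::
  "('k::real_normed_field, 'v::{ab_group_add, topological_space}) graded_space \<Rightarrow> real \<Rightarrow>
     ('k \<Rightarrow> ('v, 'k) ctensor) \<Rightarrow> ('v, 'k) ctensor \<Rightarrow> 'k \<Rightarrow> bool" where
  "W_has_derivative G R f D t \<longleftrightarrow>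
     limitin (W_topology G R) (\<lambda>h. W_scale G R (1 / h) (W_diff G R (f (t + h)) (f t))) D (at 0)"

end

theory Submission
  imports Defs
begin

text \<open>
  A tensor is a functional on multilinear forms, so linear maps of tensors are given by precomposition
  with their transposes; this makes the symmetrizer, the symmetric product and \<open>P\<^sub>\<Lambda>\<close> computable.
  Continuity of the star product follows from a bound on products of homogeneous vectors.

  For even \<open>w\<close>, \<open>P\<^sub>\<Lambda>\<close> acts at most once on \<open>w\<^sup>n \<otimes> v\<close>, whence
  \<open>w\<^sup>n \<star> v = w\<^sup>n v + z n \<Lambda>(w, v) w\<^sup>n\<^sup>-\<^sup>1\<close>; summing the exponential series gives (i).  In
  particular the star powers of \<open>w\<close> satisfy the recursion of Hermite polynomials, so that
  \<open>w\<^sup>\<star>\<^sup>n / n!\<close> is the coefficient of \<open>t\<^sup>n\<close> in \<open>exp (tw) exp (t\<^sup>2 z \<Lambda>(w, w) / 2)\<close>.  The symmetric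
  exponential in (iii) groups the terms of this Cauchy product differently, and the difference of the
  partial sums tends to zero.  Since the series \<open>\<Sum> t\<^sup>n / n! w\<^sup>\<star>\<^sup>n\<close> converges absolutely for
  all \<open>t\<close>, it may be differentiated term by term, which gives (ii).
\<close>

text \<open>The obstacle at the bottom is that \<open>lin_ext\<close> is a definite description,
  which denotes something only if all relations between the generators are respected. A map x
  \<mapsto> x \<circ> \<psi> is linear on all functions, so exhibiting \<psi> settles existence and
  uniqueness at once. The price is that \<psi> must map forms to forms, whereas Koszul signs are
  meaningful for homogeneous vectors only; \<open>hext\<close> therefore splits every entry into its
  even and odd component. Estimates avoid infima: \<open>wrep\<close> records that some
  representation of a tensor by generators has at most a given cost, and such bounds add, scale and
  compose. Points of the completion are classes of Cauchy filters, but all points that occur are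
  classes \<open>sq a\<close> of Cauchy sequences in the uncompleted algebra, on which the extended
  operations act term by term. An identity in the completion then says that the seminorms of a
  difference of algebraic partial sums tend to 0. The condition R < 1 is what makes (n!)^R / n!
  summable against every r^n.\<close>

lemma sum_fun_apply: "(\<Sum>i\<in>A. f i) x = (\<Sum>i\<in>A. f i x)"
  by (induction A rule: infinite_finite_induct) auto

lemma vector_space_fscale: "vector_space (fscale :: 'k::field \<Rightarrow> ('x \<Rightarrow> 'k) \<Rightarrow> 'x \<Rightarrow> 'k)"
  by unfold_locales (auto simp: fscale_def fun_eq_iff algebra_simps)

text \<open>The domain type stays a variable, so that one interpretation covers tensors over V as
  well as the tensors over tensors on which \<open>P_form\<close> acts.\<close>

interpretation fs: vector_space "fscale :: 'k::field \<Rightarrow> ('x \<Rightarrow> 'k) \<Rightarrow> 'x \<Rightarrow> 'k"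
  by (rule vector_space_fscale)

lemma vector_space_times: "vector_space ((*) :: 'k::field \<Rightarrow> 'k \<Rightarrow> 'k)"
  by unfold_locales (auto simp: algebra_simps)

lemma fscale_apply [simp]: "fscale c f x = c * f x"
  by (simp add: fscale_def)

subsection \<open>Linear combinations\<close>

text \<open>Lists of coefficients and generators rather than finitely supported functions: this is
  the shape of the representations in \<open>proj_seminorm\<close>, and a cost can be summed along
  the same list.\<close>

definition lin_comb :: "('i \<Rightarrow> 'x \<Rightarrow> 'k::field) \<Rightarrow> ('k \<times> 'i) list \<Rightarrow> 'x \<Rightarrow> 'k" where
  "lin_comb g L = (\<Sum>(c, i)\<leftarrow>L. fscale c (g i))"

lemma lin_comb_simps [simp]:
  "lin_comb g [] = 0"
  "lin_comb g ((c, i) # L) = fscale c (g i) + lin_comb g L"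
  "lin_comb g (L @ L') = lin_comb g L + lin_comb g L'"
  by (simp_all add: lin_comb_def)

lemma lin_comb_scale: "lin_comb g (map (\<lambda>(c, i). (a * c, i)) L) = fscale a (lin_comb g L)"
  by (induction L) (auto simp: fun_eq_iff algebra_simps)

lemma lin_comb_in_span: "snd ` set L \<subseteq> I \<Longrightarrow> lin_comb g L \<in> fs.span (g ` I)"
  by (induction L) (auto intro!: fs.span_add fs.span_scale fs.span_zero intro: fs.span_base[OF imageI])

lemma span_lin_comb:
  assumes "x \<in> fs.span (g ` I)"
  obtains L where "snd ` set L \<subseteq> I" "x = lin_comb g L"
proof -
  have "\<exists>L. snd ` set L \<subseteq> I \<and> x = lin_comb g L" using assms
  proof (induction rule: fs.span_induct_alt)
    case base
    then show ?case by (intro exI[of _ "[]"]) auto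
  next
    case (step c x y)
    then obtain L i where "snd ` set L \<subseteq> I" "y = lin_comb g L" "i \<in> I" "x = g i" by auto
    then show ?case by (intro exI[of _ "(c, i) # L"]) auto
  qed
  with that show ?thesis by blast
qed

text \<open>The map \<open>x \<mapsto> (\<lambda>y. x (\<psi> y))\<close> is linear on the whole function space, hence it is the linear
  extension of its values on the generators.\<close>

lemma lin_ext_eq:
  fixes g :: "'i \<Rightarrow> 'x \<Rightarrow> 'k::field" and f :: "'i \<Rightarrow> 'y \<Rightarrow> 'k"
  assumes \<psi>: "\<And>i y. i \<in> I \<Longrightarrow> g i (\<psi> y) = f i y" and x: "x \<in> fs.span (g ` I)"
  shows "lin_ext I g f x = (\<lambda>y. x (\<psi> y))"
  unfolding lin_ext_def
proof (rule the_equality)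
  obtain t r where t: "finite t" "t \<subseteq> g ` I" "x = (\<Sum>a\<in>t. fscale (r a) a)"
    using x unfolding fs.span_explicit by blast
  then obtain u where u: "u \<subseteq> I" "inj_on g u" "t = g ` u"
    by (auto simp: subset_image_inj)
  have x_eq: "x = (\<Sum>i\<in>u. fscale (r (g i)) (g i))"
    using t u by (simp add: sum.reindex)
  show "\<exists>F c. finite F \<and> F \<subseteq> I \<and> x = (\<Sum>i\<in>F. fscale (c i) (g i)) \<and>
      (\<lambda>y. x (\<psi> y)) = (\<Sum>i\<in>F. fscale (c i) (f i))"
  proof (intro exI conjI)
    show "finite u" using t u finite_image_iff by blast
    show "(\<lambda>y. x (\<psi> y)) = (\<Sum>i\<in>u. fscale (r (g i)) (f i))"
      by (subst x_eq) (use u \<psi> in \<open>auto simp: fun_eq_iff sum_fun_apply intro!: sum.cong\<close>)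
  qed (use u x_eq in auto)
next
  fix y
  assume "\<exists>F c. finite F \<and> F \<subseteq> I \<and> x = (\<Sum>i\<in>F. fscale (c i) (g i)) \<and>
      y = (\<Sum>i\<in>F. fscale (c i) (f i))"
  then obtain F c where F: "F \<subseteq> I" "x = (\<Sum>i\<in>F. fscale (c i) (g i))"
      "y = (\<Sum>i\<in>F. fscale (c i) (f i))" by blast
  show "y = (\<lambda>y. x (\<psi> y))"
    unfolding F(2,3) using F(1) \<psi> by (auto simp: fun_eq_iff sum_fun_apply intro!: sum.cong)
qed

text \<open>The inclusion of a subspace has a linear left inverse. A projection is needed because
  \<open>tens2\<close> evaluates forms that are multilinear on all functions, whereas the maps at
  hand are bilinear on a subspace.\<close>

lemma exists_projection:
  fixes T :: "('a \<Rightarrow> 'b::field) set"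
  assumes "fs.subspace T"
  obtains \<pi> where "Vector_Spaces.linear fscale fscale \<pi>" "\<And>x. \<pi> x \<in> T" "\<And>x. x \<in> T \<Longrightarrow> \<pi> x = x"
proof -
  interpret vector_space_pair "fscale :: 'b \<Rightarrow> ('a \<Rightarrow> 'b) \<Rightarrow> 'a \<Rightarrow> 'b" "fscale :: 'b \<Rightarrow> ('a \<Rightarrow> 'b) \<Rightarrow> 'a \<Rightarrow> 'b"
    by unfold_locales
  have "\<exists>g. range g \<subseteq> T \<and> Vector_Spaces.linear fscale fscale g \<and> (\<forall>v\<in>T. g (id v) = v)"
    by (rule linear_exists_left_inverse_on) (simp_all add: assms fs.linear_id id_def fs.linear_ident)
  with that show ?thesis by (metis id_apply range_subsetD)
qed

subsection \<open>Multilinear forms and the tensor algebra\<close>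

definition tensors :: "('k::field \<Rightarrow> 'a::ab_group_add \<Rightarrow> 'a) \<Rightarrow> ('a, 'k) tensor set" where
  "tensors s = fs.span (range (tens s))"

context vector_space
begin

lemma linear_form_iff:
  "Vector_Spaces.linear scale (*) f \<longleftrightarrow> (\<forall>x y. f (x + y) = f x + f y) \<and> (\<forall>c x. f (scale c x) = c * f x)"
  unfolding Vector_Spaces.linear_iff using vector_space_axioms vector_space_times by blast

lemma multilinear_iff:
  "multilinear scale \<phi> \<longleftrightarrow>
     (\<forall>us ws x y. \<phi> (us @ (x + y) # ws) = \<phi> (us @ x # ws) + \<phi> (us @ y # ws)) \<and>
     (\<forall>us ws c x. \<phi> (us @ scale c x # ws) = c * \<phi> (us @ x # ws))"
  unfolding multilinear_def linear_form_iff by blast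

text \<open>Multilinearity by position instead of by splitting the list. Permuting or omitting
  entries turns an update at one position into an update at another one, so this form is easily
  transported.\<close>

lemma multilinear_iff_update:
  "multilinear scale \<phi> \<longleftrightarrow>
     (\<forall>vs i x y. i < length vs \<longrightarrow> \<phi> (vs[i := x + y]) = \<phi> (vs[i := x]) + \<phi> (vs[i := y])) \<and>
     (\<forall>vs i c x. i < length vs \<longrightarrow> \<phi> (vs[i := scale c x]) = c * \<phi> (vs[i := x]))"
  (is "?L \<longleftrightarrow> ?A \<and> ?B")
proof (rule iffI)
  assume ?L
  then show "?A \<and> ?B" by (auto simp: multilinear_iff upd_conv_take_nth_drop)
next
  assume *: "?A \<and> ?B"
  have "(us @ x # ws) = (us @ 0 # ws)[length us := x]" for us ws x by simp
  then show ?L unfolding multilinear_iff using *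
    by (metis length_append length_Cons less_add_Suc1 add_Suc_right)
qed

lemma multilinearD:
  assumes "multilinear scale \<phi>"
  shows "\<phi> (us @ (x + y) # ws) = \<phi> (us @ x # ws) + \<phi> (us @ y # ws)"
    and "\<phi> (us @ scale c x # ws) = c * \<phi> (us @ x # ws)"
  using assms by (auto simp: multilinear_iff)

lemma multilinear_update:
  assumes "multilinear scale \<phi>" "i < length vs"
  shows "\<phi> (vs[i := x + y]) = \<phi> (vs[i := x]) + \<phi> (vs[i := y])"
    and "\<phi> (vs[i := scale c x]) = c * \<phi> (vs[i := x])"
  using assms by (auto simp: multilinear_iff_update)

lemma multilinear_0: "multilinear scale \<phi> \<Longrightarrow> 0 \<in> set vs \<Longrightarrow> \<phi> vs = 0"
  by (metis multilinearD(2) mult_zero_left scale_zero_left split_list)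

lemma multilinear_zero [intro]: "multilinear scale (\<lambda>vs. 0)"
  by (simp add: multilinear_iff)

lemma multilinear_add: "multilinear scale \<phi> \<Longrightarrow> multilinear scale \<psi> \<Longrightarrow> multilinear scale (\<lambda>vs. \<phi> vs + \<psi> vs)"
  by (simp add: multilinear_iff algebra_simps)

lemma multilinear_cmult: "multilinear scale \<phi> \<Longrightarrow> multilinear scale (\<lambda>vs. c * \<phi> vs)"
  by (simp add: multilinear_iff algebra_simps)

lemma multilinear_sum:
  "(\<And>i. i \<in> A \<Longrightarrow> multilinear scale (\<phi> i)) \<Longrightarrow> multilinear scale (\<lambda>vs. \<Sum>i\<in>A. \<phi> i vs)"
  by (induction A rule: infinite_finite_induct) (auto intro!: multilinear_add)

text \<open>Changing an entry keeps the length, so a factor that depends on the degree alone does no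
  harm. With the factors 0 and 1 it cuts out single degrees.\<close>

lemma multilinear_length:
  "multilinear scale \<phi> \<Longrightarrow> multilinear scale (\<lambda>vs. c (length vs) * \<phi> vs)"
  by (simp add: multilinear_iff algebra_simps)

lemma multilinear_length_if:
  assumes "multilinear scale \<phi>"
  shows "multilinear scale (\<lambda>vs. if P (length vs) then \<phi> vs else 0)"
proof -
  have "(\<lambda>vs. if P (length vs) then \<phi> vs else 0) = (\<lambda>vs. of_bool (P (length vs)) * \<phi> vs)" by auto
  then show ?thesis using multilinear_length[OF assms] by simp
qed

lemma multilinear_append_left: "multilinear scale \<phi> \<Longrightarrow> multilinear scale (\<lambda>vs. \<phi> (us @ vs))"
  unfolding multilinear_iff by (metis append.assoc)

lemma multilinear_append_right: "multilinear scale \<phi> \<Longrightarrow> multilinear scale (\<lambda>vs. \<phi> (vs @ us))"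
  unfolding multilinear_iff by simp

lemma tens_apply: "multilinear scale \<phi> \<Longrightarrow> tens scale vs \<phi> = \<phi> vs"
  by (simp add: tens_def)

text \<open>Where \<phi> is not multilinear, \<open>tens\<close> is 0 by convention, so the value is
  a form in vs for every \<phi>. Writing \<open>tens scale vs \<phi>\<close> for
  \<open>\<phi> vs\<close> thus makes a transpose total.\<close>

lemma multilinear_tens: "multilinear scale (\<lambda>vs. tens scale vs \<phi>)"
  by (cases "multilinear scale \<phi>") (auto simp: tens_def)

lemma tens_in_tensors [simp, intro]: "tens scale vs \<in> tensors scale"
  by (auto simp: tensors_def intro: fs.span_base)

lemma subspace_tensors: "fs.subspace (tensors scale)"
  by (simp add: tensors_def)

lemma tensors_closed [intro, simp]:
  "0 \<in> tensors scale" "x \<in> tensors scale \<Longrightarrow> y \<in> tensors scale \<Longrightarrow> x + y \<in> tensors scale"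
  "x \<in> tensors scale \<Longrightarrow> fscale c x \<in> tensors scale"
  by (auto simp: tensors_def intro: fs.span_add fs.span_scale fs.span_zero)

lemma tensorsE:
  assumes "x \<in> tensors scale" obtains L where "x = lin_comb (tens scale) L"
  using assms span_lin_comb unfolding tensors_def by metis

lemma tensors_induct [consumes 1, case_names zero add]:
  assumes "x \<in> tensors scale" "P 0"
    "\<And>c vs y. y \<in> tensors scale \<Longrightarrow> P y \<Longrightarrow> P (fscale c (tens scale vs) + y)"
  shows "P x"
proof -
  have "P x \<and> x \<in> tensors scale" using assms(1)[unfolded tensors_def]
  proof (induction rule: fs.span_induct_alt)
    case base
    show ?case using assms(2) tensors_closed(1) by blast
  next
    case (step c x y)
    then obtain vs where "x = tens scale vs" by blast
    then show ?case using step assms(3) tensors_closed(2,3) tens_in_tensors by metis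
  qed
  then show ?thesis by blast
qed

text \<open>The convention in \<open>tens\<close> passes to the span. Tensors therefore have to be
  compared on multilinear forms only.\<close>

lemma tensor_not_multilinear: "x \<in> tensors scale \<Longrightarrow> \<not> multilinear scale \<phi> \<Longrightarrow> x \<phi> = 0"
  by (induction rule: tensors_induct) (auto simp: tens_def)

lemma tensor_eqI:
  assumes "x \<in> tensors scale" "y \<in> tensors scale" "\<And>\<phi>. multilinear scale \<phi> \<Longrightarrow> x \<phi> = y \<phi>"
  shows "x = y"
  using assms tensor_not_multilinear by (metis ext)

lemma tensor_add:
  assumes "x \<in> tensors scale" "multilinear scale \<phi>" "multilinear scale \<psi>"
  shows "x (\<lambda>vs. \<phi> vs + \<psi> vs) = x \<phi> + x \<psi>"
  using assms(1) by (induction rule: tensors_induct)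
    (auto simp: tens_apply assms multilinear_add algebra_simps)

lemma tensor_cmult:
  assumes "x \<in> tensors scale" "multilinear scale \<phi>"
  shows "x (\<lambda>vs. c * \<phi> vs) = c * x \<phi>"
  using assms(1) by (induction rule: tensors_induct)
    (auto simp: tens_apply assms multilinear_cmult algebra_simps)

lemma tensor_zero: "x \<in> tensors scale \<Longrightarrow> x (\<lambda>vs. 0) = 0"
  by (induction rule: tensors_induct) (simp_all add: tens_apply multilinear_zero)

lemma tensor_sum:
  assumes "x \<in> tensors scale" "\<And>i. i \<in> A \<Longrightarrow> multilinear scale (\<phi> i)"
  shows "x (\<lambda>vs. \<Sum>i\<in>A. \<phi> i vs) = (\<Sum>i\<in>A. x (\<phi> i))"
  using assms(2) by (induction A rule: infinite_finite_induct)
    (auto simp: tensor_zero[OF assms(1)] tensor_add[OF assms(1)] multilinear_sum)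

text \<open>y is additive and homogeneous in the form it is applied to. Iterated evaluations
  \<open>x (\<lambda>vs. y (h vs))\<close>, which describe products, thereby feed x with a
  form.\<close>

lemma multilinear_eval2:
  assumes y: "y \<in> tensors scale" and "\<And>vs. multilinear scale (h vs)" "\<And>ws. multilinear scale (\<lambda>vs. h vs ws)"
  shows "multilinear scale (\<lambda>vs. y (h vs))"
proof -
  have "(\<lambda>ws. h (us @ (a + b) # vs) ws) = (\<lambda>ws. h (us @ a # vs) ws + h (us @ b # vs) ws)"
    "(\<lambda>ws. h (us @ scale c a # vs) ws) = (\<lambda>ws. c * h (us @ a # vs) ws)" for us a b vs c
    using multilinearD[OF assms(3)] by (auto simp: fun_eq_iff)
  then show ?thesis unfolding multilinear_iff
    using tensor_add[OF y] tensor_cmult[OF y] assms(2) by simp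
qed

text \<open>The transpose sends y to the form \<open>\<lambda>vs. f vs y\<close>; by multilinearity
  \<open>tens\<close> evaluates there to \<open>f vs y\<close>, as \<open>lin_ext_eq\<close>
  asks.\<close>

lemma lin_ext_tens:
  assumes "\<And>y. multilinear scale (\<lambda>vs. f vs y)" "x \<in> tensors scale"
  shows "lin_ext UNIV (tens scale) f x = (\<lambda>y. x (\<lambda>vs. f vs y))"
  using assms by (intro lin_ext_eq) (auto simp: tens_apply tensors_def)

text \<open>The function in question is the linear extension of f at x, hence a linear combination
  of the values \<open>f vs\<close>.\<close>

lemma tensor_map_in:
  assumes x: "x \<in> tensors scale" and f: "\<And>y. multilinear scale (\<lambda>vs. f vs y)"
    and U: "fs.subspace U" "\<And>vs. f vs \<in> U"
  shows "(\<lambda>y. x (\<lambda>vs. f vs y)) \<in> U"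
  using x
proof (induction rule: tensors_induct)
  case zero
  then show ?case using fs.subspace_0[OF U(1)] by (simp add: zero_fun_def)
next
  case (add c vs y)
  have "(\<lambda>z. (fscale c (tens scale vs) + y) (\<lambda>vs. f vs z)) = fscale c (f vs) + (\<lambda>z. y (\<lambda>vs. f vs z))"
    using f by (auto simp: fun_eq_iff tens_apply)
  then show ?case using add U by (auto intro!: fs.subspace_add fs.subspace_scale)
qed

lemma degree_part_apply:
  assumes "x \<in> tensors scale"
  shows "degree_part scale n x = (\<lambda>\<phi>. x (\<lambda>vs. if length vs = n then tens scale vs \<phi> else 0))"
  unfolding degree_part_def
  by (subst lin_ext_tens[OF _ assms])
    (auto simp: fun_eq_iff if_distrib[of "\<lambda>f. f _"] cong: if_cong intro!: multilinear_length_if multilinear_tens)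

lemma degree_part_tens: "degree_part scale n (tens scale vs) = (if length vs = n then tens scale vs else 0)"
  by (cases "length vs = n")
    (simp_all add: degree_part_apply fun_eq_iff tens_apply[OF multilinear_length_if[OF multilinear_tens, where P="\<lambda>m. m = n"]])

lemma degree_part_add: "x \<in> tensors scale \<Longrightarrow> y \<in> tensors scale \<Longrightarrow>
    degree_part scale n (x + y) = degree_part scale n x + degree_part scale n y"
  by (auto simp: degree_part_apply fun_eq_iff)

lemma degree_part_scale: "x \<in> tensors scale \<Longrightarrow>
    degree_part scale n (fscale c x) = fscale c (degree_part scale n x)"
  by (auto simp: degree_part_apply fun_eq_iff)

lemma degree_part_0: "degree_part scale n 0 = 0"
  by (auto simp: degree_part_apply fun_eq_iff)

lemma degree_part_in_tensor_power:
  assumes "x \<in> tensors scale" shows "degree_part scale n x \<in> tensor_power scale n"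
  using assms unfolding tensor_power_def
proof (induction rule: tensors_induct)
  case zero
  show ?case unfolding degree_part_0 by (rule fs.span_zero)
next
  case (add c vs y)
  have "degree_part scale n (tens scale vs) \<in> fs.span {tens scale vs |vs. length vs = n}"
    by (cases "length vs = n") (auto simp: degree_part_tens intro: fs.span_base fs.span_zero)
  then show ?case
    using add unfolding degree_part_add[OF tensors_closed(3)[OF tens_in_tensors] add(1)] degree_part_scale[OF tens_in_tensors]
    by (intro fs.span_add fs.span_scale)
qed

text \<open>A tensor is a finite combination of words, and N bounds their lengths. This makes every
  \<open>Sum_any\<close> over the degrees a finite sum.\<close>

lemma degree_part_bound:
  assumes "x \<in> tensors scale" obtains N where "\<And>n. n > N \<Longrightarrow> degree_part scale n x = 0"
proof -
  have "\<exists>N. \<forall>n>N. degree_part scale n x = 0" using assms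
  proof (induction rule: tensors_induct)
    case (add c vs y)
    then obtain N where "\<forall>n>N. degree_part scale n y = 0" by blast
    then have "degree_part scale n (fscale c (tens scale vs) + y) = 0" if "n > max N (length vs)" for n
      using add(1) that by (simp add: degree_part_add degree_part_scale degree_part_tens)
    then show ?case by blast
  next
    case zero
    show ?case using degree_part_0 by blast
  qed
  with that show ?thesis by blast
qed

lemma tensor_power_subset: "tensor_power scale n \<subseteq> tensors scale"
  unfolding tensor_power_def tensors_def by (rule fs.span_mono) auto

lemma tensor_mult_apply:
  assumes "x \<in> tensors scale" "y \<in> tensors scale"
  shows "tensor_mult scale x y = (\<lambda>\<phi>. x (\<lambda>vs. y (\<lambda>ws. tens scale (vs @ ws) \<phi>)))"
proof -
  have 1: "lin_ext UNIV (tens scale) (\<lambda>ws. tens scale (vs @ ws)) y = (\<lambda>\<phi>. y (\<lambda>ws. tens scale (vs @ ws) \<phi>))" for vs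
    by (rule lin_ext_tens[OF _ assms(2)]) (rule multilinear_append_left[OF multilinear_tens])
  show ?thesis unfolding tensor_mult_def 1
    by (rule lin_ext_tens[OF _ assms(1)]) (rule multilinear_eval2[OF assms(2)], auto intro: multilinear_append_left multilinear_append_right multilinear_tens)
qed

end

subsection \<open>Homogeneous extension\<close>

context graded_lcs
begin

section \<open>The parity projections and the extension of functions from homogeneous lists\<close>

lemma even_odd_unique:
  assumes "a \<in> even_part G" "b \<in> odd_part G" "a' \<in> even_part G" "b' \<in> odd_part G" "a + b = a' + b'"
  shows "a = a'" "b = b'"
proof -
  have eq: "a - a' = b' - b" using assms(5) by (simp add: algebra_simps)
  have "a - a' \<in> even_part G" "b' - b \<in> odd_part G"
    using assms subspace_even subspace_odd subspace_diff by blast+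
  moreover from this(2) have "a - a' \<in> odd_part G" by (simp only: eq)
  ultimately have "a - a' = 0" using even_odd_disjoint by blast
  moreover from this have "b' - b = 0" using eq by (simp only:)
  ultimately
  show "a = a'" "b = b'" by simp_all
qed

lemma proj_sum:
  assumes "a \<in> even_part G" "b \<in> odd_part G"
  shows "even_proj G (a + b) = a" "odd_proj G (a + b) = b"
proof -
  have *: "a' = a \<and> b' = b" if "a' \<in> even_part G" "b' \<in> odd_part G" "a' + b' = a + b" for a' b'
    using even_odd_unique[OF that(1,2) assms that(3)] by simp
  show "even_proj G (a + b) = a" unfolding even_proj_def
  proof (rule the_equality)
    fix a' assume "a' \<in> even_part G \<and> a + b - a' \<in> odd_part G"
    then have "a' \<in> even_part G" "a + b - a' \<in> odd_part G" by auto
    from *[OF this] show "a' = a" by (metis add.commute diff_add_cancel)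
  next
    show "a \<in> even_part G \<and> a + b - a \<in> odd_part G"
      using assms by (metis add_diff_cancel_left')
  qed
  show "odd_proj G (a + b) = b" unfolding odd_proj_def
  proof (rule the_equality)
    fix b' assume "b' \<in> odd_part G \<and> a + b - b' \<in> even_part G"
    then have "a + b - b' \<in> even_part G" "b' \<in> odd_part G" by auto
    from *[OF this] show "b' = b" by (metis diff_add_cancel)
  next
    show "b \<in> odd_part G \<and> a + b - b \<in> even_part G"
      using assms by (metis add_diff_cancel_right')
  qed
qed

lemma even_proj_in [simp]: "even_proj G v \<in> even_part G"
  and odd_proj_in [simp]: "odd_proj G v \<in> odd_part G"
  and proj_decomp: "even_proj G v + odd_proj G v = v"
proof -
  obtain a b where v: "a \<in> even_part G" "b \<in> odd_part G" "v = a + b" using even_odd_sum[of v] by blast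
  from proj_sum[OF v(1,2)] v
  show "even_proj G v \<in> even_part G" "odd_proj G v \<in> odd_part G" "even_proj G v + odd_proj G v = v"
    by simp_all
qed

lemma proj_add: "even_proj G (x + y) = even_proj G x + even_proj G y"
    "odd_proj G (x + y) = odd_proj G x + odd_proj G y"
proof -
  have "x + y = (even_proj G x + even_proj G y) + (odd_proj G x + odd_proj G y)"
    using proj_decomp[of x] proj_decomp[of y] by (metis add.assoc add.commute)
  then show "even_proj G (x + y) = even_proj G x + even_proj G y"
    "odd_proj G (x + y) = odd_proj G x + odd_proj G y"
    using proj_sum subspace_even subspace_odd subspace_add even_proj_in odd_proj_in by metis+
qed

lemma proj_scale: "even_proj G (vscale G c x) = vscale G c (even_proj G x)"
    "odd_proj G (vscale G c x) = vscale G c (odd_proj G x)"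
proof -
  have "vscale G c x = vscale G c (even_proj G x) + vscale G c (odd_proj G x)"
    using proj_decomp[of x] scale_right_distrib by metis
  then show "even_proj G (vscale G c x) = vscale G c (even_proj G x)"
    "odd_proj G (vscale G c x) = vscale G c (odd_proj G x)"
    using proj_sum subspace_even subspace_odd subspace_scale even_proj_in odd_proj_in by metis+
qed

lemma zero_in_parts [simp]: "0 \<in> even_part G" "0 \<in> odd_part G"
  using subspace_even subspace_odd subspace_0 by auto

lemma proj_even: "v \<in> even_part G \<Longrightarrow> even_proj G v = v" "v \<in> even_part G \<Longrightarrow> odd_proj G v = 0"
  using proj_sum[of v 0] by auto

lemma proj_odd: "v \<in> odd_part G \<Longrightarrow> even_proj G v = 0" "v \<in> odd_part G \<Longrightarrow> odd_proj G v = v"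
  using proj_sum[of 0 v] by auto

lemma hom_lists_simps [simp]:
  "[] \<in> hom_lists G"
  "v # vs \<in> hom_lists G \<longleftrightarrow> (v \<in> even_part G \<or> v \<in> odd_part G) \<and> vs \<in> hom_lists G"
  "us @ vs \<in> hom_lists G \<longleftrightarrow> us \<in> hom_lists G \<and> vs \<in> hom_lists G"
  by (auto simp: hom_lists_def)

text \<open>The sum of f over the 2^n lists in which every entry is replaced by its even or its odd
  component: the multilinear extension of a function that is known on homogeneous lists.\<close>

primrec hext :: "'v list \<Rightarrow> ('v list \<Rightarrow> 'k) \<Rightarrow> 'k" where
  "hext [] f = f []"
| "hext (v # vs) f =
    hext vs (\<lambda>us. f (even_proj G v # us)) + hext vs (\<lambda>us. f (odd_proj G v # us))"

lemma hext_add: "hext vs (\<lambda>us. f us + g us) = hext vs f + hext vs g"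
  by (induction vs arbitrary: f g) (auto simp: algebra_simps)

lemma hext_cmult: "hext vs (\<lambda>us. c * f us) = c * hext vs f"
  by (induction vs arbitrary: f) (auto simp: algebra_simps)

lemma hext_zero [simp]: "hext vs (\<lambda>us. 0) = 0"
  by (induction vs) auto

lemma hext_append: "hext (us @ vs) f = hext us (\<lambda>xs. hext vs (\<lambda>ys. f (xs @ ys)))"
  by (induction us arbitrary: f) auto

text \<open>The recursion visits homogeneous lists of the given length only, so f may be altered
  elsewhere.\<close>

lemma hext_cong:
  "(\<And>us. us \<in> hom_lists G \<Longrightarrow> length us = length vs \<Longrightarrow> f us = g us) \<Longrightarrow> hext vs f = hext vs g"
proof (induction vs arbitrary: f g)
  case (Cons v vs)
  have "hext vs (\<lambda>us. f (a # us)) = hext vs (\<lambda>us. g (a # us))" if "a \<in> even_part G \<or> a \<in> odd_part G" for a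
    by (rule Cons.IH, rule Cons.prems) (use that in auto)
  from this[of "even_proj G v"] this[of "odd_proj G v"] show ?case by simp
qed auto

lemma hext_multilinear: "multilinear (vscale G) \<phi> \<Longrightarrow> hext vs \<phi> = \<phi> vs"
proof (induction vs arbitrary: \<phi>)
  case (Cons v vs)
  have "hext vs (\<lambda>us. \<phi> (a # us)) = \<phi> (a # vs)" for a
    using Cons.IH[OF multilinear_append_left[OF Cons.prems, of "[a]"]] by simp
  then show ?case using multilinearD(1)[OF Cons.prems, of "[]" "even_proj G v" "odd_proj G v"]
    by (simp add: proj_decomp)
qed auto

text \<open>Linearity inside each parity separately, since the sum of an even and an odd vector
  leaves the homogeneous lists. It makes \<open>hext\<close> multilinear and an extension of
  f.\<close>

definition hmulti :: "('v list \<Rightarrow> 'k) \<Rightarrow> bool" where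
  "hmulti f \<longleftrightarrow> (\<forall>us\<in>hom_lists G. \<forall>ws\<in>hom_lists G. \<forall>D\<in>{even_part G, odd_part G}.
     (\<forall>x\<in>D. \<forall>y\<in>D. f (us @ (x + y) # ws) = f (us @ x # ws) + f (us @ y # ws)) \<and>
     (\<forall>c. \<forall>x\<in>D. f (us @ vscale G c x # ws) = c * f (us @ x # ws)))"

lemma hmultiD:
  assumes "hmulti f" "us \<in> hom_lists G" "ws \<in> hom_lists G" "D = even_part G \<or> D = odd_part G"
  shows "x \<in> D \<Longrightarrow> y \<in> D \<Longrightarrow> f (us @ (x + y) # ws) = f (us @ x # ws) + f (us @ y # ws)"
    "x \<in> D \<Longrightarrow> f (us @ vscale G c x # ws) = c * f (us @ x # ws)"
  using assms unfolding hmulti_def by blast+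

lemma hmulti_Cons: "hmulti f \<Longrightarrow> a \<in> even_part G \<or> a \<in> odd_part G \<Longrightarrow> hmulti (\<lambda>us. f (a # us))"
  unfolding hmulti_def by (metis append_Cons hom_lists_simps(2))

text \<open>Of the two components of a homogeneous entry one is the entry itself and the other is 0,
  where f vanishes.\<close>

lemma hext_hom: "hmulti f \<Longrightarrow> vs \<in> hom_lists G \<Longrightarrow> hext vs f = f vs"
proof (induction vs arbitrary: f)
  case (Cons v vs)
  have 0: "hext vs (\<lambda>us. f (0 # us)) = 0"
  proof -
    have "f (0 # us) = 0" if "us \<in> hom_lists G" for us
      using hmultiD(2)[OF Cons.prems(1), of "[]" us "even_part G" 0 0] that by simp
    then have "hext vs (\<lambda>us. f (0 # us)) = hext vs (\<lambda>us. 0)" by (intro hext_cong) auto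
    then show ?thesis by simp
  qed
  have IH: "hext vs (\<lambda>us. f (v # us)) = f (v # vs)"
    using Cons.prems by (intro Cons.IH hmulti_Cons) auto
  from Cons.prems have "v \<in> even_part G \<or> v \<in> odd_part G" by simp
  then show ?case using 0 IH by (auto simp: proj_even proj_odd)
qed auto

text \<open>The projections are linear, and each of the two summands changes an entry within one
  parity, where \<open>hmulti\<close> applies.\<close>

lemma multilinear_hext:
  assumes f: "hmulti f" shows "multilinear (vscale G) (\<lambda>vs. hext vs f)"
  unfolding multilinear_iff
proof safe
  fix us ws x y c
  have *: "hext (us @ v # ws) f = hext us (\<lambda>xs. hext ws (\<lambda>ys. f (xs @ even_proj G v # ys)))
      + hext us (\<lambda>xs. hext ws (\<lambda>ys. f (xs @ odd_proj G v # ys)))" for v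
    by (simp add: hext_append hext_add)
  have a: "hext us (\<lambda>xs. hext ws (\<lambda>ys. f (xs @ (a + b) # ys))) =
      hext us (\<lambda>xs. hext ws (\<lambda>ys. f (xs @ a # ys))) + hext us (\<lambda>xs. hext ws (\<lambda>ys. f (xs @ b # ys)))"
    if "a \<in> D" "b \<in> D" "D = even_part G \<or> D = odd_part G" for a b D
    unfolding hext_add[symmetric]
    by (intro hext_cong) (use hmultiD(1)[OF f _ _ that(3,1,2)] in blast)
  have s: "hext us (\<lambda>xs. hext ws (\<lambda>ys. f (xs @ vscale G c a # ys))) =
      c * hext us (\<lambda>xs. hext ws (\<lambda>ys. f (xs @ a # ys)))"
    if "a \<in> D" "D = even_part G \<or> D = odd_part G" for a D
    unfolding hext_cmult[symmetric]
    by (intro hext_cong) (use hmultiD(2)[OF f _ _ that(2,1)] in blast)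
  show "hext (us @ (x + y) # ws) f = hext (us @ x # ws) f + hext (us @ y # ws) f"
    unfolding * proj_add a[OF even_proj_in even_proj_in disjI1[OF refl]] a[OF odd_proj_in odd_proj_in disjI2[OF refl]]
    by (simp add: algebra_simps)
  show "hext (us @ vscale G c x # ws) f = c * hext (us @ x # ws) f"
    unfolding * proj_scale s[OF even_proj_in disjI1[OF refl]] s[OF odd_proj_in disjI2[OF refl]]
    by (simp add: algebra_simps)
qed

lemma parity_even: "v \<in> even_part G \<Longrightarrow> parity G v = 0"
  by (simp add: parity_def)

lemma parity_odd: "v \<in> odd_part G \<Longrightarrow> v \<noteq> 0 \<Longrightarrow> parity G v = 1"
  using even_odd_disjoint by (auto simp: parity_def)

text \<open>The zero vector is even and odd, but there the form vanishes, so that the sign does not matter.\<close>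

lemma hmulti_sign:
  assumes \<phi>: "multilinear (vscale G) \<phi>"
  shows "hmulti (\<lambda>us. s (map (parity G) us) * \<phi> us)"
proof -
  let ?f = "\<lambda>us. s (map (parity G) us) * \<phi> us"
  have e: "?f (us @ x # ws) = s (map (parity G) us @ 0 # map (parity G) ws) * \<phi> (us @ x # ws)"
    if "x \<in> even_part G" for us x ws
    using that by (simp add: parity_even)
  have o: "?f (us @ x # ws) = s (map (parity G) us @ 1 # map (parity G) ws) * \<phi> (us @ x # ws)"
    if "x \<in> odd_part G" for us x ws
  proof (cases "x = 0")
    case True
    then show ?thesis using multilinear_0[OF \<phi>, of "us @ x # ws"] by simp
  qed (use that in \<open>simp add: parity_odd\<close>)
  show ?thesis unfolding hmulti_def
  proof (intro ballI conjI allI)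
    fix us ws D x y c assume D: "D \<in> {even_part G, odd_part G}"
    then have sub: "subspace D" using subspace_even subspace_odd by auto
    \<comment> \<open>b is the parity of the non-zero vectors of D; by \<open>e\<close> and
      \<open>o\<close> it may also be used for the zero vector.\<close>
    define b :: nat where "b = (if D = even_part G then 0 else 1)"
    have *: "?f (us @ x # ws) = s (map (parity G) us @ b # map (parity G) ws) * \<phi> (us @ x # ws)"
      if "x \<in> D" for x
      using D that e o unfolding b_def by (cases "D = even_part G") auto
    assume x: "x \<in> D"
    show "?f (us @ vscale G c x # ws) = c * ?f (us @ x # ws)"
      unfolding *[OF x] *[OF subspace_scale[OF sub x]] by (simp add: multilinearD[OF \<phi>])
    assume y: "y \<in> D"
    show "?f (us @ (x + y) # ws) = ?f (us @ x # ws) + ?f (us @ y # ws)"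
      unfolding *[OF x] *[OF y] *[OF subspace_add[OF sub x y]] by (simp add: multilinearD[OF \<phi>] algebra_simps)
  qed
qed

text \<open>Freezing the length allows the number of summands of f, such as the number of
  permutations, to depend on the length of the list.\<close>

lemma hmulti_by_length:
  assumes "\<And>n. hmulti (\<lambda>us. if length us = n then f us else 0)" shows "hmulti f"
  unfolding hmulti_def
proof (intro ballI conjI allI)
  fix us ws D x y c
  assume H: "us \<in> hom_lists G" "ws \<in> hom_lists G" "D \<in> {even_part G, odd_part G}" "x \<in> D"
  note H' = assms[of "length us + Suc (length ws)"] H(1,2)
  have D: "D = even_part G \<or> D = odd_part G" using H by auto
  show "f (us @ vscale G c x # ws) = c * f (us @ x # ws)"
    using hmultiD(2)[OF H' D H(4)] by simp
  assume "y \<in> D"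
  from hmultiD(1)[OF H' D H(4) this]
  show "f (us @ (x + y) # ws) = f (us @ x # ws) + f (us @ y # ws)" by simp
qed

lemma hmulti_sum: "(\<And>i. i \<in> A \<Longrightarrow> hmulti (f i)) \<Longrightarrow> hmulti (\<lambda>us. \<Sum>i\<in>A. f i us)"
  by (induction A rule: infinite_finite_induct) (auto simp: hmulti_def algebra_simps)

lemma hmulti_cmult: "hmulti f \<Longrightarrow> hmulti (\<lambda>us. c * f us)"
  by (auto simp: hmulti_def algebra_simps)

lemma hmulti_cong: "hmulti f \<Longrightarrow> (\<And>us. f us = g us) \<Longrightarrow> hmulti g"
  by (metis ext)

end

subsection \<open>The Koszul sign\<close>

text \<open>D is a function of unordered pairs, and g permutes the unordered pairs of positions. The
  pairs i < j are mere representatives, restored after g by \<open>min\<close> and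
  \<open>max\<close>.\<close>

lemma prod_pairs_permute:
  fixes D :: "nat \<Rightarrow> nat \<Rightarrow> 'a::comm_monoid_mult"
  assumes g: "g permutes {..<n}" and sym: "\<And>i j. i \<noteq> j \<Longrightarrow> D i j = D j i"
  shows "(\<Prod>(i, j)\<in>{(i, j). i < j \<and> j < n}. D (g i) (g j)) = (\<Prod>(i, j)\<in>{(i, j). i < j \<and> j < n}. D i j)"
proof -
  have inj: "g i = g j \<longleftrightarrow> i = j" "inv g i = inv g j \<longleftrightarrow> i = j" for i j
    using permutes_inj[OF g] permutes_inj[OF permutes_inv[OF g]] by (auto dest: injD)
  have lt: "g i < n \<longleftrightarrow> i < n" "inv g i < n \<longleftrightarrow> i < n" for i
    using permutes_in_image[OF g] permutes_in_image[OF permutes_inv[OF g]] by auto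
  have inv: "inv g (g i) = i" "g (inv g i) = i" for i using permutes_inverses[OF g] by auto
  \<comment> \<open>Sorting a pair before applying h does not affect the sorted image; so the two
    reindexing maps are inverse to each other.\<close>
  have mm: "(min (h (min a b)) (h (max a b)), max (h (min a b)) (h (max a b))) = (min (h a) (h b), max (h a) (h b))"
    for h :: "nat \<Rightarrow> nat" and a b by (simp add: min_def max_def)
  have mem: "min (h i) (h j) < max (h i) (h j) \<and> max (h i) (h j) < n"
    if "h i \<noteq> h j" "h i < n" "h j < n" for h :: "nat \<Rightarrow> nat" and i j using that by (simp add: min_def max_def)
  show ?thesis
  proof (rule prod.reindex_bij_witness[where
      i = "\<lambda>(i, j). (min (inv g i) (inv g j), max (inv g i) (inv g j))" and
      j = "\<lambda>(i, j). (min (g i) (g j), max (g i) (g j))"], goal_cases)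
    case (1 a)
    then show ?case by (cases a) (simp only: split mm inv, simp)
  next
    case (2 a)
    then obtain i j where "a = (i, j)" "i < j" "j < n" by auto
    then show ?case using mem[of g i j] inj(1)[of i j] lt(1) by simp
  next
    case (3 b)
    then show ?case by (cases b) (simp only: split mm inv, simp)
  next
    case (4 b)
    then obtain i j where "b = (i, j)" "i < j" "j < n" by auto
    then show ?case using mem[of "inv g" i j] inj(2)[of i j] lt(2) by simp
  next
    case (5 a)
    then obtain i j where a: "a = (i, j)" "i < j" by auto
    then have "D (g i) (g j) = D (g j) (g i)" using inj(1)[of i j] sym by simp
    then show ?case using a by (simp add: min_def max_def)
  qed
qed

text \<open>One factor of the Koszul sign. A product over pairs of positions can be split and
  reindexed, unlike the cardinality in \<open>koszul_sign\<close>.\<close>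

definition swap_sign :: "(nat \<Rightarrow> bool) \<Rightarrow> nat \<Rightarrow> nat \<Rightarrow> 'k::comm_ring_1" where
  "swap_sign od a b = (if od a \<and> od b \<and> a > b then -1 else 1)"

lemma koszul_sign_prod:
  "koszul_sign G \<sigma> vs =
     (\<Prod>(i, j)\<in>{(i, j). i < j \<and> j < length vs}. swap_sign (\<lambda>i. parity G (vs ! i) = 1) (\<sigma> i) (\<sigma> j))"
proof -
  let ?T = "{(i, j). i < j \<and> j < length vs}"
  let ?S = "{(i, j). i < j \<and> j < length vs \<and> \<sigma> i > \<sigma> j \<and> parity G (vs ! \<sigma> i) = 1 \<and> parity G (vs ! \<sigma> j) = 1}"
  have fin: "finite ?T" by (rule finite_subset[of _ "{..<length vs} \<times> {..<length vs}"]) auto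
  have "(\<Prod>(i, j)\<in>?T. swap_sign (\<lambda>i. parity G (vs ! i) = 1) (\<sigma> i) (\<sigma> j)) =
      (\<Prod>p\<in>?T. if p \<in> ?S then (-1::'a) else 1)"
    by (rule prod.cong) (auto simp: swap_sign_def split: if_splits)
  also have "\<dots> = (\<Prod>p\<in>?T \<inter> ?S. -1)"
    by (rule prod.inter_restrict[symmetric]) (rule fin)
  also have "?T \<inter> ?S = ?S" by auto
  finally show ?thesis by (simp add: koszul_sign_def)
qed

text \<open>The cocycle identity that makes the signed permutation of words a right action.\<close>

lemma koszul_sign_compose:
  fixes G :: "('k::comm_ring_1, 'v) graded_space"
  assumes f: "f permutes {..<length vs}" and g: "g permutes {..<length vs}"
  shows "koszul_sign G (f \<circ> g) vs = koszul_sign G f vs * koszul_sign G g (permute_list f vs)"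
proof -
  let ?n = "length vs" and ?T = "{(i, j). i < j \<and> j < length vs}"
  define od where "od i \<longleftrightarrow> parity G (vs ! i) = 1" for i
  define od' where "od' i \<longleftrightarrow> od (f i)" for i
  \<comment> \<open>For two odd entries D compares the order of f i and f j with that of i and j.
    Exchanging i and j flips both comparisons, so D is symmetric and g can be removed from its
    product.\<close>
  define D :: "nat \<Rightarrow> nat \<Rightarrow> 'k" where "D i j = swap_sign od (f i) (f j) * swap_sign od' i j" for i j
  have inj: "f i = f j \<longleftrightarrow> i = j" for i j using permutes_inj[OF f] by (auto dest: injD)
  have Dsym: "D i j = D j i" if "i \<noteq> j" for i j
  proof -
    have "f i < f j \<or> f j < f i" "i < j \<or> j < i" using that inj[of i j] by linarith+
    then show ?thesis unfolding D_def swap_sign_def od'_def by (elim disjE) simp_all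
  qed
  have 1: "koszul_sign G (f \<circ> g) vs = (\<Prod>(i, j)\<in>?T. swap_sign od (f (g i)) (f (g j)))"
    by (simp add: koszul_sign_prod od_def[abs_def])
  also have "\<dots> = (\<Prod>(i, j)\<in>?T. D (g i) (g j) * swap_sign od' (g i) (g j))"
    by (rule prod.cong) (auto simp: D_def swap_sign_def)
  also have "\<dots> = (\<Prod>(i, j)\<in>?T. D (g i) (g j)) * (\<Prod>(i, j)\<in>?T. swap_sign od' (g i) (g j))"
    by (simp add: prod.distrib case_prod_unfold)
  also have "(\<Prod>(i, j)\<in>?T. D (g i) (g j)) = (\<Prod>(i, j)\<in>?T. D i j)"
    by (rule prod_pairs_permute[OF g Dsym])
  also have "\<dots> = (\<Prod>(i, j)\<in>?T. swap_sign od (f i) (f j))"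
    by (rule prod.cong) (auto simp: D_def swap_sign_def)
  also have "\<dots> = koszul_sign G f vs" by (simp add: koszul_sign_prod od_def[abs_def])
  also have "(\<Prod>(i, j)\<in>?T. swap_sign od' (g i) (g j)) = koszul_sign G g (permute_list f vs)"
    unfolding koszul_sign_prod length_permute_list
  proof (rule prod.cong)
    fix p assume "p \<in> ?T"
    then obtain i j where p: "p = (i, j)" "i < j" "j < ?n" by auto
    have "g i < ?n" "g j < ?n" using p permutes_in_image[OF g] by auto
    then show "(case p of (i, j) \<Rightarrow> swap_sign od' (g i) (g j)) = (case p of (i, j) \<Rightarrow>
        swap_sign (\<lambda>i. parity G (permute_list f vs ! i) = 1) (g i) (g j))"
      using p by (auto simp: swap_sign_def od'_def od_def permute_list_nth[OF f])
  qed auto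
  finally show ?thesis .
qed

lemma koszul_sign_id: "koszul_sign G id vs = 1"
  unfolding koszul_sign_prod by (rule prod.neutral) (auto simp: swap_sign_def)

text \<open>An adjacent transposition inverts the pair (i, i + 1) and no other.\<close>

lemma koszul_sign_adjacent:
  fixes G :: "('k::comm_ring_1, 'v) graded_space"
  assumes n: "Suc i < length vs"
  shows "koszul_sign G (Transposition.transpose i (Suc i)) vs = (-1) ^ (parity G (vs ! i) * parity G (vs ! Suc i))"
proof -
  have tr: "Transposition.transpose i (Suc i) a = (if a = i then Suc i else if a = Suc i then i else a)" for a
    by (simp add: Transposition.transpose_def)
  have "{(a, b). a < b \<and> b < length vs \<and> Transposition.transpose i (Suc i) a > Transposition.transpose i (Suc i) b \<and>
     parity G (vs ! Transposition.transpose i (Suc i) a) = 1 \<and> parity G (vs ! Transposition.transpose i (Suc i) b) = 1} =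
     {p. p = (i, Suc i) \<and> parity G (vs ! i) = 1 \<and> parity G (vs ! Suc i) = 1}" (is "?L = ?R")
  proof (rule set_eqI)
    fix p :: "nat \<times> nat"
    obtain a b where p: "p = (a, b)" by fastforce
    have "a < b \<and> Transposition.transpose i (Suc i) a > Transposition.transpose i (Suc i) b \<longleftrightarrow> a = i \<and> b = Suc i"
      unfolding tr by (simp split: if_split)
    then show "p \<in> ?L \<longleftrightarrow> p \<in> ?R" using n unfolding p tr by auto
  qed
  also have "\<dots> = (if parity G (vs ! i) = 1 \<and> parity G (vs ! Suc i) = 1 then {(i, Suc i)} else {})"
    by simp
  finally have *: "card {(a, b). a < b \<and> b < length vs \<and> Transposition.transpose i (Suc i) a > Transposition.transpose i (Suc i) b \<and>
     parity G (vs ! Transposition.transpose i (Suc i) a) = 1 \<and> parity G (vs ! Transposition.transpose i (Suc i) b) = 1} =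
     (if parity G (vs ! i) = 1 \<and> parity G (vs ! Suc i) = 1 then 1 else 0)" by simp
  have "parity G (vs ! i) = 0 \<or> parity G (vs ! i) = 1" "parity G (vs ! Suc i) = 0 \<or> parity G (vs ! Suc i) = 1"
    by (simp_all add: parity_def)
  then show ?thesis unfolding koszul_sign_def * by auto
qed

subsection \<open>Graded symmetric forms\<close>

context graded_lcs
begin

text \<open>Only neighbours are exchanged, and only in homogeneous lists, where parities determine
  the sign; \<open>gsym_permute\<close> recovers all permutations.\<close>

definition gsym :: "('v list \<Rightarrow> 'k) \<Rightarrow> bool" where
  "gsym \<phi> \<longleftrightarrow> multilinear (vscale G) \<phi> \<and>
     (\<forall>us a b ws. us @ a # b # ws \<in> hom_lists G \<longrightarrow>
        \<phi> (us @ a # b # ws) = (-1) ^ (parity G a * parity G b) * \<phi> (us @ b # a # ws))"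

lemma gsym_multilinear: "gsym \<phi> \<Longrightarrow> multilinear (vscale G) \<phi>"
  by (simp add: gsym_def)

lemma gsym_swap: "gsym \<phi> \<Longrightarrow> us @ a # b # ws \<in> hom_lists G \<Longrightarrow>
    \<phi> (us @ a # b # ws) = (-1) ^ (parity G a * parity G b) * \<phi> (us @ b # a # ws)"
  unfolding gsym_def by blast

lemma permute_hom_lists: "\<sigma> permutes {..<length us} \<Longrightarrow> us \<in> hom_lists G \<Longrightarrow> permute_list \<sigma> us \<in> hom_lists G"
  by (simp add: hom_lists_def lists_eq_set)

lemma permute_list_adjacent:
  "permute_list (Transposition.transpose (length xs) (Suc (length xs))) (xs @ a # b # ys) = xs @ b # a # ys"
proof (rule nth_equalityI)
  fix i assume "i < length (permute_list (Transposition.transpose (length xs) (Suc (length xs))) (xs @ a # b # ys))"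
  then have i: "i < length (xs @ a # b # ys)" by simp
  have "Transposition.transpose (length xs) (Suc (length xs)) permutes {..<length (xs @ a # b # ys)}"
    by (rule permutes_swap_id) auto
  note nth = permute_list_nth[OF this]
  consider "i < length xs" | "i = length xs" | "i = Suc (length xs)" | k where "i = length xs + Suc (Suc k)"
    by (metis add_Suc_right less_antisym linorder_neqE_nat less_imp_add_positive Suc_pred add.right_neutral not_less_eq)
  then show "permute_list (Transposition.transpose (length xs) (Suc (length xs))) (xs @ a # b # ys) ! i = (xs @ b # a # ys) ! i"
    unfolding nth[OF i]
    using i by cases (simp_all add: nth_append Transposition.transpose_def)
qed simp

text \<open>The permutations that satisfy the equation on all homogeneous lists are closed under
  composition by the cocycle identity. They contain the adjacent transpositions, hence all
  transpositions, hence everything.\<close>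

lemma gsym_permute:
  assumes \<phi>: "gsym \<phi>" and \<sigma>: "\<sigma> permutes {..<n}" and us: "us \<in> hom_lists G" "length us = n"
  shows "koszul_sign G \<sigma> us * \<phi> (permute_list \<sigma> us) = \<phi> us"
proof -
  define good where "good \<sigma> \<longleftrightarrow> \<sigma> permutes {..<n} \<and>
    (\<forall>us\<in>hom_lists G. length us = n \<longrightarrow> koszul_sign G \<sigma> us * \<phi> (permute_list \<sigma> us) = \<phi> us)" for \<sigma>
  have comp: "good (f \<circ> g)" if f: "good f" and g: "good g" for f g
    unfolding good_def
  proof (intro conjI ballI impI)
    have perm: "f permutes {..<n}" "g permutes {..<n}" using f g by (auto simp: good_def)
    then show "f \<circ> g permutes {..<n}" by (rule permutes_compose[rotated])
    fix us assume us: "us \<in> hom_lists G" "length us = n"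
    have "koszul_sign G (f \<circ> g) us * \<phi> (permute_list (f \<circ> g) us) =
        koszul_sign G f us * (koszul_sign G g (permute_list f us) * \<phi> (permute_list g (permute_list f us)))"
      using perm us by (simp add: koszul_sign_compose permute_list_compose)
    also have "\<dots> = \<phi> us"
      using f g us perm permute_hom_lists[of f us] by (simp add: good_def)
    finally show "koszul_sign G (f \<circ> g) us * \<phi> (permute_list (f \<circ> g) us) = \<phi> us" .
  qed
  have adj: "good (Transposition.transpose i (Suc i))" if i: "Suc i < n" for i
    unfolding good_def
  proof (intro conjI ballI impI)
    show "Transposition.transpose i (Suc i) permutes {..<n}" using i by (intro permutes_swap_id) auto
    fix us assume us: "us \<in> hom_lists G" "length us = n"
    define xs a b ys where "xs = take i us" "a = us ! i" "b = us ! Suc i" "ys = drop (Suc (Suc i)) us"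
    have eq: "us = xs @ a # b # ys" and len: "length xs = i"
      using i us unfolding xs_a_b_ys_def by (auto simp: Cons_nth_drop_Suc id_take_nth_drop[symmetric])
    have "koszul_sign G (Transposition.transpose i (Suc i)) us = ((-1) ^ (parity G a * parity G b) :: 'k)"
      using koszul_sign_adjacent[of i us G] i us xs_a_b_ys_def by simp
    moreover have "permute_list (Transposition.transpose i (Suc i)) us = xs @ b # a # ys"
      using permute_list_adjacent[of xs a b ys] eq len by simp
    ultimately show "koszul_sign G (Transposition.transpose i (Suc i)) us * \<phi> (permute_list (Transposition.transpose i (Suc i)) us) = \<phi> us"
      using gsym_swap[OF \<phi>, of xs a b ys] us(1) eq by simp
  qed
  have lt: "good (Transposition.transpose a b)" if "a < b" "b < n" for a b
    using that
  proof (induction b)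
    case (Suc b)
    show ?case
    proof (cases "a = b")
      case True
      then show ?thesis using adj Suc.prems by simp
    next
      case False
      \<comment> \<open>Conjugation with the exchange of b and b + 1 moves the upper end of the
        transposition from b to b + 1.\<close>
      then have "Transposition.transpose a (Suc b) = Transposition.transpose b (Suc b) \<circ> Transposition.transpose a b \<circ> Transposition.transpose b (Suc b)"
        using Suc.prems by (auto simp: fun_eq_iff Transposition.transpose_def)
      moreover have "good (Transposition.transpose a b)" "good (Transposition.transpose b (Suc b))"
        using Suc False adj[of b] by auto
      ultimately show ?thesis using comp by metis
    qed
  qed auto
  have trans: "good (Transposition.transpose a b)" if "a < n" "b < n" "a \<noteq> b" for a b
    using lt[of a b] lt[of b a] that by (metis linorder_neqE_nat Transposition.transpose_commute)
  have good_id: "good id" by (auto simp: good_def koszul_sign_id permutes_id)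
  have "good \<sigma>" using \<sigma> finite_lessThan
  proof (induction rule: permutes_induct)
    case id
    show ?case by (rule good_id)
  next
    case (swap a b p)
    then show ?case by (intro comp trans) simp_all
  qed
  with us show ?thesis by (auto simp: good_def)
qed

text \<open>The transpose of the symmetrizer.\<close>

definition sym_form :: "('v list \<Rightarrow> 'k) \<Rightarrow> 'v list \<Rightarrow> 'k" where
  "sym_form \<phi> vs = hext vs (\<lambda>us. 1 / fact (length us) *
     (\<Sum>\<sigma> | \<sigma> permutes {..<length us}. koszul_sign G \<sigma> us * tens (vscale G) (permute_list \<sigma> us) \<phi>))"

text \<open>The sign depends on the list through its parities only, the form in which
  \<open>hmulti_sign\<close> accepts it.\<close>

lemma koszul_sign_parity:
  assumes "\<sigma> permutes {..<length us}"
  shows "koszul_sign G \<sigma> us = (-1) ^ card {(i, j). i < j \<and> j < length us \<and> \<sigma> i > \<sigma> j \<and>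
     map (parity G) us ! \<sigma> i = 1 \<and> map (parity G) us ! \<sigma> j = 1}"
proof -
  have lt: "i < length us \<Longrightarrow> \<sigma> i < length us" for i using permutes_in_image[OF assms, of i] by simp
  have "(i < j \<and> j < length us \<and> \<sigma> i > \<sigma> j \<and> parity G (us ! \<sigma> i) = 1 \<and> parity G (us ! \<sigma> j) = 1) =
    (i < j \<and> j < length us \<and> \<sigma> i > \<sigma> j \<and> map (parity G) us ! \<sigma> i = 1 \<and> map (parity G) us ! \<sigma> j = 1)" for i j
  proof (cases "i < j \<and> j < length us")
    case True
    then have "\<sigma> i < length us" "\<sigma> j < length us" using lt by simp_all
    then show ?thesis by simp
  qed blast
  then show ?thesis by (simp only: koszul_sign_def)
qed

text \<open>An update at i in the list becomes an update at \<open>inv \<sigma> i\<close> in the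
  permuted list. The condition on the length is there because \<sigma> permutes n positions.\<close>

lemma multilinear_permute:
  assumes \<phi>: "multilinear (vscale G) \<phi>" and \<sigma>: "\<sigma> permutes {..<n}"
  shows "multilinear (vscale G) (\<lambda>us. if length us = n then \<phi> (permute_list \<sigma> us) else 0)"
proof -
  have upd: "permute_list \<sigma> (us[i := x]) = (permute_list \<sigma> us)[inv \<sigma> i := x]"
    if "length us = n" "i < n" for us :: "'v list" and i x
  proof (rule nth_equalityI)
    fix j assume "j < length (permute_list \<sigma> (us[i := x]))"
    then have j: "j < n" "\<sigma> j < n" using that permutes_in_image[OF \<sigma>, of j] by auto
    have "inv \<sigma> i = j \<longleftrightarrow> i = \<sigma> j" using permutes_inverses[OF \<sigma>] by metis
    then show "permute_list \<sigma> (us[i := x]) ! j = (permute_list \<sigma> us)[inv \<sigma> i := x] ! j"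
      using j that by (auto simp: permute_list_def nth_list_update)
  qed simp
  have lt: "inv \<sigma> i < n \<longleftrightarrow> i < n" for i using permutes_in_image[OF permutes_inv[OF \<sigma>], of i] by auto
  show ?thesis unfolding multilinear_iff_update
    using upd multilinear_update[OF \<phi>] lt by simp
qed

lemma hmulti_permute:
  assumes \<phi>: "multilinear (vscale G) \<phi>" and \<sigma>: "\<sigma> permutes {..<n}"
  shows "hmulti (\<lambda>us. if length us = n then koszul_sign G \<sigma> us * \<phi> (permute_list \<sigma> us) else 0)"
proof -
  have *: "(\<lambda>us. if length us = n then koszul_sign G \<sigma> us * \<phi> (permute_list \<sigma> us) else 0) =
    (\<lambda>us. (\<lambda>ps. (-1) ^ card {(i, j). i < j \<and> j < n \<and> \<sigma> i > \<sigma> j \<and> ps ! \<sigma> i = 1 \<and> ps ! \<sigma> j = 1})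
       (map (parity G) us) * (if length us = n then \<phi> (permute_list \<sigma> us) else 0))"
    using koszul_sign_parity \<sigma> by (auto simp: fun_eq_iff)
  show ?thesis unfolding * by (rule hmulti_sign[OF multilinear_permute[OF assms]])
qed

lemma hmulti_sym_form:
  "hmulti (\<lambda>us. 1 / fact (length us) *
     (\<Sum>\<sigma> | \<sigma> permutes {..<length us}. koszul_sign G \<sigma> us * tens (vscale G) (permute_list \<sigma> us) \<phi>))"
proof (rule hmulti_by_length)
  fix n
  have "hmulti (\<lambda>us. 1 / fact n * (\<Sum>\<sigma> | \<sigma> permutes {..<n}.
      if length us = n then koszul_sign G \<sigma> us * tens (vscale G) (permute_list \<sigma> us) \<phi> else 0))"
    by (intro hmulti_cmult hmulti_sum hmulti_permute multilinear_tens) auto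
  then show "hmulti (\<lambda>us. if length us = n then 1 / fact (length us) *
     (\<Sum>\<sigma> | \<sigma> permutes {..<length us}. koszul_sign G \<sigma> us * tens (vscale G) (permute_list \<sigma> us) \<phi>) else 0)"
    by (rule hmulti_cong) auto
qed

text \<open>True for every \<phi>, since the definition evaluates \<open>tens\<close> at \<phi>
  instead of applying \<phi>.\<close>

lemma multilinear_sym_form: "multilinear (vscale G) (sym_form \<phi>)"
  unfolding sym_form_def[abs_def] by (rule multilinear_hext[OF hmulti_sym_form])

lemma sym_form_hom:
  assumes "us \<in> hom_lists G"
  shows "sym_form \<phi> us = 1 / fact (length us) *
     (\<Sum>\<sigma> | \<sigma> permutes {..<length us}. koszul_sign G \<sigma> us * tens (vscale G) (permute_list \<sigma> us) \<phi>)"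
  unfolding sym_form_def by (rule hext_hom[OF hmulti_sym_form assms])

lemma sym_form_not_multilinear: "\<not> multilinear (vscale G) \<phi> \<Longrightarrow> sym_form \<phi> = (\<lambda>vs. 0)"
  by (simp add: sym_form_def[abs_def] tens_def)

text \<open>By \<open>gsym_permute\<close> each of the n! summands equals \<open>\<phi> us\<close>,
  so the average is \<phi>.\<close>

lemma sym_form_gsym:
  assumes \<phi>: "gsym \<phi>" shows "sym_form \<phi> = \<phi>"
proof
  fix vs
  have "sym_form \<phi> vs = hext vs \<phi>" unfolding sym_form_def
  proof (rule hext_cong)
    fix us assume us: "us \<in> hom_lists G"
    have "(\<Sum>\<sigma> | \<sigma> permutes {..<length us}. koszul_sign G \<sigma> us * tens (vscale G) (permute_list \<sigma> us) \<phi>)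
      = (\<Sum>\<sigma> | \<sigma> permutes {..<length us}. \<phi> us)"
      by (rule sum.cong)
        (use gsym_permute[OF \<phi> _ us refl] gsym_multilinear[OF \<phi>] in \<open>auto simp: tens_apply\<close>)
    also have "\<dots> = fact (length us) * \<phi> us"
      by (simp add: card_permutations[of _ "length us"])
    finally show "1 / fact (length us) * (\<Sum>\<sigma> | \<sigma> permutes {..<length us}.
        koszul_sign G \<sigma> us * tens (vscale G) (permute_list \<sigma> us) \<phi>) = \<phi> us" by simp
  qed
  then show "sym_form \<phi> vs = \<phi> vs" using hext_multilinear[OF gsym_multilinear[OF \<phi>]] by simp
qed

text \<open>Exchanging two neighbours composes every summand with a transposition; this permutes the
  summation and, by the cocycle identity, splits off the sign.\<close>

lemma gsym_sym_form: "gsym (sym_form \<phi>)"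
  unfolding gsym_def
proof (intro conjI multilinear_sym_form allI impI)
  fix us a b and ws :: "'v list"
  let ?vs = "us @ a # b # ws" and ?n = "length us + Suc (Suc (length ws))"
  let ?\<tau> = "Transposition.transpose (length us) (Suc (length us))"
  let ?S = "\<lambda>vs. \<Sum>\<sigma> | \<sigma> permutes {..<?n}. koszul_sign G \<sigma> vs * tens (vscale G) (permute_list \<sigma> vs) \<phi>"
  assume hom: "?vs \<in> hom_lists G"
  have \<tau>: "?\<tau> permutes {..<?n}" by (intro permutes_swap_id) auto
  have pl: "permute_list ?\<tau> ?vs = us @ b # a # ws" by (rule permute_list_adjacent)
  have sg: "koszul_sign G ?\<tau> ?vs = ((-1) ^ (parity G a * parity G b) :: 'k)"
    using koszul_sign_adjacent[of "length us" ?vs G] by (simp add: nth_append)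
  have "?S ?vs = (\<Sum>\<sigma> | \<sigma> permutes {..<?n}.
      koszul_sign G (?\<tau> \<circ> \<sigma>) ?vs * tens (vscale G) (permute_list (?\<tau> \<circ> \<sigma>) ?vs) \<phi>)"
    by (rule setum_permutations_compose_left[OF \<tau>])
  also have "\<dots> = (\<Sum>\<sigma> | \<sigma> permutes {..<?n}. (-1) ^ (parity G a * parity G b) *
      (koszul_sign G \<sigma> (us @ b # a # ws) * tens (vscale G) (permute_list \<sigma> (us @ b # a # ws)) \<phi>))"
  proof (rule sum.cong)
    fix \<sigma> assume "\<sigma> \<in> {\<sigma>. \<sigma> permutes {..<?n}}"
    then have \<sigma>: "\<sigma> permutes {..<length ?vs}" by simp
    have \<tau>': "?\<tau> permutes {..<length ?vs}" using \<tau> by simp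
    show "koszul_sign G (?\<tau> \<circ> \<sigma>) ?vs * tens (vscale G) (permute_list (?\<tau> \<circ> \<sigma>) ?vs) \<phi> =
      (-1) ^ (parity G a * parity G b) *
      (koszul_sign G \<sigma> (us @ b # a # ws) * tens (vscale G) (permute_list \<sigma> (us @ b # a # ws)) \<phi>)"
      unfolding koszul_sign_compose[OF \<tau>' \<sigma>] permute_list_compose[OF \<sigma>] pl sg by (simp only: mult.assoc)
  qed auto
  also have "\<dots> = (-1) ^ (parity G a * parity G b) * ?S (us @ b # a # ws)"
    by (simp only: sum_distrib_left)
  finally have "?S ?vs = (-1) ^ (parity G a * parity G b) * ?S (us @ b # a # ws)" .
  moreover have "us @ b # a # ws \<in> hom_lists G" using hom by auto
  ultimately show "sym_form \<phi> ?vs = (-1) ^ (parity G a * parity G b) * sym_form \<phi> (us @ b # a # ws)"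
    using hom by (simp add: sym_form_hom del: sum_distrib_left)
qed

end

subsection \<open>The symmetric algebra\<close>

context graded_lcs
begin

abbreviation "T \<equiv> tensors (vscale G)"
abbreviation "ten \<equiv> tens (vscale G)"
abbreviation "ml \<equiv> multilinear (vscale G)"

lemma hext_sum: "hext vs (\<lambda>us. \<Sum>i\<in>A. f i us) = (\<Sum>i\<in>A. hext vs (f i))"
  by (induction A rule: infinite_finite_induct) (simp_all add: hext_add)

text \<open>\<open>hext\<close> forms finite sums of values of h. The statement is pointwise in
  \<phi> because \<open>hext\<close> is scalar-valued.\<close>

lemma hext_in_subspace:
  assumes U: "fs.subspace U" and h: "\<And>us. us \<in> hom_lists G \<Longrightarrow> length us = length vs \<Longrightarrow> h us \<in> U"
  shows "(\<lambda>\<phi>. hext vs (\<lambda>us. h us \<phi>)) \<in> U"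
  using h
proof (induction vs arbitrary: h)
  case Nil
  then show ?case by simp
next
  case (Cons v vs)
  have "(\<lambda>\<phi>. hext (v # vs) (\<lambda>us. h us \<phi>)) =
      (\<lambda>\<phi>. hext vs (\<lambda>us. h (even_proj G v # us) \<phi>)) + (\<lambda>\<phi>. hext vs (\<lambda>us. h (odd_proj G v # us) \<phi>))"
    by (simp add: fun_eq_iff)
  also have "\<dots> \<in> U"
    by (intro fs.subspace_add[OF U] Cons.IH Cons.prems) auto
  finally show ?case .
qed

lemma tens_hext: "ten vs = (\<lambda>\<phi>. hext vs (\<lambda>us. ten us \<phi>))"
  using hext_multilinear[OF multilinear_tens] by (simp add: fun_eq_iff)

text \<open>Permutations act by linear extension from homogeneous words; splitting the entries shows
  that these words span.\<close>

lemma tensor_power_hom: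
  "tensor_power (vscale G) n = fs.span (ten ` {vs \<in> hom_lists G. length vs = n})"
proof
  show "tensor_power (vscale G) n \<subseteq> fs.span (ten ` {vs \<in> hom_lists G. length vs = n})"
    unfolding tensor_power_def
  proof (rule fs.span_minimal)
    show "{ten vs |vs. length vs = n} \<subseteq> fs.span (ten ` {vs \<in> hom_lists G. length vs = n})"
    proof clarify
      fix vs :: "'v list" assume n: "n = length vs"
      show "ten vs \<in> fs.span (ten ` {us \<in> hom_lists G. length us = length vs})"
        by (subst tens_hext, rule hext_in_subspace) (auto intro: fs.span_base)
    qed
  qed (rule fs.subspace_span)
  show "fs.span (ten ` {vs \<in> hom_lists G. length vs = n}) \<subseteq> tensor_power (vscale G) n"
    unfolding tensor_power_def by (rule fs.span_mono) auto
qed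

lemma multilinear_perm_form:
  assumes "\<sigma> permutes {..<n}"
  shows "ml (\<lambda>vs. hext vs (\<lambda>us. if length us = n then koszul_sign G \<sigma> us * ten (permute_list \<sigma> us) \<phi> else 0))"
  by (rule multilinear_hext[OF hmulti_permute[OF multilinear_tens assms]])

lemma perm_act_apply:
  assumes x: "x \<in> tensor_power (vscale G) n" and \<sigma>: "\<sigma> permutes {..<n}"
  shows "perm_act G n x \<sigma> = (\<lambda>\<phi>. x (\<lambda>vs. hext vs (\<lambda>us.
    if length us = n then koszul_sign G \<sigma> us * ten (permute_list \<sigma> us) \<phi> else 0)))"
  unfolding perm_act_def
proof (rule lin_ext_eq)
  fix vs \<phi> assume vs: "vs \<in> {vs \<in> hom_lists G. length vs = n}"
  show "ten vs (\<lambda>vs. hext vs (\<lambda>us. if length us = n then koszul_sign G \<sigma> us * ten (permute_list \<sigma> us) \<phi> else 0)) =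
      fscale (koszul_sign G \<sigma> vs) (ten (permute_list \<sigma> vs)) \<phi>"
    unfolding tens_apply[OF multilinear_perm_form[OF \<sigma>]]
    using hext_hom[OF hmulti_permute[OF multilinear_tens \<sigma>], of vs \<phi>] vs by simp
qed (use x tensor_power_hom in blast)

lemma sym_form_length_if:
  "(\<lambda>vs. if length vs = n then sym_form \<phi> vs else 0) =
   (\<lambda>vs. 1 / fact n * (\<Sum>\<sigma> | \<sigma> permutes {..<n}. hext vs (\<lambda>us.
      if length us = n then koszul_sign G \<sigma> us * ten (permute_list \<sigma> us) \<phi> else 0)))"
proof
  fix vs :: "'v list"
  show "(if length vs = n then sym_form \<phi> vs else 0) =
     1 / fact n * (\<Sum>\<sigma> | \<sigma> permutes {..<n}. hext vs (\<lambda>us.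
      if length us = n then koszul_sign G \<sigma> us * ten (permute_list \<sigma> us) \<phi> else 0))"
  proof (cases "length vs = n")
    case True
    have "sym_form \<phi> vs = hext vs (\<lambda>us. 1 / fact n * (\<Sum>\<sigma> | \<sigma> permutes {..<n}.
        if length us = n then koszul_sign G \<sigma> us * ten (permute_list \<sigma> us) \<phi> else 0))"
      unfolding sym_form_def by (rule hext_cong) (simp add: True)
    then show ?thesis using True by (simp only: hext_sum hext_cmult True refl if_True)
  next
    case False
    then have "hext vs (\<lambda>us. if length us = n then koszul_sign G \<sigma> us * ten (permute_list \<sigma> us) \<phi> else 0) =
        hext vs (\<lambda>us. 0)" for \<sigma> by (intro hext_cong) simp
    with False show ?thesis by simp
  qed
qed

lemma symmetrizer_n_apply:
  assumes x: "x \<in> tensor_power (vscale G) n"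
  shows "symmetrizer_n G n x = (\<lambda>\<phi>. x (\<lambda>vs. if length vs = n then sym_form \<phi> vs else 0))"
proof
  fix \<phi>
  have xT: "x \<in> T" using x tensor_power_subset by blast
  have "symmetrizer_n G n x \<phi> = 1 / fact n * (\<Sum>\<sigma> | \<sigma> permutes {..<n}. x (\<lambda>vs. hext vs (\<lambda>us.
      if length us = n then koszul_sign G \<sigma> us * ten (permute_list \<sigma> us) \<phi> else 0)))"
    by (simp add: symmetrizer_n_def sum_fun_apply perm_act_apply[OF x])
  also have "\<dots> = x (\<lambda>vs. 1 / fact n * (\<Sum>\<sigma> | \<sigma> permutes {..<n}. hext vs (\<lambda>us.
      if length us = n then koszul_sign G \<sigma> us * ten (permute_list \<sigma> us) \<phi> else 0)))"
    by (subst tensor_cmult[OF xT], intro multilinear_sum multilinear_perm_form, simp,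
        subst tensor_sum[OF xT], intro multilinear_perm_form, simp_all)
  finally show "symmetrizer_n G n x \<phi> = x (\<lambda>vs. if length vs = n then sym_form \<phi> vs else 0)"
    by (simp only: sym_form_length_if)
qed

text \<open>The decomposition into degrees in evaluated form. It holds for every bound M from some N
  on, so that two bounds may be compared.\<close>

lemma tensor_degree_sum:
  assumes "x \<in> T"
  obtains N where "\<And>M \<psi>. M \<ge> N \<Longrightarrow> ml \<psi> \<Longrightarrow> x \<psi> = (\<Sum>n\<le>M. x (\<lambda>vs. if length vs = n then \<psi> vs else 0))"
proof -
  obtain L where L: "x = lin_comb ten L" by (rule tensorsE[OF assms])
  have "\<exists>N. \<forall>M\<ge>N. \<forall>\<psi>. ml \<psi> \<longrightarrow>
      lin_comb ten L \<psi> = (\<Sum>n\<le>M. lin_comb ten L (\<lambda>vs. if length vs = n then \<psi> vs else 0))"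
  proof (induction L)
    case (Cons p L)
    obtain c vs where p: "p = (c, vs)" by fastforce
    obtain N where N: "\<And>M \<psi>. M \<ge> N \<Longrightarrow> ml \<psi> \<Longrightarrow>
      lin_comb ten L \<psi> = (\<Sum>n\<le>M. lin_comb ten L (\<lambda>vs. if length vs = n then \<psi> vs else 0))"
      using Cons.IH by blast
    have "lin_comb ten (p # L) \<psi> = (\<Sum>n\<le>M. lin_comb ten (p # L) (\<lambda>vs. if length vs = n then \<psi> vs else 0))"
      if "M \<ge> max N (length vs)" "ml \<psi>" for M \<psi>
    proof -
      have "c * \<psi> vs = (\<Sum>n\<le>M. c * ten vs (\<lambda>vs. if length vs = n then \<psi> vs else 0))"
        unfolding tens_apply[OF multilinear_length_if[OF that(2), of "\<lambda>m. m = n" for n]]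
        using that(1) by (simp add: sum_distrib_left[symmetric])
      then show ?thesis using N[of M \<psi>] that by (simp add: p sum.distrib tens_apply)
    qed
    then show ?case by blast
  qed auto
  with that L show ?thesis by blast
qed

text \<open>The transposes of the single degrees add up to \<open>sym_form\<close>, so the
  symmetrizer is precomposition with one map of forms.\<close>

lemma symmetrizer_apply:
  assumes x: "x \<in> T"
  shows "symmetrizer G x = (\<lambda>\<phi>. x (sym_form \<phi>))"
proof -
  have d: "symmetrizer_n G n (degree_part (vscale G) n x) =
      (\<lambda>\<phi>. x (\<lambda>vs. if length vs = n then sym_form \<phi> vs else 0))" for n
    unfolding symmetrizer_n_apply[OF degree_part_in_tensor_power[OF x]] unfolding degree_part_apply[OF x]
    by (simp add: tens_apply[OF multilinear_length_if[OF multilinear_sym_form, of "\<lambda>m. m = n"]] cong: if_cong)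
  obtain N where N: "\<And>M \<psi>. M \<ge> N \<Longrightarrow> ml \<psi> \<Longrightarrow> x \<psi> = (\<Sum>n\<le>M. x (\<lambda>vs. if length vs = n then \<psi> vs else 0))"
    using tensor_degree_sum[OF x] by blast
  \<comment> \<open>Comparing the decompositions with the bounds n and n - 1 shows that the summand
    of degree n is 0.\<close>
  have z: "x (\<lambda>vs. if length vs = n then sym_form \<phi> vs else 0) = 0" if "n > N" for n \<phi>
  proof -
    let ?f = "\<lambda>k. x (\<lambda>vs. if length vs = k then sym_form \<phi> vs else 0)"
    obtain m where m: "n = Suc m" "N \<le> m" using \<open>n > N\<close> by (cases n) auto
    have e1: "x (sym_form \<phi>) = sum ?f {..Suc m}" by (rule N[OF _ multilinear_sym_form]) (use m in simp)
    have e2: "x (sym_form \<phi>) = sum ?f {..m}" by (rule N[OF m(2) multilinear_sym_form])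
    have "sum ?f {..m} = sum ?f {..m} + ?f (Suc m)"
      by (rule trans[OF e2[symmetric] trans[OF e1 sum.atMost_Suc]])
    then show ?thesis unfolding m(1) by (rule add_cancel_right_right[THEN iffD1])
  qed
  have "symmetrizer G x = (\<Sum>n\<le>N. (\<lambda>\<phi>. x (\<lambda>vs. if length vs = n then sym_form \<phi> vs else 0)))"
    unfolding symmetrizer_def d
    by (rule Sum_any.expand_superset) (use z in \<open>auto simp: fun_eq_iff not_le[symmetric]\<close>)
  also have "\<dots> = (\<lambda>\<phi>. x (sym_form \<phi>))"
    using N[of N, OF order_refl multilinear_sym_form] by (simp add: fun_eq_iff sum_fun_apply)
  finally show ?thesis .
qed

lemma symmetrizer_in_tensors: "x \<in> T \<Longrightarrow> symmetrizer G x \<in> T"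
proof -
  have "sym_form \<phi> us = 0" if "\<not> ml \<phi>" for \<phi> us using sym_form_not_multilinear[OF that] by simp
  assume x: "x \<in> T"
  have eq: "symmetrizer G x = (\<lambda>\<phi>. x (\<lambda>vs. (\<lambda>vs \<phi>. sym_form \<phi> vs) vs \<phi>))"
    by (simp add: symmetrizer_apply[OF x])
  have h: "(\<lambda>\<phi>. sym_form \<phi> vs) \<in> T" for vs
    unfolding sym_form_def
  proof (rule hext_in_subspace[OF subspace_tensors])
    fix us :: "'v list"
    have "(\<lambda>\<phi>. 1 / fact (length us) * (\<Sum>\<sigma> | \<sigma> permutes {..<length us}. koszul_sign G \<sigma> us * ten (permute_list \<sigma> us) \<phi>))
      = fscale (1 / fact (length us)) (\<Sum>\<sigma> | \<sigma> permutes {..<length us}. fscale (koszul_sign G \<sigma> us) (ten (permute_list \<sigma> us)))"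
      by (simp add: fun_eq_iff sum_fun_apply)
    also have "\<dots> \<in> T"
      by (intro fs.subspace_scale[OF subspace_tensors] fs.subspace_sum[OF subspace_tensors]) auto
    finally show "(\<lambda>\<phi>. 1 / fact (length us) * (\<Sum>\<sigma> | \<sigma> permutes {..<length us}. koszul_sign G \<sigma> us * ten (permute_list \<sigma> us) \<phi>)) \<in> T" .
  qed
  show ?thesis unfolding eq
    by (rule tensor_map_in[OF x _ subspace_tensors h]) (rule multilinear_sym_form)
qed

lemma symmetrizer_n_in_tensors:
  assumes "x \<in> tensor_power (vscale G) n" shows "symmetrizer_n G n x \<in> T"
proof -
  have xT: "x \<in> T" using assms tensor_power_subset by blast
  let ?y = "degree_part (vscale G) n x"
  have yT: "?y \<in> T" using degree_part_in_tensor_power[OF xT] tensor_power_subset by blast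
  have "symmetrizer_n G n x = symmetrizer G ?y"
    unfolding symmetrizer_apply[OF yT] symmetrizer_n_apply[OF assms] unfolding degree_part_apply[OF xT]
    by (simp add: tens_apply multilinear_sym_form cong: if_cong)
  with symmetrizer_in_tensors[OF yT] show ?thesis by simp
qed

lemma sym_form_idem: "sym_form (sym_form \<phi>) = sym_form \<phi>"
  by (rule sym_form_gsym[OF gsym_sym_form])

section \<open>The symmetric algebra as the fixed space of the symmetrizer\<close>

abbreviation "W \<equiv> sym_algebra G"

lemma subspace_W: "fs.subspace W"
  by (simp add: sym_algebra_def)

lemma W_closed [simp, intro]:
  "0 \<in> W" "x \<in> W \<Longrightarrow> y \<in> W \<Longrightarrow> x + y \<in> W" "x \<in> W \<Longrightarrow> y \<in> W \<Longrightarrow> x - y \<in> W" "x \<in> W \<Longrightarrow> fscale c x \<in> W"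
  using subspace_W fs.subspace_0 fs.subspace_add fs.subspace_diff fs.subspace_scale by metis+

text \<open>Generators are fixed by the symmetrizer because \<open>sym_form\<close> is idempotent;
  conversely a fixed tensor equals its own symmetrization, a finite sum of members of symmetric
  powers. Membership thus becomes an equation.\<close>

lemma W_iff: "x \<in> W \<longleftrightarrow> x \<in> T \<and> (\<forall>\<phi>. x (sym_form \<phi>) = x \<phi>)"
proof
  have sub: "fs.subspace {x \<in> T. \<forall>\<phi>. x (sym_form \<phi>) = x \<phi>}"
    using subspace_tensors by (auto simp: fs.subspace_def)
  have "(\<Union>n. sym_power G n) \<subseteq> {x \<in> T. \<forall>\<phi>. x (sym_form \<phi>) = x \<phi>}"
  proof clarify
    fix n x assume "x \<in> sym_power G n"
    then obtain y where y: "y \<in> tensor_power (vscale G) n" "x = symmetrizer_n G n y"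
      by (auto simp: sym_power_def)
    show "x \<in> T \<and> (\<forall>\<phi>. x (sym_form \<phi>) = x \<phi>)"
      using symmetrizer_n_in_tensors[OF y(1)] y(2) by (simp add: symmetrizer_n_apply[OF y(1)] sym_form_idem cong: if_cong)
  qed
  from fs.span_minimal[OF this sub] show "x \<in> W \<Longrightarrow> x \<in> T \<and> (\<forall>\<phi>. x (sym_form \<phi>) = x \<phi>)"
    unfolding sym_algebra_def by blast
next
  assume x: "x \<in> T \<and> (\<forall>\<phi>. x (sym_form \<phi>) = x \<phi>)"
  then have "x = symmetrizer G x" by (simp add: symmetrizer_apply)
  also have "\<dots> \<in> W"
  proof -
    obtain N where "\<And>n. n > N \<Longrightarrow> degree_part (vscale G) n x = 0"
      using degree_part_bound x by blast
    moreover have "symmetrizer_n G n 0 = 0" for n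
      by (subst symmetrizer_n_apply) (auto simp: tensor_power_def fs.span_zero fun_eq_iff)
    ultimately have "symmetrizer G x = (\<Sum>n\<le>N. symmetrizer_n G n (degree_part (vscale G) n x))"
      unfolding symmetrizer_def by (intro Sum_any.expand_superset) (auto simp: not_le[symmetric])
    also have "\<dots> \<in> W" unfolding sym_algebra_def
      by (intro fs.span_sum fs.span_base) (use degree_part_in_tensor_power x in \<open>auto simp: sym_power_def\<close>)
    finally show ?thesis .
  qed
  finally show "x \<in> W" .
qed

lemma W_in_T: "x \<in> W \<Longrightarrow> x \<in> T"
  by (simp add: W_iff)

lemma W_sym_form: "x \<in> W \<Longrightarrow> x (sym_form \<phi>) = x \<phi>"
  by (simp add: W_iff)

text \<open>The value at \<phi> is the value at \<open>sym_form \<phi>\<close>, which is graded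
  symmetric. Factors may thus be reordered with signs when elements of the symmetric algebra are
  compared.\<close>

lemma W_eqI:
  assumes "x \<in> W" "y \<in> W" "\<And>\<phi>. gsym \<phi> \<Longrightarrow> x \<phi> = y \<phi>" shows "x = y"
  using assms W_sym_form gsym_sym_form by (metis ext)

lemma symmetrizer_in_W: "x \<in> T \<Longrightarrow> symmetrizer G x \<in> W"
  unfolding W_iff by (rule conjI[OF symmetrizer_in_tensors]) (simp_all add: symmetrizer_apply sym_form_idem)

section \<open>The symmetric product of tensors and of vectors\<close>

lemma tensor_mult_in_T:
  assumes a: "a \<in> T" and b: "b \<in> T" shows "tensor_mult (vscale G) a b \<in> T"
  unfolding tensor_mult_apply[OF assms]
proof (rule tensor_map_in[OF a _ subspace_tensors])
  show "ml (\<lambda>vs. b (\<lambda>ws. ten (vs @ ws) \<phi>))" for \<phi>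
    by (rule multilinear_eval2[OF b]) (auto intro: multilinear_append_left multilinear_append_right multilinear_tens)
  show "(\<lambda>\<phi>. b (\<lambda>ws. ten (vs @ ws) \<phi>)) \<in> T" for vs
    by (rule tensor_map_in[OF b _ subspace_tensors]) (auto intro: multilinear_append_left multilinear_tens)
qed

lemma sym_mult_in_W: "a \<in> T \<Longrightarrow> b \<in> T \<Longrightarrow> sym_mult G a b \<in> W"
  unfolding sym_mult_def by (intro symmetrizer_in_W tensor_mult_in_T)

lemma sym_mult_apply:
  assumes "a \<in> T" "b \<in> T"
  shows "sym_mult G a b = (\<lambda>\<phi>. a (\<lambda>vs. b (\<lambda>ws. sym_form \<phi> (vs @ ws))))"
  unfolding sym_mult_def symmetrizer_apply[OF tensor_mult_in_T[OF assms]]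
  unfolding tensor_mult_apply[OF assms] by (simp add: tens_apply multilinear_sym_form)

text \<open>The inner symmetrization is absorbed by the outer one, because for homogeneous v the
  form \<open>\<lambda>ws. sym_form \<phi> (v # ws)\<close> is already graded symmetric. An iterated
  product is therefore one symmetrization of the whole word.\<close>

lemma sym_prod_apply: "sym_prod G vs = (\<lambda>\<phi>. sym_form \<phi> vs)"
  and sym_prod_in_W: "sym_prod G vs \<in> W"
proof -
  have "sym_prod G vs = (\<lambda>\<phi>. sym_form \<phi> vs) \<and> sym_prod G vs \<in> W"
  proof (induction vs)
    case Nil
    have "ten [] = (\<lambda>\<phi>. sym_form \<phi> [])"
      by (rule ext) (simp add: sym_form_def koszul_sign_id)
    moreover have "symmetrizer G (ten []) = (\<lambda>\<phi>. sym_form \<phi> [])"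
      by (simp add: symmetrizer_apply tens_apply multilinear_sym_form)
    ultimately show ?case using symmetrizer_in_W[OF tens_in_tensors, of "[]"] by (simp add: sym_prod_def sym_one_def)
  next
    case (Cons v vs)
    then have IH: "sym_prod G vs = (\<lambda>\<phi>. sym_form \<phi> vs)" and vs: "sym_prod G vs \<in> T" by (auto simp: W_iff)
    have eq: "sym_prod G (v # vs) = sym_mult G (ten [v]) (sym_prod G vs)"
      by (simp add: sym_prod_def sym_vec_def)
    have "sym_mult G (ten [v]) (sym_prod G vs) \<phi> = sym_form \<phi> (v # vs)" for \<phi>
    proof -
      have g: "gsym (\<lambda>ws. sym_form \<phi> (v' # ws))" if "v' \<in> even_part G \<or> v' \<in> odd_part G" for v'
        unfolding gsym_def
      proof (intro conjI allI impI)
        show "ml (\<lambda>ws. sym_form \<phi> (v' # ws))"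
          using multilinear_append_left[OF multilinear_sym_form, where us="[v']"] by simp
        fix us a b ws assume "us @ a # b # ws \<in> hom_lists G"
        then show "sym_form \<phi> (v' # us @ a # b # ws) = (-1) ^ (parity G a * parity G b) * sym_form \<phi> (v' # us @ b # a # ws)"
          using gsym_swap[OF gsym_sym_form, of "v' # us" a b ws \<phi>] that by simp
      qed
      have m: "ml (\<lambda>vs. sym_prod G vs' (\<lambda>ws. sym_form \<phi> (vs @ ws)))" if "sym_prod G vs' \<in> T" for vs'
        by (rule multilinear_eval2[OF that]) (auto intro: multilinear_append_left multilinear_append_right multilinear_sym_form)
      have h: "sym_prod G vs (\<lambda>ws. sym_form \<phi> (v' # ws)) = sym_form \<phi> (v' # vs)"
        if "v' \<in> even_part G \<or> v' \<in> odd_part G" for v'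
        unfolding IH sym_form_gsym[OF g[OF that]] ..
      have "sym_mult G (ten [v]) (sym_prod G vs) \<phi> = sym_prod G vs (\<lambda>ws. sym_form \<phi> (v # ws))"
        using m[OF vs] by (simp add: sym_mult_apply vs tens_apply)
      \<comment> \<open>The sign rule asks for a homogeneous first entry, so a general v is split
        into its components.\<close>
      also have "\<dots> = sym_prod G vs (\<lambda>ws. sym_form \<phi> (even_proj G v # ws)) + sym_prod G vs (\<lambda>ws. sym_form \<phi> (odd_proj G v # ws))"
        using multilinearD(1)[OF m[OF vs], of "[]" "even_proj G v" "odd_proj G v" "[]"] by (simp add: proj_decomp)
      also have "\<dots> = sym_form \<phi> (even_proj G v # vs) + sym_form \<phi> (odd_proj G v # vs)"
        using h by simp
      also have "\<dots> = sym_form \<phi> (v # vs)"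
        using multilinearD(1)[OF multilinear_sym_form, of \<phi> "[]" "even_proj G v" "odd_proj G v" vs] by (simp add: proj_decomp)
      finally show ?thesis .
    qed
    then have "sym_prod G (v # vs) = (\<lambda>\<phi>. sym_form \<phi> (v # vs))" unfolding eq by (rule ext)
    moreover have "sym_prod G (v # vs) \<in> W"
      unfolding eq by (rule sym_mult_in_W[OF tens_in_tensors vs])
    ultimately show ?case by blast
  qed
  then show "sym_prod G vs = (\<lambda>\<phi>. sym_form \<phi> vs)" "sym_prod G vs \<in> W" by auto
qed

lemma sym_prod_gsym: "gsym \<phi> \<Longrightarrow> sym_prod G vs \<phi> = \<phi> vs"
  by (simp add: sym_prod_apply sym_form_gsym)

lemma multilinear_sym_prod: "ml (\<lambda>vs. sym_prod G vs \<phi>)"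
  unfolding sym_prod_apply by (rule multilinear_sym_form)

lemma sym_prod_hext: "sym_prod G vs = (\<lambda>\<phi>. hext vs (\<lambda>us. sym_prod G us \<phi>))"
  using hext_multilinear[OF multilinear_sym_prod] by (simp add: fun_eq_iff)

text \<open>A fixed tensor x is its own image under the linear extension of \<open>ten vs\<close>
  \<mapsto> \<open>sym_prod G vs\<close>, hence a combination of products, and each product splits
  into products of homogeneous vectors.\<close>

lemma W_span: "W = fs.span (sym_prod G ` hom_lists G)"
proof
  show "fs.span (sym_prod G ` hom_lists G) \<subseteq> W"
    by (rule fs.span_minimal[OF _ subspace_W]) (auto intro: sym_prod_in_W)
  show "W \<subseteq> fs.span (sym_prod G ` hom_lists G)"
  proof
    fix x assume x: "x \<in> W"
    have "x = (\<lambda>\<phi>. x (\<lambda>vs. sym_prod G vs \<phi>))"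
      using W_sym_form[OF x] by (simp add: sym_prod_apply)
    also have "\<dots> \<in> fs.span (sym_prod G ` hom_lists G)"
    proof (rule tensor_map_in[OF W_in_T[OF x] multilinear_sym_prod fs.subspace_span])
      show "sym_prod G vs \<in> fs.span (sym_prod G ` hom_lists G)" for vs
        by (subst sym_prod_hext, rule hext_in_subspace) (auto intro: fs.span_base)
    qed
    finally show "x \<in> fs.span (sym_prod G ` hom_lists G)" .
  qed
qed

text \<open>Tested on a graded symmetric form: fixing a homogeneous beginning or end of the list
  leaves a graded symmetric form, at which a product of vectors just evaluates.\<close>

lemma sym_mult_sym_prod:
  assumes "us \<in> hom_lists G" "vs \<in> hom_lists G"
  shows "sym_mult G (sym_prod G us) (sym_prod G vs) = sym_prod G (us @ vs)"
proof (rule W_eqI)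
  show "sym_mult G (sym_prod G us) (sym_prod G vs) \<in> W" by (intro sym_mult_in_W W_in_T sym_prod_in_W)
  fix \<phi> assume \<phi>: "gsym \<phi>"
  have g1: "gsym (\<lambda>ws. \<phi> (us' @ ws))" if "us' \<in> hom_lists G" for us'
    unfolding gsym_def
  proof (intro conjI allI impI multilinear_append_left[OF gsym_multilinear[OF \<phi>]])
    fix us a b ws assume "us @ a # b # ws \<in> hom_lists G"
    then show "\<phi> (us' @ us @ a # b # ws) = (-1) ^ (parity G a * parity G b) * \<phi> (us' @ us @ b # a # ws)"
      using gsym_swap[OF \<phi>, of "us' @ us" a b ws] that by simp
  qed
  have g2: "gsym (\<lambda>us. \<phi> (us @ vs))"
    unfolding gsym_def
  proof (intro conjI allI impI multilinear_append_right[OF gsym_multilinear[OF \<phi>]])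
    fix us a b ws assume "us @ a # b # ws \<in> hom_lists G"
    then show "\<phi> ((us @ a # b # ws) @ vs) = (-1) ^ (parity G a * parity G b) * \<phi> ((us @ b # a # ws) @ vs)"
      using gsym_swap[OF \<phi>, of us a b "ws @ vs"] assms by simp
  qed
  have m: "ml (\<lambda>us. sym_prod G vs (\<lambda>ws. \<phi> (us @ ws)))"
    by (rule multilinear_eval2[OF W_in_T[OF sym_prod_in_W]])
      (auto intro: multilinear_append_left multilinear_append_right gsym_multilinear[OF \<phi>])
  \<comment> \<open>The equation is clear for homogeneous us. Both sides are multilinear in us, so
    \<open>hext\<close> carries it to all lists.\<close>
  have "(\<lambda>us. sym_prod G vs (\<lambda>ws. \<phi> (us @ ws))) = (\<lambda>us. \<phi> (us @ vs))"
  proof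
    fix us
    have "sym_prod G vs (\<lambda>ws. \<phi> (us @ ws)) = hext us (\<lambda>us. sym_prod G vs (\<lambda>ws. \<phi> (us @ ws)))"
      by (rule hext_multilinear[OF m, symmetric])
    also have "\<dots> = hext us (\<lambda>us. \<phi> (us @ vs))"
      by (rule hext_cong) (rule sym_prod_gsym[OF g1])
    also have "\<dots> = \<phi> (us @ vs)" by (rule hext_multilinear[OF gsym_multilinear[OF g2]])
    finally show "sym_prod G vs (\<lambda>ws. \<phi> (us @ ws)) = \<phi> (us @ vs)" .
  qed
  then show "sym_mult G (sym_prod G us) (sym_prod G vs) \<phi> = sym_prod G (us @ vs) \<phi>"
    by (simp add: sym_mult_apply W_in_T sym_prod_in_W sym_form_gsym[OF \<phi>] sym_prod_gsym[OF g2] sym_prod_gsym[OF \<phi>])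
qed (rule sym_prod_in_W)

end

subsection \<open>The bidifferential operator\<close>

text \<open>\<beta> is bilinear on S, but a form for \<open>tens2\<close> must be multilinear on all
  functions. Composing both arguments with a linear projection onto S provides one.\<close>

lemma bilinear_form_ext:
  fixes \<beta> :: "('x \<Rightarrow> 'k::field) \<Rightarrow> ('x \<Rightarrow> 'k) \<Rightarrow> 'k"
  assumes S: "fs.subspace S"
    and add: "\<And>a a' b. a \<in> S \<Longrightarrow> a' \<in> S \<Longrightarrow> b \<in> S \<Longrightarrow> \<beta> (a + a') b = \<beta> a b + \<beta> a' b"
      "\<And>a b b'. a \<in> S \<Longrightarrow> b \<in> S \<Longrightarrow> b' \<in> S \<Longrightarrow> \<beta> a (b + b') = \<beta> a b + \<beta> a b'"
    and sc: "\<And>c a b. a \<in> S \<Longrightarrow> b \<in> S \<Longrightarrow> \<beta> (fscale c a) b = c * \<beta> a b"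
      "\<And>c a b. a \<in> S \<Longrightarrow> b \<in> S \<Longrightarrow> \<beta> a (fscale c b) = c * \<beta> a b"
  obtains \<Psi> where "multilinear fscale \<Psi>" "\<And>a b. a \<in> S \<Longrightarrow> b \<in> S \<Longrightarrow> \<Psi> [a, b] = \<beta> a b"
proof -
  obtain \<pi> where \<pi>: "Vector_Spaces.linear fscale fscale \<pi>" "\<And>x. \<pi> x \<in> S" "\<And>x. x \<in> S \<Longrightarrow> \<pi> x = x"
    using exists_projection[OF S] by blast
  have \<pi>_add: "\<pi> (x + y) = \<pi> x + \<pi> y" and \<pi>_sc: "\<pi> (fscale c x) = fscale c (\<pi> x)" for x y c
    using \<pi>(1) by (auto simp: Vector_Spaces.linear_iff)
  \<comment> \<open>Lists of any other length get 0; forms of different degrees are independent of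
    each other.\<close>
  define \<Psi> where "\<Psi> xs = (if length xs = 2 then \<beta> (\<pi> (xs ! 0)) (\<pi> (xs ! 1)) else 0)" for xs
  have "multilinear fscale \<Psi>"
    unfolding fs.multilinear_iff
  proof (intro conjI allI)
    fix us ws :: "('x \<Rightarrow> 'k) list" and x y c
    consider b where "us = []" "ws = [b]" | a where "us = [a]" "ws = []" | "length us + length ws \<noteq> 1"
    proof (cases us)
      case Nil
      then show ?thesis using that by (cases ws) (auto simp: length_Suc_conv)
    next
      case (Cons a us')
      then show ?thesis using that by (cases us'; cases ws) auto
    qed
    then have "\<Psi> (us @ (x + y) # ws) = \<Psi> (us @ x # ws) + \<Psi> (us @ y # ws) \<and>
      \<Psi> (us @ fscale c x # ws) = c * \<Psi> (us @ x # ws)"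
      by cases (simp_all only: \<Psi>_def, simp_all add: \<pi>_add \<pi>_sc add sc \<pi>(2))
    then show "\<Psi> (us @ (x + y) # ws) = \<Psi> (us @ x # ws) + \<Psi> (us @ y # ws)"
      "\<Psi> (us @ fscale c x # ws) = c * \<Psi> (us @ x # ws)" by blast+
  qed
  moreover have "\<Psi> [a, b] = \<beta> a b" if "a \<in> S" "b \<in> S" for a b
    using that by (simp add: \<Psi>_def \<pi>(3))
  ultimately show ?thesis using that by blast
qed

lemma tens2_apply: "multilinear fscale \<Psi> \<Longrightarrow> tens2 a b \<Psi> = \<Psi> [a, b]"
  by (simp add: tens2_def tens_def)

lemma tens2_add:
  "tens2 (a + a') b = tens2 a b + tens2 a' b" "tens2 a (b + b') = tens2 a b + tens2 a b'"
  using fs.multilinearD(1)[OF fs.multilinear_tens, where us="[]" and x=a and y=a' and ws="[b]"]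
    fs.multilinearD(1)[OF fs.multilinear_tens, where us="[a]" and x=b and y=b' and ws="[]"]
  by (simp_all add: tens2_def fun_eq_iff)

lemma tens2_scale:
  "tens2 (fscale c a) b = fscale c (tens2 a b)" "tens2 a (fscale c b) = fscale c (tens2 a b)"
  using fs.multilinearD(2)[OF fs.multilinear_tens, where us="[]" and x=a and c=c and ws="[b]"]
    fs.multilinearD(2)[OF fs.multilinear_tens, where us="[a]" and x=b and c=c and ws="[]"]
  by (simp_all add: tens2_def fun_eq_iff)

lemma tens2_0: "tens2 0 b = 0" "tens2 a 0 = 0"
  using tens2_scale(1)[where c=0 and a=0 and b=b] tens2_scale(2)[where c=0 and b=0 and a=a] by simp_all

lemma omit_append: "k < length us \<Longrightarrow> omit k (us @ ws) = omit k us @ ws"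
    "omit (length us + k) (us @ ws) = us @ omit k ws"
  by (simp_all add: omit_def)

lemma omit_simps [simp]: "omit 0 (x # xs) = xs" "omit (Suc k) (x # xs) = x # omit k xs"
  by (simp_all add: omit_def)

lemma length_omit [simp]: "k < length xs \<Longrightarrow> length (omit k xs) = length xs - 1"
  by (simp add: omit_def)

lemma omit_update:
  assumes "i < length xs" "k < length xs"
  shows "omit k (xs[i := x]) = (if i = k then omit k xs else (omit k xs)[(if i < k then i else i - 1) := x])"
  using assms
proof (induction xs arbitrary: i k)
  case (Cons y ys)
  then show ?case by (cases i; cases k) (auto split: if_splits nat.split)
qed simp

lemma sum_lessThan_add: "(\<Sum>k<m + n. f k) = (\<Sum>k<m. f k) + (\<Sum>k<n. f (m + k :: nat) :: 'a::comm_monoid_add)"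
  by (induction n) (auto simp: add.assoc)

context graded_lcs
begin

section \<open>Contraction of graded symmetric forms\<close>

lemma hom_omit: "vs \<in> hom_lists G \<Longrightarrow> omit k vs \<in> hom_lists G"
  unfolding hom_lists_def lists_eq_set omit_def using set_take_subset[of k vs] set_drop_subset[of "Suc k" vs] by auto

text \<open>The shape shared by both slots of P: one entry is taken out, with a sign that depends on
  its position and on the parities alone.\<close>

definition contract :: "(nat \<Rightarrow> nat list \<Rightarrow> 'k) \<Rightarrow> ('v \<Rightarrow> 'v list \<Rightarrow> 'k) \<Rightarrow> 'v list \<Rightarrow> 'k" where
  "contract sg \<theta> vs = (\<Sum>k<length vs. sg k (map (parity G) vs) * \<theta> (vs ! k) (omit k vs))"

text \<open>What a sign needs for contraction to preserve graded symmetry: exchanging two neighbours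
  leaves the signs of the other positions alone and trades those of the two neighbours up to the
  Koszul sign.\<close>

definition swap_compatible :: "(nat \<Rightarrow> nat list \<Rightarrow> 'k) \<Rightarrow> bool" where
  "swap_compatible sg \<longleftrightarrow> (\<forall>p x y q.
     (\<forall>k<length p. sg k (p @ x # y # q) = sg k (p @ y # x # q)) \<and>
     (\<forall>k. sg (length p + Suc (Suc k)) (p @ x # y # q) = sg (length p + Suc (Suc k)) (p @ y # x # q)) \<and>
     sg (length p) (p @ x # y # q) = (-1) ^ (x * y) * sg (Suc (length p)) (p @ y # x # q))"

text \<open>The sign of moving the k-th vector past everything to its right;
  \<open>left_sign\<close> belongs to moving it to the front.\<close>

definition right_sign :: "nat \<Rightarrow> nat list \<Rightarrow> 'k" where
  "right_sign k ps = (-1) ^ (ps ! k * sum_list (drop (Suc k) ps))"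

definition left_sign :: "nat \<Rightarrow> nat list \<Rightarrow> 'k" where
  "left_sign k ps = (-1) ^ (ps ! k * sum_list (take k ps))"

lemma swap_compatible_right: "swap_compatible right_sign"
  unfolding swap_compatible_def right_sign_def
  by (auto simp: nth_append power_add algebra_simps eval_nat_numeral)

lemma swap_compatible_left: "swap_compatible left_sign"
  unfolding swap_compatible_def left_sign_def
  by (auto simp: nth_append power_add algebra_simps power_mult_distrib[symmetric] simp flip: power_mult)

text \<open>An updated entry is either the one taken out, where \<theta> is linear in its first
  argument, or it survives in the shortened list, one place earlier if it stood behind k.\<close>

lemma multilinear_contract_term:
  assumes \<theta>1: "\<And>v. ml (\<theta> v)" and \<theta>2: "\<And>vs. Vector_Spaces.linear (vscale G) (*) (\<lambda>v. \<theta> v vs)"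
  shows "ml (\<lambda>vs. if k < length vs then \<theta> (vs ! k) (omit k vs) else 0)"
  unfolding multilinear_iff_update
proof (intro conjI allI impI)
  fix vs :: "'v list" and i x y c assume i: "i < length vs"
  have lin: "\<theta> (a + b) vs = \<theta> a vs + \<theta> b vs" "\<theta> (vscale G c a) vs = c * \<theta> a vs" for a b c vs
    using \<theta>2[of vs] by (auto simp: linear_form_iff)
  have lt: "(if i < k then i else i - 1) < length (omit k vs)" if "k < length vs" "i \<noteq> k"
    using that i by auto
  note upd = multilinear_update[OF \<theta>1]
  show "(if k < length (vs[i := x + y]) then \<theta> (vs[i := x + y] ! k) (omit k (vs[i := x + y])) else 0) =
    (if k < length (vs[i := x]) then \<theta> (vs[i := x] ! k) (omit k (vs[i := x])) else 0) +
    (if k < length (vs[i := y]) then \<theta> (vs[i := y] ! k) (omit k (vs[i := y])) else 0)"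
    using i lt upd(1)[of _ "omit k vs"] lin by (cases "k < length vs"; cases "i = k") (simp_all add: omit_update)
  show "(if k < length (vs[i := vscale G c x]) then \<theta> (vs[i := vscale G c x] ! k) (omit k (vs[i := vscale G c x])) else 0) =
    c * (if k < length (vs[i := x]) then \<theta> (vs[i := x] ! k) (omit k (vs[i := x])) else 0)"
    using i lt upd(2)[of _ "omit k vs"] lin by (cases "k < length vs"; cases "i = k") (simp_all add: omit_update)
qed

lemma hmulti_contract:
  assumes "\<And>v. ml (\<theta> v)" "\<And>vs. Vector_Spaces.linear (vscale G) (*) (\<lambda>v. \<theta> v vs)"
  shows "hmulti (contract sg \<theta>)"
proof (rule hmulti_by_length)
  fix n
  have "hmulti (\<lambda>vs. \<Sum>k<n. sg k (map (parity G) vs) *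
      (\<lambda>us. if length us = n then if k < length us then \<theta> (us ! k) (omit k us) else 0 else 0) vs)"
    by (intro hmulti_sum hmulti_sign multilinear_length_if multilinear_contract_term assms)
  then show "hmulti (\<lambda>us. if length us = n then contract sg \<theta> us else 0)"
    by (rule hmulti_cong) (simp add: contract_def)
qed

lemma contract_split:
  "contract sg \<theta> (us @ a # b # ws) = (let ps = map (parity G) (us @ a # b # ws) in
     (\<Sum>k<length us. sg k ps * \<theta> (us ! k) (omit k us @ a # b # ws)) +
     (sg (length us) ps * \<theta> a (us @ b # ws) + sg (Suc (length us)) ps * \<theta> b (us @ a # ws)) +
     (\<Sum>k<length ws. sg (length us + Suc (Suc k)) ps * \<theta> (ws ! k) (us @ a # b # omit k ws)))"
proof -
  have 2: "(\<Sum>k<Suc (Suc n). f k) = f 0 + f 1 + (\<Sum>k<n. f (Suc (Suc k)))" for n and f :: "nat \<Rightarrow> 'k"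
    by (induction n) (simp_all add: algebra_simps)
  have o: "omit (length us) (us @ a # b # ws) = us @ b # ws" "omit (Suc (length us)) (us @ a # b # ws) = us @ a # ws"
    "omit (Suc (Suc (length us + k))) (us @ a # b # ws) = us @ a # b # omit k ws" for k
    using omit_append(2)[of us 0 "a # b # ws"] omit_append(2)[of us 1 "a # b # ws"]
      omit_append(2)[of us "Suc (Suc k)" "a # b # ws"] by simp_all
  show ?thesis unfolding contract_def Let_def length_append length_Cons sum_lessThan_add 2
    by (simp add: nth_append omit_append o add.assoc)
qed

text \<open>The terms of the other positions acquire the sign from \<theta>. The two terms that
  remove a or b trade places, and \<open>swap_compatible\<close> supplies their sign.\<close>

lemma contract_swap:
  assumes sg: "swap_compatible sg" and \<theta>: "\<And>v. gsym (\<theta> v)" and hom: "us @ a # b # ws \<in> hom_lists G"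
  shows "contract sg \<theta> (us @ a # b # ws) = (-1) ^ (parity G a * parity G b) * contract sg \<theta> (us @ b # a # ws)"
proof -
  let ?s = "(-1) ^ (parity G a * parity G b) :: 'k"
  have ss: "?s * (?s * x) = x" for x by (simp flip: mult.assoc power_add)
  let ?p = "map (parity G) us" and ?q = "map (parity G) ws"
  have sg1: "sg k (?p @ parity G a # parity G b # ?q) = sg k (?p @ parity G b # parity G a # ?q)" if "k < length us" for k
    using sg that unfolding swap_compatible_def by simp
  have sg2: "sg (length us + Suc (Suc k)) (?p @ parity G a # parity G b # ?q) = sg (length us + Suc (Suc k)) (?p @ parity G b # parity G a # ?q)" for k
    using sg unfolding swap_compatible_def by (metis length_map)
  have sg3: "sg (length us) (?p @ x # y # ?q) = (-1) ^ (x * y) * sg (Suc (length us)) (?p @ y # x # ?q)" for x y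
    using sg unfolding swap_compatible_def by (metis length_map)
  have a: "\<theta> (us ! k) (omit k us @ a # b # ws) = ?s * \<theta> (us ! k) (omit k us @ b # a # ws)" for k
    by (rule gsym_swap[OF \<theta>]) (use hom hom_omit in auto)
  have b: "\<theta> (ws ! k) (us @ a # b # omit k ws) = ?s * \<theta> (ws ! k) (us @ b # a # omit k ws)" for k
    by (rule gsym_swap[OF \<theta>]) (use hom hom_omit in auto)
  have sg4: "sg (Suc (length us)) (?p @ parity G a # parity G b # ?q) = ?s * sg (length us) (?p @ parity G b # parity G a # ?q)"
    using sg3[of "parity G b" "parity G a"] ss by (simp add: mult.commute)
  have 1: "(\<Sum>k<length us. sg k (?p @ parity G a # parity G b # ?q) * \<theta> (us ! k) (omit k us @ a # b # ws)) =
    ?s * (\<Sum>k<length us. sg k (?p @ parity G b # parity G a # ?q) * \<theta> (us ! k) (omit k us @ b # a # ws))"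
    unfolding sum_distrib_left by (rule sum.cong) (simp_all add: a sg1)
  have 2: "(\<Sum>k<length ws. sg (length us + Suc (Suc k)) (?p @ parity G a # parity G b # ?q) * \<theta> (ws ! k) (us @ a # b # omit k ws)) =
    ?s * (\<Sum>k<length ws. sg (length us + Suc (Suc k)) (?p @ parity G b # parity G a # ?q) * \<theta> (ws ! k) (us @ b # a # omit k ws))"
    unfolding sum_distrib_left by (rule sum.cong) (simp_all only: b sg2 mult.left_commute)
  show ?thesis unfolding contract_split Let_def map_append list.map 1 2 sg3[of "parity G a" "parity G b"] sg4
    by (simp add: algebra_simps)
qed

lemma gsymI:
  assumes "ml \<phi>" "\<And>us a b ws. us @ a # b # ws \<in> hom_lists G \<Longrightarrow>
    \<phi> (us @ a # b # ws) = (-1) ^ (parity G a * parity G b) * \<phi> (us @ b # a # ws)"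
  shows "gsym \<phi>"
  using assms unfolding gsym_def by blast

lemma gsym_cmult:
  assumes "gsym \<phi>" shows "gsym (\<lambda>vs. c * \<phi> vs)"
proof (rule gsymI[OF multilinear_cmult[OF gsym_multilinear[OF assms]]])
  fix us a b ws assume "us @ a # b # ws \<in> hom_lists G"
  from gsym_swap[OF assms this]
  show "c * \<phi> (us @ a # b # ws) = (-1) ^ (parity G a * parity G b) * (c * \<phi> (us @ b # a # ws))"
    by (simp only: mult.left_commute)
qed

lemma gsym_add:
  assumes "gsym \<phi>" "gsym \<psi>" shows "gsym (\<lambda>vs. \<phi> vs + \<psi> vs)"
proof (rule gsymI[OF multilinear_add[OF gsym_multilinear[OF assms(1)] gsym_multilinear[OF assms(2)]]])
  fix us a b ws assume h: "us @ a # b # ws \<in> hom_lists G"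
  from gsym_swap[OF assms(1) h] gsym_swap[OF assms(2) h]
  show "\<phi> (us @ a # b # ws) + \<psi> (us @ a # b # ws) =
      (-1) ^ (parity G a * parity G b) * (\<phi> (us @ b # a # ws) + \<psi> (us @ b # a # ws))"
    by (simp only: distrib_left)
qed

lemma gsym_zero: "gsym (\<lambda>vs. 0)"
  by (rule gsymI[OF multilinear_zero]) simp

lemma gsym_sum: "(\<And>i. i \<in> A \<Longrightarrow> gsym (f i)) \<Longrightarrow> gsym (\<lambda>vs. \<Sum>i\<in>A. f i vs)"
  by (induction A rule: infinite_finite_induct) (simp_all add: gsym_zero gsym_add)

lemma sym_prod_add: "sym_prod G (us @ (x + y) # ws) = sym_prod G (us @ x # ws) + sym_prod G (us @ y # ws)"
  by (rule ext) (simp add: multilinearD[OF multilinear_sym_prod])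

lemma sym_prod_scale: "sym_prod G (us @ vscale G c x # ws) = fscale c (sym_prod G (us @ x # ws))"
  by (rule ext) (simp add: multilinearD[OF multilinear_sym_prod])

lemma sym_prod_swap:
  assumes "us @ a # b # ws \<in> hom_lists G"
  shows "sym_prod G (us @ a # b # ws) = fscale ((-1) ^ (parity G a * parity G b)) (sym_prod G (us @ b # a # ws))"
  by (rule ext) (simp add: sym_prod_apply gsym_swap[OF gsym_sym_form assms])

text \<open>Graded symmetry of \<open>sym_prod\<close> passes through \<open>tens2\<close>, which is
  linear in each factor.\<close>

lemma gsym_tens2:
  "gsym (\<lambda>vs. tens2 (sym_prod G vs) b \<Phi>)" "gsym (\<lambda>vs. tens2 a (sym_prod G vs) \<Phi>)"
proof -
  have "ml (\<lambda>vs. tens2 (sym_prod G vs) b \<Phi>)" "ml (\<lambda>vs. tens2 a (sym_prod G vs) \<Phi>)"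
    unfolding multilinear_iff sym_prod_add sym_prod_scale tens2_add tens2_scale by simp_all
  note m = this
  show "gsym (\<lambda>vs. tens2 (sym_prod G vs) b \<Phi>)"
    by (rule gsymI[OF m(1)]) (subst sym_prod_swap, assumption, simp add: tens2_scale)
  show "gsym (\<lambda>vs. tens2 a (sym_prod G vs) \<Phi>)"
    by (rule gsymI[OF m(2)]) (subst sym_prod_swap, assumption, simp add: tens2_scale)
qed

lemma hmulti_hext:
  assumes "\<And>ws'. ws' \<in> hom_lists G \<Longrightarrow> hmulti (\<lambda>vs. h vs ws')"
  shows "hmulti (\<lambda>vs. hext ws (h vs))"
  unfolding hmulti_def
proof (intro ballI conjI allI)
  fix us vs D x y c
  assume H: "us \<in> hom_lists G" "vs \<in> hom_lists G" "D \<in> {even_part G, odd_part G}" "x \<in> D"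
  then have D: "D = even_part G \<or> D = odd_part G" by auto
  show "hext ws (h (us @ vscale G c x # vs)) = c * hext ws (h (us @ x # vs))"
    unfolding hext_cmult[symmetric] by (rule hext_cong) (rule hmultiD(2)[OF assms H(1,2) D H(4)])
  assume y: "y \<in> D"
  show "hext ws (h (us @ (x + y) # vs)) = hext ws (h (us @ x # vs)) + hext ws (h (us @ y # vs))"
    unfolding hext_add[symmetric] by (rule hext_cong) (rule hmultiD(1)[OF assms H(1,2) D H(4) y])
qed

lemma hext_commute: "hext vs (\<lambda>us. hext ws (\<lambda>us'. h us us')) = hext ws (\<lambda>us'. hext vs (\<lambda>us. h us us'))"
  by (induction vs arbitrary: h) (simp_all add: hext_add)

lemma gsym_hext:
  assumes "hmulti f" "\<And>us a b ws. us @ a # b # ws \<in> hom_lists G \<Longrightarrow>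
    f (us @ a # b # ws) = (-1) ^ (parity G a * parity G b) * f (us @ b # a # ws)"
  shows "gsym (\<lambda>vs. hext vs f)"
proof (rule gsymI[OF multilinear_hext[OF assms(1)]])
  fix us a b ws assume h: "us @ a # b # ws \<in> hom_lists G"
  then have h': "us @ b # a # ws \<in> hom_lists G" by simp
  show "hext (us @ a # b # ws) f = (-1) ^ (parity G a * parity G b) * hext (us @ b # a # ws) f"
    unfolding hext_hom[OF assms(1) h] hext_hom[OF assms(1) h'] by (rule assms(2)[OF h])
qed


lemma sym_mult_bilinear:
  assumes "a \<in> T" "a' \<in> T" "b \<in> T" "b' \<in> T"
  shows "sym_mult G (a + a') b = sym_mult G a b + sym_mult G a' b"
    "sym_mult G a (b + b') = sym_mult G a b + sym_mult G a b'"
    "sym_mult G (fscale c a) b = fscale c (sym_mult G a b)"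
    "sym_mult G a (fscale c b) = fscale c (sym_mult G a b)"
proof -
  have m: "ml (\<lambda>vs. y (\<lambda>ws. sym_form \<phi> (vs @ ws)))" if "y \<in> T" for y \<phi>
    by (rule multilinear_eval2[OF that]) (auto intro: multilinear_append_left multilinear_append_right multilinear_sym_form)
  show "sym_mult G (a + a') b = sym_mult G a b + sym_mult G a' b"
    "sym_mult G (fscale c a) b = fscale c (sym_mult G a b)"
    by (rule ext, simp add: sym_mult_apply assms)+
  show "sym_mult G a (b + b') = sym_mult G a b + sym_mult G a b'"
    by (rule ext) (simp add: sym_mult_apply assms tensor_add[OF assms(1) m m])
  show "sym_mult G a (fscale c b) = fscale c (sym_mult G a b)"
    by (rule ext) (simp add: sym_mult_apply assms tensor_cmult[OF assms(1) m])
qed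

lemma sum_list_drop_map:
  assumes "k < length vs"
  shows "sum_list (drop (Suc k) (map f vs)) = (\<Sum>j\<in>{k<..<length vs}. f (vs ! j) :: nat)"
proof -
  have "sum_list (drop (Suc k) (map f vs)) = (\<Sum>i = 0..<length vs - Suc k. f (vs ! (Suc k + i)))"
    using assms by (simp add: sum_list_sum_nth)
  also have "\<dots> = (\<Sum>j\<in>{k<..<length vs}. f (vs ! j))"
    by (rule sum.reindex_bij_witness[where i = "\<lambda>j. j - Suc k" and j = "\<lambda>i. Suc k + i"]) auto
  finally show ?thesis .
qed

lemma sum_list_take_map:
  "l < length vs \<Longrightarrow> sum_list (take l (map f vs)) = (\<Sum>j<l. f (vs ! j) :: nat)"
  by (simp add: sum_list_sum_nth atLeast0LessThan)

abbreviation pair_gens :: "(('v, 'k) tensor, 'k) tensor set" where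
  "pair_gens \<equiv> (\<lambda>(vs, ws). tens2 (sym_prod G vs) (sym_prod G ws)) ` (hom_lists G \<times> hom_lists G)"

text \<open>Products of homogeneous vectors span the symmetric algebra; linearity of
  \<open>tens2\<close> is used in one factor at a time.\<close>

lemma tens2_in_span: "a \<in> W \<Longrightarrow> b \<in> W \<Longrightarrow> tens2 a b \<in> fs.span pair_gens"
proof -
  have "W \<subseteq> {a. \<forall>ws\<in>hom_lists G. tens2 a (sym_prod G ws) \<in> fs.span pair_gens}"
    unfolding W_span
  proof (rule fs.span_minimal)
    show "sym_prod G ` hom_lists G \<subseteq> {a. \<forall>ws\<in>hom_lists G. tens2 a (sym_prod G ws) \<in> fs.span pair_gens}"
      by (auto intro!: fs.span_base)
    show "fs.subspace {a. \<forall>ws\<in>hom_lists G. tens2 a (sym_prod G ws) \<in> fs.span pair_gens}"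
      unfolding fs.subspace_def mem_Collect_eq tens2_0 tens2_add tens2_scale
      by (blast intro: fs.span_zero fs.span_add fs.span_scale)
  qed
  then have 1: "tens2 a (sym_prod G ws) \<in> fs.span pair_gens" if "a \<in> W" "ws \<in> hom_lists G" for a ws
    using that by blast
  have "W \<subseteq> {b. \<forall>a\<in>W. tens2 a b \<in> fs.span pair_gens}"
  proof (rule subset_trans[OF equalityD1[OF W_span] fs.span_minimal])
    show "sym_prod G ` hom_lists G \<subseteq> {b. \<forall>a\<in>W. tens2 a b \<in> fs.span pair_gens}"
      using 1 by blast
    show "fs.subspace {b. \<forall>a\<in>W. tens2 a b \<in> fs.span pair_gens}"
      unfolding fs.subspace_def mem_Collect_eq tens2_0 tens2_add tens2_scale
      by (blast intro: fs.span_zero fs.span_add fs.span_scale)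
  qed
  then show "a \<in> W \<Longrightarrow> b \<in> W \<Longrightarrow> tens2 a b \<in> fs.span pair_gens" by blast
qed

text \<open>The transpose exhibits \<open>mu\<close> as linear on the span, and the second clause
  gives its values on pure tensors. The transpose exists because the symmetric product is
  bilinear.\<close>

lemma mu_formula:
  obtains \<psi> where "\<And>X. X \<in> fs.span pair_gens \<Longrightarrow> mu G X = (\<lambda>\<phi>. X (\<psi> \<phi>))"
    "\<And>a b. a \<in> W \<Longrightarrow> b \<in> W \<Longrightarrow> mu G (tens2 a b) = sym_mult G a b"
proof -
  have "\<exists>\<Psi>. \<forall>a\<in>W. \<forall>b\<in>W. tens2 a b \<Psi> = sym_mult G a b \<phi>" for \<phi>
  proof -
    obtain \<Psi> where "multilinear fscale \<Psi>" "\<And>a b. a \<in> T \<Longrightarrow> b \<in> T \<Longrightarrow> \<Psi> [a, b] = sym_mult G a b \<phi>"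
      by (rule bilinear_form_ext[OF subspace_tensors, of "\<lambda>a b. sym_mult G a b \<phi>"])
        (simp_all add: sym_mult_bilinear)
    then show ?thesis using W_in_T by (metis tens2_apply)
  qed
  then obtain \<psi> where \<psi>: "\<And>\<phi> a b. a \<in> W \<Longrightarrow> b \<in> W \<Longrightarrow> tens2 a b (\<psi> \<phi>) = sym_mult G a b \<phi>"
    by metis
  have eq: "mu G X = (\<lambda>\<phi>. X (\<psi> \<phi>))" if "X \<in> fs.span ((\<lambda>(a, b). tens2 a b) ` (W \<times> W))" for X
    unfolding mu_def by (rule lin_ext_eq[OF _ that]) (use \<psi> in auto)
  have sub: "fs.span pair_gens \<subseteq> fs.span ((\<lambda>(a, b). tens2 a b) ` (W \<times> W))"
    by (rule fs.span_mono) (use sym_prod_in_W in auto)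
  show ?thesis
  proof (rule that)
    show "mu G X = (\<lambda>\<phi>. X (\<psi> \<phi>))" if "X \<in> fs.span pair_gens" for X using eq sub that by blast
    fix a b assume ab: "a \<in> W" "b \<in> W"
    then have "tens2 a b \<in> fs.span ((\<lambda>(a, b). tens2 a b) ` (W \<times> W))" by (auto intro!: fs.span_base)
    from eq[OF this] show "mu G (tens2 a b) = sym_mult G a b" using \<psi>[OF ab] by simp
  qed
qed

end

locale bilinear_space = graded_lcs G
  for G :: "('k::real_normed_field, 'v::{topological_ab_group_add, t2_space}) graded_space" +
  fixes \<Lambda> :: "'v \<Rightarrow> 'v \<Rightarrow> 'k"
  assumes bilin: "bilinear_form G \<Lambda>"
begin

lemma \<Lambda>_linear:
  "\<Lambda> (x + y) v = \<Lambda> x v + \<Lambda> y v" "\<Lambda> (vscale G c x) v = c * \<Lambda> x v"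
  "\<Lambda> v (x + y) = \<Lambda> v x + \<Lambda> v y" "\<Lambda> v (vscale G c x) = c * \<Lambda> v x"
  using bilin unfolding bilinear_form_def linear_form_iff by auto

definition P_gen :: "'v list \<Rightarrow> 'v list \<Rightarrow> (('v, 'k) tensor, 'k) tensor" where
  "P_gen vs ws = (\<Sum>k<length vs. \<Sum>l<length ws.
     fscale (right_sign k (map (parity G) vs) * left_sign l (map (parity G) ws) * \<Lambda> (vs ! k) (ws ! l))
       (tens2 (sym_prod G (omit k vs)) (sym_prod G (omit l ws))))"

text \<open>\<open>P_gen\<close> evaluated at \<Phi>, arranged as a contraction in vs of
  contractions in ws, so that the results on \<open>contract\<close> apply.\<close>

definition P_val :: "((('v, 'k) tensor list \<Rightarrow> 'k)) \<Rightarrow> 'v list \<Rightarrow> 'v list \<Rightarrow> 'k" where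
  "P_val \<Phi> vs ws = contract right_sign (\<lambda>v us. contract left_sign
     (\<lambda>w us'. \<Lambda> v w * tens2 (sym_prod G us) (sym_prod G us') \<Phi>) ws) vs"

text \<open>Interchanging the sums makes ws the outer list; symmetry in ws then follows by the same
  argument as symmetry in vs.\<close>

lemma P_val_commute:
  "P_val \<Phi> vs ws = contract left_sign (\<lambda>w us'. contract right_sign
     (\<lambda>v us. \<Lambda> v w * tens2 (sym_prod G us) (sym_prod G us') \<Phi>) vs) ws"
  unfolding P_val_def contract_def sum_distrib_left
  by (subst sum.swap) (simp only: mult_ac)

lemma P_gen_apply: "P_gen vs ws \<Phi> = P_val \<Phi> vs ws"
  unfolding P_val_def contract_def P_gen_def sum_fun_apply sum_distrib_left fscale_apply
  by (simp only: mult_ac)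

lemma hmulti_P_val: "hmulti (\<lambda>vs. P_val \<Phi> vs ws)" "hmulti (P_val \<Phi> vs)"
  and P_val_swap: "us @ a # b # us' \<in> hom_lists G \<Longrightarrow>
      P_val \<Phi> (us @ a # b # us') ws = (-1) ^ (parity G a * parity G b) * P_val \<Phi> (us @ b # a # us') ws"
    "us @ a # b # us' \<in> hom_lists G \<Longrightarrow>
      P_val \<Phi> vs (us @ a # b # us') = (-1) ^ (parity G a * parity G b) * P_val \<Phi> vs (us @ b # a # us')"
proof -
  let ?f = "\<lambda>v us. contract left_sign (\<lambda>w us'. \<Lambda> v w * tens2 (sym_prod G us) (sym_prod G us') \<Phi>) ws"
  let ?g = "\<lambda>w us'. contract right_sign (\<lambda>v us. \<Lambda> v w * tens2 (sym_prod G us) (sym_prod G us') \<Phi>) vs"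
  have f1: "gsym (?f v)" for v
    unfolding contract_def by (intro gsym_sum gsym_cmult gsym_tens2)
  have g1: "gsym (?g v)" for v
    unfolding contract_def by (intro gsym_sum gsym_cmult gsym_tens2)
  have f2: "Vector_Spaces.linear (vscale G) (*) (\<lambda>v. ?f v us)" for us
    unfolding linear_form_iff contract_def \<Lambda>_linear
    by (simp add: algebra_simps sum.distrib sum_distrib_left)
  have g2: "Vector_Spaces.linear (vscale G) (*) (\<lambda>v. ?g v us)" for us
    unfolding linear_form_iff contract_def \<Lambda>_linear
    by (simp add: algebra_simps sum.distrib sum_distrib_left)
  show "hmulti (\<lambda>vs. P_val \<Phi> vs ws)"
    unfolding P_val_def by (rule hmulti_contract[OF gsym_multilinear[OF f1] f2])
  show "hmulti (P_val \<Phi> vs)"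
    unfolding P_val_commute[abs_def] by (rule hmulti_contract[OF gsym_multilinear[OF g1] g2])
  assume h: "us @ a # b # us' \<in> hom_lists G"
  show "P_val \<Phi> (us @ a # b # us') ws = (-1) ^ (parity G a * parity G b) * P_val \<Phi> (us @ b # a # us') ws"
    unfolding P_val_def by (rule contract_swap[OF swap_compatible_right f1 h])
  show "P_val \<Phi> vs (us @ a # b # us') = (-1) ^ (parity G a * parity G b) * P_val \<Phi> vs (us @ b # a # us')"
    unfolding P_val_commute by (rule contract_swap[OF swap_compatible_left g1 h])
qed

text \<open>Well-definedness of P rests on the graded symmetry of \<open>P_val\<close> in each of
  the two lists: products with reordered factors agree up to the Koszul sign, and such a form
  respects this.\<close>

lemma P_form_formula:
  obtains \<psi> where "\<And>X. X \<in> fs.span pair_gens \<Longrightarrow> P_form G \<Lambda> X = (\<lambda>\<phi>. X (\<psi> \<phi>))"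
    "\<And>vs ws. vs \<in> hom_lists G \<Longrightarrow> ws \<in> hom_lists G \<Longrightarrow>
      P_form G \<Lambda> (tens2 (sym_prod G vs) (sym_prod G ws)) = P_gen vs ws"
proof -
  have "\<exists>\<Psi>. \<forall>vs\<in>hom_lists G. \<forall>ws\<in>hom_lists G. tens2 (sym_prod G vs) (sym_prod G ws) \<Psi> = P_gen vs ws \<Phi>" for \<Phi>
  proof -
    \<comment> \<open>H extends \<open>P_val\<close> from homogeneous to arbitrary lists, in both
      arguments.\<close>
    define H where "H vs ws = hext vs (\<lambda>us. hext ws (\<lambda>us'. P_val \<Phi> us us'))" for vs ws
    have g1: "gsym (\<lambda>vs. H vs ws)" for ws
      unfolding H_def
    proof (rule gsym_hext[OF hmulti_hext[OF hmulti_P_val(1)]])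
      fix us a b vs assume "us @ a # b # vs \<in> hom_lists G"
      from P_val_swap(1)[OF this]
      show "hext ws (P_val \<Phi> (us @ a # b # vs)) =
          (-1) ^ (parity G a * parity G b) * hext ws (P_val \<Phi> (us @ b # a # vs))"
        unfolding hext_cmult[symmetric] by (intro hext_cong)
    qed
    have g2: "gsym (H vs)" for vs
      unfolding H_def[abs_def] hext_commute[of vs]
    proof (rule gsym_hext[OF hmulti_hext[OF hmulti_P_val(2)]])
      fix us a b us' assume "us @ a # b # us' \<in> hom_lists G"
      from P_val_swap(2)[OF this]
      show "hext vs (\<lambda>vs. P_val \<Phi> vs (us @ a # b # us')) =
          (-1) ^ (parity G a * parity G b) * hext vs (\<lambda>vs. P_val \<Phi> vs (us @ b # a # us'))"
        unfolding hext_cmult[symmetric] by (intro hext_cong)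
    qed
    have m: "ml (\<lambda>vs. y (H vs))" if "y \<in> T" for y
      by (rule multilinear_eval2[OF that gsym_multilinear[OF g2] gsym_multilinear[OF g1]])
    \<comment> \<open>H becomes a form on pairs of tensors: b is evaluated in the second list, then
      a in the first.\<close>
    obtain \<Psi> where \<Psi>: "multilinear fscale \<Psi>" "\<And>a b. a \<in> T \<Longrightarrow> b \<in> T \<Longrightarrow> \<Psi> [a, b] = a (\<lambda>vs. b (H vs))"
      by (rule bilinear_form_ext[OF subspace_tensors, of "\<lambda>a b. a (\<lambda>vs. b (H vs))"])
        (simp_all add: tensor_add[OF _ m m] tensor_cmult[OF _ m])
    have "tens2 (sym_prod G vs) (sym_prod G ws) \<Psi> = P_gen vs ws \<Phi>"
      if "vs \<in> hom_lists G" "ws \<in> hom_lists G" for vs ws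
    proof -
      have "tens2 (sym_prod G vs) (sym_prod G ws) \<Psi> = sym_prod G vs (\<lambda>vs. H vs ws)"
        by (simp add: tens2_apply \<Psi> W_in_T sym_prod_in_W sym_prod_gsym[OF g2])
      also have "\<dots> = H vs ws" by (rule sym_prod_gsym[OF g1])
      also have "\<dots> = hext vs (\<lambda>us. hext ws (P_val \<Phi> us))" by (rule H_def)
      also have "\<dots> = P_val \<Phi> vs ws"
        by (simp only: hext_hom[OF hmulti_P_val(2) that(2)] hext_hom[OF hmulti_P_val(1) that(1)])
      finally show ?thesis by (simp only: P_gen_apply)
    qed
    then show ?thesis by blast
  qed
  then obtain \<psi> where \<psi>: "\<And>\<Phi> vs ws. vs \<in> hom_lists G \<Longrightarrow> ws \<in> hom_lists G \<Longrightarrow>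
      tens2 (sym_prod G vs) (sym_prod G ws) (\<psi> \<Phi>) = P_gen vs ws \<Phi>"
    by metis
  \<comment> \<open>The sign in the definition of \<open>P_form\<close> is the product of
    \<open>right_sign\<close> and \<open>left_sign\<close>.\<close>
  have gen: "(case i of (vs, ws) \<Rightarrow> \<Sum>k<length vs. \<Sum>l<length ws.
        fscale ((-1) ^ (parity G (vs ! k) * (\<Sum>j\<in>{k<..<length vs}. parity G (vs ! j))
                        + parity G (ws ! l) * (\<Sum>j<l. parity G (ws ! j)))
                * \<Lambda> (vs ! k) (ws ! l))
          (tens2 (sym_prod G (omit k vs)) (sym_prod G (omit l ws)))) = (case i of (vs, ws) \<Rightarrow> P_gen vs ws)" for i
    unfolding P_gen_def right_sign_def left_sign_def
    by (cases i) (simp add: sum_list_drop_map sum_list_take_map power_add cong: sum.cong_simp)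
  have eq: "P_form G \<Lambda> X = (\<lambda>\<phi>. X (\<psi> \<phi>))" if "X \<in> fs.span pair_gens" for X
    unfolding P_form_def gen by (rule lin_ext_eq[OF _ that]) (use \<psi> in auto)
  show ?thesis
  proof (rule that[OF eq])
    fix vs ws assume h: "vs \<in> hom_lists G" "ws \<in> hom_lists G"
    then have "tens2 (sym_prod G vs) (sym_prod G ws) \<in> fs.span pair_gens" by (auto intro!: fs.span_base)
    from eq[OF this] show "P_form G \<Lambda> (tens2 (sym_prod G vs) (sym_prod G ws)) = P_gen vs ws"
      using \<psi>[OF h] by simp
  qed
qed

end

subsection \<open>Continuous seminorms\<close>

context graded_lcs
begin

abbreviation "CS \<equiv> cont_seminorms G"

lemma seminormD:
  assumes "p \<in> CS"
  shows "p (x + y) \<le> p x + p y" "p (vscale G c x) = norm c * p x" "continuous_on UNIV p"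
    "p 0 = 0" "p (- x) = p x" "0 \<le> p x" "p (x - y) \<le> p x + p y"
proof -
  show 1: "p (x + y) \<le> p x + p y" "p (vscale G c x) = norm c * p x" "continuous_on UNIV p" for x y c
    using assms by (auto simp: cont_seminorms_def)
  show 0: "p 0 = 0" using 1(2)[of 0 0] by simp
  show m: "p (- x) = p x" for x using 1(2)[of "-1" x] by simp
  show "0 \<le> p x" using 1(1)[of x "-x"] m[of x] 0 by simp
  show "p (x - y) \<le> p x + p y" using 1(1)[of x "-y"] m[of y] by simp
qed

lemma seminorm_add: "p \<in> CS \<Longrightarrow> q \<in> CS \<Longrightarrow> (\<lambda>v. p v + q v) \<in> CS"
  using seminormD(1)[of p] seminormD(1)[of q]
  by (auto simp: cont_seminorms_def algebra_simps intro!: continuous_intros) (smt (verit))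

lemma seminorm_cmult: "p \<in> CS \<Longrightarrow> 0 \<le> c \<Longrightarrow> (\<lambda>v. c * p v) \<in> CS"
  by (auto simp: cont_seminorms_def algebra_simps intro!: continuous_intros)
    (metis distrib_left mult_left_mono)

lemma seminorm_zero: "(\<lambda>v. 0) \<in> CS"
  by (auto simp: cont_seminorms_def)

text \<open>Continuous because the projections are; it controls p on both components of a
  vector.\<close>

definition ghull :: "('v \<Rightarrow> real) \<Rightarrow> 'v \<Rightarrow> real" where
  "ghull p v = p (even_proj G v) + p (odd_proj G v)"

lemma seminorm_ghull:
  assumes p: "p \<in> CS" shows "ghull p \<in> CS"
proof -
  note D = seminormD[OF p]
  have "continuous_on UNIV (\<lambda>v. p (even_proj G v))" "continuous_on UNIV (\<lambda>v. p (odd_proj G v))"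
    by (rule continuous_on_compose2[OF D(3) continuous_even_proj], simp)
      (rule continuous_on_compose2[OF D(3) continuous_odd_proj], simp)
  then have c: "continuous_on UNIV (ghull p)" unfolding ghull_def[abs_def] by (intro continuous_intros)
  have "ghull p (v + w) \<le> ghull p v + ghull p w" for v w
    using D(1)[of "even_proj G v" "even_proj G w"] D(1)[of "odd_proj G v" "odd_proj G w"]
    by (simp add: ghull_def proj_add)
  moreover have "ghull p (vscale G c v) = norm c * ghull p v" for c v
    by (simp add: ghull_def proj_scale D(2) algebra_simps)
  ultimately show ?thesis using c unfolding cont_seminorms_def by blast
qed

lemma continuous_vscale': "continuous_on UNIV (\<lambda>v. vscale G c v)" "continuous_on UNIV (\<lambda>c. vscale G c v)"
proof -
  have "continuous_on UNIV (\<lambda>v. (c, v))" "continuous_on UNIV (\<lambda>c. (c, v))" by (intro continuous_intros)+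
  then show "continuous_on UNIV (\<lambda>v. vscale G c v)" "continuous_on UNIV (\<lambda>c. vscale G c v)"
    using continuous_on_compose2[OF continuous_vscale, of UNIV "\<lambda>v. (c, v)"]
      continuous_on_compose2[OF continuous_vscale, of UNIV "\<lambda>c. (c, v)"] by auto
qed

text \<open>The gauge \<open>p v = inf {\<Sum>\<bar>c\<^sub>i\<bar> | v = \<Sum> c\<^sub>i u\<^sub>i, u\<^sub>i \<in> U\<^sub>0}\<close> of a neighbourhood \<open>U\<^sub>0\<close> whose
  balanced hull is contained in a convex subset of \<open>U\<close>.\<close>

lemma seminorm_of_nhd:
  assumes U: "open U" "0 \<in> U"
  obtains p where "p \<in> CS" "\<And>v. p v < 1 \<Longrightarrow> v \<in> U"
proof -
  obtain C where C: "open C" "0 \<in> C" "C \<subseteq> U"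
    "\<And>x y t. x \<in> C \<Longrightarrow> y \<in> C \<Longrightarrow> t \<in> {0..1::real} \<Longrightarrow>
       vscale G (of_real (1 - t)) x + vscale G (of_real t) y \<in> C"
    using locally_convex[OF U] by blast
  have "open ((\<lambda>(c, v). vscale G c v) -` C)"
    using continuous_vscale C(1) by (simp add: continuous_on_open_vimage)
  moreover have "(0, 0) \<in> (\<lambda>(c, v). vscale G c v) -` C" using C(2) by simp
  ultimately obtain A B where AB: "open A" "open B" "(0, 0) \<in> A \<times> B" "A \<times> B \<subseteq> (\<lambda>(c, v). vscale G c v) -` C"
    by (rule open_prod_elim)
  then have "0 \<in> A" by simp
  then obtain d where d: "d > 0" "ball 0 d \<subseteq> A" using AB(1) open_contains_ball by blast
  \<comment> \<open>For norm c \<le> 1 the scalar c * d / 2 lies in A, and the compensating factor 2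
    / d is built into the neighbourhood, so that c u ends up in C.\<close>
  define U0 where "U0 = (\<lambda>v. vscale G (of_real (2 / d)) v) -` B"
  have U0_open: "open U0" unfolding U0_def
    using continuous_vscale'(1) AB(2) by (simp add: continuous_on_open_vimage)
  have U0_0: "0 \<in> U0" using AB(3) by (simp add: U0_def)
  have bal: "vscale G c u \<in> C" if "u \<in> U0" "norm c \<le> 1" for c u
  proof -
    have "norm (c * of_real (d / 2)) = norm c * (d / 2)" using d by (simp add: norm_mult)
    also have "\<dots> \<le> 1 * (d / 2)" using that(2) d by (intro mult_right_mono) auto
    also have "\<dots> < d" using d by simp
    finally have "c * of_real (d / 2) \<in> A" using d(2) by (auto simp: subset_iff)
    then have "vscale G (c * of_real (d / 2)) (vscale G (of_real (2 / d)) u) \<in> C"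
      using AB(4) that(1) by (auto simp: U0_def)
    moreover have "c * of_real (d / 2) * of_real (2 / d) = c" using d
      by (simp flip: of_real_mult)
    ultimately show ?thesis by simp
  qed
  have absorb: "\<exists>r>0. vscale G (of_real r) v \<in> U0" for v
  proof -
    have "open ((\<lambda>c. vscale G c v) -` U0)" using continuous_vscale'(2) U0_open by (simp add: continuous_on_open_vimage)
    moreover have "0 \<in> (\<lambda>c. vscale G c v) -` U0" using U0_0 by simp
    ultimately obtain e where e: "e > 0" "ball 0 e \<subseteq> (\<lambda>c. vscale G c v) -` U0" using open_contains_ball by blast
    then have "of_real (e / 2) \<in> (\<lambda>c. vscale G c v) -` U0" by (auto simp: subset_iff)
    then show ?thesis using e(1) by (intro exI[of _ "e / 2"]) auto
  qed
  define w :: "('k \<times> 'v) list \<Rightarrow> real" where "w L = (\<Sum>(c, u)\<leftarrow>L. norm c)" for L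
  define s where "s L = (\<Sum>(c, u)\<leftarrow>L. vscale G c u)" for L
  define S where "S v = {w L | L. snd ` set L \<subseteq> U0 \<and> v = s L}" for v
  define p where "p v = Inf (S v)" for v
  have w_nonneg: "0 \<le> w L" for L unfolding w_def by (induction L) auto
  have bdd: "bdd_below (S v)" for v using w_nonneg by (auto simp: S_def intro!: bdd_belowI[of _ 0])
  have p_le: "p (s L) \<le> w L" if "snd ` set L \<subseteq> U0" for L
    unfolding p_def by (rule cInf_lower[OF _ bdd]) (use that in \<open>auto simp: S_def\<close>)
  have ne: "S v \<noteq> {}" for v
  proof -
    obtain r where r: "r > 0" "vscale G (of_real r) v \<in> U0" using absorb by blast
    have "v = s [(of_real (1 / r), vscale G (of_real r) v)]" using r by (simp add: s_def flip: of_real_mult)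
    then have "w [(of_real (1 / r), vscale G (of_real r) v)] \<in> S v" using r unfolding S_def by fastforce
    then show ?thesis by blast
  qed
  have approx: "\<exists>L. snd ` set L \<subseteq> U0 \<and> v = s L \<and> w L < t" if "p v < t" for v t
    using cInf_lessD[OF ne that[unfolded p_def]] by (auto simp: S_def)
  have p_nonneg: "0 \<le> p v" for v unfolding p_def by (rule cInf_greatest[OF ne]) (auto simp: S_def w_nonneg)
  have tri: "p (x + y) \<le> p x + p y" for x y
  proof (rule field_le_epsilon)
    fix e :: real assume e: "e > 0"
    obtain L where L: "snd ` set L \<subseteq> U0" "x = s L" "w L < p x + e / 2" using approx[of x "p x + e / 2"] e by auto
    obtain M where M: "snd ` set M \<subseteq> U0" "y = s M" "w M < p y + e / 2" using approx[of y "p y + e / 2"] e by auto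
    have "x + y = s (L @ M)" "w (L @ M) = w L + w M" using L M by (simp_all add: s_def w_def)
    moreover have "snd ` set (L @ M) \<subseteq> U0" using L(1) M(1) by (simp add: image_Un)
    ultimately have "p (x + y) \<le> w L + w M" using p_le[of "L @ M"] by simp
    then show "p (x + y) \<le> p x + p y + e" using L(3) M(3) by linarith
  qed
  have sc_le: "p (vscale G c x) \<le> norm c * p x" for c x
  proof (cases "c = 0")
    case True
    then show ?thesis using p_le[of "[]"] by (simp add: s_def w_def)
  next
    case False
    show ?thesis
    proof (rule field_le_epsilon)
      fix e :: real assume e: "e > 0"
      then have "p x < p x + e / norm c" using False by simp
      then obtain L where L: "snd ` set L \<subseteq> U0" "x = s L" "w L < p x + e / norm c" using approx by blast
      let ?M = "map (\<lambda>(a, u). (c * a, u)) L"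
      have "vscale G c (s L) = s ?M" unfolding s_def
        by (induction L) (auto simp: scale_right_distrib)
      moreover have "w ?M = norm c * w L" unfolding w_def
        by (induction L) (auto simp: norm_mult algebra_simps)
      moreover have "snd ` set ?M \<subseteq> U0" using L(1) by (auto simp: case_prod_unfold)
      ultimately have "p (vscale G c x) \<le> norm c * w L" using p_le[of ?M] L(2) by simp
      also have "\<dots> \<le> norm c * (p x + e / norm c)" using L(3) by (intro mult_left_mono) auto
      also have "\<dots> = norm c * p x + e" using False by (simp add: field_simps)
      finally show "p (vscale G c x) \<le> norm c * p x + e" .
    qed
  qed
  have sc: "p (vscale G c x) = norm c * p x" for c x
  proof (cases "c = 0")
    case True
    then show ?thesis using sc_le[of c x] p_nonneg[of "vscale G c x"] by simp
  next
    case False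
    have "p x \<le> norm (1 / c) * p (vscale G c x)" using sc_le[of "1 / c" "vscale G c x"] False by simp
    then have "norm c * p x \<le> p (vscale G c x)" using False by (simp add: norm_divide field_simps)
    with sc_le[of c x] show ?thesis by simp
  qed
  have U0_1: "p u \<le> 1" if "u \<in> U0" for u
    using p_le[of "[(1, u)]"] that by (simp add: s_def w_def)
  have diff: "\<bar>p y - p x\<bar> \<le> p (y - x)" for x y
    using tri[of "y - x" x] tri[of "x - y" y] sc[of "-1" "y - x"] by simp
  have cont: "continuous_on UNIV p"
  proof (rule continuous_at_imp_continuous_on, rule ballI)
    fix x
    have "(p \<longlongrightarrow> p x) (nhds x)"
    proof (rule tendstoI)
      fix e :: real assume e: "e > 0"
      \<comment> \<open>On N the factor 2 / e forces p (v - x) \<le> e / 2.\<close>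
      define N where "N = (\<lambda>v. vscale G (of_real (2 / e)) (v - x)) -` U0"
      have "continuous_on UNIV (\<lambda>v. vscale G (of_real (2 / e)) (v - x))"
        by (rule continuous_on_compose2[OF continuous_vscale'(1), of UNIV "\<lambda>v. v - x"]) (auto intro!: continuous_intros)
      then have "open N" unfolding N_def using U0_open by (simp add: continuous_on_open_vimage)
      moreover have "x \<in> N" using U0_0 by (simp add: N_def)
      ultimately have "eventually (\<lambda>v. v \<in> N) (nhds x)" by (rule eventually_nhds_in_open)
      then show "eventually (\<lambda>v. dist (p v) (p x) < e) (nhds x)"
      proof (rule eventually_mono)
        fix v assume "v \<in> N"
        then have "p (vscale G (of_real (2 / e)) (v - x)) \<le> 1" using U0_1 by (simp add: N_def)
        then have "2 / e * p (v - x) \<le> 1" using e unfolding sc norm_of_real by simp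
        then have "p (v - x) \<le> e / 2" using e by (simp add: field_simps)
        then show "dist (p v) (p x) < e" using diff[of v x] e by (simp add: dist_real_def)
      qed
    qed
    then show "isCont p x" by (simp add: continuous_at tendsto_nhds_iff)
  qed
  \<comment> \<open>Induction on the list: the sum divided by t is a convex combination of the tail
    divided by t' and of the head with a coefficient of norm at most 1.\<close>
  have conv: "vscale G (of_real (1 / t)) (s L) \<in> C" if "snd ` set L \<subseteq> U0" "w L < t" for L t
    using that
  proof (induction L arbitrary: t)
    case Nil
    then show ?case using C(2) by (simp add: s_def)
  next
    case (Cons q L)
    obtain c u where q: "q = (c, u)" by fastforce
    define t' where "t' = t - norm c"
    have lt: "w L < t'" using Cons.prems by (simp add: w_def q t'_def)
    then have t': "0 < t'" "0 < t" using w_nonneg[of L] norm_ge_zero[of c] unfolding t'_def by linarith+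
    have x: "vscale G (of_real (1 / t')) (s L) \<in> C" by (rule Cons.IH) (use Cons.prems lt in auto)
    have u: "u \<in> U0" using Cons.prems q by simp
    \<comment> \<open>For c = 0 the quotient is 0 / 0 = 0, and its norm is still at most 1.\<close>
    have y: "vscale G (c / of_real (norm c)) u \<in> C" by (rule bal[OF u]) (simp add: norm_divide)
    have "norm c / t \<in> {0..1}" using t' by (auto simp: t'_def field_simps)
    from C(4)[OF x y this]
    have "vscale G (of_real (1 - norm c / t) * of_real (1 / t')) (s L) + vscale G (of_real (norm c / t) * (c / of_real (norm c))) u \<in> C"
      by simp
    moreover have "of_real (1 - norm c / t) * of_real (1 / t') = (of_real (1 / t) :: 'k)"
      using t' by (simp add: t'_def field_simps flip: of_real_mult)
    moreover have "of_real (norm c / t) * (c / of_real (norm c)) = of_real (1 / t) * c"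
      by (cases "c = 0") simp_all
    ultimately show ?case by (simp add: s_def q scale_right_distrib add.commute)
  qed
  show ?thesis
  proof (rule that)
    show "p \<in> CS" using tri sc cont by (auto simp: cont_seminorms_def)
    fix v assume "p v < 1"
    then obtain L where "snd ` set L \<subseteq> U0" "v = s L" "w L < 1" using approx by blast
    then show "v \<in> U" using conv[of L 1] C(3) by auto
  qed
qed

end

text \<open>Continuity at the origin bounds \<Lambda> by 1 on the unit ball of some p; rescaling
  both arguments gives the product bound.\<close>

lemma (in bilinear_space) seminorm_bound_form:
  assumes cont: "continuous_on UNIV (\<lambda>(v, v'). \<Lambda> v v')"
  obtains p where "p \<in> CS" "\<And>v w. norm (\<Lambda> v w) \<le> p v * p w"
proof -
  have "open ((\<lambda>(v, v'). \<Lambda> v v') -` ball 0 1)" using cont by (simp add: continuous_on_open_vimage)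
  moreover have "(0, 0) \<in> (\<lambda>(v, v'). \<Lambda> v v') -` ball 0 1" using \<Lambda>_linear(2)[of 0 0 0] by simp
  ultimately obtain A B where AB: "open A" "open B" "(0, 0) \<in> A \<times> B" "A \<times> B \<subseteq> (\<lambda>(v, v'). \<Lambda> v v') -` ball 0 1"
    by (rule open_prod_elim)
  obtain p where p: "p \<in> CS" "\<And>v. p v < 1 \<Longrightarrow> v \<in> A \<inter> B"
    using seminorm_of_nhd[of "A \<inter> B"] AB by auto
  note D = seminormD[OF p(1)]
  \<comment> \<open>The summand e keeps the divisors positive where p vanishes; it tends to 0 in the
    end.\<close>
  have "norm (\<Lambda> v w) \<le> (p v + e) * (p w + e)" if e: "e > 0" for v w e
  proof -
    have pos: "p v + e > 0" "p w + e > 0" using e D(6)[of v] D(6)[of w] by simp_all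
    have "p (vscale G (of_real (1 / (p u + e))) u) < 1" for u
    proof -
      have "p (vscale G (of_real (1 / (p u + e))) u) = \<bar>1 / (p u + e)\<bar> * p u" by (simp only: D(2) norm_of_real)
      then show ?thesis using e D(6)[of u] by simp
    qed
    then have "norm (\<Lambda> (vscale G (of_real (1 / (p v + e))) v) (vscale G (of_real (1 / (p w + e))) w)) < 1"
      using p(2) AB(4) by fastforce
    then have "\<bar>1 / (p v + e)\<bar> * (\<bar>1 / (p w + e)\<bar> * norm (\<Lambda> v w)) < 1"
      unfolding \<Lambda>_linear norm_mult norm_of_real by (simp only: mult.left_commute)
    then have "norm (\<Lambda> v w) / ((p v + e) * (p w + e)) < 1" using pos by (simp add: mult.assoc)
    then have "norm (\<Lambda> v w) < (p v + e) * (p w + e)" using mult_pos_pos[OF pos] by (simp only: pos_divide_less_eq mult_1)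
    then show ?thesis by simp
  qed
  note * = this
  have "norm (\<Lambda> v w) \<le> p v * p w" for v w
  proof (rule tendsto_lowerbound)
    have "((\<lambda>e. (p v + e) * (p w + e)) \<longlongrightarrow> (p v + 0) * (p w + 0)) (at_right 0)" by (intro tendsto_intros)
    then show "((\<lambda>e. (p v + e) * (p w + e)) \<longlongrightarrow> p v * p w) (at_right 0)" by simp
    show "\<forall>\<^sub>F e in at_right 0. norm (\<Lambda> v w) \<le> (p v + e) * (p w + e)"
      using * eventually_at_right_less by (rule eventually_mono[rotated])
  qed simp
  with p(1) that show ?thesis by blast
qed

subsection \<open>Weighted representations\<close>

text \<open>C bounds the cost of some representation of x. Such bounds replace the infimum: they
  add, and generators can be exchanged, without any epsilon.\<close>

definition wrep :: "('i \<Rightarrow> 'x \<Rightarrow> 'k::real_normed_field) \<Rightarrow> 'i set \<Rightarrow> ('i \<Rightarrow> real) \<Rightarrow> ('x \<Rightarrow> 'k) \<Rightarrow> real \<Rightarrow> bool" where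
  "wrep g I wt x C \<longleftrightarrow> (\<exists>L. snd ` set L \<subseteq> I \<and> x = lin_comb g L \<and> (\<Sum>(c, i)\<leftarrow>L. norm c * wt i) \<le> C)"

lemma wrep_zero: "0 \<le> C \<Longrightarrow> wrep g I wt 0 C"
  unfolding wrep_def by (rule exI[of _ "[]"]) simp

lemma wrep_base: "i \<in> I \<Longrightarrow> wt i \<le> C \<Longrightarrow> wrep g I wt (g i) C"
  unfolding wrep_def by (rule exI[of _ "[(1, i)]"]) simp

lemma wrep_mono: "wrep g I wt x C \<Longrightarrow> C \<le> D \<Longrightarrow> wrep g I wt x D"
  unfolding wrep_def by force

lemma wrep_add:
  assumes "wrep g I wt x C" "wrep g I wt y D" shows "wrep g I wt (x + y) (C + D)"
proof -
  obtain L M where "snd ` set L \<subseteq> I" "x = lin_comb g L" "(\<Sum>(c, i)\<leftarrow>L. norm c * wt i) \<le> C"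
    "snd ` set M \<subseteq> I" "y = lin_comb g M" "(\<Sum>(c, i)\<leftarrow>M. norm c * wt i) \<le> D"
    using assms unfolding wrep_def by blast
  then show ?thesis unfolding wrep_def by (intro exI[of _ "L @ M"]) auto
qed

lemma wrep_scale:
  assumes "wrep g I wt x C" shows "wrep g I wt (fscale a x) (norm a * C)"
proof -
  obtain L where L: "snd ` set L \<subseteq> I" "x = lin_comb g L" "(\<Sum>(c, i)\<leftarrow>L. norm c * wt i) \<le> C"
    using assms unfolding wrep_def by blast
  let ?M = "map (\<lambda>(c, i). (a * c, i)) L"
  have "(\<Sum>(c, i)\<leftarrow>?M. norm c * wt i) = norm a * (\<Sum>(c, i)\<leftarrow>L. norm c * wt i)"
    by (induction L) (auto simp: norm_mult algebra_simps)
  also have "\<dots> \<le> norm a * C" using L(3) by (rule mult_left_mono) simp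
  finally have "(\<Sum>(c, i)\<leftarrow>?M. norm c * wt i) \<le> norm a * C" .
  moreover have "snd ` set ?M \<subseteq> I" using L(1) by force
  moreover have "fscale a x = lin_comb g ?M" by (simp only: L(2) lin_comb_scale)
  ultimately show ?thesis unfolding wrep_def by blast
qed

lemma wrep_sum:
  assumes "\<And>i. i \<in> A \<Longrightarrow> wrep g I wt (x i) (C i)"
  shows "wrep g I wt (\<Sum>i\<in>A. x i) (\<Sum>i\<in>A. C i)"
  using assms by (induction A rule: infinite_finite_induct) (auto intro: wrep_zero wrep_add)

lemma wrep_lin_comb:
  assumes "snd ` set L \<subseteq> I" "\<And>i. i \<in> I \<Longrightarrow> wrep h J wt' (g i) (wt i)"
  shows "wrep h J wt' (lin_comb g L) (\<Sum>(c, i)\<leftarrow>L. norm c * wt i)"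
  using assms(1)
proof (induction L)
  case Nil
  show ?case unfolding lin_comb_simps by (rule wrep_zero) simp
next
  case (Cons q L)
  obtain c i where q: "q = (c, i)" by fastforce
  show ?case unfolding q lin_comb_simps list.map sum_list.Cons split
    by (intro wrep_add wrep_scale assms(2)) (use Cons q in auto)
qed

text \<open>Representations of the old generators are substituted into a representation of
  x.\<close>

lemma wrep_trans:
  assumes "wrep g I wt x C" "\<And>i. i \<in> I \<Longrightarrow> wrep h J wt' (g i) (wt i)"
  shows "wrep h J wt' x C"
proof -
  obtain L where L: "snd ` set L \<subseteq> I" "x = lin_comb g L" "(\<Sum>(c, i)\<leftarrow>L. norm c * wt i) \<le> C"
    using assms(1) unfolding wrep_def by blast
  have "wrep h J wt' (lin_comb g L) (\<Sum>(c, i)\<leftarrow>L. norm c * wt i)"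
    by (rule wrep_lin_comb[OF L(1) assms(2)])
  from wrep_mono[OF this L(3)] show ?thesis by (simp only: L(2))
qed

text \<open>The triangle inequality along a representation: an infimum of costs dominates every
  subadditive function that respects the weights.\<close>

lemma wrep_bound:
  assumes "wrep g I wt x C"
    and add: "\<And>x y. x \<in> fs.span (g ` I) \<Longrightarrow> y \<in> fs.span (g ` I) \<Longrightarrow> q (x + y) \<le> q x + q y"
    and sc: "\<And>c i. i \<in> I \<Longrightarrow> q (fscale c (g i)) \<le> norm c * wt i" and 0: "q 0 \<le> (0::real)"
  shows "q x \<le> C"
proof -
  obtain L where L: "snd ` set L \<subseteq> I" "x = lin_comb g L" "(\<Sum>(c, i)\<leftarrow>L. norm c * wt i) \<le> C"
    using assms(1) unfolding wrep_def by blast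
  have "q (lin_comb g L) \<le> (\<Sum>(c, i)\<leftarrow>L. norm c * wt i)" using L(1)
  proof (induction L)
    case (Cons p L)
    obtain c i where p: "p = (c, i)" by fastforce
    have i: "i \<in> I" using Cons.prems p by simp
    have "q (fscale c (g i) + lin_comb g L) \<le> q (fscale c (g i)) + q (lin_comb g L)"
      by (rule add) (use i Cons.prems lin_comb_in_span in \<open>auto intro!: fs.span_scale intro: fs.span_base[OF imageI]\<close>)
    moreover have "q (lin_comb g L) \<le> (\<Sum>(c, i)\<leftarrow>L. norm c * wt i)" using Cons by simp
    ultimately show ?case using sc[OF i, of c] unfolding p lin_comb_simps list.map sum_list.Cons split by linarith
  qed (use 0 in simp)
  with L show ?thesis by simp
qed

subsection \<open>The projective seminorms\<close>

context graded_lcs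
begin

abbreviation wgt :: "('v \<Rightarrow> real) \<Rightarrow> 'v list \<Rightarrow> real" where
  "wgt p vs \<equiv> prod_list (map p vs)"

abbreviation "psn \<equiv> proj_seminorm (vscale G)"

lemma wgt_nonneg: "p \<in> CS \<Longrightarrow> 0 \<le> wgt p vs"
  using seminormD(6)[of p] by (induction vs) auto

lemma psn_eq: "psn p n x = Inf {(\<Sum>(c, vs)\<leftarrow>L. norm c * wgt p vs) | L. snd ` set L \<subseteq> {vs. length vs = n} \<and> x = lin_comb ten L}"
proof -
  have "(\<forall>(c, vs)\<in>set L. length vs = n) \<longleftrightarrow> snd ` set L \<subseteq> {vs. length vs = n}" for L :: "('k \<times> 'v list) list"
    by auto
  then show ?thesis unfolding proj_seminorm_def lin_comb_def by presburger
qed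

lemma psn_bdd:
  "p \<in> CS \<Longrightarrow> bdd_below {(\<Sum>(c, vs)\<leftarrow>L. norm c * wgt p vs) | L. snd ` set L \<subseteq> {vs. length vs = n} \<and> x = lin_comb ten L}"
  by (rule bdd_belowI[of _ 0]) (auto intro!: sum_list_nonneg simp: wgt_nonneg)

text \<open>Every representation bounds the infimum. Together with \<open>psn_approx\<close>, the
  converse up to e, this translates between \<open>psn\<close> and \<open>wrep\<close>.\<close>

lemma psn_le:
  assumes p: "p \<in> CS" and w: "wrep ten {vs. length vs = n} (wgt p) x C" shows "psn p n x \<le> C"
proof -
  obtain L where L: "snd ` set L \<subseteq> {vs. length vs = n}" "x = lin_comb ten L" "(\<Sum>(c, i)\<leftarrow>L. norm c * wgt p i) \<le> C"
    using w unfolding wrep_def by blast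
  have "psn p n x \<le> (\<Sum>(c, i)\<leftarrow>L. norm c * wgt p i)"
    unfolding psn_eq by (rule cInf_lower[OF _ psn_bdd[OF p]]) (use L in blast)
  with L(3) show ?thesis by simp
qed

lemma tensor_power_eq: "tensor_power (vscale G) n = fs.span (ten ` {vs. length vs = n})"
  unfolding tensor_power_def by (rule arg_cong[of _ _ fs.span]) auto

lemma psn_approx:
  assumes x: "x \<in> tensor_power (vscale G) n" and e: "e > 0"
  shows "wrep ten {vs. length vs = n} (wgt p) x (psn p n x + e)"
proof -
  let ?S = "{(\<Sum>(c, vs)\<leftarrow>L. norm c * wgt p vs) | L. snd ` set L \<subseteq> {vs. length vs = n} \<and> x = lin_comb ten L}"
  have "?S \<noteq> {}" using x unfolding tensor_power_eq by (elim span_lin_comb) blast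
  from cInf_lessD[OF this, of "psn p n x + e"] e
  obtain L where "snd ` set L \<subseteq> {vs. length vs = n}" "x = lin_comb ten L"
    "(\<Sum>(c, i)\<leftarrow>L. norm c * wgt p i) < psn p n x + e" unfolding psn_eq by auto
  then show ?thesis unfolding wrep_def by (intro exI[of _ L]) auto
qed

lemma psn_nonneg:
  assumes p: "p \<in> CS" and x: "x \<in> tensor_power (vscale G) n" shows "0 \<le> psn p n x"
proof -
  let ?S = "{(\<Sum>(c, vs)\<leftarrow>L. norm c * wgt p vs) | L. snd ` set L \<subseteq> {vs. length vs = n} \<and> x = lin_comb ten L}"
  have "?S \<noteq> {}" using x unfolding tensor_power_eq by (elim span_lin_comb) blast
  then show ?thesis unfolding psn_eq
    by (rule cInf_greatest) (auto intro!: sum_list_nonneg simp: wgt_nonneg[OF p])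
qed

lemma zero_in_tensor_power: "0 \<in> tensor_power (vscale G) n"
  unfolding tensor_power_def by (rule fs.span_zero)

lemma psn_0: assumes "p \<in> CS" shows "psn p n 0 = 0"
  using psn_le[OF assms wrep_zero[OF order_refl]] psn_nonneg[OF assms zero_in_tensor_power] by (rule antisym)

lemma psn_add:
  assumes p: "p \<in> CS" and x: "x \<in> tensor_power (vscale G) n" and y: "y \<in> tensor_power (vscale G) n"
  shows "psn p n (x + y) \<le> psn p n x + psn p n y"
proof (rule field_le_epsilon)
  fix e :: real assume "e > 0"
  then have "wrep ten {vs. length vs = n} (wgt p) (x + y) ((psn p n x + e / 2) + (psn p n y + e / 2))"
    by (intro wrep_add psn_approx x y) auto
  from psn_le[OF p this] show "psn p n (x + y) \<le> psn p n x + psn p n y + e" by simp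
qed

lemma psn_scale:
  assumes p: "p \<in> CS" and x: "x \<in> tensor_power (vscale G) n"
  shows "psn p n (fscale c x) \<le> norm c * psn p n x"
proof (rule field_le_epsilon)
  fix e :: real assume e: "e > 0"
  \<comment> \<open>norm c + 1 serves as a divisor that is positive even for c = 0.\<close>
  have pos: "norm c + 1 > 0" using norm_ge_zero[of c] by linarith
  have "psn p n (fscale c x) \<le> norm c * (psn p n x + e / (norm c + 1))"
    by (rule psn_le[OF p wrep_scale[OF psn_approx[OF x]]]) (use e pos in simp)
  also have "\<dots> = norm c * psn p n x + norm c / (norm c + 1) * e" by (simp add: algebra_simps)
  also have "norm c / (norm c + 1) * e \<le> 1 * e" using e pos by (intro mult_right_mono) auto
  finally show "psn p n (fscale c x) \<le> norm c * psn p n x + e" by simp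
qed

lemma psn_mono:
  assumes p: "p \<in> CS" "p' \<in> CS" "\<And>v. p v \<le> p' v" and x: "x \<in> tensor_power (vscale G) n"
  shows "psn p n x \<le> psn p' n x"
proof (rule field_le_epsilon)
  fix e :: real assume e: "e > 0"
  have "wgt p vs \<le> wgt p' vs" for vs
  proof (induction vs)
    case (Cons v vs)
    from mult_mono[OF p(3) this seminormD(6)[OF p(2)] wgt_nonneg[OF p(1)]] show ?case by simp
  qed simp
  then have "wrep ten {vs. length vs = n} (wgt p) x (psn p' n x + e)"
    by (intro wrep_trans[OF psn_approx[OF x e]] wrep_base) auto
  from psn_le[OF p(1) this] show "psn p n x \<le> psn p' n x + e" .
qed

abbreviation "dpt \<equiv> degree_part (vscale G)"

lemma dpt_power: "x \<in> T \<Longrightarrow> dpt n x \<in> tensor_power (vscale G) n"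
  by (rule degree_part_in_tensor_power)

lemma seminorm_R_sum:
  assumes p: "p \<in> CS" and N: "\<forall>n>N. dpt n x = 0"
  shows "seminorm_R G R p x = (\<Sum>n\<le>N. psn p n (dpt n x) * fact n powr R)"
  unfolding seminorm_R_def
proof (rule Sum_any.expand_superset)
  show "{n. psn p n (dpt n x) * fact n powr R \<noteq> 0} \<subseteq> {..N}"
  proof (rule subsetI, rule ccontr)
    fix n assume n: "n \<in> {n. psn p n (dpt n x) * fact n powr R \<noteq> 0}" "n \<notin> {..N}"
    then have "dpt n x = 0" using N by simp
    with n(1) show False unfolding mem_Collect_eq by (simp only: psn_0[OF p] mult_zero_left)
  qed
qed simp

lemma seminorm_R_nonneg:
  assumes "p \<in> CS" "x \<in> T" shows "0 \<le> seminorm_R G R p x"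
proof -
  obtain N where N: "\<forall>n>N. dpt n x = 0" using degree_part_bound[OF assms(2)] by blast
  show ?thesis unfolding seminorm_R_sum[OF assms(1) N]
    by (intro sum_nonneg mult_nonneg_nonneg psn_nonneg[OF assms(1)] dpt_power assms(2)) auto
qed

lemma seminorm_R_0: "p \<in> CS \<Longrightarrow> seminorm_R G R p 0 = 0"
  by (simp add: seminorm_R_def degree_part_0 psn_0)

lemma seminorm_R_add:
  assumes p: "p \<in> CS" and x: "x \<in> T" and y: "y \<in> T"
  shows "seminorm_R G R p (x + y) \<le> seminorm_R G R p x + seminorm_R G R p y"
proof -
  obtain N1 N2 where N: "\<forall>n>N1. dpt n x = 0" "\<forall>n>N2. dpt n y = 0"
    using degree_part_bound[OF x] degree_part_bound[OF y] by meson
  let ?N = "max N1 N2"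
  have N': "\<forall>n>?N. dpt n x = 0" "\<forall>n>?N. dpt n y = 0" using N by auto
  then have N'': "\<forall>n>?N. dpt n (x + y) = 0" by (simp add: degree_part_add x y)
  have "psn p n (dpt n (x + y)) * fact n powr R \<le> psn p n (dpt n x) * fact n powr R + psn p n (dpt n y) * fact n powr R" for n
    unfolding degree_part_add[OF x y] distrib_right[symmetric]
    by (intro mult_right_mono psn_add p dpt_power x y) auto
  then show ?thesis
    unfolding seminorm_R_sum[OF p N'(1)] seminorm_R_sum[OF p N'(2)] seminorm_R_sum[OF p N''] sum.distrib[symmetric]
    by (intro sum_mono)
qed

lemma seminorm_R_scale:
  assumes p: "p \<in> CS" and x: "x \<in> T"
  shows "seminorm_R G R p (fscale c x) \<le> norm c * seminorm_R G R p x"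
proof -
  obtain N where N: "\<forall>n>N. dpt n x = 0" using degree_part_bound[OF x] by blast
  then have N': "\<forall>n>N. dpt n (fscale c x) = 0" by (simp add: degree_part_scale x)
  have "psn p n (dpt n (fscale c x)) * fact n powr R \<le> norm c * (psn p n (dpt n x) * fact n powr R)" for n
    unfolding degree_part_scale[OF x] mult.assoc[symmetric]
    by (intro mult_right_mono psn_scale p dpt_power x) auto
  then show ?thesis unfolding seminorm_R_sum[OF p N] seminorm_R_sum[OF p N'] sum_distrib_left
    by (intro sum_mono)
qed

lemma seminorm_R_mono:
  assumes p: "p \<in> CS" "p' \<in> CS" "\<And>v. p v \<le> p' v" and x: "x \<in> T"
  shows "seminorm_R G R p x \<le> seminorm_R G R p' x"
proof -
  obtain N where N: "\<forall>n>N. dpt n x = 0" using degree_part_bound[OF x] by blast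
  show ?thesis unfolding seminorm_R_sum[OF p(1) N] seminorm_R_sum[OF p(2) N]
    by (intro sum_mono mult_right_mono psn_mono p dpt_power x) auto
qed

section \<open>The seminorms of all degrees treated as one infimum\<close>

abbreviation fwgt :: "real \<Rightarrow> ('v \<Rightarrow> real) \<Rightarrow> 'v list \<Rightarrow> real" where
  "fwgt R p vs \<equiv> fact (length vs) powr R * wgt p vs"

lemma seminorm_R_tens:
  assumes p: "p \<in> CS" shows "seminorm_R G R p (ten vs) \<le> fwgt R p vs"
proof -
  let ?n = "length vs"
  have N: "\<forall>n>?n. dpt n (ten vs) = 0" by (simp add: degree_part_tens)
  have "seminorm_R G R p (ten vs) = (\<Sum>n\<le>?n. psn p n (dpt n (ten vs)) * fact n powr R)"
    by (rule seminorm_R_sum[OF p N])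
  also have "\<dots> = (\<Sum>n\<le>?n. if n = ?n then psn p ?n (ten vs) * fact ?n powr R else 0)"
    by (rule sum.cong[OF refl]) (simp add: degree_part_tens psn_0[OF p])
  also have "\<dots> = psn p ?n (ten vs) * fact ?n powr R" by simp
  also have "\<dots> \<le> wgt p vs * fact ?n powr R"
    by (intro mult_right_mono psn_le[OF p] wrep_base) auto
  finally show ?thesis by (simp add: mult.commute)
qed

text \<open>With the power of the factorial put into the weight of a word, representations that mix
  degrees bound the whole seminorm, and degrees need no separate treatment.\<close>

lemma seminorm_R_le:
  assumes p: "p \<in> CS" and w: "wrep ten UNIV (fwgt R p) x C" shows "seminorm_R G R p x \<le> C"
proof (rule wrep_bound[OF w, of "seminorm_R G R p"])
  show "seminorm_R G R p (x + y) \<le> seminorm_R G R p x + seminorm_R G R p y"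
    if "x \<in> fs.span (range ten)" "y \<in> fs.span (range ten)" for x y
    using that by (intro seminorm_R_add p) (simp_all add: tensors_def)
  show "seminorm_R G R p (fscale c (ten vs)) \<le> norm c * fwgt R p vs" for c vs
    using seminorm_R_scale[OF p tens_in_tensors] mult_left_mono[OF seminorm_R_tens[OF p] norm_ge_zero] by (rule order_trans)
qed (simp add: seminorm_R_0[OF p])

lemma seminorm_R_approx:
  assumes p: "p \<in> CS" and x: "x \<in> T" and e: "e > 0"
  shows "wrep ten UNIV (fwgt R p) x (seminorm_R G R p x + e)"
proof -
  obtain N0 where N0: "\<And>n. n > N0 \<Longrightarrow> dpt n x = 0" using degree_part_bound[OF x] by blast
  obtain N1 where N1: "\<And>M \<psi>. M \<ge> N1 \<Longrightarrow> ml \<psi> \<Longrightarrow> x \<psi> = (\<Sum>n\<le>M. x (\<lambda>vs. if length vs = n then \<psi> vs else 0))"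
    using tensor_degree_sum[OF x] by blast
  define N where "N = max N0 N1"
  have N: "\<forall>n>N. dpt n x = 0" using N0 by (simp add: N_def)
  have sT: "(\<Sum>n\<le>N. dpt n x) \<in> T"
    using dpt_power[OF x] tensor_power_subset by (intro fs.subspace_sum[OF subspace_tensors]) blast
  have eq: "x = (\<Sum>n\<le>N. dpt n x)"
  proof (rule tensor_eqI[OF x sT])
    fix \<psi> assume m: "ml \<psi>"
    have "x \<psi> = (\<Sum>n\<le>N. x (\<lambda>vs. if length vs = n then \<psi> vs else 0))" by (rule N1[OF _ m]) (simp add: N_def)
    then show "x \<psi> = (\<Sum>n\<le>N. dpt n x) \<psi>" by (simp add: sum_fun_apply degree_part_apply[OF x] tens_apply[OF m] cong: if_cong)
  qed
  \<comment> \<open>The allowance e is shared equally by the N + 1 degrees; dividing by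
    \<open>fact n powr R\<close> undoes the weight of degree n.\<close>
  define d where "d n = e / (real (Suc N) * fact n powr R)" for n :: nat
  have d: "d n > 0" "d n * fact n powr R = e / real (Suc N)" for n using e by (simp_all add: d_def)
  have "wrep ten UNIV (fwgt R p) (dpt n x) ((psn p n (dpt n x) + d n) * fact n powr R)" for n
  proof -
    obtain L where L: "snd ` set L \<subseteq> {vs. length vs = n}" "dpt n x = lin_comb ten L"
      "(\<Sum>(c, i)\<leftarrow>L. norm c * wgt p i) \<le> psn p n (dpt n x) + d n"
      using psn_approx[OF dpt_power[OF x] d(1), where p=p] unfolding wrep_def by blast
    have "(\<Sum>(c, i)\<leftarrow>L. norm c * fwgt R p i) = (\<Sum>(c, i)\<leftarrow>L. norm c * wgt p i) * fact n powr R"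
      using L(1) by (induction L) (auto simp: algebra_simps)
    also have "\<dots> \<le> (psn p n (dpt n x) + d n) * fact n powr R" using L(3) by (intro mult_right_mono) auto
    finally show ?thesis unfolding wrep_def using L(2) by blast
  qed
  then have "wrep ten UNIV (fwgt R p) (\<Sum>n\<le>N. dpt n x) (\<Sum>n\<le>N. (psn p n (dpt n x) + d n) * fact n powr R)"
    by (rule wrep_sum)
  moreover have "(\<Sum>n\<le>N. (psn p n (dpt n x) + d n) * fact n powr R) = seminorm_R G R p x + e"
  proof -
    have "(\<Sum>n\<le>N. e / real (Suc N)) = real (Suc N) * (e / real (Suc N))" by simp
    also have "\<dots> = e" by (rule nonzero_mult_div_cancel_left[of "real (Suc N)", unfolded times_divide_eq_right[symmetric]]) simp
    finally show ?thesis unfolding seminorm_R_sum[OF p N] distrib_right sum.distrib d(2) by (simp only:)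
  qed
  ultimately show ?thesis using eq by simp
qed

text \<open>Passing from arbitrary vectors to their homogeneous components costs the hull of the seminorm.\<close>

lemma wrep_sym_prod_hom:
  assumes p: "p \<in> CS" shows "wrep (sym_prod G) (hom_lists G) (fwgt R p) (sym_prod G vs) (fwgt R (ghull p) vs)"
proof -
  \<comment> \<open>K lists the homogeneous choices visited by \<open>hext\<close>. Their weights
    add up to the product of the sums over both components, which is the weight for the
    hull.\<close>
  have "\<exists>K. set K \<subseteq> {us \<in> hom_lists G. length us = length vs} \<and> (\<forall>f. hext vs f = (\<Sum>us\<leftarrow>K. f us)) \<and>
      (\<Sum>us\<leftarrow>K. wgt p us) = wgt (ghull p) vs"
  proof (induction vs)
    case Nil
    show ?case by (rule exI[of _ "[[]]"]) simp
  next
    case (Cons v vs)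
    then obtain K where K: "set K \<subseteq> {us \<in> hom_lists G. length us = length vs}" "\<And>f. hext vs f = (\<Sum>us\<leftarrow>K. f us)"
      "(\<Sum>us\<leftarrow>K. wgt p us) = wgt (ghull p) vs" by blast
    let ?K = "map ((#) (even_proj G v)) K @ map ((#) (odd_proj G v)) K"
    have "(\<Sum>us\<leftarrow>?K. wgt p us) = wgt (ghull p) (v # vs)"
      by (simp add: o_def sum_list_const_mult K(3) ghull_def distrib_right)
    moreover have "set ?K \<subseteq> {us \<in> hom_lists G. length us = length (v # vs)}" using K(1) by auto
    moreover have "\<forall>f. hext (v # vs) f = (\<Sum>us\<leftarrow>?K. f us)" using K(2) by (simp add: o_def)
    ultimately show ?case by blast
  qed
  then obtain K where K: "set K \<subseteq> {us \<in> hom_lists G. length us = length vs}" "\<And>f. hext vs f = (\<Sum>us\<leftarrow>K. f us)"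
      "(\<Sum>us\<leftarrow>K. wgt p us) = wgt (ghull p) vs" by blast
  let ?L = "map (\<lambda>us. (1 :: 'k, us)) K"
  have "lin_comb (sym_prod G) ?L \<phi> = (\<Sum>us\<leftarrow>K. sym_prod G us \<phi>)" for \<phi> by (induction K) auto
  then have "sym_prod G vs = lin_comb (sym_prod G) ?L"
    by (subst sym_prod_hext) (simp add: fun_eq_iff K(2))
  moreover have "(\<Sum>(c, us)\<leftarrow>?L. norm c * fwgt R p us) = fact (length vs) powr R * (\<Sum>us\<leftarrow>K. wgt p us)"
    using K(1) by (induction K) (auto simp: algebra_simps)
  moreover have "snd ` set ?L \<subseteq> hom_lists G" using K(1) by auto
  ultimately show ?thesis unfolding wrep_def by (intro exI[of _ ?L]) (auto simp: K(3))
qed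

text \<open>The symmetrizer fixes x and turns words into products, so a cheap representation by
  words becomes one by products at the same cost. The hull enters when these are split into
  homogeneous ones.\<close>

lemma W_hom_approx:
  assumes p: "p \<in> CS" and x: "x \<in> W" and e: "e > 0"
  shows "wrep (sym_prod G) (hom_lists G) (fwgt R p) x (seminorm_R G R (ghull p) x + e)"
proof -
  obtain L where L: "x = lin_comb ten L"
    "(\<Sum>(c, i)\<leftarrow>L. norm c * fwgt R (ghull p) i) \<le> seminorm_R G R (ghull p) x + e"
    using seminorm_R_approx[OF seminorm_ghull[OF p] W_in_T[OF x] e] unfolding wrep_def by blast
  have "lin_comb ten L (sym_form \<phi>) = lin_comb (sym_prod G) L \<phi>" for \<phi>
    by (induction L) (auto simp: tens_apply multilinear_sym_form sym_prod_apply)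
  then have "x = lin_comb (sym_prod G) L" using W_sym_form[OF x] L(1) by (metis ext)
  then have "wrep (sym_prod G) UNIV (fwgt R (ghull p)) x (seminorm_R G R (ghull p) x + e)"
    unfolding wrep_def using L(2) by blast
  from wrep_trans[OF this wrep_sym_prod_hom[OF p]] show ?thesis .
qed

text \<open>The symmetrizer averages over n! permutations with signs of norm 1, and the weight of a
  word does not depend on the order of its entries.\<close>

lemma seminorm_R_sym_prod:
  assumes p: "p \<in> CS" and us: "us \<in> hom_lists G" shows "seminorm_R G R p (sym_prod G us) \<le> fwgt R p us"
proof (rule seminorm_R_le[OF p])
  let ?n = "length us" and ?P = "{\<sigma>. \<sigma> permutes {..<length us}}"
  have eq: "sym_prod G us = fscale (1 / fact ?n) (\<Sum>\<sigma>\<in>?P. fscale (koszul_sign G \<sigma> us) (ten (permute_list \<sigma> us)))"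
    by (rule ext) (simp add: sym_prod_apply sym_form_hom[OF us] sum_fun_apply)
  have ks: "norm (koszul_sign G \<sigma> us :: 'k) = 1" for \<sigma> by (simp add: koszul_sign_def norm_power)
  have w: "wgt p (permute_list \<sigma> us) = wgt p us" if "\<sigma> permutes {..<length us}" for \<sigma>
  proof -
    have "mset (map p (permute_list \<sigma> us)) = mset (map p us)" using that by simp
    then show ?thesis by (metis prod_mset_prod_list)
  qed
  have "wrep ten UNIV (fwgt R p) (fscale (koszul_sign G \<sigma> us) (ten (permute_list \<sigma> us))) (fwgt R p us)" if "\<sigma> \<in> ?P" for \<sigma>
    using wrep_scale[OF wrep_base[of "permute_list \<sigma> us" UNIV "fwgt R p" _ ten, OF UNIV_I order_refl], of "koszul_sign G \<sigma> us"] that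
    by (simp add: ks w)
  then have "wrep ten UNIV (fwgt R p) (sym_prod G us) (norm (1 / fact ?n :: 'k) * (\<Sum>\<sigma>\<in>?P. fwgt R p us))"
    unfolding eq by (intro wrep_scale wrep_sum)
  moreover have "norm (1 / fact ?n :: 'k) * (\<Sum>\<sigma>\<in>?P. fwgt R p us) = fwgt R p us"
  proof -
    have "norm (fact ?n :: 'k) = fact ?n" by (metis norm_of_nat of_nat_fact)
    then show ?thesis by (simp add: card_permutations[OF card_lessThan finite_lessThan] norm_divide)
  qed
  ultimately show "wrep ten UNIV (fwgt R p) (sym_prod G us) (fwgt R p us)" by (simp only:)
qed

text \<open>Expanding one argument at a time along a cheap representation reduces continuity to
  pairs of products of homogeneous vectors. The allowance e in both representations then tends to
  0.\<close>

lemma bilinear_bound: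
  assumes p: "p \<in> CS" and q: "q \<in> CS" and x: "x \<in> W" and y: "y \<in> W"
    and f: "\<And>a b. a \<in> W \<Longrightarrow> b \<in> W \<Longrightarrow> f a b \<in> W"
    and add: "\<And>a a' b. a \<in> W \<Longrightarrow> a' \<in> W \<Longrightarrow> b \<in> W \<Longrightarrow> f (a + a') b = f a b + f a' b"
      "\<And>a b b'. a \<in> W \<Longrightarrow> b \<in> W \<Longrightarrow> b' \<in> W \<Longrightarrow> f a (b + b') = f a b + f a b'"
    and sc: "\<And>c a b. a \<in> W \<Longrightarrow> b \<in> W \<Longrightarrow> f (fscale c a) b = fscale c (f a b)"
      "\<And>c a b. a \<in> W \<Longrightarrow> b \<in> W \<Longrightarrow> f a (fscale c b) = fscale c (f a b)"
    and bd: "\<And>us ws. us \<in> hom_lists G \<Longrightarrow> ws \<in> hom_lists G \<Longrightarrow>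
      seminorm_R G R p (f (sym_prod G us) (sym_prod G ws)) \<le> fwgt R q us * fwgt R q ws"
  shows "seminorm_R G R p (f x y) \<le> seminorm_R G R (ghull q) x * seminorm_R G R (ghull q) y"
proof -
  let ?X = "seminorm_R G R (ghull q) x" and ?Y = "seminorm_R G R (ghull q) y"
  let ?p = "seminorm_R G R p"
  have sp: "fs.span (sym_prod G ` hom_lists G) = W" by (rule W_span[symmetric])
  have f0: "f a 0 = 0" "f 0 a = 0" if "a \<in> W" for a
  proof -
    have "f (fscale 0 0) a = fscale 0 (f 0 a)" "f a (fscale 0 0) = fscale 0 (f a 0)"
      by (rule sc(1)[OF W_closed(1) that], rule sc(2)[OF that W_closed(1)])
    then show "f a 0 = 0" "f 0 a = 0" by (simp_all only: fs.scale_zero_left)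
  qed
  have 1: "?p (f (sym_prod G us) b) \<le> fwgt R q us * C"
    if A: "us \<in> hom_lists G" "wrep (sym_prod G) (hom_lists G) (fwgt R q) b C" for us b C
  proof -
    obtain L where L: "snd ` set L \<subseteq> hom_lists G" "b = lin_comb (sym_prod G) L" "(\<Sum>(c, i)\<leftarrow>L. norm c * fwgt R q i) \<le> C"
      using A(2) unfolding wrep_def by blast
    have nn: "0 \<le> fwgt R q us" using wgt_nonneg[OF q] by simp
    have "?p (f (sym_prod G us) (lin_comb (sym_prod G) L)) \<le> fwgt R q us * (\<Sum>(c, i)\<leftarrow>L. norm c * fwgt R q i)"
      using L(1)
    proof (induction L)
      case Nil
      show ?case by (simp only: lin_comb_simps f0 sym_prod_in_W seminorm_R_0[OF p]) simp
    next
      case (Cons r L)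
      obtain c vs where r: "r = (c, vs)" by fastforce
      have vs: "vs \<in> hom_lists G" "snd ` set L \<subseteq> hom_lists G" using Cons.prems r by auto
      have LW: "lin_comb (sym_prod G) L \<in> W" using lin_comb_in_span[OF vs(2)] sp by blast
      have "?p (f (sym_prod G us) (lin_comb (sym_prod G) (r # L))) =
          ?p (fscale c (f (sym_prod G us) (sym_prod G vs)) + f (sym_prod G us) (lin_comb (sym_prod G) L))"
        by (simp only: r lin_comb_simps add(2) sc(2) LW sym_prod_in_W W_closed)
      also have "\<dots> \<le> ?p (fscale c (f (sym_prod G us) (sym_prod G vs))) + ?p (f (sym_prod G us) (lin_comb (sym_prod G) L))"
        by (intro seminorm_R_add p W_in_T W_closed f sym_prod_in_W LW)
      also have "?p (fscale c (f (sym_prod G us) (sym_prod G vs))) \<le> norm c * (fwgt R q us * fwgt R q vs)"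
        using seminorm_R_scale[OF p W_in_T[OF f[OF sym_prod_in_W sym_prod_in_W]]] mult_left_mono[OF bd[OF A(1) vs(1)] norm_ge_zero]
        by (rule order_trans)
      finally have F: "?p (f (sym_prod G us) (lin_comb (sym_prod G) (r # L))) \<le>
          norm c * (fwgt R q us * fwgt R q vs) + ?p (f (sym_prod G us) (lin_comb (sym_prod G) L))" by (simp only: add_right_mono)
      have "fwgt R q us * (\<Sum>(c, i)\<leftarrow>r # L. norm c * fwgt R q i) =
          norm c * (fwgt R q us * fwgt R q vs) + fwgt R q us * (\<Sum>(c, i)\<leftarrow>L. norm c * fwgt R q i)"
        by (simp add: r algebra_simps)
      then show ?case using F Cons.IH[OF vs(2)] by linarith
    qed
    also have "\<dots> \<le> fwgt R q us * C" using L(3) nn by (rule mult_left_mono)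
    finally show ?thesis by (simp only: L(2))
  qed
  have 2: "?p (f a b) \<le> D * C"
    if A: "wrep (sym_prod G) (hom_lists G) (fwgt R q) a D" "wrep (sym_prod G) (hom_lists G) (fwgt R q) b C" "b \<in> W" "0 \<le> C" for a b C D
  proof -
    obtain L where L: "snd ` set L \<subseteq> hom_lists G" "a = lin_comb (sym_prod G) L" "(\<Sum>(c, i)\<leftarrow>L. norm c * fwgt R q i) \<le> D"
      using A(1) unfolding wrep_def by blast
    have "?p (f (lin_comb (sym_prod G) L) b) \<le> (\<Sum>(c, i)\<leftarrow>L. norm c * fwgt R q i) * C"
      using L(1)
    proof (induction L)
      case Nil
      show ?case by (simp only: lin_comb_simps f0 A(3) seminorm_R_0[OF p]) simp
    next
      case (Cons r L)
      obtain c vs where r: "r = (c, vs)" by fastforce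
      have vs: "vs \<in> hom_lists G" "snd ` set L \<subseteq> hom_lists G" using Cons.prems r by auto
      have LW: "lin_comb (sym_prod G) L \<in> W" using lin_comb_in_span[OF vs(2)] sp by blast
      have "?p (f (lin_comb (sym_prod G) (r # L)) b) =
          ?p (fscale c (f (sym_prod G vs) b) + f (lin_comb (sym_prod G) L) b)"
        by (simp only: r lin_comb_simps add(1) sc(1) LW sym_prod_in_W W_closed A(3))
      also have "\<dots> \<le> ?p (fscale c (f (sym_prod G vs) b)) + ?p (f (lin_comb (sym_prod G) L) b)"
        by (intro seminorm_R_add p W_in_T W_closed f sym_prod_in_W LW A(3))
      also have "?p (fscale c (f (sym_prod G vs) b)) \<le> norm c * (fwgt R q vs * C)"
        using seminorm_R_scale[OF p W_in_T[OF f[OF sym_prod_in_W A(3)]]] mult_left_mono[OF 1[OF vs(1) A(2)] norm_ge_zero]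
        by (rule order_trans)
      finally have F: "?p (f (lin_comb (sym_prod G) (r # L)) b) \<le>
          norm c * (fwgt R q vs * C) + ?p (f (lin_comb (sym_prod G) L) b)" by (simp only: add_right_mono)
      have "(\<Sum>(c, i)\<leftarrow>r # L. norm c * fwgt R q i) * C =
          norm c * (fwgt R q vs * C) + (\<Sum>(c, i)\<leftarrow>L. norm c * fwgt R q i) * C"
        by (simp add: r algebra_simps)
      then show ?case using F Cons.IH[OF vs(2)] by linarith
    qed
    also have "\<dots> \<le> D * C" using L(3) A(4) by (rule mult_right_mono)
    finally show ?thesis by (simp only: L(2))
  qed
  have X: "0 \<le> ?X" "0 \<le> ?Y" using seminorm_R_nonneg[OF seminorm_ghull[OF q]] W_in_T x y by auto
  show ?thesis
  proof (rule tendsto_lowerbound)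
    have "((\<lambda>e. (?X + e) * (?Y + e)) \<longlongrightarrow> (?X + 0) * (?Y + 0)) (at_right 0)" by (intro tendsto_intros)
    then show "((\<lambda>e. (?X + e) * (?Y + e)) \<longlongrightarrow> ?X * ?Y) (at_right 0)" by simp
    have "?p (f x y) \<le> (?X + e) * (?Y + e)" if "e > 0" for e
      by (rule 2[OF W_hom_approx[OF q x that] W_hom_approx[OF q y that] y]) (use X that in simp)
    then show "\<forall>\<^sub>F e in at_right 0. ?p (f x y) \<le> (?X + e) * (?Y + e)"
      using eventually_at_right_less by (rule eventually_mono[rotated])
  qed simp
qed

end

subsection \<open>Continuity of the star product\<close>

lemma wrep_weight:
  assumes "wrep g I wt x C" "0 \<le> c" "\<And>i. i \<in> I \<Longrightarrow> wt' i = c * wt i"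
  shows "wrep g I wt' x (c * C)"
proof -
  obtain L where L: "snd ` set L \<subseteq> I" "x = lin_comb g L" "(\<Sum>(a, i)\<leftarrow>L. norm a * wt i) \<le> C"
    using assms(1) unfolding wrep_def by blast
  have "(\<Sum>(a, i)\<leftarrow>L. norm a * wt' i) = c * (\<Sum>(a, i)\<leftarrow>L. norm a * wt i)"
    using L(1) by (induction L) (auto simp: assms(3) algebra_simps)
  also have "\<dots> \<le> c * C" using L(3) assms(2) by (rule mult_left_mono)
  finally show ?thesis unfolding wrep_def using L(1,2) by blast
qed

lemma prod_list_omit: "k < length xs \<Longrightarrow> prod_list xs = xs ! k * prod_list (omit k xs)"
  for xs :: "'a::comm_monoid_mult list"
  by (simp add: omit_def id_take_nth_drop[of k xs, THEN arg_cong[of _ _ prod_list]] mult.left_commute)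

lemma map_omit: "map f (omit k xs) = omit k (map f xs)"
  by (simp add: omit_def take_map drop_map)

text \<open>The falling factorial counts the choices of entries in k successive contractions.
  Truncated subtraction makes it 0 for k > n, when nothing is left to contract.\<close>

definition falling :: "nat \<Rightarrow> nat \<Rightarrow> nat" where
  "falling n k = (\<Prod>i<k. n - i)"

lemma falling_Suc: "falling n (Suc k) = falling n k * (n - k)"
  by (simp add: falling_def)

lemma falling_zero: "k > n \<Longrightarrow> falling n k = 0"
  by (auto simp: falling_def)

lemma falling_fact: "k \<le> n \<Longrightarrow> falling n k = fact k * (n choose k)"
proof (induction k)
  case (Suc k)
  have "falling n (Suc k) = fact k * ((n choose k) * (n - k))" using Suc by (simp add: falling_Suc)
  also have "(n choose k) * (n - k) = Suc k * (n choose Suc k)"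
    using binomial_absorb_comp[of n k] Suc_times_binomial_eq[of "n - 1" k] Suc.prems
    by (cases n) (auto simp: mult.commute)
  finally show ?case by (simp add: algebra_simps)
qed (simp add: falling_def)

text \<open>The binomial coefficient of i + j over i is at most \<open>2 ^ (i + j)\<close>.\<close>

lemma fact_add_le: "(fact (i + j) :: real) \<le> 2 ^ (i + j) * (fact i * fact j)"
proof -
  have "fact i * fact j * ((i + j) choose i) = (fact (i + j) :: nat)"
    using binomial_fact_lemma[of i "i + j"] by simp
  then have "real (fact i * fact j * ((i + j) choose i)) = real (fact (i + j))" by (simp only:)
  then have "(fact (i + j) :: real) = real ((i + j) choose i) * (fact i * fact j)"
    by (simp add: mult.commute)
  also have "\<dots> \<le> real (2 ^ (i + j)) * (fact i * fact j)"
    by (intro mult_right_mono of_nat_mono binomial_le_pow2) auto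
  finally show ?thesis by simp
qed

text \<open>This is where \<open>R \<ge> 1/2\<close> enters: \<open>k! \<le> (k!)\<^sup>R (k!)\<^sup>R\<close>.\<close>

lemma star_coefficient_bound:
  assumes R: "1 / 2 \<le> R" "R < 1" and k: "k \<le> n" "k \<le> m"
  shows "real (falling n k) * real (falling m k) / fact k * fact (n + m - 2 * k) powr R
    \<le> 4 ^ (n + m) * (fact n powr R * fact m powr R)"
proof -
  \<comment> \<open>i and j are the numbers of vectors left in the two factors after k
    contractions.\<close>
  define i j where "i = n - k" and "j = m - k"
  have nm: "n = k + i" "m = k + j" using k by (auto simp: i_def j_def)
  have "real (falling n k) * real (falling m k) / fact k = fact k * (real (n choose k) * real (m choose k))"
    using k by (simp add: falling_fact)
  also have "\<dots> \<le> fact k * (real (2 ^ n) * real (2 ^ m))"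
    by (intro mult_left_mono mult_mono of_nat_mono binomial_le_pow2) auto
  also have "\<dots> = 2 ^ (n + m) * fact k" by (simp add: power_add)
  finally have 1: "real (falling n k) * real (falling m k) / fact k \<le> 2 ^ (n + m) * fact k" .
  have "(fact (n + m - 2 * k) :: real) = fact (i + j)" by (simp add: nm)
  also have "(fact (i + j) :: real) powr R \<le> (2 ^ (i + j) * (fact i * fact j)) powr R"
    using R by (intro powr_mono2 fact_add_le) auto
  also have "\<dots> = (2 ^ (i + j)) powr R * (fact i powr R * fact j powr R)"
    by (simp add: powr_mult)
  also have "\<dots> \<le> 2 ^ (n + m) * (fact i powr R * fact j powr R)"
  proof (rule mult_right_mono)
    have "(2 ^ (i + j) :: real) powr R \<le> (2 ^ (i + j)) powr 1" using R by (intro powr_mono) auto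
    also have "\<dots> = 2 ^ (i + j)" by simp
    also have "\<dots> \<le> 2 ^ (n + m)" by (rule power_increasing) (auto simp: nm)
    finally show "(2 ^ (i + j) :: real) powr R \<le> 2 ^ (n + m)" .
  qed auto
  finally have 2: "fact (n + m - 2 * k) powr R \<le> 2 ^ (n + m) * (fact i powr R * fact j powr R)" .
  have "(fact k :: real) = fact k powr 1" by simp
  also have "\<dots> \<le> fact k powr (R + R)" using R by (intro powr_mono) auto
  also have "\<dots> = fact k powr R * fact k powr R" by (rule powr_add)
  finally have 3: "(fact k :: real) \<le> fact k powr R * fact k powr R" .
  \<comment> \<open>The two powers of k! obtained from R \<ge> 1/2 are absorbed one by each factor,
    in n = k + i and in m = k + j.\<close>
  have 4: "fact k powr R * fact l powr R \<le> (fact (k + l) :: real) powr R" for l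
  proof -
    have "fact k * fact l \<le> (fact (k + l) :: nat)"
      by (rule dvd_imp_le[OF fact_fact_dvd_fact]) simp
    then have "(fact k * fact l :: real) \<le> fact (k + l)" by (metis of_nat_fact of_nat_le_iff of_nat_mult)
    then have "(fact k * fact l :: real) powr R \<le> fact (k + l) powr R" using R by (intro powr_mono2) auto
    then show ?thesis by (simp add: powr_mult)
  qed
  have "real (falling n k) * real (falling m k) / fact k * fact (n + m - 2 * k) powr R
    \<le> (2 ^ (n + m) * fact k) * (2 ^ (n + m) * (fact i powr R * fact j powr R))"
    by (rule mult_mono[OF 1 2]) auto
  also have "\<dots> = 4 ^ (n + m) * (fact k * (fact i powr R * fact j powr R))"
    by (simp flip: power_mult_distrib)
  also have "\<dots> \<le> 4 ^ (n + m) * ((fact k powr R * fact k powr R) * (fact i powr R * fact j powr R))"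
    by (intro mult_left_mono mult_right_mono 3) auto
  also have "\<dots> = 4 ^ (n + m) * ((fact k powr R * fact i powr R) * (fact k powr R * fact j powr R))"
    by (simp only: mult_ac)
  also have "\<dots> \<le> 4 ^ (n + m) * (fact n powr R * fact m powr R)"
    unfolding nm by (intro mult_left_mono mult_mono 4) auto
  finally show ?thesis .
qed

locale weyl = bilinear_space G \<Lambda>
  for G :: "('k::real_normed_field, 'v::{topological_ab_group_add, t2_space}) graded_space" and \<Lambda> +
  fixes z :: 'k
  assumes cont_form: "continuous_on UNIV (\<lambda>(v, v'). \<Lambda> v v')"
begin

abbreviation "P \<equiv> P_form G \<Lambda>"
abbreviation "g2 \<equiv> (\<lambda>(vs, ws). tens2 (sym_prod G vs) (sym_prod G ws))"
abbreviation "HH \<equiv> hom_lists G \<times> hom_lists G"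
abbreviation "S2 \<equiv> fs.span pair_gens"

section \<open>Linearity of P and mu on pairs\<close>

lemma P_linear:
  assumes "X \<in> S2" "Y \<in> S2"
  shows "P (X + Y) = P X + P Y" "P (fscale c X) = fscale c (P X)" "P 0 = 0"
proof -
  obtain \<psi> where \<psi>: "\<And>X. X \<in> S2 \<Longrightarrow> P X = (\<lambda>\<phi>. X (\<psi> \<phi>))"
    by (rule P_form_formula) (rule that)
  have "X + Y \<in> S2" "fscale c X \<in> S2" "0 \<in> S2" using assms by (auto intro: fs.span_add fs.span_scale fs.span_zero)
  note 1 = this[THEN \<psi>] assms[THEN \<psi>]
  show "P (X + Y) = P X + P Y" "P (fscale c X) = fscale c (P X)" "P 0 = 0"
    unfolding 1 by (rule ext, simp)+
qed

lemma mu_linear: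
  assumes "X \<in> S2" "Y \<in> S2"
  shows "mu G (X + Y) = mu G X + mu G Y" "mu G (fscale c X) = fscale c (mu G X)" "mu G 0 = 0"
proof -
  obtain \<psi> where \<psi>: "\<And>X. X \<in> S2 \<Longrightarrow> mu G X = (\<lambda>\<phi>. X (\<psi> \<phi>))"
    by (rule mu_formula) (rule that)
  have "X + Y \<in> S2" "fscale c X \<in> S2" "0 \<in> S2" using assms by (auto intro: fs.span_add fs.span_scale fs.span_zero)
  note 1 = this[THEN \<psi>] assms[THEN \<psi>]
  show "mu G (X + Y) = mu G X + mu G Y" "mu G (fscale c X) = fscale c (mu G X)" "mu G 0 = 0"
    unfolding 1 by (rule ext, simp)+
qed

lemma P_g2:
  assumes "vs \<in> hom_lists G" "ws \<in> hom_lists G"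
  shows "P (tens2 (sym_prod G vs) (sym_prod G ws)) = P_gen vs ws"
proof (rule P_form_formula)
  assume "\<And>vs ws. vs \<in> hom_lists G \<Longrightarrow> ws \<in> hom_lists G \<Longrightarrow> P (tens2 (sym_prod G vs) (sym_prod G ws)) = P_gen vs ws"
  from this[OF assms] show ?thesis .
qed

lemma mu_tens2:
  assumes "a \<in> W" "b \<in> W" shows "mu G (tens2 a b) = sym_mult G a b"
proof (rule mu_formula)
  assume "\<And>a b. a \<in> W \<Longrightarrow> b \<in> W \<Longrightarrow> mu G (tens2 a b) = sym_mult G a b"
  from this[OF assms] show ?thesis .
qed

lemma g2_in: "i \<in> HH \<Longrightarrow> g2 i \<in> S2"
  by (rule fs.span_base) (rule imageI)

lemma lin_comb_g2_in: "snd ` set L \<subseteq> HH \<Longrightarrow> lin_comb g2 L \<in> S2"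
  by (rule lin_comb_in_span)

lemma P_gen_in: "vs \<in> hom_lists G \<Longrightarrow> ws \<in> hom_lists G \<Longrightarrow> P_gen vs ws \<in> S2"
  unfolding P_gen_def using tens2_in_span[OF sym_prod_in_W sym_prod_in_W]
  by (intro fs.span_sum fs.span_scale)

lemma linear_lin_comb:
  assumes add: "\<And>X Y. X \<in> S2 \<Longrightarrow> Y \<in> S2 \<Longrightarrow> F (X + Y) = F X + F Y"
    and sc: "\<And>c X. X \<in> S2 \<Longrightarrow> F (fscale c X) = fscale c (F X)" and 0: "F 0 = 0"
    and g: "\<And>i. i \<in> HH \<Longrightarrow> F (g2 i) = h i" and L: "snd ` set L \<subseteq> HH"
  shows "F (lin_comb g2 L) = lin_comb h L"
  using L
proof (induction L)
  case Nil
  show ?case unfolding lin_comb_simps by (rule 0)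
next
  case (Cons q L)
  obtain c i where q: "q = (c, i)" by (cases q)
  have i: "i \<in> HH" "snd ` set L \<subseteq> HH" using Cons.prems q by auto
  show ?case unfolding q lin_comb_simps
    by (simp only: add[OF fs.span_scale[OF g2_in[OF i(1)]] lin_comb_g2_in[OF i(2)]] sc[OF g2_in[OF i(1)]] g[OF i(1)] Cons.IH[OF i(2)])
qed

lemma P_lin_comb:
  assumes "snd ` set L \<subseteq> HH" shows "P (lin_comb g2 L) = lin_comb (\<lambda>(vs, ws). P_gen vs ws) L"
proof (rule linear_lin_comb[OF P_linear(1) P_linear(2)[OF _ fs.span_zero] P_linear(3)[OF fs.span_zero fs.span_zero] _ assms])
  show "P (g2 i) = (case i of (vs, ws) \<Rightarrow> P_gen vs ws)" if "i \<in> HH" for i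
    using that P_g2 by (cases i) (simp only: split mem_Times_iff fst_conv snd_conv)
qed

lemma mu_lin_comb:
  assumes "snd ` set L \<subseteq> HH" shows "mu G (lin_comb g2 L) = lin_comb (\<lambda>(vs, ws). sym_prod G (vs @ ws)) L"
proof (rule linear_lin_comb[OF mu_linear(1) mu_linear(2)[OF _ fs.span_zero] mu_linear(3)[OF fs.span_zero fs.span_zero] _ assms])
  show "mu G (g2 i) = (case i of (vs, ws) \<Rightarrow> sym_prod G (vs @ ws))" if "i \<in> HH" for i
    using that mu_tens2[OF sym_prod_in_W sym_prod_in_W] sym_mult_sym_prod
    by (cases i) (simp only: split mem_Times_iff fst_conv snd_conv)
qed

lemma P_in: assumes "X \<in> S2" shows "P X \<in> S2"
proof -
  obtain L where L: "snd ` set L \<subseteq> HH" "X = lin_comb g2 L" using span_lin_comb[OF assms] .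
  have "lin_comb (\<lambda>(vs, ws). P_gen vs ws) L \<in> fs.span ((\<lambda>(vs, ws). P_gen vs ws) ` HH)"
    by (rule lin_comb_in_span[OF L(1)])
  also have "\<dots> \<subseteq> S2" by (rule fs.span_minimal) (auto intro: P_gen_in)
  finally show ?thesis by (simp only: L(2) P_lin_comb[OF L(1)])
qed

lemma mu_in: assumes "X \<in> S2" shows "mu G X \<in> W"
proof -
  obtain L where L: "snd ` set L \<subseteq> HH" "X = lin_comb g2 L" using span_lin_comb[OF assms] .
  have "lin_comb (\<lambda>(vs, ws). sym_prod G (vs @ ws)) L \<in> fs.span ((\<lambda>(vs, ws). sym_prod G (vs @ ws)) ` HH)"
    by (rule lin_comb_in_span[OF L(1)])
  also have "\<dots> \<subseteq> W" by (rule fs.span_minimal[OF _ subspace_W]) (auto intro: sym_prod_in_W)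
  finally show ?thesis by (simp only: L(2) mu_lin_comb[OF L(1)])
qed

lemma Pk_in: "X \<in> S2 \<Longrightarrow> (P ^^ k) X \<in> S2"
  by (induction k) (auto intro: P_in)

lemma Pk_linear:
  assumes "X \<in> S2" "Y \<in> S2"
  shows "(P ^^ k) (X + Y) = (P ^^ k) X + (P ^^ k) Y" "(P ^^ k) (fscale c X) = fscale c ((P ^^ k) X)" "(P ^^ k) 0 = 0"
proof -
  show "(P ^^ k) (X + Y) = (P ^^ k) X + (P ^^ k) Y"
    by (induction k) (simp_all only: funpow.simps o_apply id_apply P_linear(1)[OF Pk_in[OF assms(1)] Pk_in[OF assms(2)]])
  show "(P ^^ k) (fscale c X) = fscale c ((P ^^ k) X)"
    by (induction k) (simp_all only: funpow.simps o_apply id_apply P_linear(2)[OF Pk_in[OF assms(1)] fs.span_zero])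
  show "(P ^^ k) 0 = 0"
    by (induction k) (simp_all only: funpow.simps o_apply id_apply P_linear(3)[OF fs.span_zero fs.span_zero])
qed

text \<open>The pairs that remain after k contractions of lists of lengths n and m. Writing the
  lengths with + makes the set empty as soon as k exceeds n or m.\<close>

definition J :: "nat \<Rightarrow> nat \<Rightarrow> nat \<Rightarrow> ('v list \<times> 'v list) set" where
  "J n m k = {(vs, ws). vs \<in> hom_lists G \<and> ws \<in> hom_lists G \<and> length vs + k = n \<and> length ws + k = m}"

lemma J_subset: "J n m k \<subseteq> HH"
  by (auto simp: J_def)

definition wgt2 :: "('v \<Rightarrow> real) \<Rightarrow> 'v list \<times> 'v list \<Rightarrow> real" where
  "wgt2 p = (\<lambda>(vs, ws). wgt p vs * wgt p ws)"

text \<open>There are (n - k) * (m - k) terms, each with a sign of norm 1; the bound on \<Lambda>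
  makes up for the weights of the two removed vectors.\<close>

lemma wrep_P_gen:
  assumes p: "p \<in> CS" and \<Lambda>: "\<And>v w. norm (\<Lambda> v w) \<le> p v * p w" and i: "(vs, ws) \<in> J n m k"
  shows "wrep g2 (J n m (Suc k)) (wgt2 p) (P_gen vs ws) (real ((n - k) * (m - k)) * wgt2 p (vs, ws))"
proof -
  have len: "length vs = n - k" "length ws = m - k" and hom: "vs \<in> hom_lists G" "ws \<in> hom_lists G" "k \<le> n" "k \<le> m"
    and len': "length vs + k = n" "length ws + k = m"
    using i by (auto simp: J_def)
  have "wrep g2 (J n m (Suc k)) (wgt2 p)
      (fscale (right_sign a (map (parity G) vs) * left_sign b (map (parity G) ws) * \<Lambda> (vs ! a) (ws ! b))
       (tens2 (sym_prod G (omit a vs)) (sym_prod G (omit b ws)))) (wgt2 p (vs, ws))"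
    if ab: "a < length vs" "b < length ws" for a b
  proof -
    let ?c = "right_sign a (map (parity G) vs) * left_sign b (map (parity G) ws) * \<Lambda> (vs ! a) (ws ! b)"
    have mem: "(omit a vs, omit b ws) \<in> J n m (Suc k)" using ab len' hom by (auto simp: J_def hom_omit)
    have "wrep g2 (J n m (Suc k)) (wgt2 p) (g2 (omit a vs, omit b ws)) (wgt2 p (omit a vs, omit b ws))"
      by (rule wrep_base[OF mem order_refl])
    from wrep_scale[OF this, of ?c]
    have 1: "wrep g2 (J n m (Suc k)) (wgt2 p) (fscale ?c (tens2 (sym_prod G (omit a vs)) (sym_prod G (omit b ws))))
        (norm ?c * wgt2 p (omit a vs, omit b ws))" by simp
    have w: "wgt p vs = p (vs ! a) * wgt p (omit a vs)" "wgt p ws = p (ws ! b) * wgt p (omit b ws)"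
      using prod_list_omit[of a "map p vs"] prod_list_omit[of b "map p ws"] ab by (simp_all add: map_omit)
    have "norm ?c = norm (\<Lambda> (vs ! a) (ws ! b))"
      by (simp add: norm_mult norm_power right_sign_def left_sign_def)
    then have "norm ?c * wgt2 p (omit a vs, omit b ws) \<le> (p (vs ! a) * p (ws ! b)) * wgt2 p (omit a vs, omit b ws)"
      using \<Lambda> by (intro mult_right_mono) (auto simp: wgt2_def wgt_nonneg[OF p])
    also have "\<dots> = wgt2 p (vs, ws)" by (simp add: wgt2_def w)
    finally show ?thesis by (rule wrep_mono[OF 1])
  qed
  then have "wrep g2 (J n m (Suc k)) (wgt2 p) (P_gen vs ws) (\<Sum>a<length vs. \<Sum>b<length ws. wgt2 p (vs, ws))"
    unfolding P_gen_def by (intro wrep_sum) auto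
  then show ?thesis by (simp add: len mult.assoc)
qed

text \<open>The numbers of terms in successive contractions multiply to falling factorials.\<close>

lemma wrep_Pk:
  assumes p: "p \<in> CS" and \<Lambda>: "\<And>v w. norm (\<Lambda> v w) \<le> p v * p w"
    and hom: "vs \<in> hom_lists G" "ws \<in> hom_lists G" "length vs = n" "length ws = m"
  shows "wrep g2 (J n m k) (wgt2 p) ((P ^^ k) (g2 (vs, ws))) (real (falling n k * falling m k) * wgt2 p (vs, ws))"
proof (induction k)
  case 0
  have "(vs, ws) \<in> J n m 0" using hom by (simp add: J_def)
  then have "wrep g2 (J n m 0) (wgt2 p) (g2 (vs, ws)) (real (falling n 0 * falling m 0) * wgt2 p (vs, ws))"
    by (rule wrep_base) (simp add: falling_def)
  then show ?case by (simp only: funpow.simps id_apply)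
next
  case (Suc k)
  obtain L where L: "snd ` set L \<subseteq> J n m k" "(P ^^ k) (g2 (vs, ws)) = lin_comb g2 L"
    "(\<Sum>(c, i)\<leftarrow>L. norm c * wgt2 p i) \<le> real (falling n k * falling m k) * wgt2 p (vs, ws)"
    using Suc.IH unfolding wrep_def by blast
  have e1: "(P ^^ Suc k) (g2 (vs, ws)) = lin_comb (\<lambda>(vs, ws). P_gen vs ws) L"
    using P_lin_comb[OF subset_trans[OF L(1) J_subset]] by (simp only: funpow.simps o_apply L(2))
  have e2: "wrep g2 (J n m (Suc k)) (wgt2 p) (lin_comb (\<lambda>(vs, ws). P_gen vs ws) L)
      (\<Sum>(c, i)\<leftarrow>L. norm c * (real ((n - k) * (m - k)) * wgt2 p i))"
    by (rule wrep_lin_comb[OF L(1)]) (use wrep_P_gen[OF p \<Lambda>] in auto)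
  have e3: "(\<Sum>(c, i)\<leftarrow>L. norm c * (real ((n - k) * (m - k)) * wgt2 p i)) =
      real ((n - k) * (m - k)) * (\<Sum>(c, i)\<leftarrow>L. norm c * wgt2 p i)"
    by (induction L) (auto simp: algebra_simps)
  have e4: "real ((n - k) * (m - k)) * (\<Sum>(c, i)\<leftarrow>L. norm c * wgt2 p i) \<le>
      real ((n - k) * (m - k)) * (real (falling n k * falling m k) * wgt2 p (vs, ws))"
    by (rule mult_left_mono[OF L(3)]) simp
  have e5: "real ((n - k) * (m - k)) * (real (falling n k * falling m k) * wgt2 p (vs, ws)) =
      real (falling n (Suc k) * falling m (Suc k)) * wgt2 p (vs, ws)"
    by (simp add: falling_Suc)
  show ?case unfolding e1 by (rule wrep_mono[OF e2]) (unfold e3, rule order_trans[OF e4 eq_refl[OF e5]])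
qed

text \<open>Nilpotency is read off the estimate: \<open>J\<close> is empty for such k, and so is the
  representation.\<close>

lemma Pk_g2_zero:
  assumes "vs \<in> hom_lists G" "ws \<in> hom_lists G" "k > length vs"
  shows "(P ^^ k) (g2 (vs, ws)) = 0"
proof -
  obtain p where p: "p \<in> CS" "\<And>v w. norm (\<Lambda> v w) \<le> p v * p w" using seminorm_bound_form[OF cont_form] by blast
  have "J (length vs) (length ws) k = {}" using assms(3) by (auto simp: J_def)
  with wrep_Pk[OF p assms(1,2) refl refl, of k]
  obtain L where "snd ` set L \<subseteq> {}" "(P ^^ k) (g2 (vs, ws)) = lin_comb g2 L" unfolding wrep_def by metis
  then show ?thesis by simp
qed

text \<open>Each generator is annihilated by a high power of P, and X is a finite combination of
  generators; hence the star series is a finite sum.\<close>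

lemma Pk_bound:
  assumes "X \<in> S2" obtains K where "\<forall>k>K. (P ^^ k) X = 0"
proof -
  have "\<exists>K. \<forall>k>K. (P ^^ k) X = 0 \<and> X \<in> S2" using assms
  proof (induction rule: fs.span_induct_alt)
    case base
    show ?case using Pk_linear(3)[OF fs.span_zero fs.span_zero] fs.span_zero by blast
  next
    case (step c x y)
    obtain vs ws where x: "x = g2 (vs, ws)" "vs \<in> hom_lists G" "ws \<in> hom_lists G" using step by auto
    obtain K where K: "\<forall>k>K. (P ^^ k) y = 0 \<and> y \<in> S2" using step by blast
    then have y: "y \<in> S2" by blast
    have xS: "x \<in> S2" using g2_in[of "(vs, ws)"] x by blast
    have "(P ^^ k) (fscale c x + y) = 0" if "k > max K (length vs)" for k
    proof -
      have "(P ^^ k) x = 0" "(P ^^ k) y = 0" using that Pk_g2_zero[OF x(2,3)] K x(1) by simp_all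
      then show ?thesis
        by (simp only: Pk_linear(1)[OF fs.span_scale[OF xS] y] Pk_linear(2)[OF xS xS] fs.scale_zero_right add_0_right)
    qed
    then show ?case using fs.span_add[OF fs.span_scale[OF xS] y] by blast
  qed
  with that show ?thesis by blast
qed

text \<open>The star product as a linear map on pairs; bilinearity of \<open>\<star>\<close> then
  comes from \<open>tens2\<close>.\<close>

definition st :: "(('v, 'k) tensor, 'k) tensor \<Rightarrow> ('v, 'k) tensor" where
  "st X = Sum_any (\<lambda>k. fscale (z ^ k / fact k) (mu G ((P ^^ k) X)))"

lemma star_eq: "star G z \<Lambda> a b = st (tens2 a b)"
  by (simp only: star_def st_def)

lemma st_sum:
  assumes "\<forall>k>K. (P ^^ k) X = 0"
  shows "st X = (\<Sum>k\<le>K. fscale (z ^ k / fact k) (mu G ((P ^^ k) X)))"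
  unfolding st_def
proof (rule Sum_any.expand_superset)
  show "{k. fscale (z ^ k / fact k) (mu G ((P ^^ k) X)) \<noteq> 0} \<subseteq> {..K}"
  proof (rule subsetI, rule ccontr)
    fix k assume k: "k \<in> {k. fscale (z ^ k / fact k) (mu G ((P ^^ k) X)) \<noteq> 0}" "k \<notin> {..K}"
    then have "(P ^^ k) X = 0" using assms by simp
    with k(1) show False
      unfolding mem_Collect_eq by (simp only: mu_linear(3)[OF fs.span_zero fs.span_zero] fs.scale_zero_right simp_thms)
  qed
qed simp

lemma st_in: "X \<in> S2 \<Longrightarrow> st X \<in> W"
proof -
  assume X: "X \<in> S2"
  obtain K where K: "\<forall>k>K. (P ^^ k) X = 0" using Pk_bound[OF X] by blast
  have "(\<Sum>k\<le>K. fscale (z ^ k / fact k) (mu G ((P ^^ k) X))) \<in> W"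
    by (intro fs.subspace_sum[OF subspace_W] W_closed mu_in Pk_in X)
  then show ?thesis by (simp only: st_sum[OF K])
qed

lemma st_linear:
  assumes X: "X \<in> S2" and Y: "Y \<in> S2"
  shows "st (X + Y) = st X + st Y" "st (fscale c X) = fscale c (st X)"
proof -
  obtain K1 where K1: "\<forall>k>K1. (P ^^ k) X = 0" using Pk_bound[OF X] by blast
  obtain K2 where K2: "\<forall>k>K2. (P ^^ k) Y = 0" using Pk_bound[OF Y] by blast
  define K where "K = max K1 K2"
  have KX: "\<forall>k>K. (P ^^ k) X = 0" and KY: "\<forall>k>K. (P ^^ k) Y = 0" using K1 K2 by (simp_all add: K_def)
  have KA: "\<forall>k>K. (P ^^ k) (X + Y) = 0" unfolding Pk_linear(1)[OF X Y] using KX KY by simp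
  have KS: "\<forall>k>K. (P ^^ k) (fscale c X) = 0" unfolding Pk_linear(2)[OF X X] using KX by simp
  show "st (X + Y) = st X + st Y"
    unfolding st_sum[OF KX] st_sum[OF KY] st_sum[OF KA]
    by (simp only: Pk_linear(1)[OF X Y] mu_linear(1)[OF Pk_in[OF X] Pk_in[OF Y]] fs.scale_right_distrib sum.distrib)
  show "st (fscale c X) = fscale c (st X)"
    unfolding st_sum[OF KX] st_sum[OF KS]
    by (simp only: Pk_linear(2)[OF X X] mu_linear(2)[OF Pk_in[OF X] Pk_in[OF X]] fs.scale_sum_right fs.scale_scale mult.commute)
qed

abbreviation star_prod (infixl "\<star>" 70) where "a \<star> b \<equiv> star G z \<Lambda> a b"

lemma star_in: "a \<in> W \<Longrightarrow> b \<in> W \<Longrightarrow> a \<star> b \<in> W"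
  unfolding star_eq by (intro st_in tens2_in_span)

lemma star_bilinear:
  assumes "a \<in> W" "a' \<in> W" "b \<in> W" "b' \<in> W"
  shows "(a + a') \<star> b = a \<star> b + a' \<star> b" "a \<star> (b + b') = a \<star> b + a \<star> b'"
    "fscale c a \<star> b = fscale c (a \<star> b)" "a \<star> fscale c b = fscale c (a \<star> b)"
  unfolding star_eq tens2_add tens2_scale using assms
  by (simp_all only: st_linear(1) st_linear(2)[OF _ fs.span_zero] tens2_in_span)

text \<open>The k-th term is estimated by the number of its contractions and by the factorial of its
  degree n + m - 2 k. All exponential factors are moved into q, a multiple of a seminorm.\<close>

lemma star_hom_bound:
  assumes p: "p \<in> CS" and R: "1 / 2 \<le> R" "R < 1"
  obtains q where "q \<in> CS" "\<And>us ws. us \<in> hom_lists G \<Longrightarrow> ws \<in> hom_lists G \<Longrightarrow>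
    seminorm_R G R p (sym_prod G us \<star> sym_prod G ws) \<le> fwgt R q us * fwgt R q ws"
proof -
  obtain p0 where p0: "p0 \<in> CS" "\<And>v w. norm (\<Lambda> v w) \<le> p0 v * p0 w" using seminorm_bound_form[OF cont_form] by blast
  \<comment> \<open>r dominates both p and the seminorm that bounds \<Lambda>.\<close>
  define r where "r v = p v + p0 v" for v
  have r: "r \<in> CS" unfolding r_def[abs_def] by (rule seminorm_add[OF p p0(1)])
  have pr: "p v \<le> r v" "p0 v \<le> r v" for v using seminormD(6)[OF p] seminormD(6)[OF p0(1)] by (simp_all add: r_def)
  have \<Lambda>r: "norm (\<Lambda> v w) \<le> r v * r w" for v w
    using p0(2)[of v w] mult_mono[OF pr(2) pr(2) seminormD(6)[OF r] seminormD(6)[OF p0(1)], of v w] by simp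
  \<comment> \<open>Of the factor 8, 4 comes from \<open>star_coefficient_bound\<close> and 2 from n
    + 1 \<le> 2 ^ n; the powers of 1 + norm z bound those of z.\<close>
  define K where "K = 8 * (1 + norm z)"
  have K: "K \<ge> 1" by (simp add: K_def)
  define q where "q v = K * r v" for v
  have q: "q \<in> CS" unfolding q_def[abs_def] by (rule seminorm_cmult[OF r]) (use K in simp)
  have wq: "wgt q vs = K ^ length vs * wgt r vs" for vs by (induction vs) (auto simp: q_def)
  have "seminorm_R G R p (sym_prod G us \<star> sym_prod G ws) \<le> fwgt R q us * fwgt R q ws"
    if us: "us \<in> hom_lists G" and ws: "ws \<in> hom_lists G" for us ws
  proof -
    define n m where "n = length us" and "m = length ws"
    let ?X = "g2 (us, ws)"
    have XS: "?X \<in> S2" by (rule g2_in) (use us ws in simp)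
    define A where "A = fact n powr R * fact m powr R"
    have A: "A \<ge> 0" by (simp add: A_def)
    have w2: "wgt2 r (us, ws) \<ge> 0" by (simp add: wgt2_def wgt_nonneg[OF r])
    have tm: "seminorm_R G R r (mu G ((P ^^ k) ?X)) \<le>
        fact (n + m - 2 * k) powr R * (real (falling n k * falling m k) * wgt2 r (us, ws))" for k
    proof -
      have w: "wrep g2 (J n m k) (wgt2 r) ((P ^^ k) ?X) (real (falling n k * falling m k) * wgt2 r (us, ws))"
        by (rule wrep_Pk[OF r \<Lambda>r us ws n_def[symmetric] m_def[symmetric]])
      obtain L where L: "snd ` set L \<subseteq> J n m k" "(P ^^ k) ?X = lin_comb g2 L"
        "(\<Sum>(c, i)\<leftarrow>L. norm c * wgt2 r i) \<le> real (falling n k * falling m k) * wgt2 r (us, ws)"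
        using w unfolding wrep_def by blast
      let ?g = "\<lambda>(vs, ws). sym_prod G (vs @ ws)"
      have "mu G ((P ^^ k) ?X) = lin_comb ?g L" unfolding L(2) by (rule mu_lin_comb[OF subset_trans[OF L(1) J_subset]])
      then have "wrep ?g (J n m k) (wgt2 r) (mu G ((P ^^ k) ?X)) (real (falling n k * falling m k) * wgt2 r (us, ws))"
        using L(1,3) unfolding wrep_def by blast
      then have w': "wrep ?g (J n m k) (\<lambda>i. fwgt R r (fst i @ snd i)) (mu G ((P ^^ k) ?X))
          (fact (n + m - 2 * k) powr R * (real (falling n k * falling m k) * wgt2 r (us, ws)))"
      proof (rule wrep_weight)
        fix i assume "i \<in> J n m k"
        then obtain vs vs' where i: "i = (vs, vs')" "length vs + k = n" "length vs' + k = m" by (auto simp: J_def)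
        then have "length vs + length vs' = n + m - 2 * k" by linarith
        then show "fwgt R r (fst i @ snd i) = fact (n + m - 2 * k) powr R * wgt2 r i"
          by (simp add: i wgt2_def)
      qed simp
      show ?thesis
      proof (rule wrep_bound[OF w', of "seminorm_R G R r"])
        have sub: "fs.span (?g ` J n m k) \<subseteq> T"
          by (rule fs.span_minimal[OF _ subspace_tensors]) (auto intro: W_in_T sym_prod_in_W)
        show "seminorm_R G R r (x + y) \<le> seminorm_R G R r x + seminorm_R G R r y"
          if "x \<in> fs.span (?g ` J n m k)" "y \<in> fs.span (?g ` J n m k)" for x y
          by (rule seminorm_R_add[OF r]) (use that sub in blast)+
        fix c i assume "i \<in> J n m k"
        then obtain vs vs' where i: "i = (vs, vs')" "vs @ vs' \<in> hom_lists G" by (auto simp: J_def)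
        have "seminorm_R G R r (fscale c (sym_prod G (vs @ vs'))) \<le> norm c * fwgt R r (vs @ vs')"
          using seminorm_R_scale[OF r W_in_T[OF sym_prod_in_W]] mult_left_mono[OF seminorm_R_sym_prod[OF r i(2)] norm_ge_zero]
          by (rule order_trans)
        then show "seminorm_R G R r (fscale c (?g i)) \<le> norm c * fwgt R r (fst i @ snd i)" by (simp add: i)
      next
        show "seminorm_R G R r 0 \<le> 0" by (rule eq_refl[OF seminorm_R_0[OF r]])
      qed
    qed
    have T': "fscale (z ^ k / fact k) (mu G ((P ^^ k) ?X)) \<in> T" for k
      by (intro W_in_T W_closed mu_in Pk_in XS)
    have bd: "seminorm_R G R r (fscale (z ^ k / fact k) (mu G ((P ^^ k) ?X))) \<le> norm z ^ k * (4 ^ (n + m) * A * wgt2 r (us, ws))" for k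
    proof -
      have nf: "norm (fact k :: 'k) = fact k" by (metis norm_of_nat of_nat_fact)
      have "seminorm_R G R r (fscale (z ^ k / fact k) (mu G ((P ^^ k) ?X))) \<le>
          norm (z ^ k / fact k) * seminorm_R G R r (mu G ((P ^^ k) ?X))"
        by (rule seminorm_R_scale[OF r W_in_T[OF mu_in[OF Pk_in[OF XS]]]])
      also have "\<dots> \<le> norm (z ^ k / fact k) *
          (fact (n + m - 2 * k) powr R * (real (falling n k * falling m k) * wgt2 r (us, ws)))"
        by (intro mult_left_mono tm) simp
      also have "\<dots> = norm z ^ k * ((real (falling n k) * real (falling m k) / fact k * fact (n + m - 2 * k) powr R) * wgt2 r (us, ws))"
        by (simp add: norm_divide norm_power nf)
      also have "\<dots> \<le> norm z ^ k * ((4 ^ (n + m) * A) * wgt2 r (us, ws))"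
      proof (intro mult_left_mono mult_right_mono w2)
        show "real (falling n k) * real (falling m k) / fact k * fact (n + m - 2 * k) powr R \<le> 4 ^ (n + m) * A"
          using star_coefficient_bound[OF R, of k n m] falling_zero[of n k] falling_zero[of m k] A
          unfolding A_def by (cases "k \<le> n \<and> k \<le> m") (auto simp: not_le)
      qed simp
      finally show ?thesis by simp
    qed
    have "sym_prod G us \<star> sym_prod G ws = (\<Sum>k\<le>n. fscale (z ^ k / fact k) (mu G ((P ^^ k) ?X)))"
      using st_sum[of n ?X] Pk_g2_zero[OF us ws] unfolding star_eq n_def by simp
    moreover have "seminorm_R G R r (\<Sum>k\<in>B. fscale (z ^ k / fact k) (mu G ((P ^^ k) ?X))) \<le>
        (\<Sum>k\<in>B. norm z ^ k * (4 ^ (n + m) * A * wgt2 r (us, ws)))" if "finite B" for B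
      using that
    proof (induction B)
      case empty
      show ?case unfolding sum.empty by (rule eq_refl[OF seminorm_R_0[OF r]])
    next
      case (insert k B)
      have sT: "(\<Sum>k\<in>B. fscale (z ^ k / fact k) (mu G ((P ^^ k) ?X))) \<in> T"
        by (rule fs.subspace_sum[OF subspace_tensors T'])
      show ?case unfolding sum.insert[OF insert.hyps]
        using seminorm_R_add[OF r T' sT, of R k] bd[of k] insert.IH by linarith
    qed
    ultimately have 1: "seminorm_R G R r (sym_prod G us \<star> sym_prod G ws) \<le> (\<Sum>k\<le>n. norm z ^ k * (4 ^ (n + m) * A * wgt2 r (us, ws)))"
      by simp
    have "(\<Sum>k\<le>n. norm z ^ k) \<le> (\<Sum>k\<le>n. (1 + norm z) ^ n)"
    proof (rule sum_mono)
      fix k assume "k \<in> {..n}"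
      then have "(1 + norm z) ^ k \<le> (1 + norm z) ^ n" by (intro power_increasing) auto
      moreover have "norm z ^ k \<le> (1 + norm z) ^ k" by (intro power_mono) auto
      ultimately show "norm z ^ k \<le> (1 + norm z) ^ n" by simp
    qed
    also have "\<dots> = real (Suc n) * (1 + norm z) ^ n" by simp
    also have "\<dots> \<le> 2 ^ n * (1 + norm z) ^ n"
    proof (rule mult_right_mono)
      have "Suc n \<le> 2 ^ n" by (induction n) auto
      then show "real (Suc n) \<le> 2 ^ n" by (metis of_nat_le_iff of_nat_numeral of_nat_power)
    qed simp
    also have "\<dots> = (2 * (1 + norm z)) ^ n" by (rule power_mult_distrib[symmetric])
    also have "\<dots> \<le> (2 * (1 + norm z)) ^ (n + m)"
      using norm_ge_zero[of z] by (intro power_increasing) auto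
    finally have 2: "(\<Sum>k\<le>n. norm z ^ k) \<le> (2 * (1 + norm z)) ^ (n + m)" .
    have "seminorm_R G R p (sym_prod G us \<star> sym_prod G ws) \<le> seminorm_R G R r (sym_prod G us \<star> sym_prod G ws)"
      by (rule seminorm_R_mono[OF p r pr(1) W_in_T[OF star_in[OF sym_prod_in_W sym_prod_in_W]]])
    also note 1
    also have "(\<Sum>k\<le>n. norm z ^ k * (4 ^ (n + m) * A * wgt2 r (us, ws))) = (\<Sum>k\<le>n. norm z ^ k) * (4 ^ (n + m) * A * wgt2 r (us, ws))"
      by (rule sum_distrib_right[symmetric])
    also have "\<dots> \<le> (2 * (1 + norm z)) ^ (n + m) * (4 ^ (n + m) * A * wgt2 r (us, ws))"
      using 2 by (rule mult_right_mono) (use A w2 in simp)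
    also have "\<dots> = ((2 * (1 + norm z)) ^ (n + m) * 4 ^ (n + m)) * A * wgt2 r (us, ws)" by (simp only: mult.assoc)
    also have "(2 * (1 + norm z)) ^ (n + m) * 4 ^ (n + m) = K ^ (n + m)"
      unfolding power_mult_distrib[symmetric] K_def by (simp add: algebra_simps)
    also have "K ^ (n + m) * A * wgt2 r (us, ws) = fwgt R q us * fwgt R q ws"
      by (simp add: wq A_def wgt2_def power_add n_def[symmetric] m_def[symmetric])
    finally show ?thesis .
  qed
  with q that show ?thesis by blast
qed

lemma star_continuous:
  assumes p: "p \<in> CS" and R: "1 / 2 \<le> R" "R < 1"
  obtains q where "q \<in> CS" "\<And>a b. a \<in> W \<Longrightarrow> b \<in> W \<Longrightarrow>
    seminorm_R G R p (a \<star> b) \<le> seminorm_R G R q a * seminorm_R G R q b"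
proof -
  obtain q where q: "q \<in> CS" "\<And>us ws. us \<in> hom_lists G \<Longrightarrow> ws \<in> hom_lists G \<Longrightarrow>
    seminorm_R G R p (sym_prod G us \<star> sym_prod G ws) \<le> fwgt R q us * fwgt R q ws"
    using star_hom_bound[OF p R] by blast
  have "seminorm_R G R p (a \<star> b) \<le> seminorm_R G R (ghull q) a * seminorm_R G R (ghull q) b"
    if "a \<in> W" "b \<in> W" for a b
    by (rule bilinear_bound[OF p q(1) that star_in star_bilinear(1)[OF _ _ _ W_closed(1)]
        star_bilinear(2)[OF _ W_closed(1)] star_bilinear(3)[OF _ W_closed(1) _ W_closed(1)]
        star_bilinear(4)[OF _ W_closed(1) _ W_closed(1)] q(2)])
  with that seminorm_ghull[OF q(1)] show ?thesis by blast
qed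

end

subsection \<open>The completion\<close>

locale seminormed =
  fixes V :: "'a::ab_group_add set" and Q :: "('a \<Rightarrow> real) set"
  assumes V0: "0 \<in> V" and V_add: "x \<in> V \<Longrightarrow> y \<in> V \<Longrightarrow> x + y \<in> V"
    and V_diff: "x \<in> V \<Longrightarrow> y \<in> V \<Longrightarrow> x - y \<in> V"
    and Q_ne: "Q \<noteq> {}"
    and q_nonneg: "q \<in> Q \<Longrightarrow> x \<in> V \<Longrightarrow> 0 \<le> q x"
    and q_zero: "q \<in> Q \<Longrightarrow> q 0 = 0"
    and q_add: "q \<in> Q \<Longrightarrow> x \<in> V \<Longrightarrow> y \<in> V \<Longrightarrow> q (x + y) \<le> q x + q y"
    and q_diff: "q \<in> Q \<Longrightarrow> x \<in> V \<Longrightarrow> y \<in> V \<Longrightarrow> q (x - y) \<le> q x + q y"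
begin

abbreviation "CF \<equiv> cauchy_filters V Q"
abbreviation "cls \<equiv> cauchy_class V Q"
abbreviation "Cpl \<equiv> completion_space V Q"
abbreviation "emb0 \<equiv> completion_emb V Q"
abbreviation "lift2 \<equiv> completion_lift2 V Q"
abbreviation "csn \<equiv> completion_seminorm"

section \<open>Equivalence of Cauchy filters\<close>

definition rel :: "'a filter \<Rightarrow> 'a filter \<Rightarrow> bool" where
  "rel F H \<longleftrightarrow> (\<forall>q\<in>Q. \<forall>e>0. eventually (\<lambda>(x, y). q (x - y) < e) (F \<times>\<^sub>F H))"

lemma q_sym: "q \<in> Q \<Longrightarrow> x \<in> V \<Longrightarrow> y \<in> V \<Longrightarrow> q (x - y) = q (y - x)"
proof -
  assume a: "q \<in> Q" "x \<in> V" "y \<in> V"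
  have "q (0 - u) \<le> q u" if "u \<in> V" for u using q_diff[OF a(1) V0 that] q_zero[OF a(1)] by simp
  from this[OF V_diff[OF a(2,3)]] this[OF V_diff[OF a(3,2)]] show ?thesis by simp
qed

lemma q_triangle: "q \<in> Q \<Longrightarrow> x \<in> V \<Longrightarrow> y \<in> V \<Longrightarrow> z \<in> V \<Longrightarrow> q (x - z) \<le> q (x - y) + q (y - z)"
  using q_add[of q "x - y" "y - z"] V_diff by simp

lemma CF_iff: "F \<in> CF \<longleftrightarrow> F \<noteq> bot \<and> eventually (\<lambda>x. x \<in> V) F \<and> rel F F"
  unfolding cauchy_filters_def rel_def le_principal by auto

lemma CF_D: assumes "F \<in> CF" shows "F \<noteq> bot" "eventually (\<lambda>x. x \<in> V) F" "rel F F"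
  using assms by (auto simp: CF_iff)

lemma relE:
  assumes "rel F H" "q \<in> Q" "e > 0"
  obtains P R where "eventually P F" "eventually R H" "\<And>x y. P x \<Longrightarrow> R y \<Longrightarrow> q (x - y) < e"
  using assms unfolding rel_def eventually_prod_filter by fastforce

lemma relI:
  assumes "\<And>q e. q \<in> Q \<Longrightarrow> e > 0 \<Longrightarrow> \<exists>P R. eventually P F \<and> eventually R H \<and> (\<forall>x y. P x \<longrightarrow> R y \<longrightarrow> q (x - y) < e)"
  shows "rel F H"
  using assms unfolding rel_def eventually_prod_filter by fastforce

lemma rel_sym: assumes "F \<in> CF" "H \<in> CF" "rel F H" shows "rel H F"
proof (rule relI)
  fix q and e :: real assume q: "q \<in> Q" "e > 0"
  obtain P R where PR: "eventually P F" "eventually R H" "\<And>x y. P x \<Longrightarrow> R y \<Longrightarrow> q (x - y) < e"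
    by (rule relE[OF assms(3) q]) (rule that)
  have "eventually (\<lambda>y. R y \<and> y \<in> V) H" "eventually (\<lambda>x. P x \<and> x \<in> V) F"
    using PR CF_D assms by (auto intro: eventually_conj)
  moreover have "q (y - x) < e" if "R y \<and> y \<in> V" "P x \<and> x \<in> V" for x y
    using PR(3)[of x y] q_sym[OF q(1), of x y] that by simp
  ultimately show "\<exists>P R. eventually P H \<and> eventually R F \<and> (\<forall>x y. P x \<longrightarrow> R y \<longrightarrow> q (x - y) < e)"
    by blast
qed

lemma rel_trans: assumes "F \<in> CF" "H \<in> CF" "K \<in> CF" "rel F H" "rel H K" shows "rel F K"
proof (rule relI)
  fix q and e :: real assume q: "q \<in> Q" "e > 0"
  then have e2: "e / 2 > 0" by simp
  obtain P R where PR: "eventually P F" "eventually R H" "\<And>x y. P x \<Longrightarrow> R y \<Longrightarrow> q (x - y) < e / 2"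
    by (rule relE[OF assms(4) q(1) e2]) (rule that)
  obtain R' S where RS: "eventually R' H" "eventually S K" "\<And>x y. R' x \<Longrightarrow> S y \<Longrightarrow> q (x - y) < e / 2"
    by (rule relE[OF assms(5) q(1) e2]) (rule that)
  have "eventually (\<lambda>y. R y \<and> R' y \<and> y \<in> V) H" using PR RS CF_D(2)[OF assms(2)] by (auto intro: eventually_conj)
  then obtain y where y: "R y" "R' y" "y \<in> V" using CF_D(1)[OF assms(2)] eventually_happens by blast
  have "eventually (\<lambda>x. P x \<and> x \<in> V) F" "eventually (\<lambda>x. S x \<and> x \<in> V) K"
    using PR RS CF_D(2) assms by (auto intro: eventually_conj)
  moreover have "q (x - w) < e" if "P x \<and> x \<in> V" "S w \<and> w \<in> V" for x w
    using q_triangle[OF q(1), of x y w] PR(3)[of x y] RS(3)[of y w] y that by simp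
  ultimately show "\<exists>P R. eventually P F \<and> eventually R K \<and> (\<forall>x y. P x \<longrightarrow> R y \<longrightarrow> q (x - y) < e)" by blast
qed

lemma cls_iff: "H \<in> cls F \<longleftrightarrow> H \<in> CF \<and> rel F H"
  by (simp add: cauchy_class_def rel_def)

lemma cls_eq:
  assumes "F \<in> CF" "H \<in> CF" "rel F H" shows "cls F = cls H"
  using assms rel_sym rel_trans unfolding set_eq_iff cls_iff by meson

lemma cls_self: "F \<in> CF \<Longrightarrow> F \<in> cls F"
  by (simp add: cls_iff CF_D)

lemma cls_in: "F \<in> CF \<Longrightarrow> cls F \<in> Cpl"
  by (simp add: completion_space_def)

lemma CplE: assumes "X \<in> Cpl" obtains F where "F \<in> CF" "X = cls F"
  using assms by (auto simp: completion_space_def)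

text \<open>Eventual properties pass to finer filters. This allows a product of two filters to be
  replaced by the filter of a single sequence.\<close>

lemma sub_filter:
  assumes "K \<in> CF" "F \<le> K" "F \<noteq> bot" shows "F \<in> CF" "rel K F" "cls F = cls K"
proof -
  have *: "rel F' K'" if "F' \<le> K" "K' \<le> K" for F' K'
    using CF_D(3)[OF assms(1)] prod_filter_mono[OF that] unfolding rel_def by (blast intro: filter_leD)
  show F: "F \<in> CF" using CF_D(2)[OF assms(1)] assms *[of F F] by (auto simp: CF_iff intro: filter_leD)
  show "rel K F" using *[of K F] assms by simp
  with F assms(1) show "cls F = cls K" using cls_eq by metis
qed

text \<open>Covers addition, subtraction and continuous bilinear maps at once.\<close>

definition good :: "('a \<Rightarrow> 'a \<Rightarrow> 'a) \<Rightarrow> bool" where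
  "good f \<longleftrightarrow> (\<forall>a\<in>V. \<forall>b\<in>V. f a b \<in> V) \<and> (\<forall>q\<in>Q. \<exists>q'\<in>Q. \<exists>C. \<forall>a\<in>V. \<forall>a'\<in>V. \<forall>b\<in>V. \<forall>b'\<in>V.
     q (f a b - f a' b') \<le> C * (q' (a - a') * (1 + q' b) + (1 + q' a') * q' (b - b')))"

abbreviation fm :: "('a \<Rightarrow> 'a \<Rightarrow> 'a) \<Rightarrow> 'a filter \<Rightarrow> 'a filter \<Rightarrow> 'a filter" where
  "fm f F H \<equiv> filtermap (\<lambda>(x, y). f x y) (F \<times>\<^sub>F H)"

text \<open>Eventually a Cauchy filter stays within distance 1 of one fixed point y of V.\<close>

lemma CF_bounded:
  assumes "F \<in> CF" "q \<in> Q" obtains M where "M \<ge> 0" "eventually (\<lambda>x. q x \<le> M) F"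
proof -
  obtain P R where PR: "eventually P F" "eventually R F" "\<And>x y. P x \<Longrightarrow> R y \<Longrightarrow> q (x - y) < 1"
    using relE[OF CF_D(3)[OF assms(1)] assms(2), of 1] by auto
  have "eventually (\<lambda>y. R y \<and> y \<in> V) F" using PR CF_D(2)[OF assms(1)] by (auto intro: eventually_conj)
  then obtain y where y: "R y" "y \<in> V" using CF_D(1)[OF assms(1)] eventually_happens by blast
  have "eventually (\<lambda>x. q x \<le> 1 + q y) F"
    using eventually_conj[OF PR(1) CF_D(2)[OF assms(1)]]
  proof (rule eventually_mono)
    fix x assume x: "P x \<and> x \<in> V"
    then have "q x \<le> q (x - y) + q y" using q_add[OF assms(2) V_diff[of x y] y(2)] y by simp
    then show "q x \<le> 1 + q y" using PR(3)[of x y] x y by simp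
  qed
  moreover have "0 \<le> 1 + q y" using q_nonneg[OF assms(2) y(2)] by simp
  ultimately show ?thesis using that by blast
qed

text \<open>The Lipschitz factor in \<open>good\<close> is unbounded on V, but the seminorms in it
  are bounded along H and F'.\<close>

lemma good_rel:
  assumes f: "good f" and F: "F \<in> CF" "F' \<in> CF" "rel F F'" and H: "H \<in> CF" "H' \<in> CF" "rel H H'"
  shows "rel (fm f F H) (fm f F' H')"
proof (rule relI)
  fix q and e :: real assume q: "q \<in> Q" "e > 0"
  obtain q' C where q': "q' \<in> Q" "\<And>a a' b b'. a \<in> V \<Longrightarrow> a' \<in> V \<Longrightarrow> b \<in> V \<Longrightarrow> b' \<in> V \<Longrightarrow>
     q (f a b - f a' b') \<le> C * (q' (a - a') * (1 + q' b) + (1 + q' a') * q' (b - b'))"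
    using f q(1) unfolding good_def by blast
  obtain M where M: "M \<ge> 0" "eventually (\<lambda>x. q' x \<le> M) H" using CF_bounded[OF H(1) q'(1)] .
  obtain N where N: "N \<ge> 0" "eventually (\<lambda>x. q' x \<le> N) F'" using CF_bounded[OF F(2) q'(1)] .
  \<comment> \<open>s is the Lipschitz factor for the bounds M and N, with 1 + \<bar>C\<bar> in
    place of C, whose sign is unknown. Distances below e / (2 s) then give at most e / 2.\<close>
  define s where "s = (1 + \<bar>C\<bar>) * (2 + M + N)"
  have s: "s > 0" using M N by (simp add: s_def)
  define d where "d = e / (2 * s)"
  have d: "d > 0" using q(2) s by (simp add: d_def)
  obtain P1 P1' where P1: "eventually P1 F" "eventually P1' F'" "\<And>x y. P1 x \<Longrightarrow> P1' y \<Longrightarrow> q' (x - y) < d"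
    by (rule relE[OF F(3) q'(1) d]) (rule that)
  obtain P2 P2' where P2: "eventually P2 H" "eventually P2' H'" "\<And>x y. P2 x \<Longrightarrow> P2' y \<Longrightarrow> q' (x - y) < d"
    by (rule relE[OF H(3) q'(1) d]) (rule that)
  define A B A' B' where "A x \<longleftrightarrow> P1 x \<and> x \<in> V" and "B x \<longleftrightarrow> P2 x \<and> x \<in> V \<and> q' x \<le> M"
    and "A' x \<longleftrightarrow> P1' x \<and> x \<in> V \<and> q' x \<le> N" and "B' x \<longleftrightarrow> P2' x \<and> x \<in> V" for x
  have ev: "eventually A F" "eventually B H" "eventually A' F'" "eventually B' H'"
    unfolding A_def B_def A'_def B'_def using P1 P2 M N CF_D(2) F H by (auto intro!: eventually_conj)
  have bd: "q (f a b - f a' b') < e" if "A a" "B b" "A' a'" "B' b'" for a b a' b'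
  proof -
    have nn: "0 \<le> q' (a - a')" "0 \<le> q' b" "0 \<le> q' a'" "0 \<le> q' (b - b')"
      using that q_nonneg[OF q'(1)] V_diff by (auto simp: A_def B_def A'_def B'_def)
    have "q (f a b - f a' b') \<le> C * (q' (a - a') * (1 + q' b) + (1 + q' a') * q' (b - b'))"
      by (rule q'(2)) (use that in \<open>auto simp: A_def B_def A'_def B'_def\<close>)
    also have "\<dots> \<le> (1 + \<bar>C\<bar>) * (q' (a - a') * (1 + q' b) + (1 + q' a') * q' (b - b'))"
      using nn by (intro mult_right_mono) auto
    also have "\<dots> \<le> (1 + \<bar>C\<bar>) * (d * (1 + M) + (1 + N) * d)"
    proof (rule mult_left_mono, rule add_mono; (rule mult_mono)?)
      show "q' (a - a') \<le> d" "q' (b - b') \<le> d" using P1(3) P2(3) that by (auto simp: A_def B_def A'_def B'_def intro: less_imp_le)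
      show "1 + q' b \<le> 1 + M" "1 + q' a' \<le> 1 + N" using that by (auto simp: A'_def B_def)
    qed (use d N nn in auto)
    also have "\<dots> = d * s" by (simp add: s_def algebra_simps)
    also have "\<dots> = e / 2" using s by (simp add: d_def)
    also have "\<dots> < e" using q(2) by simp
    finally show ?thesis .
  qed
  have "eventually (\<lambda>u. \<exists>a b. u = f a b \<and> A a \<and> B b) (fm f F H)"
    unfolding eventually_filtermap eventually_prod_filter using ev(1,2) by (intro exI[of _ A] exI[of _ B]) auto
  moreover have "eventually (\<lambda>u. \<exists>a b. u = f a b \<and> A' a \<and> B' b) (fm f F' H')"
    unfolding eventually_filtermap eventually_prod_filter using ev(3,4) by (intro exI[of _ A'] exI[of _ B']) auto
  ultimately show "\<exists>P R. eventually P (fm f F H) \<and> eventually R (fm f F' H') \<and> (\<forall>x y. P x \<longrightarrow> R y \<longrightarrow> q (x - y) < e)"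
    using bd by blast
qed

lemma good_CF:
  assumes "good f" "F \<in> CF" "H \<in> CF" shows "fm f F H \<in> CF"
proof -
  have "eventually (\<lambda>u. u \<in> V) (fm f F H)"
    unfolding eventually_filtermap eventually_prod_filter
    using CF_D(2)[OF assms(2)] CF_D(2)[OF assms(3)] assms(1)
    by (intro exI[of _ "\<lambda>x. x \<in> V"]) (auto simp: good_def)
  moreover have "fm f F H \<noteq> bot"
    using CF_D(1) assms(2,3) by (simp add: filtermap_bot_iff prod_filter_eq_bot)
  ultimately show ?thesis using good_rel[OF assms(1,2,2) _ assms(3,3)] CF_D(3) assms by (simp add: CF_iff)
qed

lemma lift2_cls:
  assumes f: "good f" and F: "F \<in> CF" and H: "H \<in> CF"
  shows "lift2 f (cls F) (cls H) = cls (fm f F H)"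
proof -
  have "cls (fm f F' H') = cls (fm f F H)" if "F' \<in> cls F" "H' \<in> cls H" for F' H'
    using that cls_eq[OF good_CF[OF f F H] good_CF[OF f] good_rel[OF f F _ _ H], symmetric] by (simp add: cls_iff)
  then show ?thesis unfolding completion_lift2_def using cls_self[OF F] cls_self[OF H] by blast
qed

section \<open>Cauchy sequences as representatives of points\<close>

definition cs :: "(nat \<Rightarrow> 'a) \<Rightarrow> bool" where
  "cs a \<longleftrightarrow> (\<forall>n. a n \<in> V) \<and> (\<forall>q\<in>Q. \<forall>e>0. \<exists>N. \<forall>m\<ge>N. \<forall>n\<ge>N. q (a m - a n) < e)"

definition sq :: "(nat \<Rightarrow> 'a) \<Rightarrow> 'a filter set" where
  "sq a = cls (filtermap a sequentially)"

lemma cs_CF: "cs a \<Longrightarrow> filtermap a sequentially \<in> CF"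
proof -
  assume a: "cs a"
  have "rel (filtermap a sequentially) (filtermap a sequentially)"
  proof (rule relI)
    fix q and e :: real assume "q \<in> Q" "e > 0"
    then obtain N where N: "\<And>m n. m \<ge> N \<Longrightarrow> n \<ge> N \<Longrightarrow> q (a m - a n) < e" using a unfolding cs_def by blast
    have "eventually (\<lambda>u. \<exists>n\<ge>N. u = a n) (filtermap a sequentially)"
      unfolding eventually_filtermap eventually_sequentially by blast
    then show "\<exists>P R. eventually P (filtermap a sequentially) \<and> eventually R (filtermap a sequentially) \<and> (\<forall>x y. P x \<longrightarrow> R y \<longrightarrow> q (x - y) < e)"
      using N by blast
  qed
  then show ?thesis using a by (auto simp: CF_iff filtermap_bot_iff eventually_filtermap cs_def)
qed

lemma cs_in: "cs a \<Longrightarrow> a n \<in> V"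
  by (simp add: cs_def)

lemma sq_in: "cs a \<Longrightarrow> sq a \<in> Cpl"
  unfolding sq_def by (intro cls_in cs_CF)

lemma cs_const: "x \<in> V \<Longrightarrow> cs (\<lambda>n. x)"
  by (auto simp: cs_def q_zero)

lemma emb_sq: "emb0 x = sq (\<lambda>n. x)"
proof -
  have "filtermap (\<lambda>n::nat. x) sequentially = principal {x}"
    unfolding filter_eq_iff eventually_filtermap eventually_principal by simp
  then show ?thesis by (simp add: completion_emb_def sq_def)
qed

text \<open>The criterion by which identities between limits are proved: since a is Cauchy, it
  suffices to compare the two sequences at equal indices.\<close>

lemma sq_eq:
  assumes a: "cs a" and b: "cs b" and lim: "\<And>q. q \<in> Q \<Longrightarrow> (\<lambda>n. q (a n - b n)) \<longlonglongrightarrow> 0"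
  shows "sq a = sq b"
  unfolding sq_def
proof (rule cls_eq[OF cs_CF[OF a] cs_CF[OF b] relI])
  fix q and e :: real assume q: "q \<in> Q" "e > 0"
  then have e2: "e / 2 > 0" by simp
  obtain N1 where N1: "\<And>m n. m \<ge> N1 \<Longrightarrow> n \<ge> N1 \<Longrightarrow> q (a m - a n) < e / 2" using a q(1) e2 unfolding cs_def by blast
  obtain N2 where N2: "\<And>n. n \<ge> N2 \<Longrightarrow> q (a n - b n) < e / 2"
    using order_tendstoD(2)[OF lim[OF q(1)] e2] unfolding eventually_sequentially by blast
  let ?N = "max N1 N2"
  have "eventually (\<lambda>u. \<exists>n\<ge>?N. u = a n) (filtermap a sequentially)" "eventually (\<lambda>u. \<exists>n\<ge>?N. u = b n) (filtermap b sequentially)"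
    unfolding eventually_filtermap eventually_sequentially by blast+
  moreover have "q (a m - b n) < e" if "m \<ge> ?N" "n \<ge> ?N" for m n
    using q_triangle[OF q(1), of "a m" "a n" "b n"] N1[of m n] N2[of n] that cs_in[OF a] cs_in[OF b] by simp
  ultimately show "\<exists>P R. eventually P (filtermap a sequentially) \<and> eventually R (filtermap b sequentially) \<and> (\<forall>x y. P x \<longrightarrow> R y \<longrightarrow> q (x - y) < e)"
    by (smt (verit))
qed

lemma CF_cs: "(\<And>n. a n \<in> V) \<Longrightarrow> filtermap a sequentially \<in> CF \<Longrightarrow> cs a"
proof -
  assume a: "\<And>n. a n \<in> V" "filtermap a sequentially \<in> CF"
  show "cs a" unfolding cs_def
  proof (intro conjI allI ballI impI a(1))
    fix q and e :: real assume q: "q \<in> Q" "e > 0"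
    obtain P R where PR: "eventually P (filtermap a sequentially)" "eventually R (filtermap a sequentially)" "\<And>x y. P x \<Longrightarrow> R y \<Longrightarrow> q (x - y) < e"
      by (rule relE[OF CF_D(3)[OF a(2)] q]) (rule that)
    obtain N1 N2 where "\<And>n. n \<ge> N1 \<Longrightarrow> P (a n)" "\<And>n. n \<ge> N2 \<Longrightarrow> R (a n)"
      using PR(1,2) unfolding eventually_filtermap eventually_sequentially by blast
    then show "\<exists>N. \<forall>m\<ge>N. \<forall>n\<ge>N. q (a m - a n) < e" using PR(3) by (intro exI[of _ "max N1 N2"]) auto
  qed
qed

text \<open>The sequence of pairs is finer than the product filter, so the sequence of values is
  finer than the image filter and represents the same class.\<close>

lemma lift2_sq:
  assumes f: "good f" and a: "cs a" and b: "cs b"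
  shows "lift2 f (sq a) (sq b) = sq (\<lambda>n. f (a n) (b n))" "cs (\<lambda>n. f (a n) (b n))"
proof -
  let ?K = "fm f (filtermap a sequentially) (filtermap b sequentially)"
  have K: "?K \<in> CF" by (rule good_CF[OF f cs_CF[OF a] cs_CF[OF b]])
  have "filterlim (\<lambda>n. (a n, b n)) (filtermap a sequentially \<times>\<^sub>F filtermap b sequentially) sequentially"
    by (intro filterlim_Pair) (simp_all add: filterlim_def)
  then have le: "filtermap (\<lambda>n. f (a n) (b n)) sequentially \<le> ?K"
    using filtermap_mono[of "filtermap (\<lambda>n. (a n, b n)) sequentially" _ "\<lambda>(x, y). f x y"]
    by (simp add: filterlim_def filtermap_filtermap)
  have nb: "filtermap (\<lambda>n. f (a n) (b n)) sequentially \<noteq> bot" by (simp add: filtermap_bot_iff)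
  note sub = sub_filter[OF K le nb]
  show "cs (\<lambda>n. f (a n) (b n))"
    by (rule CF_cs[OF _ sub(1)]) (use f cs_in[OF a] cs_in[OF b] in \<open>auto simp: good_def\<close>)
  show "lift2 f (sq a) (sq b) = sq (\<lambda>n. f (a n) (b n))"
    unfolding sq_def lift2_cls[OF f cs_CF[OF a] cs_CF[OF b]] using sub(3) by simp
qed

text \<open>A unary map is treated as a binary one that ignores its second argument, so that
  \<open>good\<close> serves both.\<close>

lemma lift_sq:
  assumes f: "good (\<lambda>a b. f a)" and a: "cs a"
  shows "completion_lift V Q f (sq a) = sq (\<lambda>n. f (a n))" "cs (\<lambda>n. f (a n))"
proof -
  have *: "fm (\<lambda>a b. f a) F H = filtermap f F" if FH: "F \<in> CF" "H \<in> CF" for F H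
  proof -
    have "eventually P (fm (\<lambda>a b. f a) F H) \<longleftrightarrow> eventually P (filtermap f F)" for P
    proof
      assume "eventually P (fm (\<lambda>a b. f a) F H)"
      then obtain A B where "eventually A F" "eventually B H" "\<And>x y. A x \<Longrightarrow> B y \<Longrightarrow> P (f x)"
        unfolding eventually_filtermap eventually_prod_filter by auto
      moreover obtain y where "B y" using calculation(2) CF_D(1)[OF FH(2)] eventually_happens by blast
      ultimately show "eventually P (filtermap f F)" unfolding eventually_filtermap by (auto elim: eventually_mono)
    next
      assume "eventually P (filtermap f F)"
      then show "eventually P (fm (\<lambda>a b. f a) F H)"
        unfolding eventually_filtermap eventually_prod_filter by (intro exI[of _ "\<lambda>x. P (f x)"] exI[of _ "\<lambda>x. True"]) simp
    qed
    then show ?thesis by (simp add: filter_eq_iff)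
  qed
  have "completion_lift V Q f (sq a) = lift2 (\<lambda>a b. f a) (sq a) (sq a)"
    unfolding completion_lift_def completion_lift2_def sq_def
    using * cls_self[OF cs_CF[OF a]] by (auto simp: cls_iff)
  then show "completion_lift V Q f (sq a) = sq (\<lambda>n. f (a n))" "cs (\<lambda>n. f (a n))"
    using lift2_sq[OF f a a] by simp_all
qed

lemma good_add: "good (+)" and good_minus: "good (-)"
proof -
  have m: "x + y \<le> x * (1 + b) + (1 + a) * y" if "0 \<le> x" "0 \<le> y" "0 \<le> b" "0 \<le> a" for x y a b :: real
    using mult_nonneg_nonneg[OF that(1,3)] mult_nonneg_nonneg[OF that(4,2)] by (simp add: algebra_simps)
  show "good (+)" unfolding good_def
  proof (intro conjI ballI V_add)
    fix q assume q: "q \<in> Q"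
    show "\<exists>q'\<in>Q. \<exists>C. \<forall>a\<in>V. \<forall>a'\<in>V. \<forall>b\<in>V. \<forall>b'\<in>V.
      q (a + b - (a' + b')) \<le> C * (q' (a - a') * (1 + q' b) + (1 + q' a') * q' (b - b'))"
    proof (intro bexI[OF _ q] exI[of _ 1] ballI, unfold mult_1)
      fix a a' b b' assume "a \<in> V" "a' \<in> V" "b \<in> V" "b' \<in> V"
      then show "q (a + b - (a' + b')) \<le> q (a - a') * (1 + q b) + (1 + q a') * q (b - b')"
        using q_add[OF q, of "a - a'" "b - b'"] m[of "q (a - a')" "q (b - b')" "q b" "q a'"] q_nonneg[OF q] V_diff
        by (simp add: add_diff_add)
    qed
  qed
  show "good (-)" unfolding good_def
  proof (intro conjI ballI V_diff)
    fix q assume q: "q \<in> Q"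
    show "\<exists>q'\<in>Q. \<exists>C. \<forall>a\<in>V. \<forall>a'\<in>V. \<forall>b\<in>V. \<forall>b'\<in>V.
      q (a - b - (a' - b')) \<le> C * (q' (a - a') * (1 + q' b) + (1 + q' a') * q' (b - b'))"
    proof (intro bexI[OF _ q] exI[of _ 1] ballI, unfold mult_1)
      fix a a' b b' assume h: "a \<in> V" "a' \<in> V" "b \<in> V" "b' \<in> V"
      have eq: "a - b - (a' - b') = (a - a') - (b - b')" by (simp add: algebra_simps)
      have "q ((a - a') - (b - b')) \<le> q (a - a') + q (b - b')" by (intro q_diff[OF q] V_diff h)
      also have "\<dots> \<le> q (a - a') * (1 + q b) + (1 + q a') * q (b - b')"
        by (intro m q_nonneg[OF q] V_diff h)
      finally show "q (a - b - (a' - b')) \<le> q (a - a') * (1 + q b) + (1 + q a') * q (b - b')"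
        unfolding eq .
    qed
  qed
qed

text \<open>q maps a Cauchy filter to a Cauchy filter of reals, which converges, and equivalent
  filters share the limit. This is what the definite description in
  \<open>completion_seminorm\<close> requires.\<close>

lemma csn_tendsto:
  assumes F: "F \<in> CF" and q: "q \<in> Q" shows "(q \<longlongrightarrow> csn q (cls F)) F"
proof -
  have "cauchy_filter (filtermap q F)"
    unfolding cauchy_filter_def le_filter_def eventually_uniformity_metric
  proof (intro allI impI)
    fix P :: "real \<times> real \<Rightarrow> bool" assume "\<exists>e>0. \<forall>x y. dist x y < e \<longrightarrow> P (x, y)"
    then obtain e where e: "e > 0" "\<And>x y. dist x y < e \<Longrightarrow> P (x, y)" by blast
    obtain A B where AB: "eventually A F" "eventually B F" "\<And>x y. A x \<Longrightarrow> B y \<Longrightarrow> q (x - y) < e"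
      by (rule relE[OF CF_D(3)[OF F] q e(1)]) (rule that)
    have ev: "eventually (\<lambda>x. A x \<and> x \<in> V) F" "eventually (\<lambda>x. B x \<and> x \<in> V) F"
      using AB CF_D(2)[OF F] by (auto intro: eventually_conj)
    have "P (q x, q y)" if "A x \<and> x \<in> V" "B y \<and> y \<in> V" for x y
    proof (rule e(2))
      have "q x \<le> q (x - y) + q y" "q y \<le> q (y - x) + q x"
        using q_add[OF q, of "x - y" y] q_add[OF q, of "y - x" x] V_diff that by simp_all
      then show "dist (q x) (q y) < e" using AB(3)[of x y] q_sym[OF q, of x y] that by (auto simp: dist_real_def)
    qed
    then show "eventually P (filtermap q F \<times>\<^sub>F filtermap q F)"
      unfolding eventually_prod_filter eventually_filtermap
      using ev by (intro exI[of _ "\<lambda>u. \<exists>x. u = q x \<and> A x \<and> x \<in> V"] exI[of _ "\<lambda>u. \<exists>x. u = q x \<and> B x \<and> x \<in> V"])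
        (auto elim: eventually_mono)
  qed
  then obtain r where "filtermap q F \<le> nhds r"
    using complete_UNIV CF_D(1)[OF F] unfolding complete_uniform by (metis UNIV_I filtermap_bot_iff principal_UNIV top_greatest)
  then have r: "(q \<longlongrightarrow> r) F" by (simp add: filterlim_def)
  have "csn q (cls F) = r" unfolding completion_seminorm_def
  proof (rule the_equality)
    show "\<forall>H\<in>cls F. (q \<longlongrightarrow> r) H"
    proof
      fix H assume H: "H \<in> cls F"
      show "(q \<longlongrightarrow> r) H"
      proof (rule tendstoI)
        fix e :: real assume e: "e > 0"
        then have e2: "e / 2 > 0" by simp
        obtain A B where AB: "eventually A F" "eventually B H" "\<And>x y. A x \<Longrightarrow> B y \<Longrightarrow> q (x - y) < e / 2"
          using relE[of F H q "e / 2"] H q e2 by (auto simp: cls_iff)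
        have "eventually (\<lambda>x. dist (q x) r < e / 2 \<and> A x \<and> x \<in> V) F"
          using AB CF_D(2)[OF F] tendstoD[OF r e2] by (auto intro: eventually_conj)
        then obtain x where x: "dist (q x) r < e / 2" "A x" "x \<in> V" using CF_D(1)[OF F] eventually_happens by blast
        have "eventually (\<lambda>y. B y \<and> y \<in> V) H" using AB(2) H by (auto simp: cls_iff CF_iff intro: eventually_conj)
        then show "eventually (\<lambda>y. dist (q y) r < e) H"
        proof (rule eventually_mono)
          fix y assume y: "B y \<and> y \<in> V"
          have "q x \<le> q (x - y) + q y" "q y \<le> q (y - x) + q x"
            using q_add[OF q, of "x - y" y] q_add[OF q, of "y - x" x] V_diff x y by simp_all
          then show "dist (q y) r < e"
            using AB(3)[of x y] q_sym[OF q, of x y] x y unfolding dist_real_def by linarith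
        qed
      qed
    qed
    show "r' = r" if "\<forall>H\<in>cls F. (q \<longlongrightarrow> r') H" for r'
      using that cls_self[OF F] tendsto_unique[OF CF_D(1)[OF F] _ r] by blast
  qed
  with r show ?thesis by simp
qed

section \<open>Distances and convergence in the completion\<close>

definition d :: "('a \<Rightarrow> real) \<Rightarrow> 'a filter set \<Rightarrow> 'a filter set \<Rightarrow> real" where
  "d q X Y = csn q (lift2 (-) X Y)"

lemma d_tendsto:
  assumes "F \<in> CF" "H \<in> CF" "q \<in> Q" shows "((\<lambda>(x, y). q (x - y)) \<longlongrightarrow> d q (cls F) (cls H)) (F \<times>\<^sub>F H)"
  using csn_tendsto[OF good_CF[OF good_minus assms(1,2)] assms(3)]
  unfolding d_def lift2_cls[OF good_minus assms(1,2)]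
  by (simp add: filterlim_def filtermap_filtermap case_prod_unfold)

lemma d_le:
  assumes "F \<in> CF" "H \<in> CF" "q \<in> Q" "eventually P F" "eventually R H" "\<And>x y. P x \<Longrightarrow> R y \<Longrightarrow> q (x - y) \<le> B"
  shows "d q (cls F) (cls H) \<le> B"
proof (rule tendsto_upperbound[OF d_tendsto[OF assms(1-3)]])
  show "eventually (\<lambda>u. (case u of (x, y) \<Rightarrow> q (x - y)) \<le> B) (F \<times>\<^sub>F H)"
    unfolding eventually_prod_filter using assms(4-6) by auto
  show "F \<times>\<^sub>F H \<noteq> bot" using CF_D(1) assms(1,2) by (simp add: prod_filter_eq_bot)
qed

lemma d_less:
  assumes "F \<in> CF" "H \<in> CF" "q \<in> Q" "d q (cls F) (cls H) < e"
  obtains P R where "eventually P F" "eventually R H" "\<And>x y. P x \<Longrightarrow> R y \<Longrightarrow> x \<in> V \<and> y \<in> V \<and> q (x - y) < e"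
proof -
  have "eventually (\<lambda>(x, y). q (x - y) < e) (F \<times>\<^sub>F H)"
    using order_tendstoD(2)[OF d_tendsto[OF assms(1-3)] assms(4)] by (simp add: case_prod_unfold)
  then obtain P R where PR: "eventually P F" "eventually R H" "\<And>x y. P x \<Longrightarrow> R y \<Longrightarrow> q (x - y) < e"
    unfolding eventually_prod_filter by auto
  have "eventually (\<lambda>x. P x \<and> x \<in> V) F" "eventually (\<lambda>x. R x \<and> x \<in> V) H"
    using PR CF_D(2) assms(1,2) by (auto intro: eventually_conj)
  then show ?thesis using PR(3) by (intro that[of "\<lambda>x. P x \<and> x \<in> V" "\<lambda>x. R x \<and> x \<in> V"]) auto
qed

lemma d_triangle:
  assumes X: "X \<in> Cpl" and Y: "Y \<in> Cpl" and Z: "Z \<in> Cpl" and q: "q \<in> Q"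
  shows "d q X Z \<le> d q X Y + d q Y Z"
proof (rule field_le_epsilon)
  fix e :: real assume e: "e > 0"
  obtain F H K where F: "F \<in> CF" "X = cls F" "H \<in> CF" "Y = cls H" "K \<in> CF" "Z = cls K"
    using X Y Z by (elim CplE)
  obtain P R where P: "eventually P F" "eventually R H" "\<And>x y. P x \<Longrightarrow> R y \<Longrightarrow> x \<in> V \<and> y \<in> V \<and> q (x - y) < d q X Y + e / 2"
    using d_less[OF F(1,3) q, of "d q X Y + e / 2"] e F by auto
  obtain R' S where R: "eventually R' H" "eventually S K" "\<And>x y. R' x \<Longrightarrow> S y \<Longrightarrow> x \<in> V \<and> y \<in> V \<and> q (x - y) < d q Y Z + e / 2"
    using d_less[OF F(3,5) q, of "d q Y Z + e / 2"] e F by auto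
  obtain y where y: "R y" "R' y" using eventually_conj[OF P(2) R(1)] CF_D(1)[OF F(3)] eventually_happens by blast
  have "q (x - w) \<le> d q X Y + d q Y Z + e" if "P x" "S w" for x w
    using q_triangle[OF q, of x y w] P(3)[OF that(1) y(1)] R(3)[OF y(2) that(2)] by simp
  from d_le[OF F(1,5) q P(1) R(2) this] show "d q X Z \<le> d q X Y + d q Y Z + e" using F by simp
qed

lemma d_sym_le:
  assumes X: "X \<in> Cpl" and Y: "Y \<in> Cpl" and q: "q \<in> Q" shows "d q Y X \<le> d q X Y"
proof (rule field_le_epsilon)
  fix e :: real assume e: "e > 0"
  obtain F H where F: "F \<in> CF" "X = cls F" "H \<in> CF" "Y = cls H" using X Y by (elim CplE)
  obtain P R where P: "eventually P F" "eventually R H" "\<And>x y. P x \<Longrightarrow> R y \<Longrightarrow> x \<in> V \<and> y \<in> V \<and> q (x - y) < d q X Y + e"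
    using d_less[OF F(1,3) q, of "d q X Y + e"] e F by auto
  have "q (y - x) \<le> d q X Y + e" if "R y" "P x" for x y
    using P(3)[OF that(2,1)] q_sym[OF q, of x y] by simp
  from d_le[OF F(3,1) q P(2,1) this] show "d q Y X \<le> d q X Y + e" using F by simp
qed

lemma d_self: assumes X: "X \<in> Cpl" and q: "q \<in> Q" shows "d q X X \<le> 0"
proof (rule field_le_epsilon)
  fix e :: real assume e: "e > 0"
  obtain F where F: "F \<in> CF" "X = cls F" using X by (elim CplE)
  obtain P R where P: "eventually P F" "eventually R F" "\<And>x y. P x \<Longrightarrow> R y \<Longrightarrow> q (x - y) < e"
    by (rule relE[OF CF_D(3)[OF F(1)] q e]) (rule that)
  from d_le[OF F(1,1) q P(1,2), of e] P(3) show "d q X X \<le> 0 + e" using F by fastforce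
qed

text \<open>Distance 0 for every q makes the representing filters equivalent, and equivalent filters
  have the same class: the completion is Hausdorff.\<close>

lemma d_zero_eq:
  assumes X: "X \<in> Cpl" and Y: "Y \<in> Cpl" and 0: "\<And>q. q \<in> Q \<Longrightarrow> d q X Y \<le> 0" shows "X = Y"
proof -
  obtain F H where F: "F \<in> CF" "X = cls F" "H \<in> CF" "Y = cls H" using X Y by (elim CplE)
  have "rel F H"
  proof (rule relI)
    fix q and e :: real assume q: "q \<in> Q" "e > 0"
    then have "d q (cls F) (cls H) < e" using 0[OF q(1)] F by simp
    from d_less[OF F(1,3) q(1) this]
    show "\<exists>P R. eventually P F \<and> eventually R H \<and> (\<forall>x y. P x \<longrightarrow> R y \<longrightarrow> q (x - y) < e)" by metis
  qed
  then show ?thesis using cls_eq F by simp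
qed

abbreviation "top0 \<equiv> completion_topology V Q"
abbreviation "subbase \<equiv> {{Y \<in> Cpl. csn q (lift2 (-) Y X) < e} | q X e. q \<in> Q \<and> X \<in> Cpl \<and> e > 0}"

lemma topspace_top0: "topspace top0 = Cpl"
proof -
  have "X \<in> \<Union>subbase" if X: "X \<in> Cpl" for X
  proof -
    obtain q where q: "q \<in> Q" using Q_ne by blast
    have "X \<in> {Y \<in> Cpl. csn q (lift2 (-) Y X) < 1}" using d_self[OF X q] X unfolding d_def by simp
    moreover have "{Y \<in> Cpl. csn q (lift2 (-) Y X) < 1} \<in> subbase" using q X by fastforce
    ultimately show ?thesis by blast
  qed
  then show ?thesis unfolding completion_topology_def topology_generated_by_topspace by blast
qed

text \<open>By the triangle inequality a subbasic ball that contains L contains a small ball around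
  L; the rest is induction on the generated topology.\<close>

lemma limitinI:
  assumes L: "L \<in> Cpl" and f: "\<And>i. f i \<in> Cpl" and lim: "\<And>q e. q \<in> Q \<Longrightarrow> e > 0 \<Longrightarrow> eventually (\<lambda>i. d q (f i) L \<le> e) F"
  shows "limitin top0 f L F"
proof -
  have "L \<in> U \<longrightarrow> eventually (\<lambda>i. f i \<in> U) F" if "generate_topology_on subbase U" for U
    using that
  proof (induction rule: generate_topology_on.induct)
    case (Int A B)
    then show ?case by (auto intro: eventually_conj)
  next
    case (UN K)
    show ?case
    proof
      assume "L \<in> \<Union>K"
      then obtain k where k: "k \<in> K" "L \<in> k" by blast
      with UN have "eventually (\<lambda>i. f i \<in> k) F" by blast
      then show "eventually (\<lambda>i. f i \<in> \<Union>K) F" using k by (auto elim: eventually_mono)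
    qed
  next
    case (Basis B)
    then obtain q X e where B: "B = {Y \<in> Cpl. csn q (lift2 (-) Y X) < e}" "q \<in> Q" "X \<in> Cpl" "e > 0" by blast
    show ?case
    proof
      assume "L \<in> B"
      then have "d q L X < e" using B by (simp add: d_def)
      then have "(e - d q L X) / 2 > 0" by simp
      from lim[OF B(2) this] show "eventually (\<lambda>i. f i \<in> B) F"
      proof (rule eventually_mono)
        fix i assume "d q (f i) L \<le> (e - d q L X) / 2"
        then have "d q (f i) X < e" using d_triangle[OF f[of i] L B(3) B(2)] \<open>d q L X < e\<close> by argo
        then show "f i \<in> B" using B f by (simp add: d_def)
      qed
    qed
  qed auto
  then show ?thesis unfolding limitin_def topspace_top0 using L
    by (simp add: completion_topology_def openin_topology_generated_by_iff)
qed

lemma limitinD: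
  assumes "limitin top0 f L F" "q \<in> Q" "e > 0"
  shows "L \<in> Cpl" "eventually (\<lambda>i. f i \<in> Cpl \<and> d q (f i) L < e) F"
proof -
  show L: "L \<in> Cpl" using assms(1) by (simp add: limitin_def topspace_top0)
  let ?B = "{Y \<in> Cpl. csn q (lift2 (-) Y L) < e}"
  have "?B \<in> subbase" using assms(2,3) L by blast
  then have "openin top0 ?B" unfolding completion_topology_def by (rule topology_generated_by_Basis)
  moreover have "L \<in> ?B" using d_self[OF L assms(2)] assms(3) L by (simp add: d_def)
  ultimately have "eventually (\<lambda>i. f i \<in> ?B) F" using assms(1) unfolding limitin_def by blast
  then show "eventually (\<lambda>i. f i \<in> Cpl \<and> d q (f i) L < e) F" by (simp add: d_def)
qed

text \<open>Provides the uniqueness that the definite description in \<open>W_suminf\<close> asks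
  for.\<close>

lemma limit_unique:
  assumes "limitin top0 f X F" "limitin top0 f Y F" "F \<noteq> bot" shows "X = Y"
proof -
  obtain q0 where q0: "q0 \<in> Q" using Q_ne by blast
  have X: "X \<in> Cpl" and Y: "Y \<in> Cpl" using limitinD(1)[OF assms(1) q0, of 1] limitinD(1)[OF assms(2) q0, of 1] by auto
  show ?thesis
  proof (rule d_zero_eq[OF X Y], rule field_le_epsilon)
    fix q and e :: real assume q: "q \<in> Q" and e: "e > 0"
    then have e2: "e / 2 > 0" by simp
    have "eventually (\<lambda>i. (f i \<in> Cpl \<and> d q (f i) X < e / 2) \<and> (f i \<in> Cpl \<and> d q (f i) Y < e / 2)) F"
      by (intro eventually_conj limitinD(2)[OF assms(1) q e2] limitinD(2)[OF assms(2) q e2])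
    then obtain i where i: "f i \<in> Cpl" "d q (f i) X < e / 2" "d q (f i) Y < e / 2"
      using assms(3) eventually_happens by blast
    then show "d q X Y \<le> 0 + e"
      using d_triangle[OF X i(1) Y q] d_sym_le[OF i(1) X q] by simp
  qed
qed

lemma d_sq_le:
  assumes "cs a" "cs b" "q \<in> Q" "\<And>n. n \<ge> N \<Longrightarrow> q (a n - b n) \<le> B" shows "d q (sq a) (sq b) \<le> B"
proof -
  have "(\<lambda>n. q (a n - b n)) \<longlonglongrightarrow> d q (sq a) (sq b)"
  proof -
    have c: "cs (\<lambda>n. a n - b n)" and e: "lift2 (-) (sq a) (sq b) = sq (\<lambda>n. a n - b n)"
      using lift2_sq[OF good_minus assms(1,2)] by auto
    have "(q \<longlongrightarrow> csn q (cls (filtermap (\<lambda>n. a n - b n) sequentially))) (filtermap (\<lambda>n. a n - b n) sequentially)"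
      by (rule csn_tendsto[OF cs_CF[OF c] assms(3)])
    then show ?thesis unfolding d_def e unfolding sq_def by (simp add: filterlim_def filtermap_filtermap)
  qed
  then show ?thesis by (rule LIMSEQ_le_const2) (use assms(4) in blast)
qed

lemma csn_emb: assumes "x \<in> V" "q \<in> Q" shows "csn q (emb0 x) = q x"
proof -
  have "principal {x} = filtermap (\<lambda>n::nat. x) sequentially"
    unfolding filter_eq_iff eventually_filtermap eventually_principal by simp
  then have A: "(q \<longlongrightarrow> csn q (emb0 x)) (principal {x})"
    using csn_tendsto[OF cs_CF[OF cs_const[OF assms(1)]] assms(2)] unfolding completion_emb_def by simp
  have B: "(q \<longlongrightarrow> q x) (principal {x})" by (rule tendsto_eventually) (simp add: eventually_principal)
  show ?thesis by (rule tendsto_unique[OF _ A B]) (simp add: principal_eq_bot_iff)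
qed

end

subsection \<open>Powers of an even vector\<close>

context graded_lcs
begin

lemma sym_prod_Nil: "sym_prod G [] = sym_one G"
  by (simp add: sym_prod_def)

lemma sym_prod_single: "sym_prod G [v] = sym_vec G v"
proof
  fix \<phi>
  have "sym_form \<phi> [v] = hext [v] (sym_form \<phi>)"
    by (rule hext_multilinear[OF multilinear_sym_form, symmetric])
  also have "\<dots> = hext [v] (\<lambda>us. ten us \<phi>)"
  proof (rule hext_cong)
    fix us assume us: "us \<in> hom_lists G" "length us = length [v]"
    have perm: "{\<sigma>. \<sigma> permutes {..<length us}} = {id}"
      using us(2) by (simp add: lessThan_Suc permutes_sing)
    show "sym_form \<phi> us = ten us \<phi>"
      unfolding sym_form_hom[OF us(1)] perm using us(2) by (simp add: koszul_sign_id)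
  qed
  also have "\<dots> = ten [v] \<phi>" by (rule hext_multilinear[OF multilinear_tens])
  finally show "sym_prod G [v] \<phi> = sym_vec G v \<phi>" by (simp add: sym_prod_apply sym_vec_def)
qed

lemma sym_one_in: "sym_one G \<in> W" and sym_vec_in: "sym_vec G v \<in> W"
  using sym_prod_in_W[of "[]"] sym_prod_in_W[of "[v]"] by (simp_all only: sym_prod_Nil sym_prod_single)

lemma sym_vec_linear: "sym_vec G (x + y) = sym_vec G x + sym_vec G y" "sym_vec G (vscale G c x) = fscale c (sym_vec G x)"
  using sym_prod_add[of "[]" x y "[]"] sym_prod_scale[of "[]" c x "[]"]
  by (simp_all only: append_Nil sym_prod_single)

abbreviation pw :: "'v \<Rightarrow> nat \<Rightarrow> ('v, 'k) tensor" where
  "pw w n \<equiv> sym_prod G (replicate n w)"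

lemma rep_hom: "w \<in> even_part G \<Longrightarrow> replicate n w \<in> hom_lists G"
  by (induction n) auto

text \<open>An even w is passed without a sign. The induction carries along the i copies of w that v
  has already passed.\<close>

lemma sym_prod_even_commute:
  assumes w: "w \<in> even_part G" and v: "v \<in> even_part G \<or> v \<in> odd_part G"
  shows "sym_prod G (v # replicate n w) = sym_prod G (replicate n w @ [v])"
proof -
  have "sym_prod G (replicate i w @ v # replicate n w) = sym_prod G (replicate (i + n) w @ [v])" for i
  proof (induction n arbitrary: i)
    case (Suc n)
    have "sym_prod G (replicate i w @ v # w # replicate n w) =
        fscale ((-1) ^ (parity G v * parity G w)) (sym_prod G (replicate i w @ w # v # replicate n w))"
      by (rule sym_prod_swap) (use rep_hom[OF w] w v in simp)
    also have "\<dots> = sym_prod G (replicate i w @ w # v # replicate n w)"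
      using parity_even[OF w] by simp
    also have "\<dots> = sym_prod G (replicate (Suc i) w @ v # replicate n w)"
      by (simp add: replicate_append_same[symmetric])
    also have "\<dots> = sym_prod G (replicate (Suc i + n) w @ [v])" by (rule Suc.IH)
    finally show ?case by simp
  qed simp
  from this[of 0] show ?thesis by simp
qed

lemma sym_mult_pw: "w \<in> even_part G \<Longrightarrow> sym_mult G (pw w n) (sym_vec G w) = pw w (Suc n)"
    "w \<in> even_part G \<Longrightarrow> sym_mult G (pw w n) (sym_one G) = pw w n"
  using sym_mult_sym_prod[of "replicate n w" "[w]"] sym_mult_sym_prod[of "replicate n w" "[]"] rep_hom[of w n]
  by (simp_all add: sym_prod_single sym_prod_Nil replicate_append_same)

lemma seminorm_pw:
  assumes "p \<in> CS" "w \<in> even_part G" shows "seminorm_R G R p (pw w n) \<le> fact n powr R * p w ^ n"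
  using seminorm_R_sym_prod[OF assms(1) rep_hom[OF assms(2)], of R n] by (simp add: prod_list_replicate)

lemma W_linear_sum:
  assumes "\<And>a b. a \<in> W \<Longrightarrow> b \<in> W \<Longrightarrow> L (a + b) = L a + L b" "\<And>c a. a \<in> W \<Longrightarrow> L (fscale c a) = fscale c (L a)"
    and "\<And>i. i \<in> A \<Longrightarrow> f i \<in> W"
  shows "L (\<Sum>i\<in>A. fscale (c i) (f i)) = (\<Sum>i\<in>A. fscale (c i) (L (f i)))"
proof -
  have 0: "L 0 = 0" using assms(2)[OF W_closed(1), of 0] by (simp only: fs.scale_zero_left)
  show ?thesis using assms(3)
  proof (induction A rule: infinite_finite_induct)
    case (infinite A)
    show ?case unfolding sum.infinite[OF infinite(1)] by (rule 0)
  next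
    case empty
    show ?case unfolding sum.empty by (rule 0)
  next
    case (insert i A)
    have s: "(\<Sum>i\<in>A. fscale (c i) (f i)) \<in> W"
      by (rule fs.subspace_sum[OF subspace_W]) (use insert.prems in blast)
    have i: "f i \<in> W" using insert.prems by blast
    have IH: "L (\<Sum>i\<in>A. fscale (c i) (f i)) = (\<Sum>i\<in>A. fscale (c i) (L (f i)))"
      by (rule insert.IH) (use insert.prems in blast)
    show ?case unfolding sum.insert[OF insert.hyps] assms(1)[OF W_closed(4)[OF i] s] assms(2)[OF i] IH ..
  qed
qed

lemma sym_mult_bilinear_W:
  assumes "a \<in> W" "a' \<in> W" "b \<in> W" "b' \<in> W"
  shows "sym_mult G (a + a') b = sym_mult G a b + sym_mult G a' b"
    "sym_mult G a (b + b') = sym_mult G a b + sym_mult G a b'"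
    "sym_mult G (fscale c a) b = fscale c (sym_mult G a b)"
    "sym_mult G a (fscale c b) = fscale c (sym_mult G a b)"
  using sym_mult_bilinear[OF assms[THEN W_in_T]] by blast+

text \<open>The case k = 0 of \<open>star_coefficient_bound\<close>, whose factor
  \<open>4 ^ (n + m)\<close> is absorbed by q = 4 p.\<close>

lemma sym_mult_continuous:
  assumes p: "p \<in> CS" and R: "1 / 2 \<le> R" "R < 1"
  obtains q where "q \<in> CS" "\<And>a b. a \<in> W \<Longrightarrow> b \<in> W \<Longrightarrow>
    seminorm_R G R p (sym_mult G a b) \<le> seminorm_R G R q a * seminorm_R G R q b"
proof -
  define q where "q v = 4 * p v" for v
  have q: "q \<in> CS" unfolding q_def[abs_def] by (rule seminorm_cmult[OF p]) simp
  have wq: "wgt q vs = 4 ^ length vs * wgt p vs" for vs by (induction vs) (auto simp: q_def)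
  have bd: "seminorm_R G R p (sym_mult G (sym_prod G us) (sym_prod G ws)) \<le> fwgt R q us * fwgt R q ws"
    if us: "us \<in> hom_lists G" and ws: "ws \<in> hom_lists G" for us ws
  proof -
    let ?n = "length us" and ?m = "length ws"
    have "seminorm_R G R p (sym_prod G (us @ ws)) \<le> fwgt R p (us @ ws)"
      by (rule seminorm_R_sym_prod[OF p]) (use us ws in simp)
    also have "\<dots> = fact (?n + ?m) powr R * (wgt p us * wgt p ws)" by simp
    also have "\<dots> \<le> (4 ^ (?n + ?m) * (fact ?n powr R * fact ?m powr R)) * (wgt p us * wgt p ws)"
      using star_coefficient_bound[OF R, of 0 ?n ?m] wgt_nonneg[OF p]
      by (intro mult_right_mono) (auto simp: falling_def)
    also have "\<dots> = fwgt R q us * fwgt R q ws" by (simp add: wq power_add)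
    finally show ?thesis unfolding sym_mult_sym_prod[OF us ws] .
  qed
  have "seminorm_R G R p (sym_mult G a b) \<le> seminorm_R G R (ghull q) a * seminorm_R G R (ghull q) b"
    if "a \<in> W" "b \<in> W" for a b
    by (rule bilinear_bound[OF p q that sym_mult_in_W[OF W_in_T W_in_T] sym_mult_bilinear_W(1)[OF _ _ _ W_closed(1)]
        sym_mult_bilinear_W(2)[OF _ W_closed(1)] sym_mult_bilinear_W(3)[OF _ W_closed(1) _ W_closed(1)]
        sym_mult_bilinear_W(4)[OF _ W_closed(1) _ W_closed(1)] bd])
  with that seminorm_ghull[OF q] show ?thesis by blast
qed

end

context weyl
begin

text \<open>All terms from k = 2 on contain P (P X) = 0.\<close>

lemma st_first_order:
  assumes X: "X \<in> S2" and PP: "P (P X) = 0"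
  shows "st X = mu G X + fscale z (mu G (P X))"
proof -
  have "(P ^^ k) X = 0" if "k > 1" for k
  proof -
    define j where "j = k - 2"
    have k: "k = j + 2" using that by (simp add: j_def)
    have "(P ^^ (j + 2)) X = (P ^^ j) (P (P X))" by (simp only: funpow_add o_apply numeral_2_eq_2 funpow.simps id_apply)
    also have "\<dots> = 0" unfolding PP by (rule Pk_linear(3)[OF fs.span_zero fs.span_zero])
    finally show ?thesis unfolding k .
  qed
  then have "\<forall>k>1. (P ^^ k) X = 0" by blast
  note st = st_sum[OF this]
  have e: "(P ^^ 0) X = X" "(P ^^ 1) X = P X" by (simp_all only: One_nat_def funpow.simps o_apply id_apply)
  from st have "st X = (\<Sum>k\<in>{0, 1}. fscale (z ^ k / fact k) (mu G ((P ^^ k) X)))"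
    by (simp only: atMost_Suc atMost_0 One_nat_def insert_commute)
  also have "\<dots> = fscale (z ^ 0 / fact 0) (mu G ((P ^^ 0) X)) + fscale (z ^ 1 / fact 1) (mu G ((P ^^ 1) X))"
    by (simp only: sum.insert finite.intros sum.empty insert_iff empty_iff zero_neq_one add_0_right simp_thms)
  also have "\<dots> = mu G X + fscale z (mu G (P X))"
    by (simp only: power_0 power_one_right fact_0 fact_1 div_by_1 fs.scale_one e)
  finally show ?thesis .
qed

lemma P_gen_Nil: "P_gen vs [] = 0" "P_gen [] vs = 0"
  by (simp_all add: P_gen_def)

lemma omit_replicate: "k < n \<Longrightarrow> omit k (replicate n w) = replicate (n - 1) w"
proof -
  assume "k < n"
  then have "omit k (replicate n w) = replicate (k + (n - Suc k)) w"
    by (simp only: omit_def take_replicate drop_replicate replicate_add min_absorb1 less_imp_le)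
  with \<open>k < n\<close> show ?thesis by simp
qed

text \<open>All n contractions agree, since the signs of an even w are trivial. For n = 0 the
  coefficient is 0, so the truncated n - 1 does no harm.\<close>

lemma P_gen_pw:
  assumes w: "w \<in> even_part G"
  shows "P_gen (replicate n w) [v] = fscale (of_nat n * \<Lambda> w v) (g2 (replicate (n - 1) w, []))"
    "P_gen [v] (replicate n w) = fscale (of_nat n * \<Lambda> v w) (g2 ([], replicate (n - 1) w))"
proof -
  have 0: "parity G w = 0" by (rule parity_even[OF w])
  have r: "right_sign k (replicate n (parity G w)) = 1" "left_sign k (replicate n (parity G w)) = 1" if "k < n" for k
    using that 0 by (simp_all add: right_sign_def left_sign_def)
  have l: "left_sign 0 [parity G v] = 1" "right_sign 0 [parity G v] = 1"
    by (simp_all add: right_sign_def left_sign_def)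
  show "P_gen (replicate n w) [v] = fscale (of_nat n * \<Lambda> w v) (g2 (replicate (n - 1) w, []))"
    by (rule ext) (simp add: P_gen_def sum_fun_apply r l omit_replicate map_replicate algebra_simps)
  show "P_gen [v] (replicate n w) = fscale (of_nat n * \<Lambda> v w) (g2 ([], replicate (n - 1) w))"
    by (rule ext) (simp add: P_gen_def sum_fun_apply r l omit_replicate map_replicate algebra_simps)
qed

text \<open>One application of P uses up v, and the empty factor that remains is annihilated by the
  next one. In both formulas v stands on the right of the symmetric product, which for even w costs
  no sign.\<close>

lemma pw_star_hom:
  assumes w: "w \<in> even_part G" and v: "v \<in> even_part G \<or> v \<in> odd_part G"
  shows "pw w n \<star> sym_vec G v = sym_mult G (pw w n) (sym_vec G v) + fscale (z * (of_nat n * \<Lambda> w v)) (pw w (n - 1))"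
    "sym_vec G v \<star> pw w n = sym_mult G (pw w n) (sym_vec G v) + fscale (z * (of_nat n * \<Lambda> v w)) (pw w (n - 1))"
proof -
  have h: "replicate m w \<in> hom_lists G" "[v] \<in> hom_lists G" "[] \<in> hom_lists G" for m using rep_hom[OF w] v by auto
  have g: "tens2 (sym_prod G us) (sym_prod G vs) \<in> S2" for us vs by (rule tens2_in_span[OF sym_prod_in_W sym_prod_in_W])
  have mu2: "mu G (tens2 (sym_prod G us) (sym_prod G vs)) = sym_prod G (us @ vs)"
    if "us \<in> hom_lists G" "vs \<in> hom_lists G" for us vs
    unfolding mu_tens2[OF sym_prod_in_W sym_prod_in_W] by (rule sym_mult_sym_prod[OF that])
  have A: "sym_mult G (pw w n) (sym_vec G v) = sym_prod G (replicate n w @ [v])"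
    unfolding sym_prod_single[symmetric] by (rule sym_mult_sym_prod[OF h(1,2)])
  have P1: "P (tens2 (pw w n) (sym_prod G [v])) = fscale (of_nat n * \<Lambda> w v) (tens2 (pw w (n - 1)) (sym_prod G []))"
    unfolding P_g2[OF h(1,2)] P_gen_pw[OF w] split ..
  have P2: "P (tens2 (sym_prod G [v]) (pw w n)) = fscale (of_nat n * \<Lambda> v w) (tens2 (sym_prod G []) (pw w (n - 1)))"
    unfolding P_g2[OF h(2,1)] P_gen_pw[OF w] split ..
  have PP1: "P (P (tens2 (pw w n) (sym_prod G [v]))) = 0"
    unfolding P1 P_linear(2)[OF g fs.span_zero] P_g2[OF h(1,3)] P_gen_Nil by (rule fs.scale_zero_right)
  have PP2: "P (P (tens2 (sym_prod G [v]) (pw w n))) = 0"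
    unfolding P2 P_linear(2)[OF g fs.span_zero] P_g2[OF h(3,1)] P_gen_Nil by (rule fs.scale_zero_right)
  show "pw w n \<star> sym_vec G v = sym_mult G (pw w n) (sym_vec G v) + fscale (z * (of_nat n * \<Lambda> w v)) (pw w (n - 1))"
    unfolding star_eq A unfolding sym_prod_single[symmetric] st_first_order[OF g PP1] P1
      mu_linear(2)[OF g fs.span_zero] mu2[OF h(1,2)] mu2[OF h(1,3)] append_Nil2 fs.scale_scale ..
  show "sym_vec G v \<star> pw w n = sym_mult G (pw w n) (sym_vec G v) + fscale (z * (of_nat n * \<Lambda> v w)) (pw w (n - 1))"
    unfolding star_eq A unfolding sym_prod_single[symmetric] st_first_order[OF g PP2] P2
      mu_linear(2)[OF g fs.span_zero] mu2[OF h(2,1)] mu2[OF h(3,1)] append_Nil append_Cons fs.scale_scale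
      sym_prod_even_commute[OF w v] ..
qed

text \<open>Both sides are linear in v, so the homogeneous case suffices.\<close>

lemma pw_star:
  assumes w: "w \<in> even_part G"
  shows "pw w n \<star> sym_vec G v = sym_mult G (pw w n) (sym_vec G v) + fscale (z * of_nat n * \<Lambda> w v) (pw w (n - 1))"
    "sym_vec G v \<star> pw w n = sym_mult G (pw w n) (sym_vec G v) + fscale (z * of_nat n * \<Lambda> v w) (pw w (n - 1))"
proof -
  let ?a = "even_proj G v" and ?b = "odd_proj G v"
  have v: "sym_vec G v = sym_vec G ?a + sym_vec G ?b" using sym_vec_linear(1)[of ?a ?b] by (simp only: proj_decomp)
  have \<Lambda>: "\<Lambda> w v = \<Lambda> w ?a + \<Lambda> w ?b" "\<Lambda> v w = \<Lambda> ?a w + \<Lambda> ?b w"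
    using \<Lambda>_linear(1)[of ?a ?b w] \<Lambda>_linear(3)[of w ?a ?b] by (simp_all only: proj_decomp)
  have e: "?a \<in> even_part G \<or> ?a \<in> odd_part G" "?b \<in> even_part G \<or> ?b \<in> odd_part G" by simp_all
  note pwW = sym_prod_in_W[of "replicate n w"]
  have m: "sym_mult G (pw w n) (sym_vec G v) = sym_mult G (pw w n) (sym_vec G ?a) + sym_mult G (pw w n) (sym_vec G ?b)"
    unfolding v by (rule sym_mult_bilinear_W(2)[OF pwW pwW sym_vec_in sym_vec_in])
  have s1: "pw w n \<star> sym_vec G v = pw w n \<star> sym_vec G ?a + pw w n \<star> sym_vec G ?b"
    unfolding v by (rule star_bilinear(2)[OF pwW pwW sym_vec_in sym_vec_in])
  have s2: "sym_vec G v \<star> pw w n = sym_vec G ?a \<star> pw w n + sym_vec G ?b \<star> pw w n"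
    unfolding v by (rule star_bilinear(1)[OF sym_vec_in sym_vec_in pwW pwW])
  show "pw w n \<star> sym_vec G v = sym_mult G (pw w n) (sym_vec G v) + fscale (z * of_nat n * \<Lambda> w v) (pw w (n - 1))"
    unfolding m s1 pw_star_hom[OF w e(1)] pw_star_hom[OF w e(2)] \<Lambda>
    by (rule ext) (simp add: algebra_simps)
  show "sym_vec G v \<star> pw w n = sym_mult G (pw w n) (sym_vec G v) + fscale (z * of_nat n * \<Lambda> v w) (pw w (n - 1))"
    unfolding m s2 pw_star_hom[OF w e(1)] pw_star_hom[OF w e(2)] \<Lambda>
    by (rule ext) (simp add: algebra_simps)
qed

end

subsection \<open>Series\<close>

text \<open>The ratio of consecutive terms is r / (n + 1) powr (1 - R), which tends to 0 because R <
  1.\<close>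

lemma summable_fact_powr:
  fixes r R :: real
  assumes R: "R < 1" and r: "0 \<le> r" shows "summable (\<lambda>n. r ^ n / fact n * fact n powr R)"
proof -
  let ?f = "\<lambda>n. r ^ n / fact n * fact n powr R"
  \<comment> \<open>N is large enough for the ratio to be at most 1/2 from N on.\<close>
  obtain N where N0: "(2 * r + 1) powr (1 / (1 - R)) \<le> real N" using real_arch_simple by blast
  have N: "2 * r + 1 \<le> real (Suc n) powr (1 - R)" if "n \<ge> N" for n
  proof -
    have "2 * r + 1 = ((2 * r + 1) powr (1 / (1 - R))) powr (1 - R)"
      using R r by (simp add: powr_powr)
    also have "\<dots> \<le> real (Suc n) powr (1 - R)"
      by (rule powr_mono2) (use R N0 that in auto)
    finally show ?thesis .
  qed
  show ?thesis
  proof (rule summable_ratio_test[of "1/2" N])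
    fix n assume "n \<ge> N"
    then have "2 * r \<le> real (Suc n) powr (1 - R)" using N[of n] by simp
    then have le: "r / real (Suc n) powr (1 - R) \<le> 1 / 2" by (simp add: field_simps)
    define x where "x = real (Suc n) powr (1 - R)"
    have x: "x > 0" by (simp add: x_def)
    have "fact (Suc n) powr R = real (Suc n) powr R * fact n powr R"
      unfolding fact_Suc by (rule powr_mult)
    also have "real (Suc n) powr R = real (Suc n) / x" by (simp add: x_def powr_diff)
    finally have "?f (Suc n) = r ^ Suc n / fact (Suc n) * (real (Suc n) / x * fact n powr R)" by (simp only:)
    also have "\<dots> = (r / x) * ?f n"
      using x unfolding fact_Suc power_Suc by (simp add: field_simps del: of_nat_Suc)
    also have "\<dots> \<le> 1 / 2 * ?f n" using le[folded x_def] r by (intro mult_right_mono) auto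
    finally show "norm (?f (Suc n)) \<le> 1 / 2 * norm (?f n)" using r by simp
  qed simp
qed

text \<open>Tannery's theorem: for fixed i the term tends to 0, and with a bound B of \<delta> the
  numbers B * v i are a summable majorant.\<close>

lemma toeplitz_tendsto:
  fixes \<delta> v :: "nat \<Rightarrow> real"
  assumes \<delta>: "\<delta> \<longlonglongrightarrow> 0" and v: "summable v" "\<And>i. 0 \<le> v i"
  shows "(\<lambda>N. \<Sum>i<N. \<delta> (N - i) * v i) \<longlonglongrightarrow> 0"
proof -
  obtain B where B: "\<And>n. norm (\<delta> n) \<le> B" using convergent_imp_Bseq[OF convergentI[OF \<delta>]] by (auto simp: Bseq_def)
  define a where "a k N = (if k < N then \<delta> (N - k) * v k else 0)" for k N
  have "((\<lambda>N. suminf (\<lambda>k. a k N)) \<longlongrightarrow> suminf (\<lambda>k. 0 :: real)) sequentially"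
  proof (rule tannerys_theorem[THEN conjunct2, THEN conjunct2])
    fix k
    have "filterlim (\<lambda>N. N - k) sequentially sequentially" by (rule filterlim_minus_const_nat_at_top)
    from filterlim_compose[OF \<delta> this] have lim: "(\<lambda>N. \<delta> (N - k) * v k) \<longlonglongrightarrow> 0"
      by (rule tendsto_mult_left_zero)
    have "eventually (\<lambda>N. \<delta> (N - k) * v k = a k N) sequentially"
      by (rule eventually_mono[OF eventually_gt_at_top[of k]]) (simp add: a_def)
    with lim show "(\<lambda>N. a k N) \<longlonglongrightarrow> 0" by (rule Lim_transform_eventually)
  next
    have "norm (a k N) \<le> B * v k" for k N
      using B[of "N - k"] B[of 0] v(2)[of k] norm_ge_zero[of "\<delta> 0"]
      by (auto simp: a_def abs_mult intro!: mult_right_mono mult_nonneg_nonneg)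
    then show "eventually (\<lambda>(k, n). norm (a k n) \<le> B * v k) (at_top \<times>\<^sub>F sequentially)"
      by (intro always_eventually) auto
    show "summable (\<lambda>k. B * v k)" by (rule summable_mult[OF v(1)])
  qed simp
  moreover have "suminf (\<lambda>k. a k N) = (\<Sum>i<N. \<delta> (N - i) * v i)" for N
    by (subst suminf_finite[of "{..<N}"]) (auto simp: a_def)
  ultimately show ?thesis by simp
qed

lemma sum_triangle:
  fixes f :: "nat \<Rightarrow> nat \<Rightarrow> 'a::comm_monoid_add"
  shows "(\<Sum>n<N. \<Sum>i\<le>n. f (n - i) i) = (\<Sum>i<N. \<Sum>m<N - i. f m i)"
proof (induction N)
  case (Suc N)
  have "(\<Sum>i<N. \<Sum>m<Suc N - i. f m i) = (\<Sum>i<N. (\<Sum>m<N - i. f m i) + f (N - i) i)"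
    by (rule sum.cong) (auto simp: Suc_diff_le)
  moreover have "(\<Sum>i\<le>N. f (N - i) i) = (\<Sum>i<N. f (N - i) i) + f 0 N"
    by (simp flip: lessThan_Suc_atMost)
  moreover have "(\<Sum>m<Suc N - N. f m N) = f 0 N" by (simp add: Suc_diff_le)
  ultimately show ?case using Suc by (simp add: sum.distrib add.assoc)
qed simp

text \<open>The hypotheses say that \<open>b\<close> are the Taylor coefficients of \<open>b\<^sub>0 exp (\<beta>s + \<gamma>s\<^sup>2/2)\<close>.\<close>

lemma coefficient_recursion:
  fixes b U :: "nat \<Rightarrow> 'k::field_char_0"
  assumes b1: "b 1 = \<beta> * b 0" and b2: "\<And>m. of_nat (m + 2) * b (m + 2) = \<beta> * b (m + 1) + \<gamma> * b m"
  shows "of_nat (Suc n) * (\<Sum>i\<le>Suc n. b (Suc n - i) * U i) =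
    (\<Sum>i\<le>n. b (n - i) * (of_nat (Suc i) * U (Suc i) + \<beta> * U i + \<gamma> * (if i = 0 then 0 else U (i - 1))))"
proof -
  have bm: "of_nat (Suc k) * b (Suc k) = \<beta> * b k + \<gamma> * (if k = 0 then 0 else b (k - 1))" for k
    using b1 b2[of "k - 1"] by (cases k) (simp_all add: algebra_simps)
  \<comment> \<open>The product rule in coefficients: n + 1 is split as i + (n + 1 - i), and the two
    parts differentiate U and b.\<close>
  have "of_nat (Suc n) * (\<Sum>i\<le>Suc n. b (Suc n - i) * U i) =
    (\<Sum>i\<le>Suc n. of_nat i * (b (Suc n - i) * U i)) + (\<Sum>i\<le>Suc n. of_nat (Suc n - i) * b (Suc n - i) * U i)"
    unfolding sum.distrib[symmetric] sum_distrib_left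
    by (rule sum.cong) (auto simp: of_nat_diff algebra_simps)
  also have "(\<Sum>i\<le>Suc n. of_nat i * (b (Suc n - i) * U i)) = (\<Sum>i\<le>n. b (n - i) * (of_nat (Suc i) * U (Suc i)))"
    unfolding sum.atMost_Suc_shift by (simp add: mult.left_commute)
  also have "(\<Sum>i\<le>Suc n. of_nat (Suc n - i) * b (Suc n - i) * U i) = (\<Sum>i\<le>n. of_nat (Suc n - i) * b (Suc n - i) * U i)"
    by simp
  also have "\<dots> = (\<Sum>i\<le>n. b (n - i) * (\<beta> * U i)) + (\<Sum>i\<le>n. \<gamma> * (if n - i = 0 then 0 else b (n - i - 1)) * U i)"
    unfolding sum.distrib[symmetric]
  proof (rule sum.cong[OF refl])
    fix i assume "i \<in> {..n}"
    then have i: "Suc n - i = Suc (n - i)" by auto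
    show "of_nat (Suc n - i) * b (Suc n - i) * U i = b (n - i) * (\<beta> * U i) + \<gamma> * (if n - i = 0 then 0 else b (n - i - 1)) * U i"
      unfolding i bm by (simp add: algebra_simps)
  qed
  \<comment> \<open>The index shift is moved from b to U; the terms without a predecessor are those
    set to 0.\<close>
  also have "(\<Sum>i\<le>n. \<gamma> * (if n - i = 0 then 0 else b (n - i - 1)) * U i) = (\<Sum>i\<le>n. b (n - i) * (\<gamma> * (if i = 0 then 0 else U (i - 1))))"
  proof (cases n)
    case (Suc k)
    have "(\<Sum>i\<le>Suc k. \<gamma> * (if Suc k - i = 0 then 0 else b (Suc k - i - 1)) * U i) = (\<Sum>i\<le>k. \<gamma> * (if Suc k - i = 0 then 0 else b (Suc k - i - 1)) * U i)"
      unfolding sum.atMost_Suc by simp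
    also have "\<dots> = (\<Sum>i\<le>k. \<gamma> * b (k - i) * U i)"
      by (rule sum.cong) (auto simp: Suc_diff_le)
    also have "\<dots> = (\<Sum>i\<le>Suc k. b (Suc k - i) * (\<gamma> * (if i = 0 then 0 else U (i - 1))))"
      unfolding sum.atMost_Suc_shift by (simp add: mult_ac)
    finally show ?thesis by (simp only: Suc)
  qed simp
  finally show ?thesis unfolding distrib_left sum.distrib by (simp only: add.assoc)
qed

section \<open>The operations of the completed algebra on Cauchy sequences\<close>

locale weyl_R = weyl G \<Lambda> z
  for G :: "('k::real_normed_field, 'v::{topological_ab_group_add, t2_space}) graded_space" and \<Lambda> z +
  fixes R :: real and w :: 'v
  assumes R: "1 / 2 \<le> R" "R < 1" and w: "w \<in> even_part G"
begin

abbreviation "Q \<equiv> seminorms_R G R"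

lemma QE: assumes "q \<in> Q" obtains p where "p \<in> CS" "q = seminorm_R G R p"
  using assms unfolding seminorms_R_def by blast

lemma Q_scale: "q \<in> Q \<Longrightarrow> x \<in> W \<Longrightarrow> q (fscale c x) \<le> norm c * q x"
  by (elim QE) (simp only: seminorm_R_scale W_in_T)

lemma seminorm_R_diff:
  assumes p: "p \<in> CS" and x: "x \<in> T" and y: "y \<in> T"
  shows "seminorm_R G R p (x - y) \<le> seminorm_R G R p x + seminorm_R G R p y"
proof -
  have eq: "x - y = x + fscale (-1) y" by (rule ext) simp
  have "fscale (-1) y \<in> T" using y unfolding tensors_def by (rule fs.span_scale)
  from seminorm_R_add[OF p x this, of R] seminorm_R_scale[OF p y, of R "-1"] show ?thesis unfolding eq by simp
qed

lemma seminormed_W: "seminormed W Q"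
proof -
  have "\<forall>x y. x \<in> W \<longrightarrow> y \<in> W \<longrightarrow> x + y \<in> W" "\<forall>x y. x \<in> W \<longrightarrow> y \<in> W \<longrightarrow> x - y \<in> W"
    by (intro allI impI W_closed; assumption)+
  moreover have "Q \<noteq> {}" unfolding seminorms_R_def using seminorm_zero by blast
  moreover have "\<forall>q x. q \<in> Q \<longrightarrow> x \<in> W \<longrightarrow> 0 \<le> q x"
    by (intro allI impI, erule QE) (simp only: seminorm_R_nonneg W_in_T)
  moreover have "\<forall>q. q \<in> Q \<longrightarrow> q 0 = 0"
    by (intro allI impI, erule QE) (simp only: seminorm_R_0)
  moreover have "\<forall>q x y. q \<in> Q \<longrightarrow> x \<in> W \<longrightarrow> y \<in> W \<longrightarrow> q (x + y) \<le> q x + q y"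
    by (intro allI impI, erule QE) (simp only: seminorm_R_add W_in_T)
  moreover have "\<forall>q x y. q \<in> Q \<longrightarrow> x \<in> W \<longrightarrow> y \<in> W \<longrightarrow> q (x - y) \<le> q x + q y"
    by (intro allI impI, erule QE) (simp only: seminorm_R_diff W_in_T)
  ultimately show ?thesis unfolding seminormed_def by (intro conjI W_closed(1))
qed

sublocale C: seminormed W Q
  by (rule seminormed_W)

lemma Q_sum: "q \<in> Q \<Longrightarrow> finite A \<Longrightarrow> (\<And>i. i \<in> A \<Longrightarrow> x i \<in> W) \<Longrightarrow> q (\<Sum>i\<in>A. x i) \<le> (\<Sum>i\<in>A. q (x i))"
proof -
  assume q: "q \<in> Q" and A: "finite A" and x: "\<And>i. i \<in> A \<Longrightarrow> x i \<in> W"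
  show ?thesis using A x
  proof (induction A)
    case empty
    show ?case unfolding sum.empty by (rule eq_refl[OF C.q_zero[OF q]])
  next
    case (insert i A)
    have s: "(\<Sum>i\<in>A. x i) \<in> W" by (rule fs.subspace_sum[OF subspace_W]) (use insert.prems in blast)
    have IH: "q (\<Sum>i\<in>A. x i) \<le> (\<Sum>i\<in>A. q (x i))" by (rule insert.IH) (use insert.prems in blast)
    have "q (x i + (\<Sum>i\<in>A. x i)) \<le> q (x i) + q (\<Sum>i\<in>A. x i)"
      by (rule C.q_add[OF q _ s]) (use insert.prems in blast)
    then show ?case unfolding sum.insert[OF insert.hyps] using IH by linarith
  qed
qed

text \<open>The difference f a b - f a' b' splits as f (a - a') b + f a' (b - b').\<close>

lemma good_bilinear:
  assumes f: "\<And>a b. a \<in> W \<Longrightarrow> b \<in> W \<Longrightarrow> f a b \<in> W"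
    and add: "\<And>a a' b. a \<in> W \<Longrightarrow> a' \<in> W \<Longrightarrow> b \<in> W \<Longrightarrow> f (a + a') b = f a b + f a' b"
      "\<And>a b b'. a \<in> W \<Longrightarrow> b \<in> W \<Longrightarrow> b' \<in> W \<Longrightarrow> f a (b + b') = f a b + f a b'"
    and bd: "\<And>p. p \<in> CS \<Longrightarrow> \<exists>p'\<in>CS. \<forall>a\<in>W. \<forall>b\<in>W. seminorm_R G R p (f a b) \<le> seminorm_R G R p' a * seminorm_R G R p' b"
  shows "C.good f"
  unfolding C.good_def
proof (intro conjI ballI f)
  fix q assume q: "q \<in> Q"
  then obtain p where p: "p \<in> CS" "q = seminorm_R G R p" by (rule QE)
  obtain p' where p': "p' \<in> CS" "\<forall>a\<in>W. \<forall>b\<in>W. seminorm_R G R p (f a b) \<le> seminorm_R G R p' a * seminorm_R G R p' b"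
    using bd[OF p(1)] by blast
  let ?q = "seminorm_R G R p'"
  have q': "?q \<in> Q" using p'(1) by (simp add: seminorms_R_def)
  have ineq: "q (f a b - f a' b') \<le> 1 * (?q (a - a') * (1 + ?q b) + (1 + ?q a') * ?q (b - b'))"
    if h: "a \<in> W" "a' \<in> W" "b \<in> W" "b' \<in> W" for a a' b b'
  proof -
    have "f a b = f (a - a') b + f a' b" "f a' b = f a' (b - b') + f a' b'"
      using add(1)[of "a - a'" a' b] add(2)[of a' "b - b'" b'] h by (simp_all only: W_closed diff_add_cancel)
    then have eq: "f a b - f a' b' = f (a - a') b + f a' (b - b')" by (simp only: add.assoc[symmetric] add_diff_cancel_right')
    have "q (f a b - f a' b') \<le> q (f (a - a') b) + q (f a' (b - b'))"
      unfolding eq by (intro C.q_add[OF q] f W_closed h)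
    also have "\<dots> \<le> ?q (a - a') * ?q b + ?q a' * ?q (b - b')"
      unfolding p(2) by (intro add_mono p'(2)[rule_format] W_closed h)
    also have "\<dots> \<le> ?q (a - a') * (1 + ?q b) + (1 + ?q a') * ?q (b - b')"
      by (intro add_mono mult_left_mono mult_right_mono C.q_nonneg[OF q'] W_closed h) simp_all
    finally show ?thesis by simp
  qed
  show "\<exists>q'\<in>Q. \<exists>C. \<forall>a\<in>W. \<forall>a'\<in>W. \<forall>b\<in>W. \<forall>b'\<in>W.
      q (f a b - f a' b') \<le> C * (q' (a - a') * (1 + q' b) + (1 + q' a') * q' (b - b'))"
    by (rule bexI[OF _ q'], rule exI[of _ 1]) (use ineq in blast)
qed

lemma good_star: "C.good (star G z \<Lambda>)"
proof (rule good_bilinear[OF star_in star_bilinear(1)[OF _ _ _ W_closed(1)] star_bilinear(2)[OF _ W_closed(1)]])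
  fix p assume p: "p \<in> CS"
  obtain q where "q \<in> CS" "\<And>a b. a \<in> W \<Longrightarrow> b \<in> W \<Longrightarrow>
    seminorm_R G R p (a \<star> b) \<le> seminorm_R G R q a * seminorm_R G R q b" by (rule star_continuous[OF p R]) (rule that)
  then show "\<exists>p'\<in>CS. \<forall>a\<in>W. \<forall>b\<in>W. seminorm_R G R p (a \<star> b) \<le> seminorm_R G R p' a * seminorm_R G R p' b" by blast
qed

lemma good_mult: "C.good (sym_mult G)"
proof (rule good_bilinear[OF sym_mult_in_W[OF W_in_T W_in_T] sym_mult_bilinear_W(1)[OF _ _ _ W_closed(1)] sym_mult_bilinear_W(2)[OF _ W_closed(1)]])
  fix p assume p: "p \<in> CS"
  obtain q where "q \<in> CS" "\<And>a b. a \<in> W \<Longrightarrow> b \<in> W \<Longrightarrow>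
    seminorm_R G R p (sym_mult G a b) \<le> seminorm_R G R q a * seminorm_R G R q b" by (rule sym_mult_continuous[OF p R]) (rule that)
  then show "\<exists>p'\<in>CS. \<forall>a\<in>W. \<forall>b\<in>W. seminorm_R G R p (sym_mult G a b) \<le> seminorm_R G R p' a * seminorm_R G R p' b" by blast
qed

lemma good_scale: "C.good (\<lambda>a b. fscale c a)"
  unfolding C.good_def
proof (intro conjI ballI W_closed)
  fix q assume q: "q \<in> Q"
  have "q (fscale c a - fscale c a') \<le> norm c * (q (a - a') * (1 + q b) + (1 + q a') * q (b - b'))"
    if h: "a \<in> W" "a' \<in> W" "b \<in> W" "b' \<in> W" for a a' b b'
  proof -
    have "q (fscale c a - fscale c a') \<le> norm c * q (a - a')"
      unfolding fs.scale_right_diff_distrib[symmetric] by (rule Q_scale[OF q W_closed(3)[OF h(1,2)]])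
    also have "\<dots> \<le> norm c * (q (a - a') * (1 + q b) + (1 + q a') * q (b - b'))"
    proof (rule mult_left_mono)
      have nn: "0 \<le> q (a - a')" "0 \<le> q b" "0 \<le> q a'" "0 \<le> q (b - b')"
        by (intro C.q_nonneg[OF q] W_closed h)+
      then have "0 \<le> q (a - a') * q b + (1 + q a') * q (b - b')" by simp
      then show "q (a - a') \<le> q (a - a') * (1 + q b) + (1 + q a') * q (b - b')" by (simp add: distrib_left)
    qed simp
    finally show ?thesis .
  qed
  then show "\<exists>q'\<in>Q. \<exists>C. \<forall>a\<in>W. \<forall>a'\<in>W. \<forall>b\<in>W. \<forall>b'\<in>W.
      q (fscale c a - fscale c a') \<le> C * (q' (a - a') * (1 + q' b) + (1 + q' a') * q' (b - b'))"
    using q by blast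
qed

lemma emb_sq: "emb G R x = C.sq (\<lambda>n. x)"
  unfolding emb_def by (rule C.emb_sq)

lemma W_add_sq: "C.cs a \<Longrightarrow> C.cs b \<Longrightarrow> W_add G R (C.sq a) (C.sq b) = C.sq (\<lambda>n. a n + b n)"
  unfolding W_add_def by (rule C.lift2_sq(1)[OF C.good_add])

lemma W_diff_sq: "C.cs a \<Longrightarrow> C.cs b \<Longrightarrow> W_diff G R (C.sq a) (C.sq b) = C.sq (\<lambda>n. a n - b n)"
    "C.cs a \<Longrightarrow> C.cs b \<Longrightarrow> C.cs (\<lambda>n. a n - b n)"
  unfolding W_diff_def by (rule C.lift2_sq[OF C.good_minus]; assumption)+

lemma W_scale_sq: "C.cs a \<Longrightarrow> W_scale G R c (C.sq a) = C.sq (\<lambda>n. fscale c (a n))"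
    "C.cs a \<Longrightarrow> C.cs (\<lambda>n. fscale c (a n))"
  unfolding W_scale_def by (rule C.lift_sq[OF good_scale]; assumption)+

lemma W_star_sq: "C.cs a \<Longrightarrow> C.cs b \<Longrightarrow> W_star G R z \<Lambda> (C.sq a) (C.sq b) = C.sq (\<lambda>n. a n \<star> b n)"
    "C.cs a \<Longrightarrow> C.cs b \<Longrightarrow> C.cs (\<lambda>n. a n \<star> b n)"
  unfolding W_star_def by (rule C.lift2_sq[OF good_star]; assumption)+

lemma W_mult_sq: "C.cs a \<Longrightarrow> C.cs b \<Longrightarrow> W_mult G R (C.sq a) (C.sq b) = C.sq (\<lambda>n. sym_mult G (a n) (b n))"
    "C.cs a \<Longrightarrow> C.cs b \<Longrightarrow> C.cs (\<lambda>n. sym_mult G (a n) (b n))"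
  unfolding W_mult_def by (rule C.lift2_sq[OF good_mult]; assumption)+

section \<open>Absolutely summable series in the completed algebra\<close>

definition ps :: "(nat \<Rightarrow> ('v, 'k) tensor) \<Rightarrow> nat \<Rightarrow> ('v, 'k) tensor" where
  "ps x N = (\<Sum>n<N. x n)"

definition abs_summable :: "(nat \<Rightarrow> ('v, 'k) tensor) \<Rightarrow> bool" where
  "abs_summable x \<longleftrightarrow> (\<forall>n. x n \<in> W) \<and> (\<forall>q\<in>Q. summable (\<lambda>n. q (x n)))"

lemma ps_in: "\<forall>n. x n \<in> W \<Longrightarrow> ps x N \<in> W"
  unfolding ps_def by (rule fs.subspace_sum[OF subspace_W]) (erule spec)

lemma ps_diff_le:
  assumes x: "\<forall>n. x n \<in> W" and q: "q \<in> Q" and mn: "n \<le> m"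
  shows "q (ps x m - ps x n) \<le> sum (\<lambda>i. q (x i)) {n..<m}"
proof -
  have "ps x m - ps x n = sum x {n..<m}"
    unfolding ps_def lessThan_atLeast0 by (rule sum_diff_nat_ivl) (use mn in simp_all)
  moreover have "q (sum x {n..<m}) \<le> sum (\<lambda>i. q (x i)) {n..<m}"
    by (rule Q_sum[OF q finite_atLeastLessThan]) (rule spec[OF x])
  ultimately show ?thesis by (simp only:)
qed

lemma cs_ps:
  assumes "abs_summable x" shows "C.cs (ps x)"
  unfolding C.cs_def
proof (intro conjI allI ballI impI)
  have x: "\<forall>n. x n \<in> W" using assms by (simp add: abs_summable_def)
  show W: "ps x n \<in> W" for n by (rule ps_in[OF x])
  fix q and e :: real assume q: "q \<in> Q" and e: "e > 0"
  then have "summable (\<lambda>n. q (x n))" using assms by (simp add: abs_summable_def)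
  then obtain N where N: "\<And>m n. m \<ge> N \<Longrightarrow> norm (sum (\<lambda>i. q (x i)) {m..<n}) < e"
    using e unfolding summable_Cauchy by blast
  have lt: "q (ps x m - ps x n) < e" if "n \<ge> N" "n \<le> m" for m n
    using order_le_less_trans[OF ps_diff_le[OF x q that(2)] order_le_less_trans[OF abs_ge_self N[OF that(1), of m, unfolded real_norm_def]]] .
  have "q (ps x m - ps x n) < e" if "m \<ge> N" "n \<ge> N" for m n
    using lt[of n m] lt[of m n] that C.q_sym[OF q W W, of m n] by (cases "n \<le> m") simp_all
  then show "\<exists>N. \<forall>m\<ge>N. \<forall>n\<ge>N. q (ps x m - ps x n) < e" by blast
qed

lemma W_partial_sum_emb:
  assumes "\<forall>n. x n \<in> W" shows "W_partial_sum G R (\<lambda>n. emb G R (x n)) N = emb G R (ps x N)"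
proof (induction N)
  case 0
  show ?case by (simp only: ps_def lessThan_0 sum.empty W_partial_sum.simps)
next
  case (Suc N)
  have "W_partial_sum G R (\<lambda>n. emb G R (x n)) (Suc N) = W_add G R (emb G R (ps x N)) (emb G R (x N))"
    by (simp only: W_partial_sum.simps Suc)
  also have "\<dots> = emb G R (ps x N + x N)"
    unfolding emb_sq by (rule W_add_sq) (intro C.cs_const ps_in assms spec[OF assms])+
  also have "ps x N + x N = ps x (Suc N)" by (simp only: ps_def sum.lessThan_Suc)
  finally show ?case .
qed

lemma W_sums_emb:
  assumes x: "abs_summable x" shows "W_sums G R (\<lambda>n. emb G R (x n)) (C.sq (ps x))"
proof -
  have xW: "\<forall>n. x n \<in> W" using x by (simp add: abs_summable_def)
  have "limitin C.top0 (\<lambda>N. emb G R (ps x N)) (C.sq (ps x)) sequentially"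
  proof (rule C.limitinI[OF C.sq_in[OF cs_ps[OF x]]])
    show "emb G R (ps x N) \<in> C.Cpl" for N unfolding emb_sq by (rule C.sq_in[OF C.cs_const[OF ps_in[OF xW]]])
    fix q and e :: real assume q: "q \<in> Q" and e: "e > 0"
    obtain N where N: "\<And>m n. m \<ge> N \<Longrightarrow> n \<ge> N \<Longrightarrow> q (ps x m - ps x n) < e"
      using cs_ps[OF x] q e unfolding C.cs_def by blast
    have "C.d q (emb G R (ps x M)) (C.sq (ps x)) \<le> e" if "M \<ge> N" for M
      unfolding emb_sq
      by (rule C.d_sq_le[OF C.cs_const[OF ps_in[OF xW]] cs_ps[OF x] q, of N]) (use N[OF that] in \<open>simp add: less_imp_le\<close>)
    then show "eventually (\<lambda>M. C.d q (emb G R (ps x M)) (C.sq (ps x)) \<le> e) sequentially"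
      unfolding eventually_sequentially by blast
  qed
  then show ?thesis unfolding W_sums_def W_topology_def W_partial_sum_emb[OF xW, abs_def] .
qed

lemma W_suminf_emb:
  assumes x: "abs_summable x" shows "W_suminf G R (\<lambda>n. emb G R (x n)) = C.sq (ps x)"
  unfolding W_suminf_def
proof (rule the_equality)
  show "W_sums G R (\<lambda>n. emb G R (x n)) (C.sq (ps x))" by (rule W_sums_emb[OF x])
  fix X assume "W_sums G R (\<lambda>n. emb G R (x n)) X"
  from C.limit_unique[OF this[unfolded W_sums_def W_topology_def] W_sums_emb[OF x, unfolded W_sums_def W_topology_def]]
  show "X = C.sq (ps x)" by simp
qed

lemma W_abs_convergent_emb:
  assumes x: "abs_summable x" shows "W_abs_convergent G R (\<lambda>n. emb G R (x n))"
proof -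
  have "summable (\<lambda>n. completion_seminorm q (emb G R (x n)))" if q: "q \<in> Q" for q
  proof -
    have "completion_seminorm q (emb G R (x n)) = q (x n)" for n
      unfolding emb_def by (rule C.csn_emb[OF _ q]) (use x in \<open>simp add: abs_summable_def\<close>)
    then show ?thesis using x q by (simp add: abs_summable_def)
  qed
  then show ?thesis unfolding W_abs_convergent_def using W_sums_emb[OF x] by blast
qed

text \<open>Powers formed before completing, with the same bracketing as in
  \<open>W_power\<close>.\<close>

primrec fpow :: "(('v, 'k) tensor \<Rightarrow> ('v, 'k) tensor \<Rightarrow> ('v, 'k) tensor) \<Rightarrow> ('v, 'k) tensor \<Rightarrow> nat \<Rightarrow> ('v, 'k) tensor" where
  "fpow f x 0 = sym_one G"
| "fpow f x (Suc n) = f (fpow f x n) x"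

lemma W_power_emb:
  assumes f: "C.good f" and x: "x \<in> W"
  shows "W_power G R (C.lift2 f) (emb G R x) n = emb G R (fpow f x n)" "fpow f x n \<in> W"
proof -
  have both: "W_power G R (C.lift2 f) (emb G R x) n = emb G R (fpow f x n) \<and> fpow f x n \<in> W"
  proof (induction n)
    case 0
    show ?case by (simp only: W_power.simps fpow.simps sym_one_in simp_thms)
  next
    case (Suc n)
    then have W: "fpow f x n \<in> W" by (rule conjunct2)
    have "C.lift2 f (emb G R (fpow f x n)) (emb G R x) = emb G R (f (fpow f x n) x)"
      unfolding emb_sq by (rule C.lift2_sq(1)[OF f C.cs_const[OF W] C.cs_const[OF x]])
    moreover have "f (fpow f x n) x \<in> W" using f W x unfolding C.good_def by (elim conjE) (drule bspec, assumption, drule bspec)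
    ultimately show ?case using Suc by (simp only: W_power.simps fpow.simps simp_thms)
  qed
  show "W_power G R (C.lift2 f) (emb G R x) n = emb G R (fpow f x n)" by (rule conjunct1[OF both])
  show "fpow f x n \<in> W" by (rule conjunct2[OF both])
qed

lemma W_scale_emb:
  assumes "x \<in> W" shows "W_scale G R c (emb G R x) = emb G R (fscale c x)"
  using W_scale_sq(1)[OF C.cs_const[OF assms], of c] unfolding emb_sq .

lemma exp_term_emb:
  assumes "C.good f" "x \<in> W"
  shows "exp_term G R (C.lift2 f) (emb G R x) = (\<lambda>n. emb G R (fscale (1 / fact n) (fpow f x n)))"
proof (rule ext)
  fix n
  show "exp_term G R (C.lift2 f) (emb G R x) n = emb G R (fscale (1 / fact n) (fpow f x n))"
    unfolding exp_term_def W_power_emb(1)[OF assms] by (rule W_scale_emb[OF W_power_emb(2)[OF assms]])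
qed

end

subsection \<open>The exponential of an even vector\<close>

text \<open>The Taylor coefficients of \<open>exp (cs)\<close> and \<open>exp (cs\<^sup>2)\<close>.\<close>

definition ec :: "'a::real_normed_field \<Rightarrow> nat \<Rightarrow> 'a" where
  "ec c m = c ^ m / fact m"

definition gc :: "'a::real_normed_field \<Rightarrow> nat \<Rightarrow> 'a" where
  "gc c m = (if even m then ec c (m div 2) else 0)"

lemma ec_0: "ec c 0 = 1"
  by (simp add: ec_def)

lemma ec_Suc:
  fixes c :: "'a::real_normed_field" shows "of_nat (Suc m) * ec c (Suc m) = c * ec c m"
proof -
  have "(of_nat (Suc m) :: 'a) \<noteq> 0" by (rule of_nat_neq_0)
  then show ?thesis unfolding ec_def fact_Suc power_Suc by (simp add: field_simps del: of_nat_Suc)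
qed

lemma norm_ec: fixes c :: "'a::real_normed_field" shows "norm (ec c m) = ec (norm c) m"
proof -
  have "norm (fact m :: 'a) = fact m" by (metis norm_of_nat of_nat_fact)
  then show ?thesis by (simp add: ec_def norm_divide norm_power)
qed

lemma norm_gc: "norm (gc c m) = gc (norm c) m"
  by (simp add: gc_def norm_ec)

lemma ec_nonneg: "0 \<le> r \<Longrightarrow> 0 \<le> ec (r::real) m"
  by (simp add: ec_def)

lemma gc_even: "gc c (2 * k) = ec c k" and gc_odd: "gc c (Suc (2 * k)) = 0"
  by (simp_all add: gc_def)

text \<open>The coefficient form of (exp (c s^2))' = 2 c s exp (c s^2).\<close>

lemma gc_rec: fixes c :: "'a::real_normed_field" shows "of_nat (m + 2) * gc c (m + 2) = 2 * c * gc c m"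
proof (cases "even m")
  case True
  then obtain k where m: "m = 2 * k" by (elim evenE)
  have "m + 2 = 2 * Suc k" by (simp add: m)
  then have "of_nat (m + 2) * gc c (m + 2) = 2 * (of_nat (Suc k) * ec c (Suc k))"
    by (simp only: gc_even of_nat_mult of_nat_numeral mult.assoc)
  then show ?thesis unfolding ec_Suc m gc_even by simp
qed (simp add: gc_def)

text \<open>The odd coefficients vanish, and (N + 1) div 2 is the number of even numbers below
  N.\<close>

lemma sum_gc: "(\<Sum>m<N. gc c m) = (\<Sum>j<(N + 1) div 2. ec c j)"
proof (induction N)
  case (Suc N)
  show ?case
  proof (cases "even N")
    case True
    then obtain k where "N = 2 * k" by (elim evenE)
    then show ?thesis using Suc by (simp add: gc_even)
  next
    case False
    then obtain k where "N = 2 * k + 1" by (elim oddE)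
    then show ?thesis using Suc by (simp add: gc_odd)
  qed
qed simp

lemma summable_ec: "summable (ec (r::real))"
  using summable_exp[of r] by (simp add: ec_def[abs_def] divide_inverse mult.commute)

lemma summable_gc: assumes "0 \<le> (r::real)" shows "summable (gc r)"
proof (rule summableI_nonneg_bounded)
  show "0 \<le> gc r n" for n using ec_nonneg[OF assms] by (simp add: gc_def)
  show "(\<Sum>i<n. gc r i) \<le> suminf (ec r)" for n
    unfolding sum_gc by (rule sum_le_suminf[OF summable_ec]) (simp_all add: ec_nonneg[OF assms])
qed

text \<open>By \<open>sum_gc\<close> the difference is a block of the exponential series from (M +
  1) div 2 to M. It is bounded by the same block for norm c, a difference of two partial sums of a
  convergent series.\<close>

lemma ec_gc_tendsto: "(\<lambda>M. norm ((\<Sum>m<M. ec c m) - (\<Sum>m<M. gc c m))) \<longlonglongrightarrow> 0"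
proof -
  let ?A = "\<lambda>N. \<Sum>m<N. ec (norm c) m" and ?h = "\<lambda>M::nat. (M + 1) div 2"
  have A: "?A \<longlonglongrightarrow> suminf (ec (norm c))" by (rule summable_LIMSEQ[OF summable_ec])
  have "filterlim ?h at_top at_top"
    unfolding filterlim_at_top
  proof
    fix Z :: nat
    show "eventually (\<lambda>M. Z \<le> ?h M) at_top"
      by (rule eventually_mono[OF eventually_ge_at_top[of "2 * Z"]]) linarith
  qed
  from tendsto_diff[OF A filterlim_compose[OF A this]]
  have lim: "(\<lambda>M. ?A M - ?A (?h M)) \<longlonglongrightarrow> 0" by simp
  have "norm ((\<Sum>m<M. ec c m) - (\<Sum>m<M. gc c m)) \<le> ?A M - ?A (?h M)" for M
  proof -
    have le: "?h M \<le> M" by linarith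
    have d: "sum f {..<M} - sum f {..<?h M} = sum f {?h M..<M}" for f :: "nat \<Rightarrow> 'z::ab_group_add"
      unfolding lessThan_atLeast0 by (rule sum_diff_nat_ivl) (use le in simp_all)
    have "norm ((\<Sum>m<M. ec c m) - (\<Sum>m<M. gc c m)) = norm (\<Sum>m\<in>{?h M..<M}. ec c m)"
      unfolding sum_gc d ..
    also have "\<dots> \<le> (\<Sum>m\<in>{?h M..<M}. norm (ec c m))" by (rule norm_sum)
    also have "\<dots> = ?A M - ?A (?h M)" unfolding norm_ec d ..
    finally show ?thesis .
  qed
  then show ?thesis
    by (intro tendsto_sandwich[OF always_eventually always_eventually tendsto_const lim]) simp_all
qed

context weyl_R
begin

definition u :: "'k \<Rightarrow> nat \<Rightarrow> ('v, 'k) tensor" where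
  "u t i = fscale (ec t i) (pw w i)"

lemma u_in: "u t i \<in> W"
  unfolding u_def by (rule W_closed(4)[OF sym_prod_in_W])

text \<open>The n-th power of w has seminorm at most (n!)^R p(w)^n, and
  \<open>summable_fact_powr\<close> sums this against t^n / n!.\<close>

lemma u_summable: assumes q: "q \<in> Q" shows "summable (\<lambda>i. q (u t i))"
proof -
  obtain p where p: "p \<in> CS" "q = seminorm_R G R p" using q by (rule QE)
  let ?r = "\<bar>p w\<bar>"
  show ?thesis
  proof (rule summable_comparison_test'[OF summable_fact_powr[OF R(2), of "norm t * ?r"]])
    fix n
    have nn: "0 \<le> q (u t n)" by (rule C.q_nonneg[OF q u_in])
    have "p w ^ n \<le> ?r ^ n" using abs_ge_self[of "p w ^ n"] by (simp only: power_abs)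
    then have "fact n powr R * p w ^ n \<le> fact n powr R * ?r ^ n" by (rule mult_left_mono) simp
    with seminorm_pw[OF p(1) w, of R n] have pw: "q (pw w n) \<le> fact n powr R * ?r ^ n" unfolding p(2) by linarith
    have "q (u t n) \<le> norm (ec t n) * q (pw w n)" unfolding u_def by (rule Q_scale[OF q sym_prod_in_W])
    also have "\<dots> \<le> norm (ec t n) * (fact n powr R * ?r ^ n)" by (rule mult_left_mono[OF pw norm_ge_zero])
    also have "\<dots> = (norm t * ?r) ^ n / fact n * fact n powr R" unfolding norm_ec unfolding ec_def by (simp add: power_mult_distrib)
    finally show "norm (q (u t n)) \<le> (norm t * ?r) ^ n / fact n * fact n powr R" using nn by simp
  qed simp
qed

lemma abs_summable_u: "abs_summable (u t)"
  unfolding abs_summable_def using u_in u_summable by blast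

text \<open>The coefficient of s^n in b(s) exp (s t w), where b(s) is the series with coefficients
  b. The formal variable s stays implicit; it explains the recursions below.\<close>

definition CP :: "(nat \<Rightarrow> 'k) \<Rightarrow> 'k \<Rightarrow> nat \<Rightarrow> ('v, 'k) tensor" where
  "CP b t n = (\<Sum>i\<le>n. fscale (b (n - i)) (u t i))"

lemma CP_in: "CP b t n \<in> W"
  unfolding CP_def by (rule fs.subspace_sum[OF subspace_W]) (rule W_closed(4)[OF u_in])

lemma abs_summable_CP:
  assumes b: "summable (\<lambda>m. norm (b m))" shows "abs_summable (CP b t)"
  unfolding abs_summable_def
proof (intro conjI allI ballI CP_in)
  fix q assume q: "q \<in> Q"
  have nn: "0 \<le> q (u t i)" for i by (rule C.q_nonneg[OF q u_in])
  have "summable (\<lambda>n. \<Sum>i\<le>n. q (u t i) * norm (b (n - i)))"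
  proof (rule summable_Cauchy_product)
    show "summable (\<lambda>k. norm (q (u t k)))" using u_summable[OF q, of t] nn by simp
    show "summable (\<lambda>k. norm (norm (b k)))" using b by simp
  qed
  then show "summable (\<lambda>n. q (CP b t n))"
  proof (rule summable_comparison_test')
    fix n
    have "q (CP b t n) \<le> (\<Sum>i\<le>n. q (fscale (b (n - i)) (u t i)))"
      unfolding CP_def by (rule Q_sum[OF q finite_atMost]) (rule W_closed(4)[OF u_in])
    also have "\<dots> \<le> (\<Sum>i\<le>n. q (u t i) * norm (b (n - i)))"
      unfolding mult.commute[of "q _"] by (rule sum_mono) (rule Q_scale[OF q u_in])
    finally show "norm (q (CP b t n)) \<le> (\<Sum>i\<le>n. q (u t i) * norm (b (n - i)))"
      using C.q_nonneg[OF q CP_in, of b t n] by simp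
  qed
qed

text \<open>Summing by columns shows \<open>u t i\<close> with a partial sum of b, shortened by i,
  as its coefficient.\<close>

lemma ps_CP: "ps (CP b t) N = (\<Sum>i<N. fscale (\<Sum>m<N - i. b m) (u t i))"
proof -
  have "ps (CP b t) N = (\<Sum>i<N. \<Sum>m<N - i. fscale (b m) (u t i))"
    unfolding ps_def CP_def by (rule sum_triangle)
  then show ?thesis by (simp only: fs.scale_sum_left)
qed

text \<open>By \<open>ps_CP\<close> the seminorm of the difference is at most a convolution of a
  null sequence with the summable q (u t i). In the limit, therefore, only the sum of b
  counts.\<close>

lemma sq_CP_cong:
  assumes b: "summable (\<lambda>m. norm (b m))" and b': "summable (\<lambda>m. norm (b' m))"
    and lim: "(\<lambda>M. norm ((\<Sum>m<M. b m) - (\<Sum>m<M. b' m))) \<longlonglongrightarrow> 0"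
  shows "C.sq (ps (CP b t)) = C.sq (ps (CP b' t))"
proof (rule C.sq_eq[OF cs_ps[OF abs_summable_CP[OF b]] cs_ps[OF abs_summable_CP[OF b']]])
  fix q assume q: "q \<in> Q"
  let ?\<delta> = "\<lambda>M. norm ((\<Sum>m<M. b m) - (\<Sum>m<M. b' m))"
  have nn: "0 \<le> q (u t i)" for i by (rule C.q_nonneg[OF q u_in])
  show "(\<lambda>N. q (ps (CP b t) N - ps (CP b' t) N)) \<longlonglongrightarrow> 0"
  proof -
    have lim': "(\<lambda>N. \<Sum>i<N. ?\<delta> (N - i) * q (u t i)) \<longlonglongrightarrow> 0"
      by (rule toeplitz_tendsto[OF lim u_summable[OF q] nn])
    have ge: "0 \<le> q (ps (CP b t) N - ps (CP b' t) N)" for N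
      by (rule C.q_nonneg[OF q W_closed(3)]) (intro ps_in allI CP_in)+
    have "q (ps (CP b t) N - ps (CP b' t) N) \<le> (\<Sum>i<N. ?\<delta> (N - i) * q (u t i))" for N
    proof -
      have eq: "ps (CP b t) N - ps (CP b' t) N = (\<Sum>i<N. fscale ((\<Sum>m<N - i. b m) - (\<Sum>m<N - i. b' m)) (u t i))"
        by (simp only: ps_CP sum_subtractf fs.scale_left_diff_distrib)
      have "q (ps (CP b t) N - ps (CP b' t) N) \<le> (\<Sum>i<N. q (fscale ((\<Sum>m<N - i. b m) - (\<Sum>m<N - i. b' m)) (u t i)))"
        unfolding eq by (rule Q_sum[OF q finite_lessThan]) (rule W_closed(4)[OF u_in])
      also have "\<dots> \<le> (\<Sum>i<N. ?\<delta> (N - i) * q (u t i))"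
        by (rule sum_mono) (rule Q_scale[OF q u_in])
      finally show ?thesis .
    qed
    then show ?thesis
      using ge by (intro tendsto_sandwich[OF always_eventually always_eventually tendsto_const lim']) simp_all
  qed
qed

lemma sq_CP_ec_gc: "C.sq (ps (CP (ec c) t)) = C.sq (ps (CP (gc c) t))" "abs_summable (CP (ec c) t)" "abs_summable (CP (gc c) t)"
proof -
  have s: "summable (\<lambda>m. norm (ec c m))" "summable (\<lambda>m. norm (gc c m))"
    unfolding norm_ec norm_gc using summable_ec[of "norm c"] summable_gc[OF norm_ge_zero[of c]] by simp_all
  show "C.sq (ps (CP (ec c) t)) = C.sq (ps (CP (gc c) t))" by (rule sq_CP_cong[OF s ec_gc_tendsto])
  show "abs_summable (CP (ec c) t)" "abs_summable (CP (gc c) t)" by (rule abs_summable_CP[OF s(1)], rule abs_summable_CP[OF s(2)])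
qed

text \<open>\<open>Lu\<close> says that L acts on exp (s t w) as d/ds + \<beta> + \<gamma> s, and
  the conditions on b say b' = (\<beta> + \<gamma> s) b. By the product rule L acts on b(s) exp (s t
  w) as d/ds, which in coefficients is the claim.\<close>

lemma CP_step:
  assumes L: "\<And>a b. a \<in> W \<Longrightarrow> b \<in> W \<Longrightarrow> L (a + b) = L a + L b" "\<And>c a. a \<in> W \<Longrightarrow> L (fscale c a) = fscale c (L a)"
    and Lu: "\<And>i. L (u t i) = fscale (of_nat (Suc i)) (u t (Suc i)) + fscale \<beta> (u t i) + fscale \<gamma> (if i = 0 then 0 else u t (i - 1))"
    and b: "b 1 = \<beta> * b 0" "\<And>m. of_nat (m + 2) * b (m + 2) = \<beta> * b (m + 1) + \<gamma> * b m"
  shows "L (CP b t n) = fscale (of_nat (Suc n)) (CP b t (Suc n))"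
proof (rule ext)
  fix \<phi>
  have "L (CP b t n) = (\<Sum>i\<le>n. fscale (b (n - i)) (L (u t i)))"
    unfolding CP_def by (rule W_linear_sum[of L]) (fact L | rule u_in)+
  then have "L (CP b t n) \<phi> = (\<Sum>i\<le>n. b (n - i) * L (u t i) \<phi>)"
    by (simp only: sum_fun_apply fscale_apply)
  also have "\<dots> = (\<Sum>i\<le>n. b (n - i) * (of_nat (Suc i) * u t (Suc i) \<phi> + \<beta> * u t i \<phi> + \<gamma> * (if i = 0 then 0 else u t (i - 1) \<phi>)))"
  proof (rule sum.cong[OF refl])
    fix i
    show "b (n - i) * L (u t i) \<phi> = b (n - i) * (of_nat (Suc i) * u t (Suc i) \<phi> + \<beta> * u t i \<phi> + \<gamma> * (if i = 0 then 0 else u t (i - 1) \<phi>))"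
      unfolding Lu by (cases "i = 0") simp_all
  qed
  also have "\<dots> = of_nat (Suc n) * (\<Sum>i\<le>Suc n. b (Suc n - i) * u t i \<phi>)"
    by (rule coefficient_recursion[OF b, symmetric])
  also have "\<dots> = fscale (of_nat (Suc n)) (CP b t (Suc n)) \<phi>"
    by (simp only: CP_def sum_fun_apply fscale_apply)
  finally show "L (CP b t n) \<phi> = fscale (of_nat (Suc n)) (CP b t (Suc n)) \<phi>" .
qed

lemma u_0: "u t 0 = sym_one G"
  unfolding u_def ec_0 fs.scale_one replicate_0 sym_prod_Nil ..

text \<open>\<open>CP_step\<close> is iterated for multiplication by x from the right; the factors n
  + 1 build up the factorial.\<close>

lemma fpow_CP:
  assumes L: "\<And>a b. a \<in> W \<Longrightarrow> b \<in> W \<Longrightarrow> f (a + b) x = f a x + f b x" "\<And>c a. a \<in> W \<Longrightarrow> f (fscale c a) x = fscale c (f a x)"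
    and Lu: "\<And>i. f (u t i) x = fscale (of_nat (Suc i)) (u t (Suc i)) + fscale \<beta> (u t i) + fscale \<gamma> (if i = 0 then 0 else u t (i - 1))"
    and b: "b 0 = 1" "b 1 = \<beta> * b 0" "\<And>m. of_nat (m + 2) * b (m + 2) = \<beta> * b (m + 1) + \<gamma> * b m"
  shows "fpow f x n = fscale (fact n) (CP b t n)"
proof (induction n)
  case 0
  have "CP b t 0 = fscale (b (0 - 0)) (u t 0)" unfolding CP_def atMost_0 by (subst sum.insert) (simp_all only: finite.emptyI empty_iff not_False_eq_True sum.empty add_0_right)
  then show ?case by (simp only: fpow.simps u_0 b(1) fact_0 fs.scale_one diff_0_eq_0)
next
  case (Suc n)
  have "f (CP b t n) x = fscale (of_nat (Suc n)) (CP b t (Suc n))"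
    by (rule CP_step[where L = "\<lambda>a. f a x" and \<beta> = \<beta> and \<gamma> = \<gamma>]) (fact L Lu b)+
  then have "f (fscale (fact n) (CP b t n)) x = fscale (fact n * of_nat (Suc n)) (CP b t (Suc n))"
    by (simp only: L(2)[OF CP_in] fs.scale_scale)
  then show ?case by (simp only: fpow.simps Suc fact_Suc mult.commute[of "fact n"])
qed

text \<open>The binomial theorem for tw + c1: multiplication by this element is d/ds + c on exp (s t
  w), and b(s) = exp (c s) solves b' = c b.\<close>

lemma fpow_mult:
  "fpow (sym_mult G) (sym_vec G (vscale G t w) + fscale c (sym_one G)) n = fscale (fact n) (CP (ec c) t n)"
proof (rule fpow_CP[where \<beta> = c and \<gamma> = 0])
  let ?x = "sym_vec G (vscale G t w) + fscale c (sym_one G)"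
  have x: "?x \<in> W" by (intro W_closed sym_vec_in sym_one_in)
  show "sym_mult G (a + b) ?x = sym_mult G a ?x + sym_mult G b ?x" if "a \<in> W" "b \<in> W" for a b
    by (rule sym_mult_bilinear_W(1)[OF that x x])
  show "sym_mult G (fscale k a) ?x = fscale k (sym_mult G a ?x)" if "a \<in> W" for k a
    by (rule sym_mult_bilinear_W(3)[OF that that x x])
  show "ec c 0 = 1" by (rule ec_0)
  show "ec c 1 = c * ec c 0" by (simp add: ec_def)
  show "of_nat (m + 2) * ec c (m + 2) = c * ec c (m + 1) + 0 * ec c m" for m
    using ec_Suc[of "m + 1" c] by simp
  fix i
  have p: "pw w i \<in> W" by (rule sym_prod_in_W)
  have "sym_mult G (pw w i) ?x = fscale t (pw w (Suc i)) + fscale c (pw w i)"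
    unfolding sym_vec_linear(2)
    unfolding sym_mult_bilinear_W(2)[OF p p W_closed(4)[OF sym_vec_in] W_closed(4)[OF sym_one_in]]
      sym_mult_bilinear_W(4)[OF p p sym_vec_in sym_vec_in] sym_mult_bilinear_W(4)[OF p p sym_one_in sym_one_in]
      sym_mult_pw[OF w] ..
  then have eq: "sym_mult G (u t i) ?x = fscale (ec t i) (fscale t (pw w (Suc i)) + fscale c (pw w i))"
    unfolding u_def sym_mult_bilinear_W(3)[OF p p x x] by (simp only:)
  show "sym_mult G (u t i) ?x = fscale (of_nat (Suc i)) (u t (Suc i)) + fscale c (u t i) + fscale 0 (if i = 0 then 0 else u t (i - 1))"
    unfolding eq
    unfolding u_def fs.scale_scale ec_Suc fs.scale_zero_left add_0_right fs.scale_right_distrib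
    by (simp only: mult.commute)
qed

section \<open>Star powers of w and their generating series\<close>

definition H :: "nat \<Rightarrow> ('v, 'k) tensor" where
  "H = fpow (star G z \<Lambda>) (sym_vec G w)"

abbreviation "\<kappa> \<equiv> z / 2 * \<Lambda> w w"

text \<open>By \<open>pw_star\<close>, star multiplication by w acts on exp (s w) as d/ds + z
  \<Lambda>(w, w) s, and b(s) = exp (\<kappa> s^2) solves b' = 2 \<kappa> s b.\<close>

lemma H_CP: "H n = fscale (fact n) (CP (gc \<kappa>) 1 n)"
  unfolding H_def
proof (rule fpow_CP[where \<beta> = 0 and \<gamma> = "2 * \<kappa>"])
  let ?x = "sym_vec G w"
  have x: "?x \<in> W" by (rule sym_vec_in)
  show "(a + b) \<star> ?x = a \<star> ?x + b \<star> ?x" if "a \<in> W" "b \<in> W" for a b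
    by (rule star_bilinear(1)[OF that x x])
  show "fscale k a \<star> ?x = fscale k (a \<star> ?x)" if "a \<in> W" for k a
    by (rule star_bilinear(3)[OF that that x x])
  show "gc \<kappa> 0 = 1" by (simp add: gc_def ec_0)
  show "gc \<kappa> 1 = 0 * gc \<kappa> 0" by (simp add: gc_def)
  show "of_nat (m + 2) * gc \<kappa> (m + 2) = 0 * gc \<kappa> (m + 1) + 2 * \<kappa> * gc \<kappa> m" for m
    unfolding gc_rec by simp
  fix i
  have p: "pw w i \<in> W" by (rule sym_prod_in_W)
  have eq: "u 1 i \<star> ?x = fscale (ec 1 i) (pw w (Suc i) + fscale (z * of_nat i * \<Lambda> w w) (pw w (i - 1)))"
    unfolding u_def star_bilinear(3)[OF p p x x] pw_star(1)[OF w] sym_mult_pw(1)[OF w] ..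
  show "u 1 i \<star> ?x = fscale (of_nat (Suc i)) (u 1 (Suc i)) + fscale 0 (u 1 i) + fscale (2 * \<kappa>) (if i = 0 then 0 else u 1 (i - 1))"
  proof (rule ext)
    fix \<phi>
    show "(u 1 i \<star> ?x) \<phi> = (fscale (of_nat (Suc i)) (u 1 (Suc i)) + fscale 0 (u 1 i) + fscale (2 * \<kappa>) (if i = 0 then 0 else u 1 (i - 1))) \<phi>"
    proof (cases i)
      case 0
      show ?thesis unfolding eq by (simp add: 0 u_def ec_def)
    next
      case (Suc j)
      \<comment> \<open>The factor produced by the contraction cancels against the
        factorial.\<close>
      have e: "of_nat (Suc i) * (ec 1 (Suc i) * X) = ec 1 i * X" "of_nat (Suc j) * (ec 1 (Suc j) * X) = ec 1 j * X" for X :: 'k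
        unfolding mult.assoc[symmetric] ec_Suc by simp_all
      have "(u 1 i \<star> ?x) \<phi> = ec 1 i * pw w (Suc i) \<phi> + z * \<Lambda> w w * (of_nat (Suc j) * (ec 1 (Suc j) * pw w j \<phi>))"
        unfolding eq by (simp add: Suc algebra_simps del: of_nat_Suc replicate_Suc)
      also have "\<dots> = of_nat (Suc i) * (ec 1 (Suc i) * pw w (Suc i) \<phi>) + 2 * \<kappa> * (ec 1 j * pw w j \<phi>)"
        unfolding e by simp
      finally show ?thesis by (simp add: Suc u_def del: of_nat_Suc replicate_Suc)
    qed
  qed
qed

lemma H_in: "H n \<in> W"
  unfolding H_CP by (rule W_closed(4)[OF CP_in])

lemma H_Suc: "H n \<star> sym_vec G w = H (Suc n)"
  unfolding H_def fpow.simps ..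

text \<open>The terms of the star exponential series of \<open>tw\<close> and of its derivative in \<open>t\<close>.\<close>

definition Ht :: "'k \<Rightarrow> nat \<Rightarrow> ('v, 'k) tensor" where
  "Ht t n = fscale (ec t n) (H n)"

definition dH :: "'k \<Rightarrow> nat \<Rightarrow> ('v, 'k) tensor" where
  "dH t n = fscale (if n = 0 then 0 else ec t (n - 1)) (H n)"

lemma gc_scale: "t ^ m * gc c m = gc (t\<^sup>2 * c) m"
  by (auto simp: gc_def ec_def power_mult_distrib power_mult[symmetric] elim!: evenE)

text \<open>Rescaling s to t s: the factor \<open>t ^ n\<close> is distributed as
  \<open>t ^ (n - i)\<close> on the quadratic exponential and \<open>t ^ i\<close> on the power of
  w.\<close>

lemma Ht_CP: "Ht t = CP (gc (t\<^sup>2 * \<kappa>)) t"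
proof (intro ext)
  fix n \<phi>
  have "Ht t n = fscale (t ^ n) (CP (gc \<kappa>) 1 n)"
    unfolding Ht_def H_CP fs.scale_scale by (simp only: ec_def) simp
  then have "Ht t n \<phi> = (\<Sum>i\<le>n. t ^ n * (gc \<kappa> (n - i) * (ec 1 i * pw w i \<phi>)))"
    by (simp only: CP_def u_def sum_fun_apply fscale_apply sum_distrib_left)
  also have "\<dots> = (\<Sum>i\<le>n. gc (t\<^sup>2 * \<kappa>) (n - i) * (ec t i * pw w i \<phi>))"
  proof (rule sum.cong[OF refl])
    fix i assume "i \<in> {..n}"
    then have "t ^ n = t ^ (n - i) * t ^ i" by (simp flip: power_add)
    then have "t ^ n * (gc \<kappa> (n - i) * (ec 1 i * pw w i \<phi>)) = (t ^ (n - i) * gc \<kappa> (n - i)) * ((t ^ i * ec 1 i) * pw w i \<phi>)"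
      by (simp add: mult_ac)
    then show "t ^ n * (gc \<kappa> (n - i) * (ec 1 i * pw w i \<phi>)) = gc (t\<^sup>2 * \<kappa>) (n - i) * (ec t i * pw w i \<phi>)"
      unfolding gc_scale by (simp add: ec_def)
  qed
  also have "\<dots> = CP (gc (t\<^sup>2 * \<kappa>)) t n \<phi>" by (simp only: CP_def u_def sum_fun_apply fscale_apply)
  finally show "Ht t n \<phi> = CP (gc (t\<^sup>2 * \<kappa>)) t n \<phi>" .
qed

lemma abs_summable_Ht: "abs_summable (Ht t)"
  unfolding Ht_CP by (rule sq_CP_ec_gc)

text \<open>The symmetric powers come with the coefficients of exp (t^2 \<kappa> s), the star powers
  with those of exp (t^2 \<kappa> s^2). The two functions agree at s = 1, and
  \<open>sq_CP_ec_gc\<close> exchanges them.\<close>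

lemma exp_quadratic:
  "W_exp G R (emb G R (sym_vec G (vscale G t w) + fscale (t\<^sup>2 * z / 2 * \<Lambda> w w) (sym_one G))) = C.sq (ps (Ht t))"
proof -
  let ?x = "sym_vec G (vscale G t w) + fscale (t\<^sup>2 * \<kappa>) (sym_one G)"
  have x: "?x \<in> W" by (intro W_closed sym_vec_in sym_one_in)
  have k: "t\<^sup>2 * z / 2 * \<Lambda> w w = t\<^sup>2 * \<kappa>" by simp
  have e: "fscale (1 / fact n) (fscale (fact n) a) = a" for n and a :: "('v, 'k) tensor"
    unfolding fs.scale_scale by (rule ext) simp
  have "W_exp G R (emb G R ?x) = W_suminf G R (\<lambda>n. emb G R (CP (ec (t\<^sup>2 * \<kappa>)) t n))"
    unfolding W_exp_def W_mult_def exp_term_emb[OF good_mult x] fpow_mult e ..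
  also have "\<dots> = C.sq (ps (Ht t))"
    unfolding W_suminf_emb[OF sq_CP_ec_gc(2)] sq_CP_ec_gc(1) Ht_CP ..
  finally show ?thesis unfolding k .
qed

lemma exp_vec: "W_exp G R (emb G R (sym_vec G w)) = C.sq (ps (u 1))"
proof -
  have "fpow (sym_mult G) (sym_vec G w) n = pw w n" for n
    by (induction n) (simp_all only: fpow.simps sym_mult_pw(1)[OF w] replicate_0 sym_prod_Nil)
  then have "fscale (1 / fact n) (fpow (sym_mult G) (sym_vec G w) n) = u 1 n" for n
    by (simp only: u_def ec_def power_one)
  then have "W_exp G R (emb G R (sym_vec G w)) = W_suminf G R (\<lambda>n. emb G R (u 1 n))"
    unfolding W_exp_def W_mult_def exp_term_emb[OF good_mult sym_vec_in] by (simp only:)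
  then show ?thesis unfolding W_suminf_emb[OF abs_summable_u] .
qed

section \<open>Star products of the exponential with a vector\<close>

lemma null_terms:
  assumes x: "abs_summable x" and q: "q \<in> Q" shows "(\<lambda>M. q (fscale c (x M))) \<longlonglongrightarrow> 0"
proof -
  have xW: "x M \<in> W" for M using x by (simp add: abs_summable_def)
  have "(\<lambda>M. q (x M)) \<longlonglongrightarrow> 0"
    by (rule summable_LIMSEQ_zero) (use x q in \<open>simp add: abs_summable_def\<close>)
  then have lim: "(\<lambda>M. norm c * q (x M)) \<longlonglongrightarrow> 0" by (rule tendsto_mult_right_zero)
  have "0 \<le> q (fscale c (x M))" "q (fscale c (x M)) \<le> norm c * q (x M)" for M
    by (rule C.q_nonneg[OF q W_closed(4)[OF xW]], rule Q_scale[OF q xW])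
  then show ?thesis by (intro tendsto_sandwich[OF always_eventually always_eventually tendsto_const lim]) simp_all
qed

text \<open>The partial sums of the two sides differ by a multiple of the last term of the exponential series.\<close>

lemma exp_linear:
  assumes F: "\<And>a b. a \<in> W \<Longrightarrow> b \<in> W \<Longrightarrow> F (a + b) = F a + F b" "\<And>c a. a \<in> W \<Longrightarrow> F (fscale c a) = fscale c (F a)"
    and cs: "C.cs (\<lambda>N. F (ps (u 1) N))"
    and Fpw: "\<And>i. F (pw w i) = sym_mult G (pw w i) (sym_vec G v) + fscale (k * of_nat i) (pw w (i - 1))"
  shows "C.sq (\<lambda>N. F (ps (u 1) N)) = W_mult G R (C.sq (ps (u 1))) (emb G R (sym_vec G v + fscale k (sym_one G)))"
proof -
  let ?x = "sym_vec G v + fscale k (sym_one G)"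
  let ?m = "\<lambda>a. sym_mult G a ?x"
  \<comment> \<open>The boundary term k w^(N-1) / (N-1)!, with the default 0 at N = 0.\<close>
  let ?A = "\<lambda>N. fscale k (if N = 0 then 0 else u 1 (N - 1))"
  have x: "?x \<in> W" by (intro W_closed sym_vec_in sym_one_in)
  note M = W_mult_sq[OF cs_ps[OF abs_summable_u] C.cs_const[OF x]]
  have p: "pw w i \<in> W" for i by (rule sym_prod_in_W)
  have psW: "ps (u 1) N \<in> W" for N by (intro ps_in allI u_in)
  have mpw: "?m (pw w i) = sym_mult G (pw w i) (sym_vec G v) + fscale k (pw w i)" for i
    unfolding sym_mult_bilinear_W(2)[OF p p sym_vec_in W_closed(4)[OF sym_one_in]]
      sym_mult_bilinear_W(4)[OF p p sym_one_in sym_one_in] sym_mult_pw(2)[OF w] ..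
  \<comment> \<open>Since i / i! = 1 / (i - 1)!, F and multiplication by \<open>?x\<close> differ by
    ?A i - ?A (i + 1), which telescopes.\<close>
  have Fu: "F (u 1 i) = ?m (u 1 i) + (?A i - fscale k (u 1 i))" for i
  proof -
    have 1: "F (u 1 i) = fscale (ec 1 i) (F (pw w i))" unfolding u_def by (rule F(2)[OF p])
    have 2: "?m (u 1 i) = fscale (ec 1 i) (?m (pw w i))" unfolding u_def by (rule sym_mult_bilinear_W(3)[OF p p x x])
    show ?thesis unfolding 1 2 mpw Fpw
    proof (rule ext)
      fix \<phi>
      show "fscale (ec 1 i) (sym_mult G (pw w i) (sym_vec G v) + fscale (k * of_nat i) (pw w (i - 1))) \<phi> =
        (fscale (ec 1 i) (sym_mult G (pw w i) (sym_vec G v) + fscale k (pw w i)) + (?A i - fscale k (u 1 i))) \<phi>"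
      proof (cases i)
        case 0
        show ?thesis by (simp add: 0 u_def algebra_simps)
      next
        case (Suc j)
        have e: "ec 1 (Suc j) * (k * of_nat (Suc j) * X) = k * (ec 1 j * X)" for X :: 'k
          using arg_cong[OF ec_Suc[of j "1 :: 'k"], of "\<lambda>y. k * (y * X)"] by (simp only: mult_ac mult_1 mult_1_right)
        show ?thesis by (simp add: Suc u_def e distrib_left del: of_nat_Suc replicate_Suc)
      qed
    qed
  qed
  have D: "F (ps (u 1) N) = ?m (ps (u 1) N) - ?A N" for N
  proof (induction N)
    case 0
    have 1: "F 0 = 0" using F(2)[OF W_closed(1), of 0] by (simp only: fs.scale_zero_left)
    have 2: "?m 0 = 0" using sym_mult_bilinear_W(3)[OF W_closed(1) W_closed(1) x x, of 0] by (simp only: fs.scale_zero_left)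
    show ?case by (simp only: ps_def lessThan_0 sum.empty 1 2 simp_thms if_True fs.scale_zero_right diff_zero)
  next
    case (Suc N)
    have s: "ps (u 1) (Suc N) = ps (u 1) N + u 1 N" by (simp only: ps_def sum.lessThan_Suc)
    have 1: "F (ps (u 1) (Suc N)) = (?m (ps (u 1) N) - ?A N) + (?m (u 1 N) + (?A N - fscale k (u 1 N)))"
      unfolding s F(1)[OF psW u_in] Fu Suc ..
    have 2: "?m (ps (u 1) (Suc N)) = ?m (ps (u 1) N) + ?m (u 1 N)"
      unfolding s by (rule sym_mult_bilinear_W(1)[OF psW u_in x x])
    have 3: "?A (Suc N) = fscale k (u 1 N)" by (simp only: nat.simps if_False diff_Suc_1)
    have "(a - b) + (c + (b - d)) = (a + c) - d" for a b c d :: "('v, 'k) tensor" by (rule ext) simp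
    then show ?case unfolding 1 2 3 .
  qed
  have "C.sq (\<lambda>N. F (ps (u 1) N)) = C.sq (\<lambda>N. ?m (ps (u 1) N))"
  proof (rule C.sq_eq[OF cs M(2)])
    fix q assume q: "q \<in> Q"
    have "F (ps (u 1) (Suc N)) - ?m (ps (u 1) (Suc N)) = fscale (- k) (u 1 N)" for N
      unfolding D by (rule ext) simp
    with null_terms[OF abs_summable_u q, of "- k" 1]
    have "(\<lambda>N. q (F (ps (u 1) (Suc N)) - ?m (ps (u 1) (Suc N)))) \<longlonglongrightarrow> 0" by (simp only:)
    then show "(\<lambda>N. q (F (ps (u 1) N) - ?m (ps (u 1) N))) \<longlonglongrightarrow> 0" by (rule LIMSEQ_imp_Suc)
  qed
  also have "\<dots> = W_mult G R (C.sq (ps (u 1))) (emb G R ?x)"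
    unfolding emb_sq by (rule M(1)[symmetric])
  finally show ?thesis .
qed

text \<open>\<open>exp_linear\<close> for star multiplication by v from the right and from the left;
  \<open>pw_star\<close> provides its hypothesis on powers.\<close>

lemma exp_star_vec:
  "W_star G R z \<Lambda> (W_exp G R (emb G R (sym_vec G w))) (emb G R (sym_vec G v)) =
    W_mult G R (W_exp G R (emb G R (sym_vec G w))) (emb G R (sym_vec G v + fscale (z * \<Lambda> w v) (sym_one G)))"
  "W_star G R z \<Lambda> (emb G R (sym_vec G v)) (W_exp G R (emb G R (sym_vec G w))) =
    W_mult G R (W_exp G R (emb G R (sym_vec G w))) (emb G R (sym_vec G v + fscale (z * \<Lambda> v w) (sym_one G)))"
proof -
  note v = sym_vec_in[of v]
  note c = cs_ps[OF abs_summable_u, of 1] C.cs_const[OF v]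
  note s = W_star_sq[OF c] W_star_sq[OF c(2,1)]
  have "C.sq (\<lambda>N. ps (u 1) N \<star> sym_vec G v) =
    W_mult G R (C.sq (ps (u 1))) (emb G R (sym_vec G v + fscale (z * \<Lambda> w v) (sym_one G)))"
  proof (rule exp_linear[where F = "\<lambda>a. a \<star> sym_vec G v"])
    show "(a + b) \<star> sym_vec G v = a \<star> sym_vec G v + b \<star> sym_vec G v" if "a \<in> W" "b \<in> W" for a b
      by (rule star_bilinear(1)[OF that v v])
    show "fscale k a \<star> sym_vec G v = fscale k (a \<star> sym_vec G v)" if "a \<in> W" for k a
      by (rule star_bilinear(3)[OF that that v v])
    show "C.cs (\<lambda>N. ps (u 1) N \<star> sym_vec G v)" by (rule s(2))
    show "pw w i \<star> sym_vec G v = sym_mult G (pw w i) (sym_vec G v) + fscale (z * \<Lambda> w v * of_nat i) (pw w (i - 1))" for i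
      unfolding pw_star(1)[OF w] by (simp only: mult_ac)
  qed
  then show "W_star G R z \<Lambda> (W_exp G R (emb G R (sym_vec G w))) (emb G R (sym_vec G v)) =
    W_mult G R (W_exp G R (emb G R (sym_vec G w))) (emb G R (sym_vec G v + fscale (z * \<Lambda> w v) (sym_one G)))"
    unfolding exp_vec emb_sq[of "sym_vec G v"] s(1) .
  have "C.sq (\<lambda>N. sym_vec G v \<star> ps (u 1) N) =
    W_mult G R (C.sq (ps (u 1))) (emb G R (sym_vec G v + fscale (z * \<Lambda> v w) (sym_one G)))"
  proof (rule exp_linear[where F = "\<lambda>a. sym_vec G v \<star> a"])
    show "sym_vec G v \<star> (a + b) = sym_vec G v \<star> a + sym_vec G v \<star> b" if "a \<in> W" "b \<in> W" for a b
      by (rule star_bilinear(2)[OF v v that])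
    show "sym_vec G v \<star> fscale k a = fscale k (sym_vec G v \<star> a)" if "a \<in> W" for k a
      by (rule star_bilinear(4)[OF v v that that])
    show "C.cs (\<lambda>N. sym_vec G v \<star> ps (u 1) N)" by (rule s(4))
    show "sym_vec G v \<star> pw w i = sym_mult G (pw w i) (sym_vec G v) + fscale (z * \<Lambda> v w * of_nat i) (pw w (i - 1))" for i
      unfolding pw_star(2)[OF w] by (simp only: mult_ac)
  qed
  then show "W_star G R z \<Lambda> (emb G R (sym_vec G v)) (W_exp G R (emb G R (sym_vec G w))) =
    W_mult G R (W_exp G R (emb G R (sym_vec G w))) (emb G R (sym_vec G v + fscale (z * \<Lambda> v w) (sym_one G)))"
    unfolding exp_vec emb_sq[of "sym_vec G v"] s(3) .
qed

text \<open>For v = w the two formulas in \<open>pw_star\<close> coincide, and the partial sums are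
  combinations of powers of w.\<close>

lemma Ht_star_comm: "sym_vec G w \<star> ps (Ht t) N = ps (Ht t) N \<star> sym_vec G w"
proof -
  note v = sym_vec_in[of w]
  have p: "pw w i \<in> W" for i by (rule sym_prod_in_W)
  have u: "sym_vec G w \<star> u t i = u t i \<star> sym_vec G w" for i
    unfolding u_def star_bilinear(4)[OF v v p p] star_bilinear(3)[OF p p v v] pw_star[OF w] ..
  have 1: "sym_vec G w \<star> (\<Sum>i<N. fscale (c i) (u t i)) = (\<Sum>i<N. fscale (c i) (sym_vec G w \<star> u t i))" for c
    by (rule W_linear_sum[of "\<lambda>a. sym_vec G w \<star> a"]) (rule star_bilinear(2)[OF v v] star_bilinear(4)[OF v v] u_in; assumption)+
  have 2: "(\<Sum>i<N. fscale (c i) (u t i)) \<star> sym_vec G w = (\<Sum>i<N. fscale (c i) (u t i \<star> sym_vec G w))" for c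
    by (rule W_linear_sum[of "\<lambda>a. a \<star> sym_vec G w"]) (rule star_bilinear(1)[OF _ _ v v] star_bilinear(3)[OF _ _ v v] u_in; assumption)+
  show ?thesis unfolding Ht_CP ps_CP 1 2 u ..
qed

section \<open>Termwise differentiation in t\<close>

lemma dH_in: "dH t n \<in> W"
  unfolding dH_def by (rule W_closed(4)[OF H_in])

text \<open>The term n = 0 of the derivative vanishes and star multiplication by w takes
  \<open>H n\<close> to \<open>H (Suc n)\<close>; hence the shift by one in the number of
  terms.\<close>

lemma ps_dH_Suc: "ps (dH t) (Suc N) = ps (Ht t) N \<star> sym_vec G w"
proof -
  note v = sym_vec_in[of w]
  have "ps (Ht t) N \<star> sym_vec G w = (\<Sum>n<N. fscale (ec t n) (H n \<star> sym_vec G w))"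
    unfolding ps_def Ht_def
    by (rule W_linear_sum[of "\<lambda>a. a \<star> sym_vec G w"]) (rule star_bilinear(1)[OF _ _ v v] star_bilinear(3)[OF _ _ v v] H_in; assumption)+
  moreover have "dH t 0 = 0" unfolding dH_def by (simp only: simp_thms if_True fs.scale_zero_left)
  moreover have "dH t (Suc n) = fscale (ec t n) (H (Suc n))" for n
    unfolding dH_def by (simp only: nat.simps if_False diff_Suc_1)
  ultimately show ?thesis unfolding ps_def sum.lessThan_Suc_shift by (simp only: H_Suc add_0_left)
qed

text \<open>The estimate \<open>Q_scale\<close> for the factor 1 / c gives the reverse
  inequality.\<close>

lemma Q_scale_eq: assumes q: "q \<in> Q" and x: "x \<in> W" shows "q (fscale c x) = norm c * q x"
proof (cases "c = 0")
  case True
  show ?thesis unfolding True fs.scale_zero_left C.q_zero[OF q] by simp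
next
  case False
  have "fscale (1 / c) (fscale c x) = x" unfolding fs.scale_scale using False by (simp add: fs.scale_one)
  with Q_scale[OF q W_closed(4)[OF x], of "1 / c" c] have "q x \<le> norm (1 / c) * q (fscale c x)" by (simp only:)
  then have "norm c * q x \<le> q (fscale c x)" using False by (simp add: norm_divide field_simps)
  with Q_scale[OF q x, of c] show ?thesis by simp
qed

text \<open>Absolute summability of \<open>Ht\<close> at the parameter r, written as a power series
  in r. It provides the majorants for the derivative.\<close>

lemma summable_H: assumes q: "q \<in> Q" and r: "0 \<le> r" shows "summable (\<lambda>n. r ^ n / fact n * q (H n))"
proof -
  have "summable (\<lambda>n. q (Ht (of_real r) n))" using abs_summable_Ht q unfolding abs_summable_def by blast
  moreover have "q (Ht (of_real r) n) = r ^ n / fact n * q (H n)" for n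
    unfolding Ht_def Q_scale_eq[OF q H_in] norm_ec using r by (simp add: ec_def)
  ultimately show ?thesis by simp
qed

lemma abs_summable_dH: "abs_summable (dH t)"
  unfolding abs_summable_def
proof (intro conjI allI ballI dH_in)
  fix q assume q: "q \<in> Q"
  let ?K = "norm t + 1"
  have "summable (\<lambda>n. (2 * ?K) ^ n / fact n * q (H n))" by (rule summable_H[OF q]) simp
  then show "summable (\<lambda>n. q (dH t n))"
  proof (rule summable_comparison_test')
    fix n
    \<comment> \<open>This comes from n norm t ^ (n - 1) \<le> (2 (norm t + 1)) ^ n, where the 2
      pays for n \<le> 2 ^ n.\<close>
    have "norm (if n = 0 then 0 else ec t (n - 1)) \<le> (2 * ?K) ^ n / fact n"
    proof (cases n)
      case (Suc m)
      have "real (Suc m) \<le> 2 ^ Suc m" using of_nat_less_two_power[of "Suc m"] by (rule less_imp_le)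
      moreover have "norm t ^ m \<le> ?K ^ Suc m"
        using power_mono[of "norm t" ?K m] power_increasing[of m "Suc m" ?K] by simp
      ultimately have "real (Suc m) * norm t ^ m \<le> 2 ^ Suc m * ?K ^ Suc m" by (intro mult_mono) simp_all
      then have le: "real (Suc m) * norm t ^ m / fact (Suc m) \<le> (2 * ?K) ^ Suc m / fact (Suc m)"
        unfolding power_mult_distrib by (rule divide_right_mono) simp
      have "norm (ec t m) = norm t ^ m / fact m" unfolding norm_ec unfolding ec_def ..
      also have "\<dots> = real (Suc m) * norm t ^ m / fact (Suc m)" unfolding fact_Suc by (simp del: of_nat_Suc)
      finally show ?thesis using le unfolding Suc by (simp only: nat.simps if_False diff_Suc_1)
    qed simp
    from mult_right_mono[OF this C.q_nonneg[OF q H_in]] C.q_nonneg[OF q dH_in, of t n]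
    show "norm (q (dH t n)) \<le> (2 * ?K) ^ n / fact n * q (H n)"
      unfolding dH_def Q_scale_eq[OF q H_in] by (simp only: real_norm_def abs_of_nonneg)
  qed
qed

text \<open>With K = norm t + 1 \<ge> norm (t + h), \<open>lemma_termdiff3\<close> bounds the
  remainder of the difference quotient of t ^ n by n (n - 1) K ^ (n - 2) norm h. The two factors n
  and n - 1 are at most 2 ^ n each, whence 4 K.\<close>

lemma diff_quotient_bound:
  fixes h t :: 'k
  assumes h: "h \<noteq> 0" "norm h \<le> 1"
  shows "norm (1 / h * (ec (t + h) n - ec t n) - (if n = 0 then 0 else ec t (n - 1))) \<le>
    norm h * ((4 * (norm t + 1)) ^ n / fact n)"
proof -
  let ?K = "norm t + 1"
  have 1: "(if n = 0 then 0 else ec t (n - 1)) = of_nat n * t ^ (n - Suc 0) / fact n"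
  proof (cases n)
    case (Suc m)
    have "(of_nat (Suc m) :: 'k) \<noteq> 0" by (rule of_nat_neq_0)
    then show ?thesis unfolding Suc fact_Suc by (simp add: ec_def del: of_nat_Suc)
  qed simp
  have nf: "norm (fact n :: 'k) = fact n" by (metis norm_of_nat of_nat_fact)
  have alg: "1 / h * (a / F - b / F) - c / F = ((a - b) / h - c) / F" if "F \<noteq> 0" for a b c F :: 'k
    using that h(1) by (simp add: field_simps)
  have "norm (1 / h * (ec (t + h) n - ec t n) - (if n = 0 then 0 else ec t (n - 1))) =
    norm (((t + h) ^ n - t ^ n) / h - of_nat n * t ^ (n - Suc 0)) / fact n"
    unfolding 1 unfolding ec_def alg[OF fact_nonzero] norm_divide[of _ "fact n"] nf ..
  also have "\<dots> \<le> (of_nat n * of_nat (n - Suc 0) * ?K ^ (n - 2) * norm h) / fact n"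
  proof (intro divide_right_mono lemma_termdiff3 h(1))
    show "norm (t + h) \<le> ?K" using norm_triangle_ineq[of t h] h(2) by linarith
  qed simp_all
  also have "\<dots> \<le> ((4 * ?K) ^ n * norm h) / fact n"
  proof (intro divide_right_mono mult_right_mono)
    have n: "real n \<le> 2 ^ n" using of_nat_less_two_power[of n] by (rule less_imp_le)
    have "real (n - Suc 0) \<le> real n" by simp
    note a = n order_trans[OF this n]
    have "?K ^ (n - 2) \<le> ?K ^ n" by (rule power_increasing) simp_all
    then have "real n * real (n - Suc 0) * ?K ^ (n - 2) \<le> 2 ^ n * 2 ^ n * ?K ^ n"
      by (intro mult_mono a) simp_all
    also have "\<dots> = (2 * 2 * ?K) ^ n" by (simp only: power_mult_distrib)
    finally show "real n * real (n - Suc 0) * ?K ^ (n - 2) \<le> (4 * ?K) ^ n" by simp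
  qed simp_all
  finally show ?thesis by (simp add: mult.commute)
qed

text \<open>The bound on the coefficients gives an estimate by norm h times a sum that does not
  depend on the number of terms, so it survives the passage to the limit classes.\<close>

lemma derivative_dH: "W_has_derivative G R (\<lambda>t. C.sq (ps (Ht t))) (C.sq (ps (dH t))) t"
proof -
  let ?a = "\<lambda>h N. fscale (1 / h) (ps (Ht (t + h)) N - ps (Ht t) N)"
  note c = cs_ps[OF abs_summable_Ht]
  have quot: "W_scale G R (1 / h) (W_diff G R (C.sq (ps (Ht (t + h)))) (C.sq (ps (Ht t)))) = C.sq (?a h)" for h
    unfolding W_diff_sq(1)[OF c c] by (rule W_scale_sq(1)[OF W_diff_sq(2)[OF c c]])
  have ca: "C.cs (?a h)" for h by (rule W_scale_sq(2)[OF W_diff_sq(2)[OF c c]])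
  show ?thesis unfolding W_has_derivative_def W_topology_def quot
  proof (rule C.limitinI[OF C.sq_in[OF cs_ps[OF abs_summable_dH]] C.sq_in[OF ca]])
    fix q and e :: real assume q: "q \<in> Q" and e: "e > 0"
    let ?s = "\<lambda>n. (4 * (norm t + 1)) ^ n / fact n * q (H n)"
    have s: "summable ?s" by (rule summable_H[OF q]) simp
    have s0: "0 \<le> ?s n" for n using C.q_nonneg[OF q H_in] by simp
    have S: "0 \<le> suminf ?s" by (rule suminf_nonneg[OF s s0])
    have le: "C.d q (C.sq (?a h)) (C.sq (ps (dH t))) \<le> norm h * suminf ?s" if h: "h \<noteq> 0" "norm h \<le> 1" for h
    proof (rule C.d_sq_le[OF ca cs_ps[OF abs_summable_dH] q, of 0])
      fix N
      let ?c = "\<lambda>n. 1 / h * (ec (t + h) n - ec t n) - (if n = 0 then 0 else ec t (n - 1))"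
      have eq: "?a h N - ps (dH t) N = (\<Sum>n<N. fscale (?c n) (H n))"
        unfolding ps_def Ht_def dH_def
        by (simp only: sum_subtractf fs.scale_left_diff_distrib fs.scale_right_diff_distrib fs.scale_sum_right fs.scale_scale right_diff_distrib)
      have "q (?a h N - ps (dH t) N) \<le> (\<Sum>n<N. q (fscale (?c n) (H n)))"
        unfolding eq by (rule Q_sum[OF q finite_lessThan]) (rule W_closed(4)[OF H_in])
      also have "\<dots> \<le> (\<Sum>n<N. norm h * ?s n)"
      proof (rule sum_mono)
        fix n
        show "q (fscale (?c n) (H n)) \<le> norm h * ?s n"
          unfolding Q_scale_eq[OF q H_in] mult.assoc[symmetric]
          by (rule mult_right_mono[OF diff_quotient_bound[OF h] C.q_nonneg[OF q H_in]])
      qed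
      also have "\<dots> = norm h * (\<Sum>n<N. ?s n)" by (simp only: sum_distrib_left)
      also have "\<dots> \<le> norm h * suminf ?s"
        by (intro mult_left_mono sum_le_suminf[OF s] s0) simp_all
      finally show "q (?a h N - ps (dH t) N) \<le> norm h * suminf ?s" .
    qed
    show "eventually (\<lambda>h. C.d q (C.sq (?a h)) (C.sq (ps (dH t))) \<le> e) (at 0)"
      unfolding eventually_at
    \<comment> \<open>The radius 1 is the range of \<open>le\<close>; adding 1 keeps the divisor
      positive when the sum is 0.\<close>
    proof (intro exI[of _ "min 1 (e / (suminf ?s + 1))"] conjI ballI impI)
      show "0 < min 1 (e / (suminf ?s + 1))" using e S by simp
      fix h :: 'k assume h: "h \<noteq> 0 \<and> dist h 0 < min 1 (e / (suminf ?s + 1))"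
      then have "C.d q (C.sq (?a h)) (C.sq (ps (dH t))) \<le> norm h * suminf ?s" by (intro le) simp_all
      also have "\<dots> \<le> norm h * (suminf ?s + 1)" by (rule mult_left_mono) simp_all
      also have "\<dots> \<le> e" using h S by (simp add: field_simps less_imp_le)
      finally show "C.d q (C.sq (?a h)) (C.sq (ps (dH t))) \<le> e" .
    qed
  qed
qed

text \<open>By \<open>ps_dH_Suc\<close> the partial sums of the derivative series and those of the
  star product differ by one term, which tends to 0.\<close>

lemma derivative_star:
  "W_has_derivative G R (\<lambda>t. C.sq (ps (Ht t))) (W_star G R z \<Lambda> (C.sq (ps (Ht t))) (emb G R (sym_vec G w))) t"
  "W_star G R z \<Lambda> (C.sq (ps (Ht t))) (emb G R (sym_vec G w)) = W_star G R z \<Lambda> (emb G R (sym_vec G w)) (C.sq (ps (Ht t)))"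
proof -
  note c = cs_ps[OF abs_summable_Ht, of t] C.cs_const[OF sym_vec_in[of w]]
  note s = W_star_sq[OF c] W_star_sq[OF c(2,1)]
  have 1: "W_star G R z \<Lambda> (C.sq (ps (Ht t))) (emb G R (sym_vec G w)) = C.sq (\<lambda>N. ps (Ht t) N \<star> sym_vec G w)"
    unfolding emb_sq by (rule s(1))
  show "W_star G R z \<Lambda> (C.sq (ps (Ht t))) (emb G R (sym_vec G w)) = W_star G R z \<Lambda> (emb G R (sym_vec G w)) (C.sq (ps (Ht t)))"
    unfolding 1 unfolding emb_sq s(3) Ht_star_comm ..
  have "C.sq (ps (dH t)) = C.sq (\<lambda>N. ps (Ht t) N \<star> sym_vec G w)"
  proof (rule C.sq_eq[OF cs_ps[OF abs_summable_dH] s(2)])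
    fix q assume q: "q \<in> Q"
    have "ps (dH t) N - ps (Ht t) N \<star> sym_vec G w = fscale (- 1) (dH t N)" for N
    proof -
      have "ps (dH t) (Suc N) = ps (dH t) N + dH t N" by (simp only: ps_def sum.lessThan_Suc)
      then show ?thesis unfolding ps_dH_Suc[symmetric] by (simp only:) (rule ext, simp)
    qed
    with null_terms[OF abs_summable_dH q, of "- 1" t]
    show "(\<lambda>N. q (ps (dH t) N - ps (Ht t) N \<star> sym_vec G w)) \<longlonglongrightarrow> 0" by (simp only:)
  qed
  with derivative_dH[of t] show "W_has_derivative G R (\<lambda>t. C.sq (ps (Ht t))) (W_star G R z \<Lambda> (C.sq (ps (Ht t))) (emb G R (sym_vec G w))) t"
    unfolding 1 by (simp only:)
qed

section \<open>The star exponential series\<close>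

lemma fpow_star_scale: "fpow (star G z \<Lambda>) (sym_vec G (vscale G t w)) n = fscale (t ^ n) (H n)"
proof (induction n)
  case 0
  show ?case unfolding H_def fpow.simps power_0 fs.scale_one ..
next
  case (Suc n)
  note v = sym_vec_in[of w]
  show ?case
    unfolding fpow.simps Suc
    unfolding sym_vec_linear(2) star_bilinear(3)[OF H_in H_in W_closed(4)[OF v] W_closed(4)[OF v]]
      star_bilinear(4)[OF H_in H_in v v] H_Suc fs.scale_scale power_Suc2 ..
qed

text \<open>Star powers of tw and star powers of w with t ^ n taken out give the same terms, so the
  two series are one.\<close>

lemma star_exp_terms:
  "exp_term G R (W_star G R z \<Lambda>) (emb G R (sym_vec G (vscale G t w))) = (\<lambda>n. emb G R (Ht t n))"
  "(\<lambda>n. W_scale G R (t ^ n / fact n) (W_power G R (W_star G R z \<Lambda>) (emb G R (sym_vec G w)) n)) = (\<lambda>n. emb G R (Ht t n))"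
proof -
  have "fscale (1 / fact n) (fscale (t ^ n) (H n)) = Ht t n" for n
    unfolding Ht_def fs.scale_scale ec_def by simp
  then show "exp_term G R (W_star G R z \<Lambda>) (emb G R (sym_vec G (vscale G t w))) = (\<lambda>n. emb G R (Ht t n))"
    unfolding W_star_def exp_term_emb[OF good_star sym_vec_in] fpow_star_scale by (simp only:)
  show "(\<lambda>n. W_scale G R (t ^ n / fact n) (W_power G R (W_star G R z \<Lambda>) (emb G R (sym_vec G w)) n)) = (\<lambda>n. emb G R (Ht t n))"
    unfolding W_star_def W_power_emb(1)[OF good_star sym_vec_in]
    unfolding H_def[symmetric] W_scale_emb[OF H_in] Ht_def ec_def ..
qed

lemma star_exp_series:
  "W_abs_convergent G R (exp_term G R (W_star G R z \<Lambda>) (emb G R (sym_vec G (vscale G t w))))"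
  "W_star_exp G R z \<Lambda> (emb G R (sym_vec G (vscale G t w))) =
    W_suminf G R (\<lambda>n. W_scale G R (t ^ n / fact n) (W_power G R (W_star G R z \<Lambda>) (emb G R (sym_vec G w)) n))"
  "W_suminf G R (\<lambda>n. W_scale G R (t ^ n / fact n) (W_power G R (W_star G R z \<Lambda>) (emb G R (sym_vec G w)) n)) = C.sq (ps (Ht t))"
  unfolding W_star_exp_def star_exp_terms
  by (rule W_abs_convergent_emb[OF abs_summable_Ht], rule refl, rule W_suminf_emb[OF abs_summable_Ht])

end

theorem lemma5p5:
  fixes G :: "('k::real_normed_field, 'v::{topological_ab_group_add, t2_space}) graded_space"
    and \<Lambda> :: "'v \<Rightarrow> 'v \<Rightarrow> 'k" and z :: 'k and R :: real and w :: 'v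
  assumes "graded_lcs G"
    and "bilinear_form G \<Lambda>"
    and "continuous_on UNIV (\<lambda>(v, v'). \<Lambda> v v')"
    and "even_form G \<Lambda>"
    and "1 / 2 \<le> R" and "R < 1"
    and "w \<in> even_part G"
  shows
    "let star = W_star G R z \<Lambda>;
         mult = W_mult G R;
         vec = (\<lambda>v. emb G R (sym_vec G v));
         E = (\<lambda>t. W_exp G R (emb G R
               (sym_vec G (vscale G t w) + fscale (t\<^sup>2 * z / 2 * \<Lambda> w w) (sym_one G))))
     in
       (\<forall>v.
          star (W_exp G R (vec w)) (vec v) =
            mult (W_exp G R (vec w)) (emb G R (sym_vec G v + fscale (z * \<Lambda> w v) (sym_one G))) \<and>
          star (vec v) (W_exp G R (vec w)) =
            mult (W_exp G R (vec w)) (emb G R (sym_vec G v + fscale (z * \<Lambda> v w) (sym_one G)))) \<and>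
       (\<forall>t.
          W_has_derivative G R E (star (E t) (vec w)) t \<and>
          star (E t) (vec w) = star (vec w) (E t)) \<and>
       (\<forall>t.
          W_abs_convergent G R (exp_term G R star (vec (vscale G t w))) \<and>
          W_star_exp G R z \<Lambda> (vec (vscale G t w)) =
            W_suminf G R (\<lambda>n. W_scale G R (t ^ n / fact n) (W_power G R star (vec w) n)) \<and>
          W_suminf G R (\<lambda>n. W_scale G R (t ^ n / fact n) (W_power G R star (vec w) n)) = E t)"
proof -
  have h: "weyl_R G \<Lambda> R w"
    using assms by (intro weyl_R.intro weyl.intro bilinear_space.intro
      bilinear_space_axioms.intro weyl_axioms.intro weyl_R_axioms.intro)
  \<comment> \<open>\<open>exp_quadratic\<close> turns every value of E into the class of the
    partial sums of \<open>Ht t\<close>, for which the three statements have been shown.\<close>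
  show ?thesis
    unfolding Let_def weyl_R.exp_quadratic[OF h]
    by (intro conjI allI weyl_R.exp_star_vec[OF h] weyl_R.derivative_star[OF h] weyl_R.star_exp_series[OF h])
qed

end
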